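(* Let $X$ be a quasi-category in $\mathcal{V}$. Then the simplicial set $\tilde U(X)$ is a quasi-category.
   Context: Base category. Fix a complete and cocomplete, symmetric monoidal closed category $(\mathcal{V},\otimes,I)$. $F:\mathrm{Set}\to\mathcal{V}$ is the colimit-preserving functor with $F(\{*\})=I$ (unique up to natural isomorphism); it is strong monoidal for the cartesian product on $\mathrm{Set}$ and left adjoint to $U=\mathcal{V}(I,-):\mathcal{V}\to\mathrm{Set}$, which is lax monoidal. Quivers. For a set $S$, $\mathcal{V}\mathrm{Quiv}_S$ is the category of families $Q=(Q(a,b))_{a,b\in S}$ of objects of $\mathcal{V}$, with families of morphisms as morphisms. It is monoidal with $(Q\otimes_S P)(a,b)=\coprod_{c\in S}Q(a,c)\otimes P(c,b)$ and unit $I_S$, where $I_S(a,b)=I$ if $a=b$ and $I_S(a,b)=0$ (initial object) otherwise. For a map of sets $f:S\to T$, the functor $f^*:\mathcal{V}\mathrm{Quiv}_T\to\mathcal{V}\mathrm{Quiv}_S$, $f^*(Q)(a,b)=Q(f(a),f(b))$, is lax monoidal; its left adjoint $f_!$ is therefore colax monoidal. Intervals. $\mathbf{\Delta}_f$ is the category with objects $[n]=\{0,\dots,n\}$, $n\ge 0$, and order-preserving maps $f:[m]\to[n]$ with $f(0)=0$, $f(m)=n$ as morphisms. It is monoidal with $[m]+[n]=[m+n]$, where for $f:[m]\to[m']$, $g:[n]\to[n']$ one has $(f+g)(i)=f(i)$ for $i\le m$ and $(f+g)(i)=m'+g(i-m)$ for $i\ge m$; the unit is $[0]$. Templicial objects.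 A templicial object in $\mathcal{V}$ is a pair $(X,S)$ with $S$ a set and $X:\mathbf{\Delta}_f^{op}\to\mathcal{V}\mathrm{Quiv}_S$ a colax monoidal functor which is strongly unital (the counit $\epsilon:X_0\to I_S$ is an isomorphism). Here $X_n=X([n])$, and the colax structure consists of $\epsilon$ and comultiplications $\mu_{k,l}:X_{k+l}\to X_k\otimes_S X_l$. A templicial morphism $(X,S)\to(Y,T)$ is a pair $(\alpha,f)$ with $f:S\to T$ a map and $\alpha:f_!X\to Y$ a monoidal natural transformation. Composition of $(\alpha,f)$ and $(\beta,g)$ is $(gf)_!X\simeq g_!f_!X\xrightarrow{g_!\alpha}g_!Y\xrightarrow{\beta}Z$. This is the category $S_{\otimes}\mathcal{V}$. $\tilde F:\mathrm{SSet}\to S_\otimes\mathcal{V}$ sends $K$ to the templicial object with vertex set $K_0$ and $\tilde F(K)_n(a,b)=F(K_n(a,b))$, $K_n(a,b)$ being the $n$-simplices with first vertex $a$ and last vertex $b$, with inner faces and degeneracies from $K$ and $\mu_{k,l}$ induced by $\sigma\mapsto(d_{k+1}\cdots d_{k+l}\sigma,d_0\cdots d_0\sigma)$. Its right adjoint $\tilde U:S_\otimes\mathcal{V}\to\mathrm{SSet}$ is $\tilde U(X)_n=S_\otimes\mathcal{V}(\tilde F(\Delta^n),X)$. Necklaces. $\mathcal{N}ec$ is the category with objects pairs $(T,p)$ with $p\ge 0$ and $\{0,p\}\subseteq T\subseteq[p]$, and morphisms $(T,p)\to(U,q)$ the morphisms $f:[p]\to[q]$ of $\mathbf{\Delta}_f$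 with $U\subseteq f(T)$; $(T,p)\vee(U,q)=(T\cup(p+U),p+q)$. A map is inert if $p=q$ and $f=\mathrm{id}_{[p]}$, active if $f(T)=U$; each map factors uniquely as active followed by inert. For a templicial object $(X,S)$ and $T=\{0=t_0<\dots<t_k=p\}$ put $X_T=X_{t_1}\otimes_S\dots\otimes_S X_{p-t_{k-1}}$ (with $X_{\{0\}}=I_S$), and let $\mu_T:X_p\to X_T$ be the iterated comultiplication. This extends to $X_\bullet:\mathcal{N}ec^{op}\to\mathcal{V}\mathrm{Quiv}_S$: for inert $(T,p)\to(U,p)$ with $U=\{0=u_0<\dots<u_l=p\}$ write $T=T_1\vee\dots\vee T_l$ with $T_i$ on $[u_i-u_{i-1}]$ and use $\mu_{T_1}\otimes\dots\otimes\mu_{T_l}$; for active $f$ write $f=f_1+\dots+f_k$ with $f_i:[t_i-t_{i-1}]\to[f(t_i)-f(t_{i-1})]$ and use $X(f_1)\otimes\dots\otimes X(f_k)$ (together with $X_0\simeq I_S$). Quasi-categories in $\mathcal{V}$. $(X,S)$ is a quasi-category in $\mathcal{V}$ if for all $a,b\in S$ and $0<j<n$ every morphism $\tilde F(\Lambda^n_j)_\bullet(0,n)\to X_\bullet(a,b)$ in $\mathcal{V}^{\mathcal{N}ec^{op}}$ extends along $\tilde F(\Lambda^n_j)_\bullet(0,n)\to\tilde F(\Delta^n)_\bullet(0,n)$. "Quasi-category" without qualifier is the usual notion for simplicial sets (inner horn filling). *)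

theory Defs
  imports Main "HOL-Library.FuncSet"
begin

section \<open>Categories, functors, limits\<close>

record ('o, 'm) cat =
  Obj :: "'o set"
  Arr :: "'m set"
  Dom :: "'m \<Rightarrow> 'o"
  Cod :: "'m \<Rightarrow> 'o"
  Id :: "'o \<Rightarrow> 'm"
  Comp :: "'m \<Rightarrow> 'm \<Rightarrow> 'm"  (infixr "\<cdot>\<index>" 70)

definition hom :: "('o, 'm, 'z) cat_scheme \<Rightarrow> 'o \<Rightarrow> 'o \<Rightarrow> 'm set" where
  "hom C a b = {f \<in> Arr C. Dom C f = a \<and> Cod C f = b}"

locale category =
  fixes C :: "('o, 'm, 'z) cat_scheme" (structure)
  assumes dom_obj: "f \<in> Arr C \<Longrightarrow> Dom C f \<in> Obj C"
    and cod_obj: "f \<in> Arr C \<Longrightarrow> Cod C f \<in> Obj C"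
    and id_hom: "a \<in> Obj C \<Longrightarrow> Id C a \<in> hom C a a"
    and comp_hom: "f \<in> hom C a b \<Longrightarrow> g \<in> hom C b c \<Longrightarrow> g \<cdot> f \<in> hom C a c"
    and comp_id: "f \<in> hom C a b \<Longrightarrow> f \<cdot> Id C a = f"
    and id_comp: "f \<in> hom C a b \<Longrightarrow> Id C b \<cdot> f = f"
    and comp_assoc: "f \<in> hom C a b \<Longrightarrow> g \<in> hom C b c \<Longrightarrow> h \<in> hom C c d \<Longrightarrow>
      (h \<cdot> g) \<cdot> f = h \<cdot> (g \<cdot> f)"

definition inverse_arrows :: "('o, 'm, 'z) cat_scheme \<Rightarrow> 'm \<Rightarrow> 'm \<Rightarrow> bool" where
  "inverse_arrows C f g \<longleftrightarrow> f \<in> Arr C \<and> g \<in> hom C (Cod C f) (Dom C f) \<and>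
     g \<cdot>\<^bsub>C\<^esub> f = Id C (Dom C f) \<and> f \<cdot>\<^bsub>C\<^esub> g = Id C (Cod C f)"

definition is_iso :: "('o, 'm, 'z) cat_scheme \<Rightarrow> 'm \<Rightarrow> bool" where
  "is_iso C f \<longleftrightarrow> (\<exists>g. inverse_arrows C f g)"

definition inv_arr :: "('o, 'm, 'z) cat_scheme \<Rightarrow> 'm \<Rightarrow> 'm" where
  "inv_arr C f = (THE g. inverse_arrows C f g)"

definition op_cat :: "('o, 'm, 'z) cat_scheme \<Rightarrow> ('o, 'm) cat" where
  "op_cat C = \<lparr>Obj = Obj C, Arr = Arr C, Dom = Cod C, Cod = Dom C, Id = Id C,
     Comp = (\<lambda>g f. f \<cdot>\<^bsub>C\<^esub> g)\<rparr>"

record ('o, 'm, 'p, 'q) funct =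
  ObjF :: "'o \<Rightarrow> 'p"
  ArrF :: "'m \<Rightarrow> 'q"

definition is_functor ::
  "('o, 'm, 'y) cat_scheme \<Rightarrow> ('p, 'q, 'z) cat_scheme \<Rightarrow> ('o, 'm, 'p, 'q, 'w) funct_scheme \<Rightarrow> bool"
  where
  "is_functor C D F \<longleftrightarrow>
     (\<forall>a \<in> Obj C. ObjF F a \<in> Obj D) \<and>
     (\<forall>f \<in> Arr C. ArrF F f \<in> hom D (ObjF F (Dom C f)) (ObjF F (Cod C f))) \<and>
     (\<forall>a \<in> Obj C. ArrF F (Id C a) = Id D (ObjF F a)) \<and>
     (\<forall>f \<in> Arr C. \<forall>g \<in> Arr C. Dom C g = Cod C f \<longrightarrow>
        ArrF F (g \<cdot>\<^bsub>C\<^esub> f) = ArrF F g \<cdot>\<^bsub>D\<^esub> ArrF F f)"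

definition is_nat_trans ::
  "('o, 'm, 'y) cat_scheme \<Rightarrow> ('p, 'q, 'z) cat_scheme \<Rightarrow>
   ('o, 'm, 'p, 'q, 'v) funct_scheme \<Rightarrow> ('o, 'm, 'p, 'q, 'w) funct_scheme \<Rightarrow> ('o \<Rightarrow> 'q) \<Rightarrow> bool"
  where
  "is_nat_trans C D F G \<tau> \<longleftrightarrow>
     (\<forall>a \<in> Obj C. \<tau> a \<in> hom D (ObjF F a) (ObjF G a)) \<and>
     (\<forall>f \<in> Arr C. \<tau> (Cod C f) \<cdot>\<^bsub>D\<^esub> ArrF F f = ArrF G f \<cdot>\<^bsub>D\<^esub> \<tau> (Dom C f))"

definition is_cone ::
  "('i, 'j, 'y) cat_scheme \<Rightarrow> ('o, 'm, 'z) cat_scheme \<Rightarrow> ('i, 'j, 'o, 'm, 'w) funct_scheme \<Rightarrow>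
   'o \<Rightarrow> ('i \<Rightarrow> 'm) \<Rightarrow> bool" where
  "is_cone J C D L \<pi> \<longleftrightarrow> L \<in> Obj C \<and> (\<forall>i \<in> Obj J. \<pi> i \<in> hom C L (ObjF D i)) \<and>
     (\<forall>h \<in> Arr J. ArrF D h \<cdot>\<^bsub>C\<^esub> \<pi> (Dom J h) = \<pi> (Cod J h))"

definition is_limit ::
  "('i, 'j, 'y) cat_scheme \<Rightarrow> ('o, 'm, 'z) cat_scheme \<Rightarrow> ('i, 'j, 'o, 'm, 'w) funct_scheme \<Rightarrow>
   'o \<Rightarrow> ('i \<Rightarrow> 'm) \<Rightarrow> bool" where
  "is_limit J C D L \<pi> \<longleftrightarrow> is_cone J C D L \<pi> \<and>
     (\<forall>M \<rho>. is_cone J C D M \<rho> \<longrightarrow>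
        (\<exists>!u. u \<in> hom C M L \<and> (\<forall>i \<in> Obj J. \<pi> i \<cdot>\<^bsub>C\<^esub> u = \<rho> i)))"

definition is_cocone ::
  "('i, 'j, 'y) cat_scheme \<Rightarrow> ('o, 'm, 'z) cat_scheme \<Rightarrow> ('i, 'j, 'o, 'm, 'w) funct_scheme \<Rightarrow>
   'o \<Rightarrow> ('i \<Rightarrow> 'm) \<Rightarrow> bool" where
  "is_cocone J C D L \<iota> \<longleftrightarrow> L \<in> Obj C \<and> (\<forall>i \<in> Obj J. \<iota> i \<in> hom C (ObjF D i) L) \<and>
     (\<forall>h \<in> Arr J. \<iota> (Cod J h) \<cdot>\<^bsub>C\<^esub> ArrF D h = \<iota> (Dom J h))"

definition is_colimit ::
  "('i, 'j, 'y) cat_scheme \<Rightarrow> ('o, 'm, 'z) cat_scheme \<Rightarrow> ('i, 'j, 'o, 'm, 'w) funct_scheme \<Rightarrow>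
   'o \<Rightarrow> ('i \<Rightarrow> 'm) \<Rightarrow> bool" where
  "is_colimit J C D L \<iota> \<longleftrightarrow> is_cocone J C D L \<iota> \<and>
     (\<forall>M \<rho>. is_cocone J C D M \<rho> \<longrightarrow>
        (\<exists>!u. u \<in> hom C L M \<and> (\<forall>i \<in> Obj J. u \<cdot>\<^bsub>C\<^esub> \<iota> i = \<rho> i)))"

text \<open>The type \<open>'u\<close> bounds the size of small sets: a small category is one whose objects and
  arrows are elements of \<open>'u\<close>.\<close>

definition small_complete :: "'u itself \<Rightarrow> ('o, 'm, 'z) cat_scheme \<Rightarrow> bool" where
  "small_complete _ C \<longleftrightarrow>
     (\<forall>(J :: ('u, 'u) cat) (D :: ('u, 'u, 'o, 'm) funct).
        category J \<and> is_functor J C D \<longrightarrow> (\<exists>L \<pi>. is_limit J C D L \<pi>))"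

definition small_cocomplete :: "'u itself \<Rightarrow> ('o, 'm, 'z) cat_scheme \<Rightarrow> bool" where
  "small_cocomplete _ C \<longleftrightarrow>
     (\<forall>(J :: ('u, 'u) cat) (D :: ('u, 'u, 'o, 'm) funct).
        category J \<and> is_functor J C D \<longrightarrow> (\<exists>L \<iota>. is_colimit J C D L \<iota>))"

subsection \<open>Chosen coproducts and initial object\<close>

definition is_coproduct ::
  "('o, 'm, 'z) cat_scheme \<Rightarrow> 'i set \<Rightarrow> ('i \<Rightarrow> 'o) \<Rightarrow> 'o \<Rightarrow> ('i \<Rightarrow> 'm) \<Rightarrow> bool" where
  "is_coproduct C A X P \<iota> \<longleftrightarrow> P \<in> Obj C \<and> (\<forall>i \<in> A. \<iota> i \<in> hom C (X i) P) \<and>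
     (\<forall>Z \<in> Obj C. \<forall>g. (\<forall>i \<in> A. g i \<in> hom C (X i) Z) \<longrightarrow>
        (\<exists>!u. u \<in> hom C P Z \<and> (\<forall>i \<in> A. u \<cdot>\<^bsub>C\<^esub> \<iota> i = g i)))"

definition coprod_cocone ::
  "('o, 'm, 'z) cat_scheme \<Rightarrow> 'i set \<Rightarrow> ('i \<Rightarrow> 'o) \<Rightarrow> 'o \<times> ('i \<Rightarrow> 'm)" where
  "coprod_cocone C A X = (SOME (P, \<iota>). is_coproduct C A X P \<iota>)"

definition coprod :: "('o, 'm, 'z) cat_scheme \<Rightarrow> 'i set \<Rightarrow> ('i \<Rightarrow> 'o) \<Rightarrow> 'o" where
  "coprod C A X = fst (coprod_cocone C A X)"

definition coprod_inj :: "('o, 'm, 'z) cat_scheme \<Rightarrow> 'i set \<Rightarrow> ('i \<Rightarrow> 'o) \<Rightarrow> 'i \<Rightarrow> 'm" where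
  "coprod_inj C A X = snd (coprod_cocone C A X)"

definition copair ::
  "('o, 'm, 'z) cat_scheme \<Rightarrow> 'i set \<Rightarrow> ('i \<Rightarrow> 'o) \<Rightarrow> 'o \<Rightarrow> ('i \<Rightarrow> 'm) \<Rightarrow> 'm" where
  "copair C A X Z g =
     (THE u. u \<in> hom C (coprod C A X) Z \<and> (\<forall>i \<in> A. u \<cdot>\<^bsub>C\<^esub> coprod_inj C A X i = g i))"

definition initial :: "('o, 'm, 'z) cat_scheme \<Rightarrow> 'o" where
  "initial C = (SOME z. z \<in> Obj C \<and> (\<forall>a \<in> Obj C. \<exists>!u. u \<in> hom C z a))"

definition from_initial :: "('o, 'm, 'z) cat_scheme \<Rightarrow> 'o \<Rightarrow> 'm" where
  "from_initial C a = (THE u. u \<in> hom C (initial C) a)"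

section \<open>Monoidal categories\<close>

record ('o, 'm) moncat = "('o, 'm) cat" +
  TensO :: "'o \<Rightarrow> 'o \<Rightarrow> 'o"  (infixr "\<odot>\<index>" 75)
  TensA :: "'m \<Rightarrow> 'm \<Rightarrow> 'm"  (infixr "\<otimes>\<index>" 75)
  Unit :: "'o"
  Assoc :: "'o \<Rightarrow> 'o \<Rightarrow> 'o \<Rightarrow> 'm"
  LUnit :: "'o \<Rightarrow> 'm"
  RUnit :: "'o \<Rightarrow> 'm"

locale monoidal_category = category C
  for C :: "('o, 'm, 'z) moncat_scheme" (structure) +
  assumes unit_obj: "Unit C \<in> Obj C"
    and tens_obj: "a \<in> Obj C \<Longrightarrow> b \<in> Obj C \<Longrightarrow> a \<odot> b \<in> Obj C"
    and tens_hom: "f \<in> hom C a a' \<Longrightarrow> g \<in> hom C b b' \<Longrightarrow> f \<otimes> g \<in> hom C (a \<odot> b) (a' \<odot> b')"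
    and tens_id: "a \<in> Obj C \<Longrightarrow> b \<in> Obj C \<Longrightarrow> Id C a \<otimes> Id C b = Id C (a \<odot> b)"
    and tens_comp: "f \<in> hom C a b \<Longrightarrow> g \<in> hom C b c \<Longrightarrow> f' \<in> hom C a' b' \<Longrightarrow> g' \<in> hom C b' c' \<Longrightarrow>
      (g \<cdot> f) \<otimes> (g' \<cdot> f') = (g \<otimes> g') \<cdot> (f \<otimes> f')"
    and assoc_hom: "a \<in> Obj C \<Longrightarrow> b \<in> Obj C \<Longrightarrow> c \<in> Obj C \<Longrightarrow>
      Assoc C a b c \<in> hom C ((a \<odot> b) \<odot> c) (a \<odot> (b \<odot> c))"
    and assoc_iso: "a \<in> Obj C \<Longrightarrow> b \<in> Obj C \<Longrightarrow> c \<in> Obj C \<Longrightarrow> is_iso C (Assoc C a b c)"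
    and assoc_nat: "f \<in> hom C a a' \<Longrightarrow> g \<in> hom C b b' \<Longrightarrow> h \<in> hom C c c' \<Longrightarrow>
      Assoc C a' b' c' \<cdot> ((f \<otimes> g) \<otimes> h) = (f \<otimes> (g \<otimes> h)) \<cdot> Assoc C a b c"
    and lunit_hom: "a \<in> Obj C \<Longrightarrow> LUnit C a \<in> hom C (Unit C \<odot> a) a"
    and lunit_iso: "a \<in> Obj C \<Longrightarrow> is_iso C (LUnit C a)"
    and lunit_nat: "f \<in> hom C a b \<Longrightarrow> LUnit C b \<cdot> (Id C (Unit C) \<otimes> f) = f \<cdot> LUnit C a"
    and runit_hom: "a \<in> Obj C \<Longrightarrow> RUnit C a \<in> hom C (a \<odot> Unit C) a"
    and runit_iso: "a \<in> Obj C \<Longrightarrow> is_iso C (RUnit C a)"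
    and runit_nat: "f \<in> hom C a b \<Longrightarrow> RUnit C b \<cdot> (f \<otimes> Id C (Unit C)) = f \<cdot> RUnit C a"
    and triangle: "a \<in> Obj C \<Longrightarrow> b \<in> Obj C \<Longrightarrow>
      (Id C a \<otimes> LUnit C b) \<cdot> Assoc C a (Unit C) b = RUnit C a \<otimes> Id C b"
    and pentagon: "a \<in> Obj C \<Longrightarrow> b \<in> Obj C \<Longrightarrow> c \<in> Obj C \<Longrightarrow> d \<in> Obj C \<Longrightarrow>
      (Id C a \<otimes> Assoc C b c d) \<cdot> Assoc C a (b \<odot> c) d \<cdot> (Assoc C a b c \<otimes> Id C d) =
      Assoc C a b (c \<odot> d) \<cdot> Assoc C (a \<odot> b) c d"

definition op_moncat :: "('o, 'm, 'z) moncat_scheme \<Rightarrow> ('o, 'm) moncat" where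
  "op_moncat C = \<lparr>Obj = Obj C, Arr = Arr C, Dom = Cod C, Cod = Dom C, Id = Id C,
     Comp = (\<lambda>g f. f \<cdot>\<^bsub>C\<^esub> g), TensO = TensO C, TensA = TensA C, Unit = Unit C,
     Assoc = (\<lambda>a b c. inv_arr C (Assoc C a b c)),
     LUnit = (\<lambda>a. inv_arr C (LUnit C a)), RUnit = (\<lambda>a. inv_arr C (RUnit C a))\<rparr>"

record ('o, 'm) symcat = "('o, 'm) moncat" +
  Braid :: "'o \<Rightarrow> 'o \<Rightarrow> 'm"

locale symmetric_monoidal_category = monoidal_category C
  for C :: "('o, 'm, 'z) symcat_scheme" (structure) +
  assumes braid_hom: "a \<in> Obj C \<Longrightarrow> b \<in> Obj C \<Longrightarrow> Braid C a b \<in> hom C (a \<odot> b) (b \<odot> a)"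
    and braid_nat: "f \<in> hom C a a' \<Longrightarrow> g \<in> hom C b b' \<Longrightarrow>
      Braid C a' b' \<cdot> (f \<otimes> g) = (g \<otimes> f) \<cdot> Braid C a b"
    and braid_sym: "a \<in> Obj C \<Longrightarrow> b \<in> Obj C \<Longrightarrow> Braid C b a \<cdot> Braid C a b = Id C (a \<odot> b)"
    and hexagon: "a \<in> Obj C \<Longrightarrow> b \<in> Obj C \<Longrightarrow> c \<in> Obj C \<Longrightarrow>
      Assoc C b c a \<cdot> Braid C a (b \<odot> c) \<cdot> Assoc C a b c =
      (Id C b \<otimes> Braid C a c) \<cdot> Assoc C b a c \<cdot> (Braid C a b \<otimes> Id C c)"

locale symmetric_monoidal_closed_category = symmetric_monoidal_category C
  for C :: "('o, 'm, 'z) symcat_scheme" (structure) +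
  assumes closed: "b \<in> Obj C \<Longrightarrow> c \<in> Obj C \<Longrightarrow>
    \<exists>h \<in> Obj C. \<exists>ev \<in> hom C (h \<odot> b) c. \<forall>a \<in> Obj C. \<forall>g \<in> hom C (a \<odot> b) c.
      \<exists>!u. u \<in> hom C a h \<and> ev \<cdot> (u \<otimes> Id C b) = g"

record ('o, 'm, 'p, 'q) colax = "('o, 'm, 'p, 'q) funct" +
  counit :: "'q"
  comult :: "'o \<Rightarrow> 'o \<Rightarrow> 'q"

definition is_colax_monoidal ::
  "('o, 'm, 'y) moncat_scheme \<Rightarrow> ('p, 'q, 'z) moncat_scheme \<Rightarrow> ('o, 'm, 'p, 'q) colax \<Rightarrow> bool"
  where
  "is_colax_monoidal C D F \<longleftrightarrow> is_functor C D F \<and>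
     counit F \<in> hom D (ObjF F (Unit C)) (Unit D) \<and>
     (\<forall>a \<in> Obj C. \<forall>b \<in> Obj C.
        comult F a b \<in> hom D (ObjF F (a \<odot>\<^bsub>C\<^esub> b)) (ObjF F a \<odot>\<^bsub>D\<^esub> ObjF F b)) \<and>
     (\<forall>f \<in> Arr C. \<forall>g \<in> Arr C.
        comult F (Cod C f) (Cod C g) \<cdot>\<^bsub>D\<^esub> ArrF F (f \<otimes>\<^bsub>C\<^esub> g) =
        (ArrF F f \<otimes>\<^bsub>D\<^esub> ArrF F g) \<cdot>\<^bsub>D\<^esub> comult F (Dom C f) (Dom C g)) \<and>
     (\<forall>a \<in> Obj C. \<forall>b \<in> Obj C. \<forall>c \<in> Obj C.
        Assoc D (ObjF F a) (ObjF F b) (ObjF F c) \<cdot>\<^bsub>D\<^esub>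
          (comult F a b \<otimes>\<^bsub>D\<^esub> Id D (ObjF F c)) \<cdot>\<^bsub>D\<^esub> comult F (a \<odot>\<^bsub>C\<^esub> b) c =
        (Id D (ObjF F a) \<otimes>\<^bsub>D\<^esub> comult F b c) \<cdot>\<^bsub>D\<^esub>
          comult F a (b \<odot>\<^bsub>C\<^esub> c) \<cdot>\<^bsub>D\<^esub> ArrF F (Assoc C a b c)) \<and>
     (\<forall>a \<in> Obj C.
        LUnit D (ObjF F a) \<cdot>\<^bsub>D\<^esub> (counit F \<otimes>\<^bsub>D\<^esub> Id D (ObjF F a)) \<cdot>\<^bsub>D\<^esub> comult F (Unit C) a =
        ArrF F (LUnit C a)) \<and>
     (\<forall>a \<in> Obj C.
        RUnit D (ObjF F a) \<cdot>\<^bsub>D\<^esub> (Id D (ObjF F a) \<otimes>\<^bsub>D\<^esub> counit F) \<cdot>\<^bsub>D\<^esub> comult F a (Unit C) =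
        ArrF F (RUnit C a))"

definition colax_comp ::
  "('r, 's, 'z) moncat_scheme \<Rightarrow> ('p, 'q, 'r, 's) colax \<Rightarrow> ('o, 'm, 'p, 'q) colax \<Rightarrow>
   ('o, 'm, 'r, 's) colax" where
  "colax_comp D G F = \<lparr>ObjF = (\<lambda>a. ObjF G (ObjF F a)), ArrF = (\<lambda>f. ArrF G (ArrF F f)),
     counit = counit G \<cdot>\<^bsub>D\<^esub> ArrF G (counit F),
     comult = (\<lambda>a b. comult G (ObjF F a) (ObjF F b) \<cdot>\<^bsub>D\<^esub> ArrF G (comult F a b))\<rparr>"

definition is_monoidal_nat_trans ::
  "('o, 'm, 'y) moncat_scheme \<Rightarrow> ('p, 'q, 'z) moncat_scheme \<Rightarrow>
   ('o, 'm, 'p, 'q) colax \<Rightarrow> ('o, 'm, 'p, 'q) colax \<Rightarrow> ('o \<Rightarrow> 'q) \<Rightarrow> bool" where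
  "is_monoidal_nat_trans C D F G \<tau> \<longleftrightarrow> is_nat_trans C D F G \<tau> \<and>
     counit G \<cdot>\<^bsub>D\<^esub> \<tau> (Unit C) = counit F \<and>
     (\<forall>a \<in> Obj C. \<forall>b \<in> Obj C.
        comult G a b \<cdot>\<^bsub>D\<^esub> \<tau> (a \<odot>\<^bsub>C\<^esub> b) = (\<tau> a \<otimes>\<^bsub>D\<^esub> \<tau> b) \<cdot>\<^bsub>D\<^esub> comult F a b)"

section \<open>Quivers\<close>

text \<open>A quiver \<open>Q\<close> and a morphism of quivers on \<open>S\<close> are extensional functions on \<open>S \<times> S\<close>.\<close>

definition quiv_tens ::
  "('o, 'm, 'z) moncat_scheme \<Rightarrow> 's set \<Rightarrow> ('s \<times> 's \<Rightarrow> 'o) \<Rightarrow> ('s \<times> 's \<Rightarrow> 'o) \<Rightarrow> ('s \<times> 's \<Rightarrow> 'o)"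
  where
  "quiv_tens V S Q P = (\<lambda>(a, b) \<in> S \<times> S. coprod V S (\<lambda>c. Q (a, c) \<odot>\<^bsub>V\<^esub> P (c, b)))"

definition quiv_inj ::
  "('o, 'm, 'z) moncat_scheme \<Rightarrow> 's set \<Rightarrow> ('s \<times> 's \<Rightarrow> 'o) \<Rightarrow> ('s \<times> 's \<Rightarrow> 'o) \<Rightarrow> 's \<Rightarrow> 's \<Rightarrow> 's \<Rightarrow> 'm"
  where
  "quiv_inj V S Q P a b c = coprod_inj V S (\<lambda>c. Q (a, c) \<odot>\<^bsub>V\<^esub> P (c, b)) c"

definition quiv_copair ::
  "('o, 'm, 'z) moncat_scheme \<Rightarrow> 's set \<Rightarrow> ('s \<times> 's \<Rightarrow> 'o) \<Rightarrow> ('s \<times> 's \<Rightarrow> 'o) \<Rightarrow> 's \<Rightarrow> 's \<Rightarrow>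
   'o \<Rightarrow> ('s \<Rightarrow> 'm) \<Rightarrow> 'm" where
  "quiv_copair V S Q P a b Z g = copair V S (\<lambda>c. Q (a, c) \<odot>\<^bsub>V\<^esub> P (c, b)) Z g"

definition quiv_unit :: "('o, 'm, 'z) moncat_scheme \<Rightarrow> 's set \<Rightarrow> ('s \<times> 's \<Rightarrow> 'o)" where
  "quiv_unit V S = (\<lambda>(a, b) \<in> S \<times> S. if a = b then Unit V else initial V)"

definition quiv_dom :: "('o, 'm, 'z) cat_scheme \<Rightarrow> 's set \<Rightarrow> ('s \<times> 's \<Rightarrow> 'm) \<Rightarrow> ('s \<times> 's \<Rightarrow> 'o)" where
  "quiv_dom V S \<phi> = (\<lambda>p \<in> S \<times> S. Dom V (\<phi> p))"

definition quiv_cod :: "('o, 'm, 'z) cat_scheme \<Rightarrow> 's set \<Rightarrow> ('s \<times> 's \<Rightarrow> 'm) \<Rightarrow> ('s \<times> 's \<Rightarrow> 'o)" where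
  "quiv_cod V S \<phi> = (\<lambda>p \<in> S \<times> S. Cod V (\<phi> p))"

text \<open>As \<open>V\<close> is closed, its tensor product preserves coproducts in each variable. So a morphism
  out of \<open>(Q \<otimes> P) \<otimes> R\<close> is determined by its restrictions to the summands
  \<open>(Q(a,d) \<otimes> P(d,c)) \<otimes> R(c,b)\<close>, and one out of \<open>I\<^sub>S \<otimes> Q\<close> by its restriction to
  \<open>I\<^sub>S(a,a) \<otimes> Q(a,b)\<close>, the other summands being initial.\<close>

definition Quiv :: "('o, 'm, 'z) moncat_scheme \<Rightarrow> 's set \<Rightarrow> ('s \<times> 's \<Rightarrow> 'o, 's \<times> 's \<Rightarrow> 'm) moncat" where
  "Quiv V S = \<lparr>
     Obj = S \<times> S \<rightarrow>\<^sub>E Obj V,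
     Arr = S \<times> S \<rightarrow>\<^sub>E Arr V,
     Dom = quiv_dom V S,
     Cod = quiv_cod V S,
     Id = (\<lambda>Q. \<lambda>p \<in> S \<times> S. Id V (Q p)),
     Comp = (\<lambda>\<psi> \<phi>. \<lambda>p \<in> S \<times> S. \<psi> p \<cdot>\<^bsub>V\<^esub> \<phi> p),
     TensO = quiv_tens V S,
     TensA = (\<lambda>\<phi> \<psi>. \<lambda>(a, b) \<in> S \<times> S.
       quiv_copair V S (quiv_dom V S \<phi>) (quiv_dom V S \<psi>) a b
         (quiv_tens V S (quiv_cod V S \<phi>) (quiv_cod V S \<psi>) (a, b))
         (\<lambda>c. quiv_inj V S (quiv_cod V S \<phi>) (quiv_cod V S \<psi>) a b c \<cdot>\<^bsub>V\<^esub>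
              (\<phi> (a, c) \<otimes>\<^bsub>V\<^esub> \<psi> (c, b)))),
     Unit = quiv_unit V S,
     Assoc = (\<lambda>Q P R. \<lambda>(a, b) \<in> S \<times> S. THE u.
       u \<in> hom V (quiv_tens V S (quiv_tens V S Q P) R (a, b))
                 (quiv_tens V S Q (quiv_tens V S P R) (a, b)) \<and>
       (\<forall>c \<in> S. \<forall>d \<in> S.
          u \<cdot>\<^bsub>V\<^esub> quiv_inj V S (quiv_tens V S Q P) R a b c \<cdot>\<^bsub>V\<^esub>
            (quiv_inj V S Q P a c d \<otimes>\<^bsub>V\<^esub> Id V (R (c, b))) =
          quiv_inj V S Q (quiv_tens V S P R) a b d \<cdot>\<^bsub>V\<^esub>
            (Id V (Q (a, d)) \<otimes>\<^bsub>V\<^esub> quiv_inj V S P R d b c) \<cdot>\<^bsub>V\<^esub>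
            Assoc V (Q (a, d)) (P (d, c)) (R (c, b)))),
     LUnit = (\<lambda>Q. \<lambda>(a, b) \<in> S \<times> S. THE u.
       u \<in> hom V (quiv_tens V S (quiv_unit V S) Q (a, b)) (Q (a, b)) \<and>
       u \<cdot>\<^bsub>V\<^esub> quiv_inj V S (quiv_unit V S) Q a b a = LUnit V (Q (a, b))),
     RUnit = (\<lambda>Q. \<lambda>(a, b) \<in> S \<times> S. THE u.
       u \<in> hom V (quiv_tens V S Q (quiv_unit V S) (a, b)) (Q (a, b)) \<and>
       u \<cdot>\<^bsub>V\<^esub> quiv_inj V S Q (quiv_unit V S) a b b = RUnit V (Q (a, b)))\<rparr>"

subsection \<open>Change of vertices\<close>

text \<open>\<open>pull S f\<close> is \<open>f\<^sup>*\<close>, on objects as well as on arrows. Its lax structure consists of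
  \<open>pull_mult : f\<^sup>*Q \<otimes>\<^sub>S f\<^sup>*P \<rightarrow> f\<^sup>*(Q \<otimes>\<^sub>T P)\<close> and \<open>pull_one : I\<^sub>S \<rightarrow> f\<^sup>*I\<^sub>T\<close>.\<close>

definition pull :: "'s set \<Rightarrow> ('s \<Rightarrow> 't) \<Rightarrow> ('t \<times> 't \<Rightarrow> 'a) \<Rightarrow> ('s \<times> 's \<Rightarrow> 'a)" where
  "pull S f Q = (\<lambda>(a, b) \<in> S \<times> S. Q (f a, f b))"

definition pull_mult ::
  "('o, 'm, 'z) moncat_scheme \<Rightarrow> 's set \<Rightarrow> 't set \<Rightarrow> ('s \<Rightarrow> 't) \<Rightarrow>
   ('t \<times> 't \<Rightarrow> 'o) \<Rightarrow> ('t \<times> 't \<Rightarrow> 'o) \<Rightarrow> ('s \<times> 's \<Rightarrow> 'm)" where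
  "pull_mult V S T f Q P = (\<lambda>(a, b) \<in> S \<times> S.
     quiv_copair V S (pull S f Q) (pull S f P) a b (quiv_tens V T Q P (f a, f b))
       (\<lambda>c. quiv_inj V T Q P (f a) (f b) (f c)))"

definition pull_one ::
  "('o, 'm, 'z) moncat_scheme \<Rightarrow> 's set \<Rightarrow> 't set \<Rightarrow> ('s \<Rightarrow> 't) \<Rightarrow> ('s \<times> 's \<Rightarrow> 'm)" where
  "pull_one V S T f = (\<lambda>(a, b) \<in> S \<times> S.
     if a = b then Id V (Unit V) else from_initial V (quiv_unit V T (f a, f b)))"

text \<open>The left adjoint \<open>f\<^sub>!\<close> sums over fibres; \<open>push_unit\<close> is the unit \<open>Q \<rightarrow> f\<^sup>*f\<^sub>!Q\<close> of the
  adjunction and \<open>push_transpose\<close> turns \<open>g : Q \<rightarrow> f\<^sup>*R\<close> into \<open>f\<^sub>!Q \<rightarrow> R\<close>. The colax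
  structure of \<open>f\<^sub>!\<close> is the mate of the lax structure of \<open>f\<^sup>*\<close>.\<close>

definition fibre :: "'s set \<Rightarrow> ('s \<Rightarrow> 't) \<Rightarrow> 't \<Rightarrow> 't \<Rightarrow> ('s \<times> 's) set" where
  "fibre S f a b = {(x, y) \<in> S \<times> S. f x = a \<and> f y = b}"

definition push_obj ::
  "('o, 'm, 'z) moncat_scheme \<Rightarrow> 's set \<Rightarrow> 't set \<Rightarrow> ('s \<Rightarrow> 't) \<Rightarrow> ('s \<times> 's \<Rightarrow> 'o) \<Rightarrow> ('t \<times> 't \<Rightarrow> 'o)"
  where
  "push_obj V S T f Q = (\<lambda>(a, b) \<in> T \<times> T. coprod V (fibre S f a b) Q)"

definition push_unit ::
  "('o, 'm, 'z) moncat_scheme \<Rightarrow> 's set \<Rightarrow> ('s \<Rightarrow> 't) \<Rightarrow> ('s \<times> 's \<Rightarrow> 'o) \<Rightarrow> ('s \<times> 's \<Rightarrow> 'm)" where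
  "push_unit V S f Q = (\<lambda>(x, y) \<in> S \<times> S. coprod_inj V (fibre S f (f x) (f y)) Q (x, y))"

definition push_transpose ::
  "('o, 'm, 'z) moncat_scheme \<Rightarrow> 's set \<Rightarrow> 't set \<Rightarrow> ('s \<Rightarrow> 't) \<Rightarrow>
   ('s \<times> 's \<Rightarrow> 'o) \<Rightarrow> ('t \<times> 't \<Rightarrow> 'o) \<Rightarrow> ('s \<times> 's \<Rightarrow> 'm) \<Rightarrow> ('t \<times> 't \<Rightarrow> 'm)" where
  "push_transpose V S T f Q R g =
     (\<lambda>(a, b) \<in> T \<times> T. copair V (fibre S f a b) Q (R (a, b)) g)"

definition push ::
  "('o, 'm, 'z) moncat_scheme \<Rightarrow> 's set \<Rightarrow> 't set \<Rightarrow> ('s \<Rightarrow> 't) \<Rightarrow>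
   ('s \<times> 's \<Rightarrow> 'o, 's \<times> 's \<Rightarrow> 'm, 't \<times> 't \<Rightarrow> 'o, 't \<times> 't \<Rightarrow> 'm) colax" where
  "push V S T f = \<lparr>
     ObjF = push_obj V S T f,
     ArrF = (\<lambda>\<phi>. push_transpose V S T f (quiv_dom V S \<phi>) (push_obj V S T f (quiv_cod V S \<phi>))
       (push_unit V S f (quiv_cod V S \<phi>) \<cdot>\<^bsub>Quiv V S\<^esub> \<phi>)),
     counit = push_transpose V S T f (quiv_unit V S) (quiv_unit V T) (pull_one V S T f),
     comult = (\<lambda>Q P. push_transpose V S T f (quiv_tens V S Q P)
       (quiv_tens V T (push_obj V S T f Q) (push_obj V S T f P))
       (pull_mult V S T f (push_obj V S T f Q) (push_obj V S T f P) \<cdot>\<^bsub>Quiv V S\<^esub>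
         (push_unit V S f Q \<otimes>\<^bsub>Quiv V S\<^esub> push_unit V S f P)))\<rparr>"

text \<open>The canonical isomorphism \<open>(g f)\<^sub>! Q \<rightarrow> g\<^sub>! f\<^sub>! Q\<close>.\<close>

definition push_push ::
  "('o, 'm, 'z) moncat_scheme \<Rightarrow> 's set \<Rightarrow> 't set \<Rightarrow> 'w set \<Rightarrow> ('s \<Rightarrow> 't) \<Rightarrow> ('t \<Rightarrow> 'w) \<Rightarrow>
   ('s \<times> 's \<Rightarrow> 'o) \<Rightarrow> ('w \<times> 'w \<Rightarrow> 'm)" where
  "push_push V S T W f g Q =
     push_transpose V S W (compose S g f) Q (push_obj V T W g (push_obj V S T f Q))
       (pull S f (push_unit V T g (push_obj V S T f Q)) \<cdot>\<^bsub>Quiv V S\<^esub> push_unit V S f Q)"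

section \<open>Simplicial sets\<close>

text \<open>An arrow \<open>[m] \<rightarrow> [n]\<close> of the simplex category is a triple \<open>(m, f, n)\<close> with \<open>f\<close> extensional
  on \<open>{..m}\<close>.\<close>

type_synonym delta = "nat \<times> (nat \<Rightarrow> nat) \<times> nat"

abbreviation dfun :: "delta \<Rightarrow> nat \<Rightarrow> nat" where
  "dfun h \<equiv> fst (snd h)"

definition Delta :: "(nat, delta) cat" where
  "Delta = \<lparr>Obj = UNIV,
     Arr = {(m, f, n). f \<in> {..m} \<rightarrow>\<^sub>E {..n} \<and> mono_on {..m} f},
     Dom = (\<lambda>(m, f, n). m), Cod = (\<lambda>(m, f, n). n),
     Id = (\<lambda>n. (n, \<lambda>i \<in> {..n}. i, n)),
     Comp = (\<lambda>(m, g, n) (l, f, k). (l, compose {..l} g f, n))\<rparr>"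

definition Delta_f :: "(nat, delta) moncat" where
  "Delta_f = \<lparr>Obj = UNIV,
     Arr = {(m, f, n) \<in> Arr Delta. f 0 = 0 \<and> f m = n},
     Dom = Dom Delta, Cod = Cod Delta, Id = Id Delta, Comp = Comp Delta,
     TensO = (+),
     TensA = (\<lambda>(m, f, m') (n, g, n').
       (m + n, \<lambda>i \<in> {..m + n}. if i \<le> m then f i else m' + g (i - m), m' + n')),
     Unit = 0,
     Assoc = (\<lambda>k m n. Id Delta (k + m + n)), LUnit = Id Delta, RUnit = Id Delta\<rparr>"

record 'k sset =
  simp :: "nat \<Rightarrow> 'k set"
  act :: "delta \<Rightarrow> 'k \<Rightarrow> 'k"

definition is_sset :: "'k sset \<Rightarrow> bool" where
  "is_sset K \<longleftrightarrow>
     (\<forall>h \<in> Arr Delta. \<forall>x \<in> simp K (Cod Delta h). act K h x \<in> simp K (Dom Delta h)) \<and>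
     (\<forall>n. \<forall>x \<in> simp K n. act K (Id Delta n) x = x) \<and>
     (\<forall>g \<in> Arr Delta. \<forall>h \<in> Arr Delta. Dom Delta g = Cod Delta h \<longrightarrow>
        (\<forall>x \<in> simp K (Cod Delta g). act K (g \<cdot>\<^bsub>Delta\<^esub> h) x = act K h (act K g x)))"

definition is_sset_map :: "'k sset \<Rightarrow> 'l sset \<Rightarrow> (nat \<Rightarrow> 'k \<Rightarrow> 'l) \<Rightarrow> bool" where
  "is_sset_map K L \<phi> \<longleftrightarrow>
     (\<forall>n. \<forall>x \<in> simp K n. \<phi> n x \<in> simp L n) \<and>
     (\<forall>h \<in> Arr Delta. \<forall>x \<in> simp K (Cod Delta h).
        \<phi> (Dom Delta h) (act K h x) = act L h (\<phi> (Cod Delta h) x))"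

definition std_simplex :: "nat \<Rightarrow> delta sset" where
  "std_simplex n = \<lparr>simp = (\<lambda>m. hom Delta m n), act = (\<lambda>h x. x \<cdot>\<^bsub>Delta\<^esub> h)\<rparr>"

definition horn :: "nat \<Rightarrow> nat \<Rightarrow> delta sset" where
  "horn n j = \<lparr>simp = (\<lambda>m. {x \<in> hom Delta m n. \<not> {..n} - {j} \<subseteq> dfun x ` {..m}}),
     act = (\<lambda>h x. x \<cdot>\<^bsub>Delta\<^esub> h)\<rparr>"

definition quasi_category :: "'k sset \<Rightarrow> bool" where
  "quasi_category K \<longleftrightarrow> is_sset K \<and>
     (\<forall>n j \<phi>. 0 < j \<and> j < n \<and> is_sset_map (horn n j) K \<phi> \<longrightarrow>
        (\<exists>\<psi>. is_sset_map (std_simplex n) K \<psi> \<and>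
             (\<forall>m. \<forall>x \<in> simp (horn n j) m. \<psi> m x = \<phi> m x)))"

text \<open>\<open>seg m i n\<close> is the map \<open>[m] \<rightarrow> [n]\<close> with image \<open>{i..i + m}\<close>. With it, \<open>seg 0 i n\<close> gives the
  \<open>i\<close>-th vertex, \<open>seg k 0 (k + l)\<close> the front face and \<open>seg l k (k + l)\<close> the back face.\<close>

definition seg :: "nat \<Rightarrow> nat \<Rightarrow> nat \<Rightarrow> delta" where
  "seg m i n = (m, \<lambda>r \<in> {..m}. i + r, n)"

definition simp_between :: "'k sset \<Rightarrow> nat \<Rightarrow> 'k \<Rightarrow> 'k \<Rightarrow> 'k set" where
  "simp_between K n a b = {x \<in> simp K n. act K (seg 0 0 n) x = a \<and> act K (seg 0 n n) x = b}"

section \<open>Templicial objects\<close>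

type_synonym ('s, 'o, 'm) quiv_colax = "(nat, delta, 's \<times> 's \<Rightarrow> 'o, 's \<times> 's \<Rightarrow> 'm) colax"

type_synonym ('s, 't, 'm) tmor = "(nat \<Rightarrow> 't \<times> 't \<Rightarrow> 'm) \<times> ('s \<Rightarrow> 't)"

definition templicial :: "('o, 'm, 'z) moncat_scheme \<Rightarrow> ('s, 'o, 'm) quiv_colax \<times> 's set \<Rightarrow> bool" where
  "templicial V = (\<lambda>(X, S). is_colax_monoidal (op_moncat Delta_f) (Quiv V S) X \<and>
     is_iso (Quiv V S) (counit X))"

definition templicial_hom ::
  "('o, 'm, 'z) moncat_scheme \<Rightarrow> ('s, 'o, 'm) quiv_colax \<times> 's set \<Rightarrow>
   ('t, 'o, 'm) quiv_colax \<times> 't set \<Rightarrow> ('s, 't, 'm) tmor set" where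
  "templicial_hom V = (\<lambda>(X, S) (Y, T). {(\<alpha>, f). f \<in> S \<rightarrow>\<^sub>E T \<and>
     is_monoidal_nat_trans (op_moncat Delta_f) (Quiv V T)
       (colax_comp (Quiv V T) (push V S T f) X) Y \<alpha>})"

text \<open>The composite of \<open>(\<alpha>, f) : (X, S) \<rightarrow> (Y, T)\<close> followed by \<open>(\<beta>, g) : (Y, T) \<rightarrow> (Z, W)\<close>.\<close>

definition templicial_comp ::
  "('o, 'm, 'z) moncat_scheme \<Rightarrow> ('s, 'o, 'm) quiv_colax \<times> 's set \<Rightarrow> 't set \<Rightarrow> 'w set \<Rightarrow>
   ('s, 't, 'm) tmor \<Rightarrow> ('t, 'w, 'm) tmor \<Rightarrow> ('s, 'w, 'm) tmor" where
  "templicial_comp V = (\<lambda>(X, S) T W (\<alpha>, f) (\<beta>, g).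
     (\<lambda>n. \<beta> n \<cdot>\<^bsub>Quiv V W\<^esub> ArrF (push V T W g) (\<alpha> n) \<cdot>\<^bsub>Quiv V W\<^esub>
            push_push V S T W f g (ObjF X n),
      compose S g f))"

subsection \<open>The adjunction with simplicial sets\<close>

text \<open>The functor \<open>F : Set \<rightarrow> V\<close>: being colimit-preserving with \<open>F({*}) = I\<close>, it sends a
  set \<open>A\<close> to the coproduct of copies of \<open>I\<close> indexed by \<open>A\<close>.\<close>

definition free_obj :: "('o, 'm, 'z) moncat_scheme \<Rightarrow> 'i set \<Rightarrow> 'o" where
  "free_obj V A = coprod V A (\<lambda>_. Unit V)"

definition free_inj :: "('o, 'm, 'z) moncat_scheme \<Rightarrow> 'i set \<Rightarrow> 'i \<Rightarrow> 'm" where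
  "free_inj V A = coprod_inj V A (\<lambda>_. Unit V)"

definition free_copair :: "('o, 'm, 'z) moncat_scheme \<Rightarrow> 'i set \<Rightarrow> 'o \<Rightarrow> ('i \<Rightarrow> 'm) \<Rightarrow> 'm" where
  "free_copair V A Z g = copair V A (\<lambda>_. Unit V) Z g"

definition free_map :: "('o, 'm, 'z) moncat_scheme \<Rightarrow> 'i set \<Rightarrow> 'j set \<Rightarrow> ('i \<Rightarrow> 'j) \<Rightarrow> 'm" where
  "free_map V A B g = free_copair V A (free_obj V B) (\<lambda>i. free_inj V B (g i))"

definition free_quiv :: "('o, 'm, 'z) moncat_scheme \<Rightarrow> 'k sset \<Rightarrow> nat \<Rightarrow> ('k \<times> 'k \<Rightarrow> 'o)" where
  "free_quiv V K n = (\<lambda>(a, b) \<in> simp K 0 \<times> simp K 0. free_obj V (simp_between K n a b))"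

text \<open>The counit \<open>F(K\<^sub>0(a,b)) \<rightarrow> I\<^sub>S(a,b)\<close> uses that \<open>K\<^sub>0(a,b)\<close> is \<open>{a}\<close> if \<open>a = b\<close> and empty
  otherwise. The comultiplication sends the summand \<open>I\<close> of \<open>F(K\<^sub>k\<^sub>+\<^sub>l(a,b))\<close> at \<open>x\<close> to
  the summand \<open>I \<otimes> I\<close> at the pair of the front and back faces of \<open>x\<close>, which are
  \<open>d\<^sub>k\<^sub>+\<^sub>1 \<dots> d\<^sub>k\<^sub>+\<^sub>l x\<close> and \<open>d\<^sub>0 \<dots> d\<^sub>0 x\<close>.\<close>

definition F_tilde :: "('o, 'm, 'z) moncat_scheme \<Rightarrow> 'k sset \<Rightarrow> ('k, 'o, 'm) quiv_colax \<times> 'k set" where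
  "F_tilde V K = (\<lparr>
     ObjF = free_quiv V K,
     ArrF = (\<lambda>h. \<lambda>(a, b) \<in> simp K 0 \<times> simp K 0.
       free_map V (simp_between K (Cod Delta h) a b) (simp_between K (Dom Delta h) a b) (act K h)),
     counit = (\<lambda>(a, b) \<in> simp K 0 \<times> simp K 0.
       free_copair V (simp_between K 0 a b) (quiv_unit V (simp K 0) (a, b)) (\<lambda>_. Id V (Unit V))),
     comult = (\<lambda>k l. \<lambda>(a, b) \<in> simp K 0 \<times> simp K 0.
       free_copair V (simp_between K (k + l) a b)
         (quiv_tens V (simp K 0) (free_quiv V K k) (free_quiv V K l) (a, b))
         (\<lambda>x. let c = act K (seg 0 k (k + l)) x;
                  y = act K (seg k 0 (k + l)) x;
                  z = act K (seg l k (k + l)) x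
              in quiv_inj V (simp K 0) (free_quiv V K k) (free_quiv V K l) a b c \<cdot>\<^bsub>V\<^esub>
                 (free_inj V (simp_between K k a c) y \<otimes>\<^bsub>V\<^esub>
                  free_inj V (simp_between K l c b) z) \<cdot>\<^bsub>V\<^esub>
                 inv_arr V (LUnit V (Unit V))))\<rparr>,
     simp K 0)"

definition F_tilde_map ::
  "('o, 'm, 'z) moncat_scheme \<Rightarrow> 'k sset \<Rightarrow> 'l sset \<Rightarrow> (nat \<Rightarrow> 'k \<Rightarrow> 'l) \<Rightarrow> ('k, 'l, 'm) tmor" where
  "F_tilde_map V K L \<phi> =
     (let f = restrict (\<phi> 0) (simp K 0)
      in (\<lambda>n. push_transpose V (simp K 0) (simp L 0) f (free_quiv V K n) (free_quiv V L n)
            (\<lambda>(a, b) \<in> simp K 0 \<times> simp K 0.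
               free_map V (simp_between K n a b) (simp_between L n (f a) (f b)) (\<phi> n)),
          f))"

definition U_tilde ::
  "('o, 'm, 'z) moncat_scheme \<Rightarrow> ('s, 'o, 'm) quiv_colax \<times> 's set \<Rightarrow> (delta, 's, 'm) tmor sset" where
  "U_tilde V = (\<lambda>(X, S). \<lparr>
     simp = (\<lambda>n. templicial_hom V (F_tilde V (std_simplex n)) (X, S)),
     act = (\<lambda>h. let m = Dom Delta h; n = Cod Delta h in
       templicial_comp V (F_tilde V (std_simplex m)) (simp (std_simplex n) 0) S
         (F_tilde_map V (std_simplex m) (std_simplex n) (\<lambda>_ x. h \<cdot>\<^bsub>Delta\<^esub> x)))\<rparr>)"

section \<open>Necklaces\<close>

type_synonym neck = "nat set \<times> nat"

text \<open>An arrow \<open>(T, p) \<rightarrow> (U, q)\<close> is stored as \<open>((T, p), f, (U, q))\<close> with \<open>f\<close> extensional on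
  \<open>{..p}\<close>.\<close>

type_synonym neck_arr = "neck \<times> (nat \<Rightarrow> nat) \<times> neck"

definition Nec :: "(neck, neck_arr) cat" where
  "Nec = \<lparr>Obj = {(T, p). {0, p} \<subseteq> T \<and> T \<subseteq> {..p}},
     Arr = {((T, p), f, (U, q)). {0, p} \<subseteq> T \<and> T \<subseteq> {..p} \<and> {0, q} \<subseteq> U \<and> U \<subseteq> {..q} \<and>
              (p, f, q) \<in> Arr Delta_f \<and> U \<subseteq> f ` T},
     Dom = (\<lambda>(t, f, u). t), Cod = (\<lambda>(t, f, u). u),
     Id = (\<lambda>(T, p). ((T, p), \<lambda>i \<in> {..p}. i, (T, p))),
     Comp = (\<lambda>(t, g, u) ((T, p), f, s). ((T, p), compose {..p} g f, u))\<rparr>"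

definition steps :: "nat set \<Rightarrow> (nat \<times> nat) list" where
  "steps T = (let ts = sorted_list_of_set T in zip ts (tl ts))"

definition gaps :: "nat set \<Rightarrow> nat list" where
  "gaps T = map (\<lambda>(s, t). t - s) (steps T)"

subsection \<open>Iterated tensor products and comultiplications\<close>

text \<open>Let \<open>X\<close> be a colax monoidal functor from the opposite of \<open>Delta_f\<close> to \<open>D\<close>. Lists
  \<open>ds = [d\<^sub>1, \<dots>, d\<^sub>k]\<close> index the tensor products \<open>X\<^sub>d\<^sub>1 \<otimes> (X\<^sub>d\<^sub>2 \<otimes> \<dots>)\<close>, bracketed to
  the right; \<open>X\<^sub>T\<close> is the one with \<open>ds = gaps T\<close>.\<close>

fun tens :: "('p, 'q, 'z) moncat_scheme \<Rightarrow> (nat, delta, 'p, 'q) colax \<Rightarrow> nat list \<Rightarrow> 'p" where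
  "tens D X [] = Unit D"
| "tens D X (d # ds) = (if ds = [] then ObjF X d else ObjF X d \<odot>\<^bsub>D\<^esub> tens D X ds)"

text \<open>\<open>X\<^sub>d \<otimes> tens ds \<rightarrow> tens (d # ds)\<close>; it is the identity unless \<open>ds = []\<close>.\<close>

definition tens_cons ::
  "('p, 'q, 'z) moncat_scheme \<Rightarrow> (nat, delta, 'p, 'q) colax \<Rightarrow> nat \<Rightarrow> nat list \<Rightarrow> 'q" where
  "tens_cons D X d ds =
     (if ds = [] then RUnit D (ObjF X d) else Id D (ObjF X d \<odot>\<^bsub>D\<^esub> tens D X ds))"

text \<open>\<open>tens ds \<otimes> tens es \<rightarrow> tens (ds @ es)\<close>\<close>

fun tens_append ::
  "('p, 'q, 'z) moncat_scheme \<Rightarrow> (nat, delta, 'p, 'q) colax \<Rightarrow> nat list \<Rightarrow> nat list \<Rightarrow> 'q" where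
  "tens_append D X [] es = LUnit D (tens D X es)"
| "tens_append D X (d # ds) es =
     tens_cons D X d (ds @ es) \<cdot>\<^bsub>D\<^esub>
     (Id D (ObjF X d) \<otimes>\<^bsub>D\<^esub> tens_append D X ds es) \<cdot>\<^bsub>D\<^esub>
     Assoc D (ObjF X d) (tens D X ds) (tens D X es) \<cdot>\<^bsub>D\<^esub>
     (inv_arr D (tens_cons D X d ds) \<otimes>\<^bsub>D\<^esub> Id D (tens D X es))"

text \<open>The iterated comultiplication \<open>X\<^sub>p \<rightarrow> tens ds\<close> for \<open>p = sum_list ds\<close>.\<close>

fun mu :: "('p, 'q, 'z) moncat_scheme \<Rightarrow> (nat, delta, 'p, 'q) colax \<Rightarrow> nat list \<Rightarrow> 'q" where
  "mu D X [] = counit X"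
| "mu D X (d # ds) = (if ds = [] then Id D (ObjF X d)
     else (Id D (ObjF X d) \<otimes>\<^bsub>D\<^esub> mu D X ds) \<cdot>\<^bsub>D\<^esub> comult X d (sum_list ds))"

text \<open>\<open>\<mu>\<^sub>T\<^sub>1 \<otimes> \<dots> \<otimes> \<mu>\<^sub>T\<^sub>l : tens (map sum_list dss) \<rightarrow> tens (concat dss)\<close>, where \<open>dss\<close> lists the
  gaps of \<open>T\<^sub>1, \<dots>, T\<^sub>l\<close>.\<close>

fun inert_map :: "('p, 'q, 'z) moncat_scheme \<Rightarrow> (nat, delta, 'p, 'q) colax \<Rightarrow> nat list list \<Rightarrow> 'q" where
  "inert_map D X [] = Id D (Unit D)"
| "inert_map D X (ds # dss) =
     tens_append D X ds (concat dss) \<cdot>\<^bsub>D\<^esub>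
     (mu D X ds \<otimes>\<^bsub>D\<^esub> inert_map D X dss) \<cdot>\<^bsub>D\<^esub>
     inv_arr D (tens_cons D X (sum_list ds) (map sum_list dss))"

text \<open>The isomorphism \<open>tens (filter (\<lambda>d. d \<noteq> 0) ds) \<rightarrow> tens ds\<close> inserting factors \<open>X\<^sub>0\<close> by means
  of the inverse of \<open>counit X\<close>.\<close>

fun insert_zeros :: "('p, 'q, 'z) moncat_scheme \<Rightarrow> (nat, delta, 'p, 'q) colax \<Rightarrow> nat list \<Rightarrow> 'q" where
  "insert_zeros D X [] = Id D (Unit D)"
| "insert_zeros D X (d # ds) =
     (let es = filter (\<lambda>d. d \<noteq> 0) ds in
      tens_cons D X d ds \<cdot>\<^bsub>D\<^esub>
      (if d = 0
       then (inv_arr D (counit X) \<otimes>\<^bsub>D\<^esub> insert_zeros D X ds) \<cdot>\<^bsub>D\<^esub>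
            inv_arr D (LUnit D (tens D X es))
       else (Id D (ObjF X d) \<otimes>\<^bsub>D\<^esub> insert_zeros D X ds) \<cdot>\<^bsub>D\<^esub>
            inv_arr D (tens_cons D X d es)))"

text \<open>\<open>X(f\<^sub>1) \<otimes> \<dots> \<otimes> X(f\<^sub>k)\<close>\<close>

fun active_map :: "('p, 'q, 'z) moncat_scheme \<Rightarrow> (nat, delta, 'p, 'q) colax \<Rightarrow> delta list \<Rightarrow> 'q" where
  "active_map D X [] = Id D (Unit D)"
| "active_map D X (f # fs) =
     (if fs = [] then ArrF X f else ArrF X f \<otimes>\<^bsub>D\<^esub> active_map D X fs)"

subsection \<open>The functor of necklaces of a templicial object\<close>

definition neck_obj :: "('p, 'q, 'z) moncat_scheme \<Rightarrow> (nat, delta, 'p, 'q) colax \<Rightarrow> neck \<Rightarrow> 'p" where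
  "neck_obj D X = (\<lambda>(T, p). tens D X (gaps T))"

text \<open>\<open>f = f\<^sub>1 + \<dots> + f\<^sub>k\<close> for the beads of \<open>T\<close>.\<close>

definition beads :: "nat set \<Rightarrow> (nat \<Rightarrow> nat) \<Rightarrow> delta list" where
  "beads T f = map (\<lambda>(s, t). (t - s, \<lambda>i \<in> {..t - s}. f (s + i) - f s, f t - f s)) (steps T)"

text \<open>\<open>(T, p) \<rightarrow> (U, q)\<close> is the active map \<open>(T, p) \<rightarrow> (f(T), q)\<close> followed by the inert map
  \<open>(f(T), q) \<rightarrow> (U, q)\<close>.\<close>

definition neck_map :: "('p, 'q, 'z) moncat_scheme \<Rightarrow> (nat, delta, 'p, 'q) colax \<Rightarrow> neck_arr \<Rightarrow> 'q" where
  "neck_map D X = (\<lambda>((T, p), f, (U, q)).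
     active_map D X (beads T f) \<cdot>\<^bsub>D\<^esub>
     insert_zeros D X (map (Cod Delta_f) (beads T f)) \<cdot>\<^bsub>D\<^esub>
     inert_map D X (map (\<lambda>(u, v). gaps (f ` T \<inter> {u..v})) (steps U)))"

text \<open>\<open>X\<^sub>\<bullet>(a,b)\<close>, contravariant in necklaces.\<close>

definition neck_functor ::
  "('o, 'm, 'z) moncat_scheme \<Rightarrow> ('s, 'o, 'm) quiv_colax \<times> 's set \<Rightarrow> 's \<Rightarrow> 's \<Rightarrow>
   (neck, neck_arr, 'o, 'm) funct" where
  "neck_functor V = (\<lambda>(X, S) a b. \<lparr>
     ObjF = (\<lambda>t. neck_obj (Quiv V S) X t (a, b)),
     ArrF = (\<lambda>h. neck_map (Quiv V S) X h (a, b))\<rparr>)"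

text \<open>For a templicial morphism \<open>(\<alpha>, f) : (X, S) \<rightarrow> (Y, T)\<close>, the induced morphisms of quivers
  \<open>X\<^sub>t \<rightarrow> f\<^sup>*(Y\<^sub>t)\<close>, for \<open>t\<close> a necklace: tensor products of the adjuncts
  \<open>X\<^sub>d \<rightarrow> f\<^sup>*(Y\<^sub>d)\<close> of \<open>\<alpha>\<^sub>d\<close>, followed by the lax structure of \<open>f\<^sup>*\<close>.\<close>

fun tens_map ::
  "('o, 'm, 'z) moncat_scheme \<Rightarrow> ('s, 'o, 'm) quiv_colax \<times> 's set \<Rightarrow>
   ('t, 'o, 'm) quiv_colax \<times> 't set \<Rightarrow> ('s, 't, 'm) tmor \<Rightarrow> nat list \<Rightarrow> 's \<times> 's \<Rightarrow> 'm" where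
  "tens_map V (X, S) (Y, T) (\<alpha>, f) [] = pull_one V S T f"
| "tens_map V (X, S) (Y, T) (\<alpha>, f) (d # ds) =
     (let \<alpha>' = pull S f (\<alpha> d) \<cdot>\<^bsub>Quiv V S\<^esub> push_unit V S f (ObjF X d)
      in if ds = [] then \<alpha>'
         else pull_mult V S T f (ObjF Y d) (tens (Quiv V T) Y ds) \<cdot>\<^bsub>Quiv V S\<^esub>
              (\<alpha>' \<otimes>\<^bsub>Quiv V S\<^esub> tens_map V (X, S) (Y, T) (\<alpha>, f) ds))"

definition horn_incl :: "('o, 'm, 'z) moncat_scheme \<Rightarrow> nat \<Rightarrow> nat \<Rightarrow> neck \<Rightarrow> 'm" where
  "horn_incl V n j = (\<lambda>(T, p).
     tens_map V (F_tilde V (horn n j)) (F_tilde V (std_simplex n))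
       (F_tilde_map V (horn n j) (std_simplex n) (\<lambda>_ x. x)) (gaps T) (seg 0 0 n, seg 0 n n))"

section \<open>Quasi-categories in \<open>V\<close>\<close>

definition quasi_category_in ::
  "('o, 'm, 'z) moncat_scheme \<Rightarrow> ('s, 'o, 'm) quiv_colax \<times> 's set \<Rightarrow> bool" where
  "quasi_category_in V XS \<longleftrightarrow> templicial V XS \<and>
     (\<forall>a \<in> snd XS. \<forall>b \<in> snd XS. \<forall>n j \<phi>. 0 < j \<and> j < n \<and>
        is_nat_trans (op_cat Nec) V
          (neck_functor V (F_tilde V (horn n j)) (seg 0 0 n) (seg 0 n n))
          (neck_functor V XS a b) \<phi> \<longrightarrow>
        (\<exists>\<psi>. is_nat_trans (op_cat Nec) V
               (neck_functor V (F_tilde V (std_simplex n)) (seg 0 0 n) (seg 0 n n))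
               (neck_functor V XS a b) \<psi> \<and>
             (\<forall>t \<in> Obj Nec. \<psi> t \<cdot>\<^bsub>V\<^esub> horn_incl V n j t = \<phi> t)))"

end

theory Submission
  imports Defs
begin

text \<open>A map of simplicial sets \<open>K \<rightarrow> U~(X)\<close> is the same as a family of elements
  \<open>I \<rightarrow> X\<^sub>n(f a, f b)\<close>, one for each \<open>n\<close>-simplex of \<open>K\<close> from \<open>a\<close> to \<open>b\<close>, which is
  compatible with inner faces, degeneracies and comultiplications. A family on the horn induces a
  natural transformation \<open>F~(\<Lambda>)\<^sub>\<bullet>(0,n) \<rightarrow> X\<^sub>\<bullet>(f 0, f n)\<close>. Its naturality can be tested on
  products of elements, which are jointly epic as the tensor product is closed; on these, both
  sides are the product of the same chain of simplices. As \<open>X\<close> is a quasi-category in \<open>V\<close>, the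
  transformation extends to some \<open>\<psi>\<close> on \<open>F~(\<Delta>)\<^sub>\<bullet>(0,n)\<close>.

  An \<open>m\<close>-simplex \<open>x\<close> of the standard simplex outside the horn runs from \<open>0\<close> to \<open>n\<close>, and \<open>\<psi>\<close> at the
  necklace \<open>({0,m},m)\<close> assigns an element to it. Compatibility with the comultiplications is naturality
  of \<open>\<psi>\<close> for \<open>({0,k,m},m) \<rightarrow> ({0,m},m)\<close>, provided that \<open>\<psi>\<close> at \<open>({0,k,m},m)\<close> sends the two faces of
  \<open>x\<close> to the product of their elements. This is clear if both lie in the horn. If one does not,
  it already runs from \<open>0\<close> to \<open>n\<close>, so that the other one is constant; then one uses naturality for
  the map of necklaces that collapses the bead of the constant face.\<close>

text \<open>Morphisms are compared on elements, that is, on arrows out of the unit. Each structure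
  morphism of quivers gets a rule for its value on a product of elements, which turns necklace maps
  into combinatorics of chains of simplices: splitting at joints, inserting vertices, acting bead by
  bead. These rules presuppose a family. For the simplices outside the horn that is what has to be
  shown, so there the few necklace maps involved are computed on arbitrary elements, and this is
  where unit coherence for quivers enters.

  Dimension 0 needs care: the necklace \<open>({0}, 0)\<close> has no bead, so its value is the unit
  quiver and not the isomorphic object in degree 0. The extension is therefore used in positive
  dimensions only, and comultiplications with \<open>k = 0\<close> or \<open>l = 0\<close> are
  settled by the counit laws.

  Size is tracked per index set, as cocompleteness concerns diagrams inside \<open>'u\<close>: a set
  has coproducts once it injects into \<open>'u\<close>. The vertex set \<open>S\<close> lies in
  \<open>'u\<close>, and each dimension of a standard simplex is a finite set, which injects as
  \<open>'u\<close> is infinite.\<close>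

lemma hom_iff: "f \<in> hom C a b \<longleftrightarrow> f \<in> Arr C \<and> Dom C f = a \<and> Cod C f = b"
  by (auto simp: hom_def)

section \<open>Calculus of arrows and isomorphisms\<close>

context category
begin

lemma arr_comp [simp]: "f \<in> Arr C \<Longrightarrow> g \<in> Arr C \<Longrightarrow> Cod C f = Dom C g \<Longrightarrow> g \<cdot> f \<in> Arr C"
  and dom_comp [simp]: "f \<in> Arr C \<Longrightarrow> g \<in> Arr C \<Longrightarrow> Cod C f = Dom C g \<Longrightarrow> Dom C (g \<cdot> f) = Dom C f"
  and cod_comp [simp]: "f \<in> Arr C \<Longrightarrow> g \<in> Arr C \<Longrightarrow> Cod C f = Dom C g \<Longrightarrow> Cod C (g \<cdot> f) = Cod C g"
  using comp_hom[of f "Dom C f" "Cod C f" g "Cod C g"] by (auto simp: hom_iff)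

lemma assoc [simp]:
  "f \<in> Arr C \<Longrightarrow> g \<in> Arr C \<Longrightarrow> h \<in> Arr C \<Longrightarrow> Cod C f = Dom C g \<Longrightarrow> Cod C g = Dom C h \<Longrightarrow>
   (h \<cdot> g) \<cdot> f = h \<cdot> g \<cdot> f"
  using comp_assoc[of f "Dom C f" "Cod C f" g "Cod C g" h "Cod C h"] by (auto simp: hom_iff)

lemma arr_id [simp]: "a \<in> Obj C \<Longrightarrow> Id C a \<in> Arr C"
  and dom_id [simp]: "a \<in> Obj C \<Longrightarrow> Dom C (Id C a) = a"
  and cod_id [simp]: "a \<in> Obj C \<Longrightarrow> Cod C (Id C a) = a"
  using id_hom[of a] by (auto simp: hom_iff)

lemma comp_id_right [simp]: "f \<in> Arr C \<Longrightarrow> Dom C f = a \<Longrightarrow> f \<cdot> Id C a = f"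
  and comp_id_left [simp]: "f \<in> Arr C \<Longrightarrow> Cod C f = a \<Longrightarrow> Id C a \<cdot> f = f"
  using comp_id[of f a "Cod C f"] id_comp[of f "Dom C f" a] by (auto simp: hom_iff)

declare dom_obj [simp] cod_obj [simp]

lemma hom_obj: "f \<in> hom C a b \<Longrightarrow> a \<in> Obj C" "f \<in> hom C a b \<Longrightarrow> b \<in> Obj C"
  by (auto simp: hom_iff)

lemma comp_reassoc:
  "g \<cdot> f = k \<Longrightarrow> f \<in> Arr C \<Longrightarrow> g \<in> Arr C \<Longrightarrow> Cod C f = Dom C g \<Longrightarrow> x \<in> Arr C \<Longrightarrow> Cod C x = Dom C f \<Longrightarrow>
   g \<cdot> f \<cdot> x = k \<cdot> x"
  by (metis assoc)

lemma inv_arr_eqI: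
  assumes "inverse_arrows C f g"
  shows "inv_arr C f = g"
  unfolding inv_arr_def
proof (rule the_equality[where P = "inverse_arrows C f"])
  fix g' assume g': "inverse_arrows C f g'"
  have "g' = g' \<cdot> f \<cdot> g" using assms g' by (auto simp: inverse_arrows_def hom_iff)
  also have "\<dots> = (g' \<cdot> f) \<cdot> g"
    using assms g' by (subst assoc) (auto simp: inverse_arrows_def hom_iff)
  also have "\<dots> = g" using assms g' by (auto simp: inverse_arrows_def hom_iff)
  finally show "g' = g" .
qed (fact assms)

lemma inverse_arrows_inv: "is_iso C f \<Longrightarrow> inverse_arrows C f (inv_arr C f)"
  by (auto simp: is_iso_def inv_arr_eqI)

lemma iso_arr: "is_iso C f \<Longrightarrow> f \<in> Arr C"
  by (auto simp: is_iso_def inverse_arrows_def)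

lemma
  assumes "is_iso C f"
  shows arr_inv [simp]: "inv_arr C f \<in> Arr C"
    and dom_inv [simp]: "Dom C (inv_arr C f) = Cod C f"
    and cod_inv [simp]: "Cod C (inv_arr C f) = Dom C f"
    and inv_comp [simp]: "inv_arr C f \<cdot> f = Id C (Dom C f)"
    and comp_inv [simp]: "f \<cdot> inv_arr C f = Id C (Cod C f)"
  using inverse_arrows_inv[OF assms] by (auto simp: inverse_arrows_def hom_iff)

lemma inv_hom: "is_iso C f \<Longrightarrow> f \<in> hom C a b \<Longrightarrow> inv_arr C f \<in> hom C b a"
  by (auto simp: hom_iff)

lemma inv_comp_reassoc [simp]:
  assumes "is_iso C f" "x \<in> Arr C" "Cod C x = Dom C f"
  shows "inv_arr C f \<cdot> f \<cdot> x = x"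
  using comp_reassoc[OF inv_comp[OF assms(1)]] iso_arr[OF assms(1)] assms by simp

lemma comp_inv_reassoc [simp]:
  assumes "is_iso C f" "x \<in> Arr C" "Cod C x = Cod C f"
  shows "f \<cdot> inv_arr C f \<cdot> x = x"
  using comp_reassoc[OF comp_inv[OF assms(1)]] iso_arr[OF assms(1)] assms by simp

lemma iso_epi:
  assumes "is_iso C e" "f \<cdot> e = g \<cdot> e" "f \<in> Arr C" "g \<in> Arr C" "Dom C f = Cod C e" "Dom C g = Cod C e"
  shows "f = g"
proof -
  have "k = (k \<cdot> e) \<cdot> inv_arr C e" if "k \<in> Arr C" "Dom C k = Cod C e" for k
    using that assms(1) iso_arr[OF assms(1)] by simp
  then show ?thesis using assms by metis
qed

lemma iso_mono:
  assumes "is_iso C e" "e \<cdot> f = e \<cdot> g" "f \<in> Arr C" "g \<in> Arr C" "Cod C f = Dom C e" "Cod C g = Dom C e"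
  shows "f = g"
  by (metis assms inv_comp_reassoc)

lemma inv_comp_eq:
  assumes "is_iso C e" "e \<cdot> x = y" "x \<in> Arr C" "Cod C x = Dom C e"
  shows "inv_arr C e \<cdot> y = x"
  using assms inv_comp_reassoc by blast

lemma is_isoI: "f \<in> hom C a b \<Longrightarrow> g \<in> hom C b a \<Longrightarrow> g \<cdot> f = Id C a \<Longrightarrow> f \<cdot> g = Id C b \<Longrightarrow> is_iso C f"
  by (auto simp: is_iso_def inverse_arrows_def hom_iff intro!: exI[of _ g])

lemma iso_id: "a \<in> Obj C \<Longrightarrow> is_iso C (Id C a)"
  by (rule_tac is_isoI[of _ a a "Id C a"]) (auto simp: hom_iff)

lemma inv_id: "a \<in> Obj C \<Longrightarrow> inv_arr C (Id C a) = Id C a"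
  by (rule inv_arr_eqI) (simp add: inverse_arrows_def hom_iff)

end

section \<open>Unit coherence in a monoidal category, and elements\<close>

context monoidal_category
begin

declare unit_obj [simp] tens_obj [simp] tens_id [simp]

abbreviation I where "I \<equiv> Unit C"

lemma arr_tens [simp]: "f \<in> Arr C \<Longrightarrow> g \<in> Arr C \<Longrightarrow> f \<otimes> g \<in> Arr C"
  and dom_tens [simp]: "f \<in> Arr C \<Longrightarrow> g \<in> Arr C \<Longrightarrow> Dom C (f \<otimes> g) = Dom C f \<odot> Dom C g"
  and cod_tens [simp]: "f \<in> Arr C \<Longrightarrow> g \<in> Arr C \<Longrightarrow> Cod C (f \<otimes> g) = Cod C f \<odot> Cod C g"
  using tens_hom[of f "Dom C f" "Cod C f" g "Dom C g" "Cod C g"] by (auto simp: hom_iff)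

lemma interchange [simp]:
  "f \<in> Arr C \<Longrightarrow> g \<in> Arr C \<Longrightarrow> f' \<in> Arr C \<Longrightarrow> g' \<in> Arr C \<Longrightarrow> Cod C f = Dom C g \<Longrightarrow> Cod C f' = Dom C g' \<Longrightarrow>
   (g \<otimes> g') \<cdot> (f \<otimes> f') = (g \<cdot> f) \<otimes> (g' \<cdot> f')"
  using tens_comp[of f "Dom C f" "Cod C f" g "Cod C g" f' "Dom C f'" "Cod C f'" g' "Cod C g'"]
  by (auto simp: hom_iff)

lemma interchange_reassoc [simp]:
  "f \<in> Arr C \<Longrightarrow> g \<in> Arr C \<Longrightarrow> f' \<in> Arr C \<Longrightarrow> g' \<in> Arr C \<Longrightarrow> Cod C f = Dom C g \<Longrightarrow> Cod C f' = Dom C g' \<Longrightarrow>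
   x \<in> Arr C \<Longrightarrow> Cod C x = Dom C f \<odot> Dom C f' \<Longrightarrow>
   (g \<otimes> g') \<cdot> (f \<otimes> f') \<cdot> x = ((g \<cdot> f) \<otimes> (g' \<cdot> f')) \<cdot> x"
  by (rule_tac comp_reassoc) auto

lemma
  assumes "a \<in> Obj C" "b \<in> Obj C" "c \<in> Obj C"
  shows arr_assoc [simp]: "Assoc C a b c \<in> Arr C"
    and dom_assoc [simp]: "Dom C (Assoc C a b c) = (a \<odot> b) \<odot> c"
    and cod_assoc [simp]: "Cod C (Assoc C a b c) = a \<odot> (b \<odot> c)"
  using assoc_hom[OF assms] by (auto simp: hom_iff)

lemma
  assumes "a \<in> Obj C"
  shows arr_lunit [simp]: "LUnit C a \<in> Arr C"
    and dom_lunit [simp]: "Dom C (LUnit C a) = I \<odot> a"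
    and cod_lunit [simp]: "Cod C (LUnit C a) = a"
    and arr_runit [simp]: "RUnit C a \<in> Arr C"
    and dom_runit [simp]: "Dom C (RUnit C a) = a \<odot> I"
    and cod_runit [simp]: "Cod C (RUnit C a) = a"
  using lunit_hom[OF assms] runit_hom[OF assms] by (auto simp: hom_iff)

declare assoc_iso [simp] lunit_iso [simp] runit_iso [simp]

lemma iso_tens [simp]:
  assumes "is_iso C f" "is_iso C g"
  shows "is_iso C (f \<otimes> g)"
proof (rule is_isoI)
  show "f \<otimes> g \<in> hom C (Dom C f \<odot> Dom C g) (Cod C f \<odot> Cod C g)"
    "inv_arr C f \<otimes> inv_arr C g \<in> hom C (Cod C f \<odot> Cod C g) (Dom C f \<odot> Dom C g)"
    "(inv_arr C f \<otimes> inv_arr C g) \<cdot> (f \<otimes> g) = Id C (Dom C f \<odot> Dom C g)"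
    "(f \<otimes> g) \<cdot> (inv_arr C f \<otimes> inv_arr C g) = Id C (Cod C f \<odot> Cod C g)"
    using assms iso_arr[OF assms(1)] iso_arr[OF assms(2)] by (auto simp: hom_iff)
qed

lemma iso_id' [simp]: "a \<in> Obj C \<Longrightarrow> is_iso C (Id C a)"
  by (rule iso_id)

lemma lunit_nat': "f \<in> Arr C \<Longrightarrow> LUnit C (Cod C f) \<cdot> (Id C I \<otimes> f) = f \<cdot> LUnit C (Dom C f)"
  and runit_nat': "f \<in> Arr C \<Longrightarrow> RUnit C (Cod C f) \<cdot> (f \<otimes> Id C I) = f \<cdot> RUnit C (Dom C f)"
  using lunit_nat runit_nat by (auto simp: hom_iff)

lemma assoc_nat': "f \<in> Arr C \<Longrightarrow> g \<in> Arr C \<Longrightarrow> h \<in> Arr C \<Longrightarrow>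
  Assoc C (Cod C f) (Cod C g) (Cod C h) \<cdot> ((f \<otimes> g) \<otimes> h) =
  (f \<otimes> (g \<otimes> h)) \<cdot> Assoc C (Dom C f) (Dom C g) (Dom C h)"
  using assoc_nat by (auto simp: hom_iff)

text \<open>The left unitor identifies tensoring with I with the identity functor. An equation may
  thus be checked after tensoring with I, where the pentagon and the triangle can act.\<close>

lemma unit_tens_faithful:
  assumes "Id C I \<otimes> f = Id C I \<otimes> g" "f \<in> Arr C" "g \<in> Arr C" "Dom C f = Dom C g" "Cod C f = Cod C g"
  shows "f = g"
proof -
  have "f \<cdot> LUnit C (Dom C f) = g \<cdot> LUnit C (Dom C f)"
    using lunit_nat'[OF assms(2)] lunit_nat'[OF assms(3)] assms by simp
  then show ?thesis using assms by (rule_tac iso_epi[of "LUnit C (Dom C f)"]) auto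
qed

lemma tens_unit_faithful:
  assumes "f \<otimes> Id C I = g \<otimes> Id C I" "f \<in> Arr C" "g \<in> Arr C" "Dom C f = Dom C g" "Cod C f = Cod C g"
  shows "f = g"
proof -
  have "f \<cdot> RUnit C (Dom C f) = g \<cdot> RUnit C (Dom C f)"
    using runit_nat'[OF assms(2)] runit_nat'[OF assms(3)] assms by simp
  then show ?thesis using assms by (rule_tac iso_epi[of "RUnit C (Dom C f)"]) auto
qed

text \<open>Kelly's argument: after tensoring with I on the left and precomposing with the
  isomorphism \<open>?e\<close>, the pentagon for I, I, a, b and the triangle apply;
  \<open>?e\<close> and the extra I are cancelled at the end.\<close>

lemma lunit_tens:
  assumes a: "a \<in> Obj C" and b: "b \<in> Obj C"
  shows "LUnit C (a \<odot> b) \<cdot> Assoc C I a b = LUnit C a \<otimes> Id C b"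
proof (rule unit_tens_faithful)
  let ?e = "Assoc C I (I \<odot> a) b \<cdot> (Assoc C I I a \<otimes> Id C b)"
  have 1: "(Id C I \<otimes> (LUnit C (a \<odot> b) \<cdot> Assoc C I a b)) \<cdot> ?e =
      (Id C I \<otimes> LUnit C (a \<odot> b)) \<cdot> (Id C I \<otimes> Assoc C I a b) \<cdot> ?e"
    using a b by simp
  also have "\<dots> = (Id C I \<otimes> LUnit C (a \<odot> b)) \<cdot> Assoc C I I (a \<odot> b) \<cdot> Assoc C (I \<odot> I) a b"
    using a b by (subst pentagon) auto
  also have "\<dots> = (RUnit C I \<otimes> (Id C a \<otimes> Id C b)) \<cdot> Assoc C (I \<odot> I) a b"
    using a b triangle[of I "a \<odot> b"] by (rule_tac comp_reassoc) auto
  also have "\<dots> = Assoc C I a b \<cdot> ((RUnit C I \<otimes> Id C a) \<otimes> Id C b)"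
    using a b assoc_nat'[of "RUnit C I" "Id C a" "Id C b"] by simp
  also have "\<dots> = Assoc C I a b \<cdot> ((Id C I \<otimes> LUnit C a) \<otimes> Id C b) \<cdot> (Assoc C I I a \<otimes> Id C b)"
    using a b by (simp add: triangle)
  also have "\<dots> = (Id C I \<otimes> (LUnit C a \<otimes> Id C b)) \<cdot> ?e"
    using a b assoc_nat'[of "Id C I" "LUnit C a" "Id C b"]
    by (subst comp_reassoc[where k = "(Id C I \<otimes> (LUnit C a \<otimes> Id C b)) \<cdot> Assoc C I (I \<odot> a) b"]) auto
  finally have eq: "(Id C I \<otimes> (LUnit C (a \<odot> b) \<cdot> Assoc C I a b)) \<cdot> ?e =
    (Id C I \<otimes> (LUnit C a \<otimes> Id C b)) \<cdot> ?e" .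
  have "(Id C I \<otimes> (LUnit C (a \<odot> b) \<cdot> Assoc C I a b)) \<cdot> Assoc C I (I \<odot> a) b =
    (Id C I \<otimes> (LUnit C a \<otimes> Id C b)) \<cdot> Assoc C I (I \<odot> a) b"
    using eq a b by (rule_tac iso_epi[of "Assoc C I I a \<otimes> Id C b"]) auto
  then show "Id C I \<otimes> (LUnit C (a \<odot> b) \<cdot> Assoc C I a b) = Id C I \<otimes> (LUnit C a \<otimes> Id C b)"
    using a b by (rule_tac iso_epi[of "Assoc C I (I \<odot> a) b"]) auto
qed (use a b in auto)

text \<open>Naturality of the left unitor at itself computes the left unitor of
  \<open>I \<odot> I\<close>; then \<open>lunit_tens\<close> and the triangle, both at I and I,
  differ only by the two unitors tensored with I. By this lemma it makes no difference that
  \<open>etens\<close> is built from \<open>LUnit C I\<close> and not from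
  \<open>RUnit C I\<close>.\<close>

lemma lunit_unit: "LUnit C I = RUnit C I"
proof (rule tens_unit_faithful)
  have "LUnit C (I \<odot> I) = Id C I \<otimes> LUnit C I"
    using lunit_nat'[of "LUnit C I"] by (rule_tac iso_mono[of "LUnit C I"]) auto
  then show "LUnit C I \<otimes> Id C I = RUnit C I \<otimes> Id C I"
    using lunit_tens[of I I] triangle[of I I] by simp
qed auto

text \<open>Arrows out of the unit play the role of elements.\<close>

definition etens (infixr "\<boxtimes>" 75) where
  "x \<boxtimes> y = (x \<otimes> y) \<cdot> inv_arr C (LUnit C I)"

lemma
  assumes "x \<in> hom C I a" "y \<in> hom C I b"
  shows etens_hom: "x \<boxtimes> y \<in> hom C I (a \<odot> b)"
  using assms by (auto simp: hom_iff etens_def)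

lemma tens_comp_etens:
  assumes "x \<in> hom C I a" "y \<in> hom C I b" "f \<in> hom C a a'" "g \<in> hom C b b'"
  shows "(f \<otimes> g) \<cdot> (x \<boxtimes> y) = (f \<cdot> x) \<boxtimes> (g \<cdot> y)"
  using assms by (auto simp: hom_iff etens_def)

lemma lunit_etens:
  assumes "x \<in> hom C I a"
  shows "LUnit C a \<cdot> (Id C I \<boxtimes> x) = x"
proof -
  have "LUnit C a \<cdot> (Id C I \<otimes> x) = x \<cdot> LUnit C I"
    using lunit_nat'[of x] assms by (auto simp: hom_iff)
  then have "LUnit C a \<cdot> (Id C I \<otimes> x) \<cdot> inv_arr C (LUnit C I) = (x \<cdot> LUnit C I) \<cdot> inv_arr C (LUnit C I)"
    using assms by (rule_tac comp_reassoc) (auto simp: hom_iff)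
  then show ?thesis using assms by (auto simp: hom_iff etens_def)
qed

lemma runit_etens:
  assumes "x \<in> hom C I a"
  shows "RUnit C a \<cdot> (x \<boxtimes> Id C I) = x"
proof -
  have "RUnit C a \<cdot> (x \<otimes> Id C I) = x \<cdot> LUnit C I"
    using runit_nat'[of x] assms by (auto simp: hom_iff lunit_unit)
  then have "RUnit C a \<cdot> (x \<otimes> Id C I) \<cdot> inv_arr C (LUnit C I) = (x \<cdot> LUnit C I) \<cdot> inv_arr C (LUnit C I)"
    using assms by (rule_tac comp_reassoc) (auto simp: hom_iff)
  then show ?thesis using assms by (auto simp: hom_iff etens_def)
qed

text \<open>Naturality of the associator reduces the claim to the triple I, I, I. There it says that
  the two ways of splitting I into three factors correspond, which is the triangle combined with
  \<open>lunit_unit\<close>.\<close>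

lemma assoc_etens:
  assumes x: "x \<in> hom C I a" and y: "y \<in> hom C I b" and z: "z \<in> hom C I c"
  shows "Assoc C a b c \<cdot> ((x \<boxtimes> y) \<boxtimes> z) = x \<boxtimes> (y \<boxtimes> z)"
proof -
  let ?l = "inv_arr C (LUnit C I)"
  have ab: "a \<in> Obj C" "b \<in> Obj C" "c \<in> Obj C" using x y z by (auto simp: hom_iff)
  have "(Id C I \<otimes> LUnit C I) \<cdot> Assoc C I I I = LUnit C I \<otimes> Id C I"
    using triangle[of I I] by (simp add: lunit_unit)
  then have "((Id C I \<otimes> LUnit C I) \<cdot> Assoc C I I I) \<cdot> (?l \<otimes> Id C I) = Id C (I \<odot> I)"
    by simp
  then have "(Id C I \<otimes> LUnit C I) \<cdot> Assoc C I I I \<cdot> (?l \<otimes> Id C I) = (Id C I \<otimes> LUnit C I) \<cdot> (Id C I \<otimes> ?l)"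
    by simp
  then have l: "Assoc C I I I \<cdot> (?l \<otimes> Id C I) = Id C I \<otimes> ?l"
    by (rule_tac iso_mono[of "Id C I \<otimes> LUnit C I"]) auto
  have "(x \<boxtimes> y) \<boxtimes> z = ((x \<otimes> y) \<otimes> z) \<cdot> (?l \<otimes> Id C I) \<cdot> ?l"
    using x y z by (simp add: etens_def hom_iff)
  then have "Assoc C a b c \<cdot> ((x \<boxtimes> y) \<boxtimes> z) = (Assoc C a b c \<cdot> ((x \<otimes> y) \<otimes> z)) \<cdot> (?l \<otimes> Id C I) \<cdot> ?l"
    using x y z ab by (simp add: hom_iff)
  also have "\<dots> = (x \<otimes> (y \<otimes> z)) \<cdot> (Assoc C I I I \<cdot> (?l \<otimes> Id C I)) \<cdot> ?l"
    using assoc_nat[OF x y z] x y z ab by (auto simp: hom_iff)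
  also have "\<dots> = x \<boxtimes> (y \<boxtimes> z)"
    using x y z by (simp add: etens_def l hom_iff)
  finally show ?thesis .
qed

end

section \<open>Jointly epimorphic families and the closed structure\<close>

definition jointly_epi :: "('o, 'm, 'z) cat_scheme \<Rightarrow> 'o \<Rightarrow> 'm set \<Rightarrow> bool" where
  "jointly_epi C a E \<longleftrightarrow>
     (\<forall>c g g'. g \<in> hom C a c \<and> g' \<in> hom C a c \<and> (\<forall>x \<in> E. g \<cdot>\<^bsub>C\<^esub> x = g' \<cdot>\<^bsub>C\<^esub> x) \<longrightarrow> g = g')"

lemma jointly_epiD:
  "jointly_epi C a E \<Longrightarrow> g \<in> hom C a c \<Longrightarrow> g' \<in> hom C a c \<Longrightarrow>
   (\<And>x. x \<in> E \<Longrightarrow> g \<cdot>\<^bsub>C\<^esub> x = g' \<cdot>\<^bsub>C\<^esub> x) \<Longrightarrow> g = g'"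
  unfolding jointly_epi_def by blast

lemma (in category) jointly_epi_id: "jointly_epi C a {Id C a}"
  unfolding jointly_epi_def by (metis comp_id singletonI)

context symmetric_monoidal_closed_category
begin

text \<open>Tensoring with \<open>b\<close> on the right has a right adjoint, so it preserves
  jointly epimorphic families: the transposes \<open>u\<close> and \<open>u'\<close> are compared
  instead of \<open>g\<close> and \<open>g'\<close>. The family is indexed by a set of any type
  because the lemma serves for coproduct injections, for sets of elements and, with the empty
  family, for the initial object.\<close>

lemma tens_left_cancel:
  assumes a: "a \<in> Obj C" and b: "b \<in> Obj C"
    and E: "\<And>i. i \<in> A \<Longrightarrow> x i \<in> hom C (d i) a"
    and epi: "\<And>c g g'. g \<in> hom C a c \<Longrightarrow> g' \<in> hom C a c \<Longrightarrow> (\<And>i. i \<in> A \<Longrightarrow> g \<cdot> x i = g' \<cdot> x i) \<Longrightarrow> g = g'"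
    and g: "g \<in> hom C (a \<odot> b) c" "g' \<in> hom C (a \<odot> b) c"
    and eq: "\<And>i. i \<in> A \<Longrightarrow> g \<cdot> (x i \<otimes> Id C b) = g' \<cdot> (x i \<otimes> Id C b)"
  shows "g = g'"
proof -
  have c: "c \<in> Obj C" using g by (auto simp: hom_iff)
  obtain h ev where h: "h \<in> Obj C" and ev: "ev \<in> hom C (h \<odot> b) c"
    and univ: "\<And>a g. a \<in> Obj C \<Longrightarrow> g \<in> hom C (a \<odot> b) c \<Longrightarrow> \<exists>!u. u \<in> hom C a h \<and> ev \<cdot> (u \<otimes> Id C b) = g"
    using closed[OF b c] by meson
  obtain u where u: "u \<in> hom C a h" "ev \<cdot> (u \<otimes> Id C b) = g" using univ[OF a g(1)] by blast
  obtain u' where u': "u' \<in> hom C a h" "ev \<cdot> (u' \<otimes> Id C b) = g'" using univ[OF a g(2)] by blast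
  have "u = u'"
  proof (rule epi[OF u(1) u'(1)])
    fix i assume i: "i \<in> A"
    have *: "ev \<cdot> ((v \<cdot> x i) \<otimes> Id C b) = (ev \<cdot> (v \<otimes> Id C b)) \<cdot> (x i \<otimes> Id C b)" if "v \<in> hom C a h" for v
      using that E[OF i] ev b by (auto simp: hom_iff)
    have "d i \<in> Obj C" using hom_obj(1)[OF E[OF i]] .
    moreover have "g \<cdot> (x i \<otimes> Id C b) \<in> hom C (d i \<odot> b) c"
      using comp_hom[OF tens_hom[OF E[OF i] id_hom[OF b]] g(1)] .
    \<comment> \<open>Both \<open>u \<cdot> x i\<close> and \<open>u' \<cdot> x i\<close> are
      transposes of this one arrow, hence equal.\<close>
    ultimately have "\<exists>!u. u \<in> hom C (d i) h \<and> ev \<cdot> (u \<otimes> Id C b) = g \<cdot> (x i \<otimes> Id C b)" by (rule univ)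
    then show "u \<cdot> x i = u' \<cdot> x i"
      using *[OF u(1)] *[OF u'(1)] u u' eq[OF i] E[OF i] by (metis comp_hom)
  qed
  then show ?thesis using u u' by simp
qed

text \<open>One variable at a time: for fixed \<open>x\<close>, the inverse left unitor turns
  \<open>x \<otimes> Id C b\<close> into an arrow out of \<open>b\<close>, which is tested on
  \<open>E'\<close>; afterwards \<open>tens_left_cancel\<close> varies \<open>x\<close> in
  \<open>E\<close>.\<close>

lemma jointly_epi_etens:
  assumes a: "a \<in> Obj C" and b: "b \<in> Obj C" and E: "E \<subseteq> hom C I a" and E': "E' \<subseteq> hom C I b"
    and j: "jointly_epi C a E" "jointly_epi C b E'"
  shows "jointly_epi C (a \<odot> b) {x \<boxtimes> y |x y. x \<in> E \<and> y \<in> E'}"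
  unfolding jointly_epi_def
proof (intro allI impI, elim conjE)
  fix c g g'
  assume g: "g \<in> hom C (a \<odot> b) c" "g' \<in> hom C (a \<odot> b) c"
    and eq: "\<forall>x\<in>{x \<boxtimes> y |x y. x \<in> E \<and> y \<in> E'}. g \<cdot> x = g' \<cdot> x"
  show "g = g'"
  proof (rule tens_left_cancel[OF a b _ _ g, of E "\<lambda>x. x"])
    fix x assume x: "x \<in> E"
    then show xh: "x \<in> hom C I a" using E by blast
    have *: "(k \<cdot> (x \<otimes> Id C b) \<cdot> inv_arr C (LUnit C b)) \<cdot> y = k \<cdot> (x \<boxtimes> y)"
      if "k \<in> hom C (a \<odot> b) c" "y \<in> E'" for k y
    proof -
      have y: "y \<in> hom C I b" using that E' by blast
      have "inv_arr C (LUnit C b) \<cdot> y = Id C I \<boxtimes> y"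
        using lunit_etens[OF y] y etens_hom[of "Id C I" I y b] b
        by (rule_tac inv_comp_eq) (auto simp: hom_iff)
      then show ?thesis
        using that xh y b tens_comp_etens[of "Id C I" I y b x a "Id C b" b] etens_hom[of "Id C I" I y b]
        by (auto simp: hom_iff)
    qed
    have "g \<cdot> (x \<otimes> Id C b) \<cdot> inv_arr C (LUnit C b) = g' \<cdot> (x \<otimes> Id C b) \<cdot> inv_arr C (LUnit C b)"
    proof (rule jointly_epiD[OF j(2)])
      show "g \<cdot> (x \<otimes> Id C b) \<cdot> inv_arr C (LUnit C b) \<in> hom C b c"
        "g' \<cdot> (x \<otimes> Id C b) \<cdot> inv_arr C (LUnit C b) \<in> hom C b c"
        using g xh b by (auto simp: hom_iff)
      fix y assume y: "y \<in> E'"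
      then have "g \<cdot> (x \<boxtimes> y) = g' \<cdot> (x \<boxtimes> y)" using eq x by blast
      then show "(g \<cdot> (x \<otimes> Id C b) \<cdot> inv_arr C (LUnit C b)) \<cdot> y = (g' \<cdot> (x \<otimes> Id C b) \<cdot> inv_arr C (LUnit C b)) \<cdot> y"
        using * g y by simp
    qed
    then have "(g \<cdot> (x \<otimes> Id C b)) \<cdot> inv_arr C (LUnit C b) = (g' \<cdot> (x \<otimes> Id C b)) \<cdot> inv_arr C (LUnit C b)"
      using g xh b by (auto simp: hom_iff)
    moreover have "is_iso C (inv_arr C (LUnit C b))"
      using b by (rule_tac is_isoI[of _ b "I \<odot> b" "LUnit C b"]) (auto simp: hom_iff)
    ultimately show "g \<cdot> (x \<otimes> Id C b) = g' \<cdot> (x \<otimes> Id C b)"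
      using g xh b by (rule_tac iso_epi[of "inv_arr C (LUnit C b)"]) (auto simp: hom_iff)
  next
    fix c k k' assume "k \<in> hom C a c" "k' \<in> hom C a c" "\<And>x. x \<in> E \<Longrightarrow> k \<cdot> x = k' \<cdot> x"
    then show "k = k'" using jointly_epiD[OF j(1)] by blast
  qed
qed

end

section \<open>Coproducts\<close>

text \<open>A property of one index set at a time: the index sets that occur live in several types,
  while small cocompleteness concerns diagrams in a single type.\<close>

definition has_coprods :: "('o, 'm, 'z) cat_scheme \<Rightarrow> 'i set \<Rightarrow> bool" where
  "has_coprods C A \<longleftrightarrow> (\<forall>X. (\<forall>i \<in> A. X i \<in> Obj C) \<longrightarrow> (\<exists>P \<iota>. is_coproduct C A X P \<iota>))"

text \<open>A coproduct over \<open>A\<close> is a colimit over a discrete category, and the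
  injection \<open>g\<close> supplies a copy of that category inside the type of small sets.\<close>

lemma (in category) has_coprods_small:
  fixes A :: "'i set" and g :: "'i \<Rightarrow> 'u"
  assumes cocomp: "small_cocomplete TYPE('u) C" and g: "inj_on g A"
  shows "has_coprods C A"
  unfolding has_coprods_def
proof (intro allI impI)
  fix X :: "'i \<Rightarrow> 'o" assume X: "\<forall>i \<in> A. X i \<in> Obj C"
  define J :: "('u, 'u) cat" where
    "J = \<lparr>Obj = g ` A, Arr = g ` A, Dom = id, Cod = id, Id = id, Comp = (\<lambda>x y. x)\<rparr>"
  define D :: "('u, 'u, 'o, 'm) funct" where
    "D = \<lparr>ObjF = (\<lambda>u. X (inv_into A g u)), ArrF = (\<lambda>u. Id C (X (inv_into A g u)))\<rparr>"
  have J: "category J" by unfold_locales (auto simp: J_def hom_def)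
  have D: "is_functor J C D" using X g by (auto simp: is_functor_def J_def D_def hom_iff)
  obtain L \<iota> where L: "is_colimit J C D L \<iota>" using cocomp J D unfolding small_cocomplete_def by blast
  have cocone: "is_cocone J C D M \<rho> \<longleftrightarrow> M \<in> Obj C \<and> (\<forall>i \<in> A. \<rho> (g i) \<in> hom C (X i) M)" for M \<rho>
    using g X by (auto simp: is_cocone_def J_def D_def comp_id)
  have "is_coproduct C A X L (\<lambda>i. \<iota> (g i))"
    unfolding is_coproduct_def
  proof (intro conjI ballI allI impI)
    show "L \<in> Obj C" "\<And>i. i \<in> A \<Longrightarrow> \<iota> (g i) \<in> hom C (X i) L"
      using L cocone unfolding is_colimit_def by blast+
    fix Z h assume "Z \<in> Obj C" "\<forall>i \<in> A. h i \<in> hom C (X i) Z"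
    then have "is_cocone J C D Z (\<lambda>u. h (inv_into A g u))" using g by (simp add: cocone)
    then have "\<exists>!u. u \<in> hom C L Z \<and> (\<forall>i \<in> Obj J. u \<cdot> \<iota> i = h (inv_into A g i))"
      using L unfolding is_colimit_def by blast
    then show "\<exists>!u. u \<in> hom C L Z \<and> (\<forall>i \<in> A. u \<cdot> \<iota> (g i) = h i)"
      using g by (simp add: J_def)
  qed
  then show "\<exists>P \<iota>. is_coproduct C A X P \<iota>" by blast
qed

lemma is_coproduct_coprod:
  assumes "has_coprods C A" "\<And>i. i \<in> A \<Longrightarrow> X i \<in> Obj C"
  shows "is_coproduct C A X (coprod C A X) (coprod_inj C A X)"
proof -
  have "\<exists>c. case c of (P, \<iota>) \<Rightarrow> is_coproduct C A X P \<iota>" using assms by (auto simp: has_coprods_def)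
  from someI_ex[OF this] show ?thesis
    by (auto simp: coprod_def coprod_inj_def coprod_cocone_def split: prod.splits)
qed

lemma
  assumes "has_coprods C A" "\<And>i. i \<in> A \<Longrightarrow> X i \<in> Obj C"
  shows coprod_obj: "coprod C A X \<in> Obj C"
    and coprod_inj_hom: "i \<in> A \<Longrightarrow> coprod_inj C A X i \<in> hom C (X i) (coprod C A X)"
  using is_coproduct_coprod[of C A X] assms by (auto simp: is_coproduct_def)

lemma copair_ex1:
  assumes "has_coprods C A" "Z \<in> Obj C" "\<And>i. i \<in> A \<Longrightarrow> X i \<in> Obj C"
    "\<And>i. i \<in> A \<Longrightarrow> g i \<in> hom C (X i) Z"
  shows "\<exists>!u. u \<in> hom C (coprod C A X) Z \<and> (\<forall>i \<in> A. u \<cdot>\<^bsub>C\<^esub> coprod_inj C A X i = g i)"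
  using is_coproduct_coprod[of C A X] assms unfolding is_coproduct_def by blast

context category
begin

lemma
  assumes "has_coprods C A" "Z \<in> Obj C" "\<And>i. i \<in> A \<Longrightarrow> g i \<in> hom C (X i) Z"
  shows copair_hom: "copair C A X Z g \<in> hom C (coprod C A X) Z"
    and copair_inj: "i \<in> A \<Longrightarrow> copair C A X Z g \<cdot> coprod_inj C A X i = g i"
  using theI'[OF copair_ex1[OF assms(1,2) hom_obj(1)[OF assms(3)] assms(3)]] by (auto simp: copair_def)

lemma coprod_eqI:
  assumes "has_coprods C A" "\<And>i. i \<in> A \<Longrightarrow> X i \<in> Obj C"
    and u: "u \<in> hom C (coprod C A X) Z" "v \<in> hom C (coprod C A X) Z"
    and eq: "\<And>i. i \<in> A \<Longrightarrow> u \<cdot> coprod_inj C A X i = v \<cdot> coprod_inj C A X i"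
  shows "u = v"
proof -
  have "u \<cdot> coprod_inj C A X i \<in> hom C (X i) Z" if "i \<in> A" for i
    using that by (intro comp_hom[OF coprod_inj_hom u(1)]) (use assms in auto)
  then have ex1: "\<exists>!w. w \<in> hom C (coprod C A X) Z \<and> (\<forall>i \<in> A. w \<cdot> coprod_inj C A X i = u \<cdot> coprod_inj C A X i)"
    using assms by (intro copair_ex1 hom_obj(2)[OF u(1)]) auto
  have "v \<in> hom C (coprod C A X) Z \<and> (\<forall>i \<in> A. v \<cdot> coprod_inj C A X i = u \<cdot> coprod_inj C A X i)"
    using u(2) eq by metis
  then show ?thesis using ex1 u(1) by blast
qed

lemma jointly_epi_coprod:
  assumes "has_coprods C A" "\<And>i. i \<in> A \<Longrightarrow> X i \<in> Obj C" "\<And>i. i \<in> A \<Longrightarrow> jointly_epi C (X i) (E i)"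
    and E: "\<And>i x. i \<in> A \<Longrightarrow> x \<in> E i \<Longrightarrow> x \<in> Arr C \<and> Cod C x = X i"
  shows "jointly_epi C (coprod C A X) {coprod_inj C A X i \<cdot> x |i x. i \<in> A \<and> x \<in> E i}"
  unfolding jointly_epi_def
proof (intro allI impI, elim conjE)
  fix c g g'
  assume g: "g \<in> hom C (coprod C A X) c" "g' \<in> hom C (coprod C A X) c"
    and eq: "\<forall>x\<in>{coprod_inj C A X i \<cdot> x |i x. i \<in> A \<and> x \<in> E i}. g \<cdot> x = g' \<cdot> x"
  show "g = g'"
  proof (rule coprod_eqI[OF assms(1,2) g])
    fix i assume i: "i \<in> A"
    note inj = coprod_inj_hom[OF assms(1,2) i]
    have *: "(k \<cdot> coprod_inj C A X i) \<cdot> x = k \<cdot> coprod_inj C A X i \<cdot> x"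
      if "k \<in> hom C (coprod C A X) c" "x \<in> E i" for k x
      using that E[OF i] inj by (simp add: hom_iff)
    show "g \<cdot> coprod_inj C A X i = g' \<cdot> coprod_inj C A X i"
    proof (rule jointly_epiD[OF assms(3)[OF i] comp_hom[OF inj g(1)] comp_hom[OF inj g(2)]])
      fix x assume x: "x \<in> E i"
      have "g \<cdot> coprod_inj C A X i \<cdot> x = g' \<cdot> coprod_inj C A X i \<cdot> x" using eq i x by blast
      then show "(g \<cdot> coprod_inj C A X i) \<cdot> x = (g' \<cdot> coprod_inj C A X i) \<cdot> x" using * g x by simp
    qed
  qed
qed

end

text \<open>The nullary coproduct provides the initial object that occurs in the unit quiver; as its
  index set is empty, the index type is immaterial. Larger coproducts are assumed per index set,
  where they occur.\<close>

locale enriching_category = symmetric_monoidal_closed_category C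
  for C :: "('o, 'm, 'z) symcat_scheme" (structure) +
  assumes has_empty_coprod: "has_coprods C ({} :: unit set)"
begin

lemma initial_universal: "initial C \<in> Obj C \<and> (\<forall>a \<in> Obj C. \<exists>!u. u \<in> hom C (initial C) a)"
  unfolding initial_def
proof (rule someI_ex)
  obtain P \<iota> where P: "is_coproduct C ({} :: unit set) (\<lambda>_. I) P \<iota>"
    using has_empty_coprod unfolding has_coprods_def by blast
  then have "P \<in> Obj C \<and> (\<forall>a \<in> Obj C. \<exists>!u. u \<in> hom C P a)"
    unfolding is_coproduct_def by simp
  then show "\<exists>z. z \<in> Obj C \<and> (\<forall>a \<in> Obj C. \<exists>!u. u \<in> hom C z a)" by blast
qed

lemma initial_obj [simp]: "initial C \<in> Obj C"
  using initial_universal by blast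

lemma from_initial_hom: "a \<in> Obj C \<Longrightarrow> from_initial C a \<in> hom C (initial C) a"
  unfolding from_initial_def using initial_universal theI'[of "\<lambda>u. u \<in> hom C (initial C) a"] by blast

lemma initial_eqI: "u \<in> hom C (initial C) a \<Longrightarrow> v \<in> hom C (initial C) a \<Longrightarrow> u = v"
  using initial_universal hom_obj(2)[of u "initial C" a] by blast

text \<open>The existence half of the fact that tensoring with \<open>b\<close> preserves
  coproducts: the transposes of the \<open>v i\<close> are copaired and the result is transposed
  back. The uniqueness half is an instance of \<open>tens_left_cancel\<close>.\<close>

lemma tens_coprod_ex:
  assumes A: "has_coprods C A" and X: "\<And>i. i \<in> A \<Longrightarrow> X i \<in> Obj C" and b: "b \<in> Obj C" and Z: "Z \<in> Obj C"
    and v: "\<And>i. i \<in> A \<Longrightarrow> v i \<in> hom C (X i \<odot> b) Z"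
  shows "\<exists>u \<in> hom C (coprod C A X \<odot> b) Z. \<forall>i \<in> A. u \<cdot> (coprod_inj C A X i \<otimes> Id C b) = v i"
proof -
  obtain h ev where h: "h \<in> Obj C" and ev: "ev \<in> hom C (h \<odot> b) Z"
    and univ: "\<And>a g. a \<in> Obj C \<Longrightarrow> g \<in> hom C (a \<odot> b) Z \<Longrightarrow> \<exists>!u. u \<in> hom C a h \<and> ev \<cdot> (u \<otimes> Id C b) = g"
    using closed[OF b Z] by meson
  have "\<forall>i \<in> A. \<exists>u. u \<in> hom C (X i) h \<and> ev \<cdot> (u \<otimes> Id C b) = v i" using univ X v by blast
  then obtain w where w: "\<And>i. i \<in> A \<Longrightarrow> w i \<in> hom C (X i) h" "\<And>i. i \<in> A \<Longrightarrow> ev \<cdot> (w i \<otimes> Id C b) = v i"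
    by metis
  let ?w = "copair C A X h w"
  have cw: "?w \<in> hom C (coprod C A X) h" by (rule copair_hom[OF A h w(1)])
  show ?thesis
  proof (intro bexI ballI)
    show "ev \<cdot> (?w \<otimes> Id C b) \<in> hom C (coprod C A X \<odot> b) Z" using ev cw b by (auto simp: hom_iff)
    fix i assume i: "i \<in> A"
    have "(ev \<cdot> (?w \<otimes> Id C b)) \<cdot> (coprod_inj C A X i \<otimes> Id C b) = ev \<cdot> ((?w \<cdot> coprod_inj C A X i) \<otimes> Id C b)"
      using ev cw b coprod_inj_hom[OF A X i] by (simp add: hom_iff)
    then show "(ev \<cdot> (?w \<otimes> Id C b)) \<cdot> (coprod_inj C A X i \<otimes> Id C b) = v i"
      using copair_inj[OF A h w(1) i] w(2)[OF i] by simp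
  qed
qed

text \<open>The empty family is jointly epimorphic on the initial object, so
  \<open>tens_left_cancel\<close> applies with \<open>A = {}\<close>; \<open>x\<close> and
  \<open>d\<close> then carry no data.\<close>

lemma initial_tens_eqI:
  assumes "b \<in> Obj C" "u \<in> hom C (initial C \<odot> b) c" "v \<in> hom C (initial C \<odot> b) c"
  shows "u = v"
  by (rule tens_left_cancel[OF initial_obj assms(1) _ _ assms(2,3), where A = "{}" and x = "\<lambda>_. undefined" and d = "\<lambda>_. undefined"])
     (rule initial_eqI, assumption+ | simp)+

text \<open>Closedness is given for the first factor; the braiding carries the result over to the
  second.\<close>

lemma tens_initial_eqI:
  assumes b: "b \<in> Obj C" and u: "u \<in> hom C (b \<odot> initial C) c" "v \<in> hom C (b \<odot> initial C) c"
  shows "u = v"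
proof (rule iso_epi)
  let ?B = "Braid C (initial C) b"
  have B: "?B \<in> hom C (initial C \<odot> b) (b \<odot> initial C)" by (rule braid_hom[OF initial_obj b])
  show "is_iso C ?B"
    by (rule is_isoI[OF B braid_hom[OF b initial_obj]]) (use b braid_sym in auto)
  show "u \<cdot> ?B = v \<cdot> ?B" by (rule initial_tens_eqI[OF b comp_hom[OF B u(1)] comp_hom[OF B u(2)]])
  show "u \<in> Arr C" "v \<in> Arr C" "Dom C u = Cod C ?B" "Dom C v = Cod C ?B"
    using u B by (auto simp: hom_iff)
qed

lemma initial_tens_ex: "b \<in> Obj C \<Longrightarrow> c \<in> Obj C \<Longrightarrow> \<exists>u. u \<in> hom C (initial C \<odot> b) c"
proof -
  assume b: "b \<in> Obj C" and c: "c \<in> Obj C"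
  obtain h ev where h: "h \<in> Obj C" "ev \<in> hom C (h \<odot> b) c" using closed[OF b c] by blast
  have "ev \<cdot> (from_initial C h \<otimes> Id C b) \<in> hom C (initial C \<odot> b) c"
    using h from_initial_hom[OF h(1)] b by (auto simp: hom_iff)
  then show ?thesis by blast
qed

lemma tens_initial_ex: "b \<in> Obj C \<Longrightarrow> c \<in> Obj C \<Longrightarrow> \<exists>u. u \<in> hom C (b \<odot> initial C) c"
  using initial_tens_ex[of b c] braid_hom[OF _ initial_obj, of b] comp_hom by meson

end

section \<open>Quivers\<close>

lemma Quiv_simps [simp]:
  "Obj (Quiv C S) = S \<times> S \<rightarrow>\<^sub>E Obj C" "Arr (Quiv C S) = S \<times> S \<rightarrow>\<^sub>E Arr C"
  "Dom (Quiv C S) = quiv_dom C S" "Cod (Quiv C S) = quiv_cod C S"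
  "TensO (Quiv C S) = quiv_tens C S" "Unit (Quiv C S) = quiv_unit C S"
  by (simp_all add: Quiv_def)

lemma Quiv_id_app [simp]: "a \<in> S \<Longrightarrow> b \<in> S \<Longrightarrow> Id (Quiv C S) Q (a, b) = Id C (Q (a, b))"
  and Quiv_comp_app [simp]: "a \<in> S \<Longrightarrow> b \<in> S \<Longrightarrow> (\<psi> \<cdot>\<^bsub>Quiv C S\<^esub> \<phi>) (a, b) = \<psi> (a, b) \<cdot>\<^bsub>C\<^esub> \<phi> (a, b)"
  by (simp_all add: Quiv_def)

lemma quiv_homI:
  assumes "Q \<in> extensional (S \<times> S)" "P \<in> extensional (S \<times> S)" "\<phi> \<in> extensional (S \<times> S)"
    "\<And>a b. a \<in> S \<Longrightarrow> b \<in> S \<Longrightarrow> \<phi> (a, b) \<in> hom C (Q (a, b)) (P (a, b))"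
  shows "\<phi> \<in> hom (Quiv C S) Q P"
  unfolding hom_iff Quiv_simps
proof (intro conjI)
  show "\<phi> \<in> S \<times> S \<rightarrow>\<^sub>E Arr C" using assms(3,4) by (auto simp: hom_iff PiE_iff)
  show "quiv_dom C S \<phi> = Q" "quiv_cod C S \<phi> = P"
    unfolding quiv_dom_def quiv_cod_def using assms
    by (auto intro!: extensionalityI[of _ "S \<times> S"] simp: hom_iff)
qed

lemma quiv_hom_app:
  "\<phi> \<in> hom (Quiv C S) Q P \<Longrightarrow> a \<in> S \<Longrightarrow> b \<in> S \<Longrightarrow> \<phi> (a, b) \<in> hom C (Q (a, b)) (P (a, b))"
  by (auto simp: hom_iff quiv_dom_def quiv_cod_def)

lemma quiv_hom_ext:
  "\<phi> \<in> hom (Quiv C S) Q P \<Longrightarrow> \<phi> \<in> extensional (S \<times> S)"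
  "\<phi> \<in> hom (Quiv C S) Q P \<Longrightarrow> Q \<in> extensional (S \<times> S)"
  "\<phi> \<in> hom (Quiv C S) Q P \<Longrightarrow> P \<in> extensional (S \<times> S)"
  by (auto simp: hom_iff quiv_dom_def quiv_cod_def PiE_iff)

lemma quiv_hom_eqI:
  assumes "\<phi> \<in> hom (Quiv C S) Q P" "\<psi> \<in> hom (Quiv C S) Q P"
    "\<And>a b. a \<in> S \<Longrightarrow> b \<in> S \<Longrightarrow> \<phi> (a, b) = \<psi> (a, b)"
  shows "\<phi> = \<psi>"
  using assms by (intro extensionalityI[OF quiv_hom_ext(1)[OF assms(1)] quiv_hom_ext(1)[OF assms(2)]]) auto

lemma quiv_objD: "Q \<in> Obj (Quiv C S) \<Longrightarrow> a \<in> S \<Longrightarrow> b \<in> S \<Longrightarrow> Q (a, b) \<in> Obj C"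
  by auto

lemma quiv_dom_cod: "\<phi> \<in> hom (Quiv C S) Q P \<Longrightarrow> quiv_dom C S \<phi> = Q \<and> quiv_cod C S \<phi> = P"
  by (simp add: hom_iff)

lemma (in monoidal_category) quiv_hom_obj:
  assumes "\<phi> \<in> hom (Quiv C S) Q P"
  shows "Q \<in> Obj (Quiv C S)" "P \<in> Obj (Quiv C S)"
  using hom_obj[OF quiv_hom_app[OF assms]] quiv_hom_ext[OF assms] by (auto simp: PiE_iff)

lemma (in monoidal_category) category_Quiv: "category (Quiv C S)"
proof
  fix \<phi> assume "\<phi> \<in> Arr (Quiv C S)"
  then have "\<phi> \<in> hom (Quiv C S) (Dom (Quiv C S) \<phi>) (Cod (Quiv C S) \<phi>)" by (simp add: hom_iff)
  from quiv_hom_obj[OF this]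
  show "Dom (Quiv C S) \<phi> \<in> Obj (Quiv C S)" "Cod (Quiv C S) \<phi> \<in> Obj (Quiv C S)" .
next
  fix Q assume Q: "Q \<in> Obj (Quiv C S)"
  then show "Id (Quiv C S) Q \<in> hom (Quiv C S) Q Q"
    by (intro quiv_homI) (auto simp: PiE_iff, auto simp: Quiv_def hom_iff)
next
  fix \<phi> \<psi> Q P R assume "\<phi> \<in> hom (Quiv C S) Q P" "\<psi> \<in> hom (Quiv C S) P R"
  then show "\<psi> \<cdot>\<^bsub>Quiv C S\<^esub> \<phi> \<in> hom (Quiv C S) Q R"
    by (intro quiv_homI) (auto dest: quiv_hom_ext quiv_hom_app intro: comp_hom, simp add: Quiv_def)
next
  fix \<phi> Q P assume \<phi>: "\<phi> \<in> hom (Quiv C S) Q P"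
  show "\<phi> \<cdot>\<^bsub>Quiv C S\<^esub> Id (Quiv C S) Q = \<phi>" "Id (Quiv C S) P \<cdot>\<^bsub>Quiv C S\<^esub> \<phi> = \<phi>"
    using comp_id[OF quiv_hom_app[OF \<phi>]] id_comp[OF quiv_hom_app[OF \<phi>]] quiv_hom_ext[OF \<phi>]
    by (auto intro!: extensionalityI[of _ "S \<times> S"] simp: Quiv_def)
next
  fix \<phi> \<psi> \<chi> Q P R T
  assume h: "\<phi> \<in> hom (Quiv C S) Q P" "\<psi> \<in> hom (Quiv C S) P R" "\<chi> \<in> hom (Quiv C S) R T"
  then show "(\<chi> \<cdot>\<^bsub>Quiv C S\<^esub> \<psi>) \<cdot>\<^bsub>Quiv C S\<^esub> \<phi> = \<chi> \<cdot>\<^bsub>Quiv C S\<^esub> \<psi> \<cdot>\<^bsub>Quiv C S\<^esub> \<phi>"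
    using comp_assoc[OF quiv_hom_app[OF h(1)] quiv_hom_app[OF h(2)] quiv_hom_app[OF h(3)]]
    by (auto intro!: extensionalityI[of _ "S \<times> S"] simp: Quiv_def)
qed

section \<open>Tensor products of quivers and of their elements\<close>

context enriching_category
begin

lemma quiv_id_hom: "Q \<in> Obj (Quiv C S) \<Longrightarrow> Id (Quiv C S) Q \<in> hom (Quiv C S) Q Q"
  by (rule category.id_hom[OF category_Quiv])

lemma quiv_comp_hom:
  "\<phi> \<in> hom (Quiv C S) Q P \<Longrightarrow> \<psi> \<in> hom (Quiv C S) P R \<Longrightarrow> \<psi> \<cdot>\<^bsub>Quiv C S\<^esub> \<phi> \<in> hom (Quiv C S) Q R"
  by (rule category.comp_hom[OF category_Quiv])

lemma quiv_inv_hom: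
  "is_iso (Quiv C S) \<phi> \<Longrightarrow> \<phi> \<in> hom (Quiv C S) Q P \<Longrightarrow> inv_arr (Quiv C S) \<phi> \<in> hom (Quiv C S) P Q"
  by (rule category.inv_hom[OF category_Quiv])

text \<open>Evaluates an inverse without a formula for it: it suffices to guess the preimage
  \<open>x\<close> of \<open>y\<close>. Inverses of the unitors, of the counit and of
  \<open>tens_cons\<close> are computed on elements in this way.\<close>

lemma quiv_inv_app:
  assumes iso: "is_iso (Quiv C S) \<phi>" and \<phi>: "\<phi> \<in> hom (Quiv C S) Q P" and ab: "a \<in> S" "b \<in> S"
    and x: "x \<in> hom C i (Q (a, b))" and eq: "\<phi> (a, b) \<cdot> x = y"
  shows "inv_arr (Quiv C S) \<phi> (a, b) \<cdot> y = x"
proof -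
  have "inv_arr (Quiv C S) \<phi> \<cdot>\<^bsub>Quiv C S\<^esub> \<phi> = Id (Quiv C S) Q"
    using category.inverse_arrows_inv[OF category_Quiv iso] \<phi> by (auto simp: inverse_arrows_def hom_iff)
  then have "inv_arr (Quiv C S) \<phi> (a, b) \<cdot> \<phi> (a, b) = Id C (Q (a, b))"
    using ab by (metis Quiv_comp_app Quiv_id_app)
  moreover have "inv_arr (Quiv C S) \<phi> (a, b) \<cdot> y = (inv_arr (Quiv C S) \<phi> (a, b) \<cdot> \<phi> (a, b)) \<cdot> x"
    using quiv_hom_app[OF quiv_inv_hom[OF iso \<phi>] ab] quiv_hom_app[OF \<phi> ab] x eq by (auto simp: hom_iff)
  ultimately show ?thesis using x by (auto simp: hom_iff)
qed

lemma quiv_is_isoI: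
  assumes \<phi>: "\<phi> \<in> hom (Quiv C S) Q P" and \<psi>: "\<psi> \<in> hom (Quiv C S) P Q"
    and eq: "\<And>a b. a \<in> S \<Longrightarrow> b \<in> S \<Longrightarrow> \<psi> (a, b) \<cdot> \<phi> (a, b) = Id C (Q (a, b))"
      "\<And>a b. a \<in> S \<Longrightarrow> b \<in> S \<Longrightarrow> \<phi> (a, b) \<cdot> \<psi> (a, b) = Id C (P (a, b))"
  shows "is_iso (Quiv C S) \<phi>"
proof (rule category.is_isoI[OF category_Quiv \<phi> \<psi>])
  note ob = quiv_hom_obj[OF \<phi>]
  show "\<psi> \<cdot>\<^bsub>Quiv C S\<^esub> \<phi> = Id (Quiv C S) Q"
    by (rule quiv_hom_eqI[OF quiv_comp_hom[OF \<phi> \<psi>] quiv_id_hom[OF ob(1)]]) (simp add: eq)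
  show "\<phi> \<cdot>\<^bsub>Quiv C S\<^esub> \<psi> = Id (Quiv C S) P"
    by (rule quiv_hom_eqI[OF quiv_comp_hom[OF \<psi> \<phi>] quiv_id_hom[OF ob(2)]]) (simp add: eq)
qed

lemma quiv_tens_app: "a \<in> S \<Longrightarrow> b \<in> S \<Longrightarrow> quiv_tens C S Q P (a, b) = coprod C S (\<lambda>c. Q (a, c) \<odot> P (c, b))"
  by (simp add: quiv_tens_def)

lemma quiv_summand_obj:
  "Q \<in> Obj (Quiv C S) \<Longrightarrow> P \<in> Obj (Quiv C S) \<Longrightarrow> a \<in> S \<Longrightarrow> b \<in> S \<Longrightarrow> c \<in> S \<Longrightarrow>
   Q (a, c) \<odot> P (c, b) \<in> Obj C"
  by (auto intro!: tens_obj)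

lemma quiv_tens_obj:
  assumes "has_coprods C S" "Q \<in> Obj (Quiv C S)" "P \<in> Obj (Quiv C S)"
  shows "quiv_tens C S Q P \<in> Obj (Quiv C S)"
  using assms by (auto simp: quiv_tens_def PiE_iff intro!: coprod_obj tens_obj)

lemma quiv_unit_obj: "quiv_unit C S \<in> Obj (Quiv C S)"
  by (auto simp: quiv_unit_def PiE_iff)

lemma quiv_unit_app [simp]: "a \<in> S \<Longrightarrow> quiv_unit C S (a, a) = I"
  by (simp add: quiv_unit_def)

lemma quiv_inj_hom:
  assumes "has_coprods C S" "Q \<in> Obj (Quiv C S)" "P \<in> Obj (Quiv C S)" "a \<in> S" "b \<in> S" "c \<in> S"
  shows "quiv_inj C S Q P a b c \<in> hom C (Q (a, c) \<odot> P (c, b)) (quiv_tens C S Q P (a, b))"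
  unfolding quiv_inj_def quiv_tens_app[OF assms(4,5)]
  by (rule coprod_inj_hom[where X = "\<lambda>c. Q (a, c) \<odot> P (c, b)", OF assms(1) _ assms(6)])
     (rule quiv_summand_obj[OF assms(2-5)])

lemma
  assumes "has_coprods C S" "Z \<in> Obj C" "a \<in> S" "b \<in> S"
    "\<And>c. c \<in> S \<Longrightarrow> g c \<in> hom C (Q (a, c) \<odot> P (c, b)) Z"
  shows quiv_copair_hom: "quiv_copair C S Q P a b Z g \<in> hom C (quiv_tens C S Q P (a, b)) Z"
    and quiv_copair_inj: "c \<in> S \<Longrightarrow> quiv_copair C S Q P a b Z g \<cdot> quiv_inj C S Q P a b c = g c"
  using copair_hom[OF assms(1,2,5)] copair_inj[OF assms(1,2,5)] assms(3,4)
  by (auto simp: quiv_copair_def quiv_inj_def quiv_tens_app)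

lemma quiv_tens_eqI:
  assumes "has_coprods C S" "Q \<in> Obj (Quiv C S)" "P \<in> Obj (Quiv C S)" "a \<in> S" "b \<in> S"
    and "u \<in> hom C (quiv_tens C S Q P (a, b)) Z" "v \<in> hom C (quiv_tens C S Q P (a, b)) Z"
    and "\<And>c. c \<in> S \<Longrightarrow> u \<cdot> quiv_inj C S Q P a b c = v \<cdot> quiv_inj C S Q P a b c"
  shows "u = v"
  by (rule coprod_eqI[OF assms(1) quiv_summand_obj[OF assms(2-5)] assms(6,7)[unfolded quiv_tens_app[OF assms(4,5)]]
        assms(8)[unfolded quiv_inj_def]])

text \<open>The pure tensor of \<open>x\<close> and \<open>y\<close> in the summand of the middle
  vertex \<open>c\<close>.\<close>

definition qprod where
  "qprod S Q P a b c x y = quiv_inj C S Q P a b c \<cdot> (x \<boxtimes> y)"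

lemma qprod_hom:
  assumes "has_coprods C S" "Q \<in> Obj (Quiv C S)" "P \<in> Obj (Quiv C S)" "a \<in> S" "b \<in> S" "c \<in> S"
    "x \<in> hom C I (Q (a, c))" "y \<in> hom C I (P (c, b))"
  shows "qprod S Q P a b c x y \<in> hom C I (quiv_tens C S Q P (a, b))"
  unfolding qprod_def using comp_hom[OF etens_hom[OF assms(7,8)] quiv_inj_hom[OF assms(1-6)]] .

text \<open>Coproduct injections are jointly epimorphic, and so are the pure tensors in each
  summand. Used inductively, this shows that products of generators detect morphisms out of the
  tensor powers of a free object.\<close>

lemma jointly_epi_quiv_tens:
  assumes S: "has_coprods C S" and Q: "Q \<in> Obj (Quiv C S)" and P: "P \<in> Obj (Quiv C S)" and ab: "a \<in> S" "b \<in> S"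
    and E: "\<And>c. c \<in> S \<Longrightarrow> E c \<subseteq> hom C I (Q (a, c))" "\<And>c. c \<in> S \<Longrightarrow> jointly_epi C (Q (a, c)) (E c)"
    and E': "\<And>c. c \<in> S \<Longrightarrow> E' c \<subseteq> hom C I (P (c, b))" "\<And>c. c \<in> S \<Longrightarrow> jointly_epi C (P (c, b)) (E' c)"
  shows "jointly_epi C (quiv_tens C S Q P (a, b)) {qprod S Q P a b c x y |c x y. c \<in> S \<and> x \<in> E c \<and> y \<in> E' c}"
proof -
  have "jointly_epi C (coprod C S (\<lambda>c. Q (a, c) \<odot> P (c, b)))
     {coprod_inj C S (\<lambda>c. Q (a, c) \<odot> P (c, b)) c \<cdot> z |c z. c \<in> S \<and> z \<in> {x \<boxtimes> y |x y. x \<in> E c \<and> y \<in> E' c}}"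
  proof (rule jointly_epi_coprod[OF S])
    fix c assume c: "c \<in> S"
    show "Q (a, c) \<odot> P (c, b) \<in> Obj C" by (rule quiv_summand_obj[OF Q P ab c])
    show "jointly_epi C (Q (a, c) \<odot> P (c, b)) {x \<boxtimes> y |x y. x \<in> E c \<and> y \<in> E' c}"
      by (rule jointly_epi_etens[OF quiv_objD[OF Q ab(1) c] quiv_objD[OF P c ab(2)] E(1)[OF c] E'(1)[OF c] E(2)[OF c] E'(2)[OF c]])
    show "z \<in> Arr C \<and> Cod C z = Q (a, c) \<odot> P (c, b)" if "z \<in> {x \<boxtimes> y |x y. x \<in> E c \<and> y \<in> E' c}" for z
      using that etens_hom[OF subsetD[OF E(1)[OF c]] subsetD[OF E'(1)[OF c]]] by (auto simp: hom_iff)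
  qed
  moreover have "{coprod_inj C S (\<lambda>c. Q (a, c) \<odot> P (c, b)) c \<cdot> z |c z. c \<in> S \<and> z \<in> {x \<boxtimes> y |x y. x \<in> E c \<and> y \<in> E' c}}
    = {qprod S Q P a b c x y |c x y. c \<in> S \<and> x \<in> E c \<and> y \<in> E' c}"
    unfolding qprod_def quiv_inj_def by blast
  ultimately show ?thesis using ab by (simp add: quiv_tens_app)
qed

lemma qtens_app:
  assumes "\<phi> \<in> hom (Quiv C S) Q Q'" "\<psi> \<in> hom (Quiv C S) P P'" "a \<in> S" "b \<in> S"
  shows "(\<phi> \<otimes>\<^bsub>Quiv C S\<^esub> \<psi>) (a, b) = quiv_copair C S Q P a b (quiv_tens C S Q' P' (a, b))
    (\<lambda>c. quiv_inj C S Q' P' a b c \<cdot> (\<phi> (a, c) \<otimes> \<psi> (c, b)))"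
  using quiv_dom_cod[OF assms(1)] quiv_dom_cod[OF assms(2)] assms(3,4) by (simp add: Quiv_def)

context
  fixes S :: "'s set" and Q Q' P P' :: "'s \<times> 's \<Rightarrow> 'o" and \<phi> \<psi> :: "'s \<times> 's \<Rightarrow> 'm"
  assumes S: "has_coprods C S" and \<phi>: "\<phi> \<in> hom (Quiv C S) Q Q'" and \<psi>: "\<psi> \<in> hom (Quiv C S) P P'"
begin

lemma qtens_summand_hom:
  assumes "a \<in> S" "b \<in> S" "c \<in> S"
  shows "quiv_inj C S Q' P' a b c \<cdot> (\<phi> (a, c) \<otimes> \<psi> (c, b)) \<in> hom C (Q (a, c) \<odot> P (c, b)) (quiv_tens C S Q' P' (a, b))"
  by (rule comp_hom[OF tens_hom[OF quiv_hom_app[OF \<phi> assms(1,3)] quiv_hom_app[OF \<psi> assms(3,2)]]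
        quiv_inj_hom[OF S quiv_hom_obj(2)[OF \<phi>] quiv_hom_obj(2)[OF \<psi>] assms]])

lemma qtens_target_obj:
  assumes "a \<in> S" "b \<in> S"
  shows "quiv_tens C S Q' P' (a, b) \<in> Obj C"
  by (rule quiv_objD[OF quiv_tens_obj[OF S quiv_hom_obj(2)[OF \<phi>] quiv_hom_obj(2)[OF \<psi>]] assms])

lemma qtens_hom: "\<phi> \<otimes>\<^bsub>Quiv C S\<^esub> \<psi> \<in> hom (Quiv C S) (quiv_tens C S Q P) (quiv_tens C S Q' P')"
proof (rule quiv_homI)
  fix a b assume ab: "a \<in> S" "b \<in> S"
  show "(\<phi> \<otimes>\<^bsub>Quiv C S\<^esub> \<psi>) (a, b) \<in> hom C (quiv_tens C S Q P (a, b)) (quiv_tens C S Q' P' (a, b))"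
    unfolding qtens_app[OF \<phi> \<psi> ab]
    by (rule quiv_copair_hom[OF S qtens_target_obj[OF ab] ab]) (rule qtens_summand_hom[OF ab])
qed (auto simp: quiv_tens_def, simp add: Quiv_def)

lemma qtens_inj:
  assumes ab: "a \<in> S" "b \<in> S" "c \<in> S"
  shows "(\<phi> \<otimes>\<^bsub>Quiv C S\<^esub> \<psi>) (a, b) \<cdot> quiv_inj C S Q P a b c =
    quiv_inj C S Q' P' a b c \<cdot> (\<phi> (a, c) \<otimes> \<psi> (c, b))"
  unfolding qtens_app[OF \<phi> \<psi> ab(1,2)]
  by (rule quiv_copair_inj[OF S qtens_target_obj[OF ab(1,2)] ab(1,2) _ ab(3)]) (rule qtens_summand_hom[OF ab(1,2)])

text \<open>With this rule composites of tensor products of quiver morphisms are evaluated from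
  right to left, without returning to the coproducts that define them.\<close>

lemma qtens_qprod:
  assumes ab: "a \<in> S" "b \<in> S" "c \<in> S" and x: "x \<in> hom C I (Q (a, c))" and y: "y \<in> hom C I (P (c, b))"
  shows "(\<phi> \<otimes>\<^bsub>Quiv C S\<^esub> \<psi>) (a, b) \<cdot> qprod S Q P a b c x y =
    qprod S Q' P' a b c (\<phi> (a, c) \<cdot> x) (\<psi> (c, b) \<cdot> y)"
proof -
  note h = quiv_hom_app[OF qtens_hom ab(1,2)] quiv_inj_hom[OF S quiv_hom_obj(1)[OF \<phi>] quiv_hom_obj(1)[OF \<psi>] ab]
    quiv_inj_hom[OF S quiv_hom_obj(2)[OF \<phi>] quiv_hom_obj(2)[OF \<psi>] ab] etens_hom[OF x y]
    quiv_hom_app[OF \<phi> ab(1,3)] quiv_hom_app[OF \<psi> ab(3,2)]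
  have "(\<phi> \<otimes>\<^bsub>Quiv C S\<^esub> \<psi>) (a, b) \<cdot> qprod S Q P a b c x y =
    (quiv_inj C S Q' P' a b c \<cdot> (\<phi> (a, c) \<otimes> \<psi> (c, b))) \<cdot> (x \<boxtimes> y)"
    unfolding qprod_def qtens_inj[OF ab, symmetric] using h by (simp add: hom_iff)
  also have "\<dots> = quiv_inj C S Q' P' a b c \<cdot> ((\<phi> (a, c) \<otimes> \<psi> (c, b)) \<cdot> (x \<boxtimes> y))"
    using h by (simp add: hom_iff)
  finally show ?thesis unfolding qprod_def tens_comp_etens[OF x y h(5,6)] .
qed

end

lemma qtens_id:
  assumes S: "has_coprods C S" and Q: "Q \<in> Obj (Quiv C S)" and P: "P \<in> Obj (Quiv C S)"
  shows "Id (Quiv C S) Q \<otimes>\<^bsub>Quiv C S\<^esub> Id (Quiv C S) P = Id (Quiv C S) (quiv_tens C S Q P)"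
proof (rule quiv_hom_eqI[OF qtens_hom[OF S quiv_id_hom[OF Q] quiv_id_hom[OF P]] quiv_id_hom[OF quiv_tens_obj[OF S Q P]]])
  fix a b assume ab: "a \<in> S" "b \<in> S"
  show "(Id (Quiv C S) Q \<otimes>\<^bsub>Quiv C S\<^esub> Id (Quiv C S) P) (a, b) = Id (Quiv C S) (quiv_tens C S Q P) (a, b)"
  proof (rule quiv_tens_eqI[OF S Q P ab quiv_hom_app[OF qtens_hom[OF S quiv_id_hom[OF Q] quiv_id_hom[OF P]] ab]
        quiv_hom_app[OF quiv_id_hom[OF quiv_tens_obj[OF S Q P]] ab]])
    fix c assume c: "c \<in> S"
    have "Q (a, c) \<in> Obj C" "P (c, b) \<in> Obj C" using ab c Q P by auto
    then show "(Id (Quiv C S) Q \<otimes>\<^bsub>Quiv C S\<^esub> Id (Quiv C S) P) (a, b) \<cdot> quiv_inj C S Q P a b c =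
         Id (Quiv C S) (quiv_tens C S Q P) (a, b) \<cdot> quiv_inj C S Q P a b c"
      unfolding qtens_inj[OF S quiv_id_hom[OF Q] quiv_id_hom[OF P] ab c]
      using quiv_inj_hom[OF S Q P ab c] ab c by (simp add: hom_iff)
  qed
qed

lemma qtens_comp:
  assumes S: "has_coprods C S"
    and \<phi>: "\<phi> \<in> hom (Quiv C S) Q Q'" "\<phi>' \<in> hom (Quiv C S) Q' Q''"
    and \<psi>: "\<psi> \<in> hom (Quiv C S) P P'" "\<psi>' \<in> hom (Quiv C S) P' P''"
  shows "(\<phi>' \<otimes>\<^bsub>Quiv C S\<^esub> \<psi>') \<cdot>\<^bsub>Quiv C S\<^esub> (\<phi> \<otimes>\<^bsub>Quiv C S\<^esub> \<psi>) =
    (\<phi>' \<cdot>\<^bsub>Quiv C S\<^esub> \<phi>) \<otimes>\<^bsub>Quiv C S\<^esub> (\<psi>' \<cdot>\<^bsub>Quiv C S\<^esub> \<psi>)" (is "?l = ?r")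
proof -
  note 1 = qtens_hom[OF S \<phi>(1) \<psi>(1)] and 2 = qtens_hom[OF S \<phi>(2) \<psi>(2)]
    and 3 = qtens_hom[OF S quiv_comp_hom[OF \<phi>] quiv_comp_hom[OF \<psi>]]
  note ob = quiv_hom_obj(1)[OF \<phi>(1)] quiv_hom_obj(1)[OF \<psi>(1)]
  show ?thesis
  proof (rule quiv_hom_eqI[OF quiv_comp_hom[OF 1 2] 3])
    fix a b assume ab: "a \<in> S" "b \<in> S"
    show "?l (a, b) = ?r (a, b)"
    proof (rule quiv_tens_eqI[OF S ob ab quiv_hom_app[OF quiv_comp_hom[OF 1 2] ab] quiv_hom_app[OF 3 ab]])
      fix c assume c: "c \<in> S"
      note h = quiv_hom_app[OF 1 ab] quiv_hom_app[OF 2 ab] quiv_inj_hom[OF S ob ab c]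
        quiv_inj_hom[OF S quiv_hom_obj(2)[OF \<phi>(1)] quiv_hom_obj(2)[OF \<psi>(1)] ab c]
        quiv_inj_hom[OF S quiv_hom_obj(2)[OF \<phi>(2)] quiv_hom_obj(2)[OF \<psi>(2)] ab c]
        quiv_hom_app[OF \<phi>(1) ab(1) c] quiv_hom_app[OF \<phi>(2) ab(1) c]
        quiv_hom_app[OF \<psi>(1) c ab(2)] quiv_hom_app[OF \<psi>(2) c ab(2)]
      have "?l (a, b) \<cdot> quiv_inj C S Q P a b c =
        (\<phi>' \<otimes>\<^bsub>Quiv C S\<^esub> \<psi>') (a, b) \<cdot> ((\<phi> \<otimes>\<^bsub>Quiv C S\<^esub> \<psi>) (a, b) \<cdot> quiv_inj C S Q P a b c)"
        using h ab by (simp add: hom_iff)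
      also have "\<dots> = ((\<phi>' \<otimes>\<^bsub>Quiv C S\<^esub> \<psi>') (a, b) \<cdot> quiv_inj C S Q' P' a b c) \<cdot> (\<phi> (a, c) \<otimes> \<psi> (c, b))"
        unfolding qtens_inj[OF S \<phi>(1) \<psi>(1) ab c] using h by (simp add: hom_iff)
      also have "\<dots> = ?r (a, b) \<cdot> quiv_inj C S Q P a b c"
        unfolding qtens_inj[OF S \<phi>(2) \<psi>(2) ab c] qtens_inj[OF S quiv_comp_hom[OF \<phi>] quiv_comp_hom[OF \<psi>] ab c]
        using h ab c by (simp add: hom_iff)
      finally show "?l (a, b) \<cdot> quiv_inj C S Q P a b c = ?r (a, b) \<cdot> quiv_inj C S Q P a b c" .
    qed
  qed
qed

end

section \<open>Associator and unitors of quivers\<close>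

context enriching_category
begin

lemma quiv_comp_app':
  assumes "\<psi> \<in> hom (Quiv C S) P R" "\<phi> \<in> hom (Quiv C S) Q P" "a \<in> S" "b \<in> S" "x \<in> hom C i (Q (a, b))"
  shows "(\<psi> \<cdot>\<^bsub>Quiv C S\<^esub> \<phi>) (a, b) \<cdot> x = \<psi> (a, b) \<cdot> \<phi> (a, b) \<cdot> x"
  using comp_assoc[OF assms(5) quiv_hom_app[OF assms(2-4)] quiv_hom_app[OF assms(1,3,4)]] assms(3,4) by simp

lemma quiv_id_app':
  assumes "Q \<in> Obj (Quiv C S)" "a \<in> S" "b \<in> S" "x \<in> hom C i (Q (a, b))"
  shows "Id (Quiv C S) Q (a, b) \<cdot> x = x"
  using assms id_comp by simp

lemma quiv_tens_extensional [simp]: "quiv_tens C S Q P \<in> extensional (S \<times> S)"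
  by (auto simp: quiv_tens_def)

context
  fixes S :: "'s set" and Q P R :: "'s \<times> 's \<Rightarrow> 'o"
  assumes S: "has_coprods C S" and Q: "Q \<in> Obj (Quiv C S)" and P: "P \<in> Obj (Quiv C S)" and R: "R \<in> Obj (Quiv C S)"
begin

lemmas QP = quiv_tens_obj[OF S Q P] and PR = quiv_tens_obj[OF S P R]
lemmas Q_PR = quiv_tens_obj[OF S Q PR]

text \<open>Justifies the definite description in \<open>Assoc (Quiv C S)\<close>. The source is a
  coproduct over \<open>c\<close> of tensor products whose first factor is itself a coproduct over
  \<open>d\<close>. The outer coproduct is a plain copairing; the inner one has to be pulled out of
  the tensor product, which is where closedness is used.\<close>

lemma qassoc_ex1:
  assumes ab: "a \<in> S" "b \<in> S"
  shows "\<exists>!u. u \<in> hom C (quiv_tens C S (quiv_tens C S Q P) R (a, b)) (quiv_tens C S Q (quiv_tens C S P R) (a, b)) \<and>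
    (\<forall>c \<in> S. \<forall>d \<in> S.
      u \<cdot> quiv_inj C S (quiv_tens C S Q P) R a b c \<cdot> (quiv_inj C S Q P a c d \<otimes> Id C (R (c, b))) =
      quiv_inj C S Q (quiv_tens C S P R) a b d \<cdot> (Id C (Q (a, d)) \<otimes> quiv_inj C S P R d b c) \<cdot>
        Assoc C (Q (a, d)) (P (d, c)) (R (c, b)))" (is "\<exists>!u. u \<in> hom C ?D ?Z \<and> (\<forall>c \<in> S. \<forall>d \<in> S. u \<cdot> ?i c \<cdot> ?j c d = ?g c d)")
proof -
  have Z: "?Z \<in> Obj C" using quiv_objD[OF Q_PR ab] .
  have Rob: "R (c, b) \<in> Obj C" if "c \<in> S" for c using quiv_objD[OF R that ab(2)] .
  have i: "?i c \<in> hom C (quiv_tens C S Q P (a, c) \<odot> R (c, b)) ?D" if "c \<in> S" for c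
    by (rule quiv_inj_hom[OF S QP R ab that])
  have j: "?j c d \<in> hom C ((Q (a, d) \<odot> P (d, c)) \<odot> R (c, b)) (quiv_tens C S Q P (a, c) \<odot> R (c, b))"
    if "c \<in> S" "d \<in> S" for c d
    by (rule tens_hom[OF quiv_inj_hom[OF S Q P ab(1) that] id_hom[OF Rob[OF that(1)]]])
  have g: "?g c d \<in> hom C ((Q (a, d) \<odot> P (d, c)) \<odot> R (c, b)) ?Z" if "c \<in> S" "d \<in> S" for c d
    by (rule comp_hom[OF comp_hom[OF assoc_hom tens_hom[OF id_hom quiv_inj_hom[OF S P R that(2) ab(2) that(1)]]]
          quiv_inj_hom[OF S Q PR ab that(2)]])
      (use quiv_objD[OF Q ab(1) that(2)] quiv_objD[OF P that(2) that(1)] Rob[OF that(1)] in auto)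
  have "\<exists>v. v \<in> hom C (quiv_tens C S Q P (a, c) \<odot> R (c, b)) ?Z \<and> (\<forall>d \<in> S. v \<cdot> ?j c d = ?g c d)" if c: "c \<in> S" for c
    using tens_coprod_ex[OF S, of "\<lambda>d. Q (a, d) \<odot> P (d, c)" "R (c, b)" ?Z "?g c"]
      quiv_summand_obj[OF Q P ab(1) c] Rob[OF c] Z g[OF c]
    unfolding quiv_tens_app[OF ab(1) c] quiv_inj_def by blast
  then obtain v where v: "\<And>c. c \<in> S \<Longrightarrow> v c \<in> hom C (quiv_tens C S Q P (a, c) \<odot> R (c, b)) ?Z"
      "\<And>c d. c \<in> S \<Longrightarrow> d \<in> S \<Longrightarrow> v c \<cdot> ?j c d = ?g c d" by metis
  let ?u = "quiv_copair C S (quiv_tens C S Q P) R a b ?Z v"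
  have u: "?u \<in> hom C ?D ?Z" by (rule quiv_copair_hom[OF S Z ab]) (rule v(1))
  have ui: "?u \<cdot> ?i c = v c" if "c \<in> S" for c by (rule quiv_copair_inj[OF S Z ab _ that]) (rule v(1))
  show ?thesis
  proof (rule ex1I[of _ ?u])
    show "?u \<in> hom C ?D ?Z \<and> (\<forall>c \<in> S. \<forall>d \<in> S. ?u \<cdot> ?i c \<cdot> ?j c d = ?g c d)"
    proof (intro conjI ballI)
      fix c d assume cd: "c \<in> S" "d \<in> S"
      have "?u \<cdot> ?i c \<cdot> ?j c d = (?u \<cdot> ?i c) \<cdot> ?j c d"
        by (rule sym[OF comp_assoc[OF j[OF cd] i[OF cd(1)] u]])
      then show "?u \<cdot> ?i c \<cdot> ?j c d = ?g c d" using ui[OF cd(1)] v(2)[OF cd] by simp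
    qed (rule u)
    fix w assume w: "w \<in> hom C ?D ?Z \<and> (\<forall>c \<in> S. \<forall>d \<in> S. w \<cdot> ?i c \<cdot> ?j c d = ?g c d)"
    then have wh: "w \<in> hom C ?D ?Z" by blast
    show "w = ?u"
    proof (rule quiv_tens_eqI[OF S QP R ab wh u])
      fix c assume c: "c \<in> S"
      show "w \<cdot> ?i c = ?u \<cdot> ?i c"
      \<comment> \<open>For fixed \<open>c\<close>, the injections over \<open>d\<close> remain
        jointly epimorphic after tensoring with \<open>R (c, b)\<close>.\<close>
      proof (rule tens_left_cancel[OF quiv_objD[OF QP ab(1) c] Rob[OF c] _ _ comp_hom[OF i[OF c] wh] comp_hom[OF i[OF c] u],
            where A = S and x = "\<lambda>d. quiv_inj C S Q P a c d"])
        show "quiv_inj C S Q P a c d \<in> hom C (Q (a, d) \<odot> P (d, c)) (quiv_tens C S Q P (a, c))" if "d \<in> S" for d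
          by (rule quiv_inj_hom[OF S Q P ab(1) c that])
        show "k = k'" if "k \<in> hom C (quiv_tens C S Q P (a, c)) z" "k' \<in> hom C (quiv_tens C S Q P (a, c)) z"
          "\<And>d. d \<in> S \<Longrightarrow> k \<cdot> quiv_inj C S Q P a c d = k' \<cdot> quiv_inj C S Q P a c d" for k k' z
          by (rule quiv_tens_eqI[OF S Q P ab(1) c that])
        fix d assume d: "d \<in> S"
        show "(w \<cdot> ?i c) \<cdot> ?j c d = (?u \<cdot> ?i c) \<cdot> ?j c d"
          using comp_assoc[OF j[OF c d] i[OF c] wh] w c d ui[OF c] v(2)[OF c d] by simp
      qed
    qed
  qed
qed

lemma
  assumes ab: "a \<in> S" "b \<in> S"
  shows qassoc_app_hom: "Assoc (Quiv C S) Q P R (a, b) \<in>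
      hom C (quiv_tens C S (quiv_tens C S Q P) R (a, b)) (quiv_tens C S Q (quiv_tens C S P R) (a, b))"
    and qassoc_inj: "c \<in> S \<Longrightarrow> d \<in> S \<Longrightarrow>
      Assoc (Quiv C S) Q P R (a, b) \<cdot> quiv_inj C S (quiv_tens C S Q P) R a b c \<cdot>
        (quiv_inj C S Q P a c d \<otimes> Id C (R (c, b))) =
      quiv_inj C S Q (quiv_tens C S P R) a b d \<cdot> (Id C (Q (a, d)) \<otimes> quiv_inj C S P R d b c) \<cdot>
        Assoc C (Q (a, d)) (P (d, c)) (R (c, b))"
  using theI'[OF qassoc_ex1[OF ab]] ab by (simp_all add: Quiv_def)

lemma qassoc_hom:
  "Assoc (Quiv C S) Q P R \<in> hom (Quiv C S) (quiv_tens C S (quiv_tens C S Q P) R) (quiv_tens C S Q (quiv_tens C S P R))"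
proof (rule quiv_homI)
  show "Assoc (Quiv C S) Q P R \<in> extensional (S \<times> S)" by (auto simp: Quiv_def)
qed (auto simp: qassoc_app_hom)

lemma qassoc_qprod:
  assumes ab: "a \<in> S" "b \<in> S" "c \<in> S" "d \<in> S"
    and x: "x \<in> hom C I (Q (a, d))" and y: "y \<in> hom C I (P (d, c))" and z: "z \<in> hom C I (R (c, b))"
  shows "Assoc (Quiv C S) Q P R (a, b) \<cdot> qprod S (quiv_tens C S Q P) R a b c (qprod S Q P a c d x y) z =
    qprod S Q (quiv_tens C S P R) a b d x (qprod S P R d b c y z)"
proof -
  let ?A = "Assoc (Quiv C S) Q P R (a, b)" and ?i = "quiv_inj C S (quiv_tens C S Q P) R a b c"
    and ?j = "quiv_inj C S Q P a c d" and ?k = "quiv_inj C S Q (quiv_tens C S P R) a b d"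
    and ?l = "quiv_inj C S P R d b c" and ?\<alpha> = "Assoc C (Q (a, d)) (P (d, c)) (R (c, b))"
  have ob: "Q (a, d) \<in> Obj C" "P (d, c) \<in> Obj C" "R (c, b) \<in> Obj C"
    using hom_obj(2)[OF x] hom_obj(2)[OF y] hom_obj(2)[OF z] by auto
  note i = quiv_inj_hom[OF S QP R ab(1,2,3)] and j = quiv_inj_hom[OF S Q P ab(1,3,4)]
    and k = quiv_inj_hom[OF S Q PR ab(1,2,4)] and l = quiv_inj_hom[OF S P R ab(4,2,3)]
  note xy = etens_hom[OF x y] and yz = etens_hom[OF y z]
  note xyz = etens_hom[OF xy z] and jid = tens_hom[OF j id_hom[OF ob(3)]] and idl = tens_hom[OF id_hom[OF ob(1)] l]
  have "qprod S (quiv_tens C S Q P) R a b c (qprod S Q P a c d x y) z =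
    ?i \<cdot> (?j \<otimes> Id C (R (c, b))) \<cdot> ((x \<boxtimes> y) \<boxtimes> z)"
    unfolding qprod_def tens_comp_etens[OF xy z j id_hom[OF ob(3)]] using z by (simp add: hom_iff)
  then have "?A \<cdot> qprod S (quiv_tens C S Q P) R a b c (qprod S Q P a c d x y) z =
    (?A \<cdot> ?i \<cdot> (?j \<otimes> Id C (R (c, b)))) \<cdot> ((x \<boxtimes> y) \<boxtimes> z)"
    using comp_assoc[OF xyz jid i] comp_assoc[OF xyz comp_hom[OF jid i] qassoc_app_hom[OF ab(1,2)]] by simp
  also have "\<dots> = (?k \<cdot> (Id C (Q (a, d)) \<otimes> ?l) \<cdot> ?\<alpha>) \<cdot> ((x \<boxtimes> y) \<boxtimes> z)"
    by (simp only: qassoc_inj[OF ab])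
  also have "\<dots> = ?k \<cdot> (Id C (Q (a, d)) \<otimes> ?l) \<cdot> ?\<alpha> \<cdot> ((x \<boxtimes> y) \<boxtimes> z)"
    using comp_assoc[OF xyz assoc_hom[OF ob] idl] comp_assoc[OF xyz comp_hom[OF assoc_hom[OF ob] idl] k] by simp
  also have "\<dots> = ?k \<cdot> (x \<boxtimes> (?l \<cdot> (y \<boxtimes> z)))"
    unfolding assoc_etens[OF x y z] tens_comp_etens[OF x yz id_hom[OF ob(1)] l] using x by (simp add: hom_iff)
  finally show ?thesis unfolding qprod_def .
qed

end

context
  fixes S :: "'s set" and Q :: "'s \<times> 's \<Rightarrow> 'o"
  assumes S: "has_coprods C S" and Q: "Q \<in> Obj (Quiv C S)"
begin

text \<open>For \<open>c\<close> different from \<open>a\<close> the summand is the initial object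
  tensored with \<open>Q (c, b)\<close>, out of which arrows are unique, so that only the summand at
  \<open>a\<close> carries information.\<close>

lemma qlunit_eqI:
  assumes ab: "a \<in> S" "b \<in> S"
    and u: "u \<in> hom C (quiv_tens C S (quiv_unit C S) Q (a, b)) Z" "v \<in> hom C (quiv_tens C S (quiv_unit C S) Q (a, b)) Z"
    and eq: "u \<cdot> quiv_inj C S (quiv_unit C S) Q a b a = v \<cdot> quiv_inj C S (quiv_unit C S) Q a b a"
  shows "u = v"
proof (rule quiv_tens_eqI[OF S quiv_unit_obj Q ab u])
  fix c assume c: "c \<in> S"
  show "u \<cdot> quiv_inj C S (quiv_unit C S) Q a b c = v \<cdot> quiv_inj C S (quiv_unit C S) Q a b c"
  proof (cases "c = a")
    case False
    then have "quiv_inj C S (quiv_unit C S) Q a b c \<in> hom C (initial C \<odot> Q (c, b)) (quiv_tens C S (quiv_unit C S) Q (a, b))"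
      using quiv_inj_hom[OF S quiv_unit_obj Q ab c] ab c by (simp add: quiv_unit_def)
    from comp_hom[OF this u(1)] comp_hom[OF this u(2)]
    show ?thesis by (rule initial_tens_eqI[OF quiv_objD[OF Q c ab(2)]])
  qed (simp add: eq)
qed

lemma qrunit_eqI:
  assumes ab: "a \<in> S" "b \<in> S"
    and u: "u \<in> hom C (quiv_tens C S Q (quiv_unit C S) (a, b)) Z" "v \<in> hom C (quiv_tens C S Q (quiv_unit C S) (a, b)) Z"
    and eq: "u \<cdot> quiv_inj C S Q (quiv_unit C S) a b b = v \<cdot> quiv_inj C S Q (quiv_unit C S) a b b"
  shows "u = v"
proof (rule quiv_tens_eqI[OF S Q quiv_unit_obj ab u])
  fix c assume c: "c \<in> S"
  show "u \<cdot> quiv_inj C S Q (quiv_unit C S) a b c = v \<cdot> quiv_inj C S Q (quiv_unit C S) a b c"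
  proof (cases "c = b")
    case False
    then have "quiv_inj C S Q (quiv_unit C S) a b c \<in> hom C (Q (a, c) \<odot> initial C) (quiv_tens C S Q (quiv_unit C S) (a, b))"
      using quiv_inj_hom[OF S Q quiv_unit_obj ab c] ab c by (simp add: quiv_unit_def)
    from comp_hom[OF this u(1)] comp_hom[OF this u(2)]
    show ?thesis by (rule tens_initial_eqI[OF quiv_objD[OF Q ab(1) c]])
  qed (simp add: eq)
qed

lemma qlunit_ex1:
  assumes ab: "a \<in> S" "b \<in> S"
  shows "\<exists>!u. u \<in> hom C (quiv_tens C S (quiv_unit C S) Q (a, b)) (Q (a, b)) \<and>
    u \<cdot> quiv_inj C S (quiv_unit C S) Q a b a = LUnit C (Q (a, b))"
proof -
  note ob = quiv_objD[OF Q ab]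
  \<comment> \<open>Off the summand at \<open>a\<close> the choice is forced: by
    \<open>initial_tens_eqI\<close> there is just one such arrow.\<close>
  define g where "g c = (if c = a then LUnit C (Q (a, b)) else SOME u. u \<in> hom C (initial C \<odot> Q (c, b)) (Q (a, b)))" for c
  have g: "g c \<in> hom C (quiv_unit C S (a, c) \<odot> Q (c, b)) (Q (a, b))" if "c \<in> S" for c
    using someI_ex[OF initial_tens_ex[OF quiv_objD[OF Q that ab(2)] ob]] lunit_hom[OF ob] that ab
    by (auto simp: g_def quiv_unit_def)
  show ?thesis
  proof (rule ex1I, intro conjI)
    show 1: "quiv_copair C S (quiv_unit C S) Q a b (Q (a, b)) g \<in> hom C (quiv_tens C S (quiv_unit C S) Q (a, b)) (Q (a, b))"
      by (rule quiv_copair_hom[OF S ob ab]) (rule g)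
    have "quiv_copair C S (quiv_unit C S) Q a b (Q (a, b)) g \<cdot> quiv_inj C S (quiv_unit C S) Q a b a = g a"
      by (rule quiv_copair_inj[OF S ob ab _ ab(1)]) (rule g)
    then show 2: "quiv_copair C S (quiv_unit C S) Q a b (Q (a, b)) g \<cdot> quiv_inj C S (quiv_unit C S) Q a b a =
      LUnit C (Q (a, b))" by (simp add: g_def)
    show "u = quiv_copair C S (quiv_unit C S) Q a b (Q (a, b)) g"
      if "u \<in> hom C (quiv_tens C S (quiv_unit C S) Q (a, b)) (Q (a, b)) \<and>
        u \<cdot> quiv_inj C S (quiv_unit C S) Q a b a = LUnit C (Q (a, b))" for u
      by (rule qlunit_eqI[OF ab _ 1]) (use that 2 in auto)
  qed
qed

lemma qrunit_ex1:
  assumes ab: "a \<in> S" "b \<in> S"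
  shows "\<exists>!u. u \<in> hom C (quiv_tens C S Q (quiv_unit C S) (a, b)) (Q (a, b)) \<and>
    u \<cdot> quiv_inj C S Q (quiv_unit C S) a b b = RUnit C (Q (a, b))"
proof -
  note ob = quiv_objD[OF Q ab]
  define g where "g c = (if c = b then RUnit C (Q (a, b)) else SOME u. u \<in> hom C (Q (a, c) \<odot> initial C) (Q (a, b)))" for c
  have g: "g c \<in> hom C (Q (a, c) \<odot> quiv_unit C S (c, b)) (Q (a, b))" if "c \<in> S" for c
    using someI_ex[OF tens_initial_ex[OF quiv_objD[OF Q ab(1) that] ob]] runit_hom[OF ob] that ab
    by (auto simp: g_def quiv_unit_def)
  show ?thesis
  proof (rule ex1I, intro conjI)
    show 1: "quiv_copair C S Q (quiv_unit C S) a b (Q (a, b)) g \<in> hom C (quiv_tens C S Q (quiv_unit C S) (a, b)) (Q (a, b))"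
      by (rule quiv_copair_hom[OF S ob ab]) (rule g)
    have "quiv_copair C S Q (quiv_unit C S) a b (Q (a, b)) g \<cdot> quiv_inj C S Q (quiv_unit C S) a b b = g b"
      by (rule quiv_copair_inj[OF S ob ab _ ab(2)]) (rule g)
    then show 2: "quiv_copair C S Q (quiv_unit C S) a b (Q (a, b)) g \<cdot> quiv_inj C S Q (quiv_unit C S) a b b =
      RUnit C (Q (a, b))" by (simp add: g_def)
    show "u = quiv_copair C S Q (quiv_unit C S) a b (Q (a, b)) g"
      if "u \<in> hom C (quiv_tens C S Q (quiv_unit C S) (a, b)) (Q (a, b)) \<and>
        u \<cdot> quiv_inj C S Q (quiv_unit C S) a b b = RUnit C (Q (a, b))" for u
      by (rule qrunit_eqI[OF ab _ 1]) (use that 2 in auto)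
  qed
qed

lemma
  assumes ab: "a \<in> S" "b \<in> S"
  shows qlunit_app_hom: "LUnit (Quiv C S) Q (a, b) \<in> hom C (quiv_tens C S (quiv_unit C S) Q (a, b)) (Q (a, b))"
    and qlunit_inj: "LUnit (Quiv C S) Q (a, b) \<cdot> quiv_inj C S (quiv_unit C S) Q a b a = LUnit C (Q (a, b))"
    and qrunit_app_hom: "RUnit (Quiv C S) Q (a, b) \<in> hom C (quiv_tens C S Q (quiv_unit C S) (a, b)) (Q (a, b))"
    and qrunit_inj: "RUnit (Quiv C S) Q (a, b) \<cdot> quiv_inj C S Q (quiv_unit C S) a b b = RUnit C (Q (a, b))"
  using theI'[OF qlunit_ex1[OF ab]] theI'[OF qrunit_ex1[OF ab]] ab by (simp_all add: Quiv_def)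

lemma qlunit_hom: "LUnit (Quiv C S) Q \<in> hom (Quiv C S) (quiv_tens C S (quiv_unit C S) Q) Q"
proof (rule quiv_homI)
  show "LUnit (Quiv C S) Q \<in> extensional (S \<times> S)" by (auto simp: Quiv_def)
qed (use Q in \<open>auto simp: qlunit_app_hom PiE_iff\<close>)

lemma qrunit_hom: "RUnit (Quiv C S) Q \<in> hom (Quiv C S) (quiv_tens C S Q (quiv_unit C S)) Q"
proof (rule quiv_homI)
  show "RUnit (Quiv C S) Q \<in> extensional (S \<times> S)" by (auto simp: Quiv_def)
qed (use Q in \<open>auto simp: qrunit_app_hom PiE_iff\<close>)

lemma qlunit_iso: "is_iso (Quiv C S) (LUnit (Quiv C S) Q)"
proof (rule quiv_is_isoI[OF qlunit_hom])
  \<comment> \<open>The inverse enters through the summand at \<open>a\<close>, the one that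
    determines arrows out of the tensor product.\<close>
  let ?g = "\<lambda>a b. quiv_inj C S (quiv_unit C S) Q a b a \<cdot> inv_arr C (LUnit C (Q (a, b)))"
  have g: "?g a b \<in> hom C (Q (a, b)) (quiv_tens C S (quiv_unit C S) Q (a, b))" if "a \<in> S" "b \<in> S" for a b
    using quiv_inj_hom[OF S quiv_unit_obj Q that that(1)] quiv_objD[OF Q that] that by (simp add: hom_iff)
  show "(\<lambda>(a, b) \<in> S \<times> S. ?g a b) \<in> hom (Quiv C S) Q (quiv_tens C S (quiv_unit C S) Q)"
    by (rule quiv_homI) (use Q g in \<open>auto simp: quiv_tens_def PiE_iff\<close>)
  fix a b assume ab: "a \<in> S" "b \<in> S"
  note h = quiv_inj_hom[OF S quiv_unit_obj Q ab ab(1)] quiv_objD[OF Q ab] qlunit_app_hom[OF ab]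
  have "LUnit (Quiv C S) Q (a, b) \<cdot> ?g a b =
      (LUnit (Quiv C S) Q (a, b) \<cdot> quiv_inj C S (quiv_unit C S) Q a b a) \<cdot> inv_arr C (LUnit C (Q (a, b)))"
    using h ab by (simp add: hom_iff)
  then have 1: "LUnit (Quiv C S) Q (a, b) \<cdot> ?g a b = Id C (Q (a, b))"
    using h by (simp add: qlunit_inj[OF ab])
  then show "LUnit (Quiv C S) Q (a, b) \<cdot> (\<lambda>(a, b) \<in> S \<times> S. ?g a b) (a, b) = Id C (Q (a, b))"
    using ab by simp
  have "?g a b \<cdot> LUnit (Quiv C S) Q (a, b) = Id C (quiv_tens C S (quiv_unit C S) Q (a, b))"
  proof (rule qlunit_eqI[OF ab comp_hom[OF h(3) g[OF ab]] id_hom[OF hom_obj(2)[OF h(1)]]])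
    show "(?g a b \<cdot> LUnit (Quiv C S) Q (a, b)) \<cdot> quiv_inj C S (quiv_unit C S) Q a b a =
      Id C (quiv_tens C S (quiv_unit C S) Q (a, b)) \<cdot> quiv_inj C S (quiv_unit C S) Q a b a"
      using comp_assoc[OF h(1,3) g[OF ab]] h ab by (simp add: qlunit_inj[OF ab] hom_iff)
  qed
  then show "(\<lambda>(a, b) \<in> S \<times> S. ?g a b) (a, b) \<cdot> LUnit (Quiv C S) Q (a, b) = Id C (quiv_tens C S (quiv_unit C S) Q (a, b))"
    using ab by simp
qed

lemma qrunit_iso: "is_iso (Quiv C S) (RUnit (Quiv C S) Q)"
proof (rule quiv_is_isoI[OF qrunit_hom])
  let ?g = "\<lambda>a b. quiv_inj C S Q (quiv_unit C S) a b b \<cdot> inv_arr C (RUnit C (Q (a, b)))"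
  have g: "?g a b \<in> hom C (Q (a, b)) (quiv_tens C S Q (quiv_unit C S) (a, b))" if "a \<in> S" "b \<in> S" for a b
    using quiv_inj_hom[OF S Q quiv_unit_obj that that(2)] quiv_objD[OF Q that] that by (simp add: hom_iff)
  show "(\<lambda>(a, b) \<in> S \<times> S. ?g a b) \<in> hom (Quiv C S) Q (quiv_tens C S Q (quiv_unit C S))"
    by (rule quiv_homI) (use Q g in \<open>auto simp: quiv_tens_def PiE_iff\<close>)
  fix a b assume ab: "a \<in> S" "b \<in> S"
  note h = quiv_inj_hom[OF S Q quiv_unit_obj ab ab(2)] quiv_objD[OF Q ab] qrunit_app_hom[OF ab]
  have "RUnit (Quiv C S) Q (a, b) \<cdot> ?g a b =
      (RUnit (Quiv C S) Q (a, b) \<cdot> quiv_inj C S Q (quiv_unit C S) a b b) \<cdot> inv_arr C (RUnit C (Q (a, b)))"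
    using h ab by (simp add: hom_iff)
  then have 1: "RUnit (Quiv C S) Q (a, b) \<cdot> ?g a b = Id C (Q (a, b))"
    using h by (simp add: qrunit_inj[OF ab])
  then show "RUnit (Quiv C S) Q (a, b) \<cdot> (\<lambda>(a, b) \<in> S \<times> S. ?g a b) (a, b) = Id C (Q (a, b))"
    using ab by simp
  have "?g a b \<cdot> RUnit (Quiv C S) Q (a, b) = Id C (quiv_tens C S Q (quiv_unit C S) (a, b))"
  proof (rule qrunit_eqI[OF ab comp_hom[OF h(3) g[OF ab]] id_hom[OF hom_obj(2)[OF h(1)]]])
    show "(?g a b \<cdot> RUnit (Quiv C S) Q (a, b)) \<cdot> quiv_inj C S Q (quiv_unit C S) a b b =
      Id C (quiv_tens C S Q (quiv_unit C S) (a, b)) \<cdot> quiv_inj C S Q (quiv_unit C S) a b b"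
      using comp_assoc[OF h(1,3) g[OF ab]] h ab by (simp add: qrunit_inj[OF ab] hom_iff)
  qed
  then show "(\<lambda>(a, b) \<in> S \<times> S. ?g a b) (a, b) \<cdot> RUnit (Quiv C S) Q (a, b) = Id C (quiv_tens C S Q (quiv_unit C S) (a, b))"
    using ab by simp
qed

lemma qlunit_qprod:
  assumes ab: "a \<in> S" "b \<in> S" and x: "x \<in> hom C I (Q (a, b))"
  shows "LUnit (Quiv C S) Q (a, b) \<cdot> qprod S (quiv_unit C S) Q a b a (Id C I) x = x"
proof -
  have 1: "Id C I \<boxtimes> x \<in> hom C I (quiv_unit C S (a, a) \<odot> Q (a, b))"
    using etens_hom[OF id_hom[OF unit_obj] x] ab by simp
  show ?thesis
    unfolding qprod_def
    using comp_assoc[OF 1 quiv_inj_hom[OF S quiv_unit_obj Q ab ab(1)] qlunit_app_hom[OF ab]] lunit_etens[OF x]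
    by (simp add: qlunit_inj[OF ab])
qed

lemma qrunit_qprod:
  assumes ab: "a \<in> S" "b \<in> S" and x: "x \<in> hom C I (Q (a, b))"
  shows "RUnit (Quiv C S) Q (a, b) \<cdot> qprod S Q (quiv_unit C S) a b b x (Id C I) = x"
proof -
  have 1: "x \<boxtimes> Id C I \<in> hom C I (Q (a, b) \<odot> quiv_unit C S (b, b))"
    using etens_hom[OF x id_hom[OF unit_obj]] ab by simp
  show ?thesis
    unfolding qprod_def
    using comp_assoc[OF 1 quiv_inj_hom[OF S Q quiv_unit_obj ab ab(2)] qrunit_app_hom[OF ab]] runit_etens[OF x]
    by (simp add: qrunit_inj[OF ab])
qed

end

end

section \<open>Simplices and chains of simplices\<close>

lemma Delta_simps [simp]:
  "Obj Delta = UNIV" "Dom Delta (m, f, n) = m" "Cod Delta (m, f, n) = n" "Id Delta n = (n, \<lambda>i \<in> {..n}. i, n)"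
  "(m', g, n') \<cdot>\<^bsub>Delta\<^esub> (l, f, k) = (l, compose {..l} g f, n')"
  by (simp_all add: Delta_def)

lemma Delta_arr: "(m, f, n) \<in> Arr Delta \<longleftrightarrow> f \<in> {..m} \<rightarrow>\<^sub>E {..n} \<and> mono_on {..m} f"
  by (simp add: Delta_def)

lemma category_Delta: "category Delta"
proof
  fix f g :: delta and a b c assume "f \<in> hom Delta a b" "g \<in> hom Delta b c"
  then show "g \<cdot>\<^bsub>Delta\<^esub> f \<in> hom Delta a c"
    by (cases f, cases g) (auto simp: hom_iff Delta_arr compose_def mono_on_def Pi_iff PiE_iff)
next
  fix f g h :: delta and a b c d assume "f \<in> hom Delta a b" "g \<in> hom Delta b c" "h \<in> hom Delta c d"
  then show "(h \<cdot>\<^bsub>Delta\<^esub> g) \<cdot>\<^bsub>Delta\<^esub> f = h \<cdot>\<^bsub>Delta\<^esub> g \<cdot>\<^bsub>Delta\<^esub> f"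
    by (cases f, cases g, cases h) (auto simp: hom_iff Delta_arr compose_def PiE_iff Pi_iff fun_eq_iff restrict_def)
next
  fix f :: delta and a b assume "f \<in> hom Delta a b"
  then show "f \<cdot>\<^bsub>Delta\<^esub> Id Delta a = f" "Id Delta b \<cdot>\<^bsub>Delta\<^esub> f = f"
    by (cases f; auto simp: hom_iff Delta_arr compose_def PiE_iff Pi_iff fun_eq_iff restrict_def extensional_def)+
qed (auto simp: hom_iff Delta_arr mono_on_def)

interpretation Delta: category Delta by (rule category_Delta)

lemma Delta_f_simps [simp]:
  "Obj Delta_f = UNIV" "Dom Delta_f = Dom Delta" "Cod Delta_f = Cod Delta" "Id Delta_f = Id Delta"
  "Comp Delta_f = Comp Delta" "TensO Delta_f = (+)" "Unit Delta_f = 0" "LUnit Delta_f = Id Delta" "RUnit Delta_f = Id Delta"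
  by (simp_all add: Delta_f_def)

lemma Delta_f_arr: "(m, f, n) \<in> Arr Delta_f \<longleftrightarrow> (m, f, n) \<in> Arr Delta \<and> f 0 = 0 \<and> f m = n"
  by (simp add: Delta_f_def)

lemma Delta_f_arrD: "h \<in> Arr Delta_f \<Longrightarrow> h \<in> Arr Delta"
  by (cases h) (simp add: Delta_f_arr)

lemma seg_dom_cod [simp]: "Dom Delta (seg m i n) = m" "Cod Delta (seg m i n) = n"
  by (simp_all add: seg_def)

lemma seg_arr [simp]: "i + m \<le> n \<Longrightarrow> seg m i n \<in> Arr Delta"
  by (auto simp: seg_def Delta_arr mono_on_def)

lemma seg_comp [simp]: "j + k \<le> m \<Longrightarrow> seg m i n \<cdot>\<^bsub>Delta\<^esub> seg k j m = seg k (i + j) n"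
  by (auto simp: seg_def compose_def fun_eq_iff)

lemma seg_id: "seg n 0 n = Id Delta n"
  by (simp add: seg_def)

text \<open>Maps in \<open>Delta_f\<close> fix both ends. Consequently inner faces and degeneracies
  keep the first and the last vertex of a simplex and act on each \<open>simp_between\<close>
  separately.\<close>

lemma Delta_f_seg:
  assumes "h \<in> Arr Delta_f"
  shows "h \<cdot>\<^bsub>Delta\<^esub> seg 0 0 (Dom Delta h) = seg 0 0 (Cod Delta h)"
    "h \<cdot>\<^bsub>Delta\<^esub> seg 0 (Dom Delta h) (Dom Delta h) = seg 0 (Cod Delta h) (Cod Delta h)"
  using assms by (cases h; auto simp: seg_def Delta_f_arr compose_def fun_eq_iff)+

definition src :: "'k sset \<Rightarrow> nat \<Rightarrow> 'k \<Rightarrow> 'k" where "src K n x = act K (seg 0 0 n) x"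
definition tgt :: "'k sset \<Rightarrow> nat \<Rightarrow> 'k \<Rightarrow> 'k" where "tgt K n x = act K (seg 0 n n) x"
definition front_face :: "'k sset \<Rightarrow> nat \<Rightarrow> nat \<Rightarrow> 'k \<Rightarrow> 'k" where "front_face K k l x = act K (seg k 0 (k + l)) x"
definition back_face :: "'k sset \<Rightarrow> nat \<Rightarrow> nat \<Rightarrow> 'k \<Rightarrow> 'k" where "back_face K k l x = act K (seg l k (k + l)) x"

lemma simp_between_iff: "x \<in> simp_between K n a b \<longleftrightarrow> x \<in> simp K n \<and> src K n x = a \<and> tgt K n x = b"
  by (simp add: simp_between_def src_def tgt_def)

locale simplicial_set =
  fixes K :: "'k sset"
  assumes is_sset: "is_sset K"
begin

lemma act_in: "h \<in> Arr Delta \<Longrightarrow> x \<in> simp K (Cod Delta h) \<Longrightarrow> act K h x \<in> simp K (Dom Delta h)"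
  using is_sset by (simp add: is_sset_def)

lemma act_id: "x \<in> simp K n \<Longrightarrow> act K (Id Delta n) x = x"
  using is_sset by (simp add: is_sset_def)

lemma act_comp:
  "g \<in> Arr Delta \<Longrightarrow> h \<in> Arr Delta \<Longrightarrow> Dom Delta g = Cod Delta h \<Longrightarrow> x \<in> simp K (Cod Delta g) \<Longrightarrow>
   act K h (act K g x) = act K (g \<cdot>\<^bsub>Delta\<^esub> h) x"
  using is_sset by (simp add: is_sset_def)

lemma src_in: "x \<in> simp K n \<Longrightarrow> src K n x \<in> simp K 0"
  and tgt_in: "x \<in> simp K n \<Longrightarrow> tgt K n x \<in> simp K 0"
  and front_in: "x \<in> simp K (k + l) \<Longrightarrow> front_face K k l x \<in> simp K k"
  and back_in: "x \<in> simp K (k + l) \<Longrightarrow> back_face K k l x \<in> simp K l"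
  using act_in[of "seg 0 0 n" x] act_in[of "seg 0 n n" x] act_in[of "seg k 0 (k + l)" x] act_in[of "seg l k (k + l)" x]
  by (simp_all add: src_def tgt_def front_face_def back_face_def)

lemma src_front: "x \<in> simp K (k + l) \<Longrightarrow> src K k (front_face K k l x) = src K (k + l) x"
  and tgt_front: "x \<in> simp K (k + l) \<Longrightarrow> tgt K k (front_face K k l x) = act K (seg 0 k (k + l)) x"
  and src_back: "x \<in> simp K (k + l) \<Longrightarrow> src K l (back_face K k l x) = act K (seg 0 k (k + l)) x"
  and tgt_back: "x \<in> simp K (k + l) \<Longrightarrow> tgt K l (back_face K k l x) = tgt K (k + l) x"
  by (simp_all add: src_def tgt_def front_face_def back_face_def act_comp)

lemma front_zero: "x \<in> simp K k \<Longrightarrow> front_face K k 0 x = x"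
  using act_id[of x k] by (simp add: front_face_def seg_id)

lemma src_vertex: "x \<in> simp K 0 \<Longrightarrow> src K 0 x = x"
  and tgt_vertex: "x \<in> simp K 0 \<Longrightarrow> tgt K 0 x = x"
  using act_id[of x 0] by (simp_all add: src_def tgt_def seg_id)

lemma src_act: "h \<in> Arr Delta_f \<Longrightarrow> x \<in> simp K (Cod Delta h) \<Longrightarrow> src K (Dom Delta h) (act K h x) = src K (Cod Delta h) x"
  and tgt_act: "h \<in> Arr Delta_f \<Longrightarrow> x \<in> simp K (Cod Delta h) \<Longrightarrow> tgt K (Dom Delta h) (act K h x) = tgt K (Cod Delta h) x"
  by (simp_all add: src_def tgt_def act_comp Delta_f_arrD Delta_f_seg)

end

text \<open>A map into \<open>K\<close> from the wedge of standard simplices of dimensions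
  \<open>ds\<close>, running from \<open>a\<close> to \<open>b\<close>. Chains index the generators
  of \<open>tens\<close> for the free templicial object; the empty chain, present for
  \<open>a = b\<close> only, matches the unit quiver.\<close>

fun chain :: "'k sset \<Rightarrow> nat list \<Rightarrow> 'k list \<Rightarrow> 'k \<Rightarrow> 'k \<Rightarrow> bool" where
  "chain K [] [] a b \<longleftrightarrow> a = b \<and> a \<in> simp K 0"
| "chain K (d # ds) (x # xs) a b \<longleftrightarrow> x \<in> simp K d \<and> src K d x = a \<and> chain K ds xs (tgt K d x) b"
| "chain K _ _ a b \<longleftrightarrow> False"

lemma chain_Nil: "chain K [] xs a b \<longleftrightarrow> xs = [] \<and> a = b \<and> a \<in> simp K 0"
  by (cases xs) auto

lemma chain_Cons: "chain K (d # ds) xs a b \<longleftrightarrow>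
  (\<exists>y ys. xs = y # ys \<and> y \<in> simp K d \<and> src K d y = a \<and> chain K ds ys (tgt K d y) b)"
  by (cases xs) auto

lemma chain_length: "chain K ds xs a b \<Longrightarrow> length xs = length ds"
proof (induction ds arbitrary: xs a)
  case (Cons d ds)
  then show ?case by (cases xs) auto
qed (simp add: chain_Nil)

lemma chain_append:
  "chain K ds xs a c \<Longrightarrow> chain K es ys c b \<Longrightarrow> chain K (ds @ es) (xs @ ys) a b"
  by (induction ds arbitrary: xs a) (auto simp: chain_Nil chain_Cons)

text \<open>\<open>split_simplex\<close>, \<open>split_chain\<close>, \<open>insert_vertices\<close>
  and \<open>act_chain\<close> are the effects on chains of \<open>mu\<close>,
  \<open>inert_map\<close>, \<open>insert_zeros\<close> and \<open>active_map\<close>, in this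
  order; \<open>mu_el\<close>, \<open>inert_map_el\<close>, \<open>insert_zeros_el\<close> and
  \<open>active_map_el\<close> make this precise.\<close>

fun split_simplex :: "'k sset \<Rightarrow> nat list \<Rightarrow> 'k \<Rightarrow> 'k list" where
  "split_simplex K [] x = []"
| "split_simplex K (d # ds) x = front_face K d (sum_list ds) x # split_simplex K ds (back_face K d (sum_list ds) x)"

fun split_chain :: "'k sset \<Rightarrow> nat list list \<Rightarrow> 'k list \<Rightarrow> 'k list" where
  "split_chain K (ds # dss) (x # xs) = split_simplex K ds x @ split_chain K dss xs"
| "split_chain K _ _ = []"

text \<open>\<open>a\<close> is the vertex reached so far. A factor of dimension 0 receives it, as
  no entry of \<open>ys\<close> corresponds to such a factor.\<close>

fun insert_vertices :: "'k sset \<Rightarrow> 'k \<Rightarrow> nat list \<Rightarrow> 'k list \<Rightarrow> 'k list" where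
  "insert_vertices K a [] ys = []"
| "insert_vertices K a (d # ds) ys =
     (if d = 0 then a # insert_vertices K a ds ys
      else hd ys # insert_vertices K (tgt K d (hd ys)) ds (tl ys))"

fun act_chain :: "'k sset \<Rightarrow> delta list \<Rightarrow> 'k list \<Rightarrow> 'k list" where
  "act_chain K (h # hs) (x # xs) = act K h x # act_chain K hs xs"
| "act_chain K _ _ = []"

context simplicial_set
begin

lemma chain_ends: "chain K ds xs a b \<Longrightarrow> a \<in> simp K 0 \<and> b \<in> simp K 0"
  by (induction ds arbitrary: xs a) (auto simp: chain_Nil chain_Cons src_in)

lemma chain_split_simplex:
  "x \<in> simp K (sum_list ds) \<Longrightarrow> chain K ds (split_simplex K ds x) (src K (sum_list ds) x) (tgt K (sum_list ds) x)"
proof (induction ds arbitrary: x)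
  case (Cons d ds)
  then show ?case
    using Cons.IH[OF back_in] by (simp add: front_in src_front tgt_front src_back tgt_back)
qed (simp add: src_vertex tgt_vertex)

lemma chain_split_chain:
  "chain K (map sum_list dss) xs a b \<Longrightarrow> chain K (concat dss) (split_chain K dss xs) a b"
proof (induction dss arbitrary: xs a)
  case (Cons ds dss)
  then show ?case using chain_append[OF chain_split_simplex] by (fastforce simp: chain_Cons)
qed (simp add: chain_Nil)

lemma chain_insert_vertices:
  "chain K (filter (\<lambda>d. d \<noteq> 0) ds) ys a b \<Longrightarrow> chain K ds (insert_vertices K a ds ys) a b"
proof (induction ds arbitrary: ys a)
  case (Cons d ds)
  show ?case
  proof (cases "d = 0")
    case True
    then have "chain K (filter (\<lambda>d. d \<noteq> 0) ds) ys a b" using Cons.prems by simp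
    then show ?thesis using True Cons.IH[of ys a] chain_ends[of _ ys a b] by (auto simp: src_vertex tgt_vertex)
  next
    case False
    then show ?thesis using Cons.prems Cons.IH by (auto simp: chain_Cons)
  qed
qed (simp add: chain_Nil)

lemma chain_act_chain:
  "set hs \<subseteq> Arr Delta_f \<Longrightarrow> chain K (map (Cod Delta_f) hs) xs a b \<Longrightarrow>
   chain K (map (Dom Delta_f) hs) (act_chain K hs xs) a b"
proof (induction hs arbitrary: xs a)
  case (Cons h hs)
  obtain y ys where xs: "xs = y # ys" and y: "y \<in> simp K (Cod Delta h)" "src K (Cod Delta h) y = a"
    and ys: "chain K (map (Cod Delta_f) hs) ys (tgt K (Cod Delta h) y) b"
    using Cons.prems(2) by (auto simp: chain_Cons)
  have h: "h \<in> Arr Delta_f" using Cons.prems by simp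
  show ?case using Cons.IH[OF _ ys] Cons.prems(1) y
    by (simp add: xs act_in[OF Delta_f_arrD[OF h]] src_act[OF h] tgt_act[OF h])
qed (simp add: chain_Nil)

end

section \<open>Elements of tensor powers\<close>

text \<open>The types of the structure maps and invertibility of the counit: what is needed to type
  necklace maps and to evaluate them on families. Both the free templicial objects and the given
  templicial object are instances, the former directly from the construction of their maps.\<close>

locale colax_quiver = enriching_category C
  for C :: "('o, 'm, 'z) symcat_scheme" (structure) +
  fixes S :: "'s set" and Y :: "('s, 'o, 'm) quiv_colax"
  assumes S: "has_coprods C S"
    and Y_obj: "ObjF Y n \<in> Obj (Quiv C S)"
    and Y_arr: "h \<in> Arr Delta_f \<Longrightarrow> ArrF Y h \<in> hom (Quiv C S) (ObjF Y (Cod Delta h)) (ObjF Y (Dom Delta h))"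
    and Y_comult: "comult Y k l \<in> hom (Quiv C S) (ObjF Y (k + l)) (quiv_tens C S (ObjF Y k) (ObjF Y l))"
    and Y_counit: "counit Y \<in> hom (Quiv C S) (ObjF Y 0) (quiv_unit C S)"
    and Y_counit_iso: "is_iso (Quiv C S) (counit Y)"
begin

abbreviation T where "T ds \<equiv> tens (Quiv C S) Y ds"

lemma T_obj: "T ds \<in> Obj (Quiv C S)"
proof (induction ds)
  case Nil
  then show ?case using quiv_unit_obj[of S] by simp
next
  case (Cons d ds)
  then show ?case using quiv_tens_obj[OF S Y_obj Cons, of d] Y_obj[of d] by simp
qed

lemma tens_cons_hom: "tens_cons (Quiv C S) Y d ds \<in> hom (Quiv C S) (quiv_tens C S (ObjF Y d) (T ds)) (T (d # ds))"
  using qrunit_hom[OF S Y_obj] quiv_id_hom[OF quiv_tens_obj[OF S Y_obj T_obj]] by (auto simp: tens_cons_def)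

lemma tens_cons_iso: "is_iso (Quiv C S) (tens_cons (Quiv C S) Y d ds)"
  using qrunit_iso[OF S Y_obj] category.iso_id[OF category_Quiv quiv_tens_obj[OF S Y_obj T_obj]]
  by (auto simp: tens_cons_def)

lemma tens_append_hom: "tens_append (Quiv C S) Y ds es \<in> hom (Quiv C S) (quiv_tens C S (T ds) (T es)) (T (ds @ es))"
proof (induction ds)
  case Nil
  then show ?case using qlunit_hom[OF S T_obj] by simp
next
  case (Cons d ds)
  have "tens_append (Quiv C S) Y (d # ds) es \<in> hom (Quiv C S) (quiv_tens C S (T (d # ds)) (T es)) (T (d # ds @ es))"
    unfolding tens_append.simps
    by (rule quiv_comp_hom[OF quiv_comp_hom[OF quiv_comp_hom[OF
        qtens_hom[OF S quiv_inv_hom[OF tens_cons_iso tens_cons_hom] quiv_id_hom[OF T_obj]]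
        qassoc_hom[OF S Y_obj T_obj T_obj]]
        qtens_hom[OF S quiv_id_hom[OF Y_obj] Cons]] tens_cons_hom])
  then show ?case by simp
qed

lemma mu_hom: "mu (Quiv C S) Y ds \<in> hom (Quiv C S) (ObjF Y (sum_list ds)) (T ds)"
proof (induction ds)
  case Nil
  then show ?case using Y_counit by simp
next
  case (Cons d ds)
  show ?case
    using quiv_comp_hom[OF Y_comult qtens_hom[OF S quiv_id_hom[OF Y_obj] Cons], of d] quiv_id_hom[OF Y_obj, of d]
    by simp
qed

lemma inert_map_hom: "inert_map (Quiv C S) Y dss \<in> hom (Quiv C S) (T (map sum_list dss)) (T (concat dss))"
proof (induction dss)
  case Nil
  then show ?case using quiv_id_hom[OF quiv_unit_obj] by simp
next
  case (Cons ds dss)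
  have "inert_map (Quiv C S) Y (ds # dss) \<in> hom (Quiv C S) (T (sum_list ds # map sum_list dss)) (T (ds @ concat dss))"
    unfolding inert_map.simps
    by (rule quiv_comp_hom[OF quiv_comp_hom[OF quiv_inv_hom[OF tens_cons_iso tens_cons_hom] qtens_hom[OF S mu_hom Cons]]
        tens_append_hom])
  then show ?case by simp
qed

lemma insert_zeros_hom:
  "insert_zeros (Quiv C S) Y ds \<in> hom (Quiv C S) (T (filter (\<lambda>d. d \<noteq> 0) ds)) (T ds)"
proof (induction ds)
  case Nil
  then show ?case using quiv_id_hom[OF quiv_unit_obj] by simp
next
  case (Cons d ds)
  let ?es = "filter (\<lambda>d. d \<noteq> 0) ds"
  show ?case
  proof (cases "d = 0")
    case True
    have "tens_cons (Quiv C S) Y 0 ds \<cdot>\<^bsub>Quiv C S\<^esub>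
      (inv_arr (Quiv C S) (counit Y) \<otimes>\<^bsub>Quiv C S\<^esub> insert_zeros (Quiv C S) Y ds) \<cdot>\<^bsub>Quiv C S\<^esub>
      inv_arr (Quiv C S) (LUnit (Quiv C S) (T ?es)) \<in> hom (Quiv C S) (T ?es) (T (0 # ds))"
      by (rule quiv_comp_hom[OF quiv_comp_hom[OF quiv_inv_hom[OF qlunit_iso[OF S T_obj] qlunit_hom[OF S T_obj]]
            qtens_hom[OF S quiv_inv_hom[OF Y_counit_iso Y_counit] Cons]] tens_cons_hom])
    then show ?thesis using True by (simp add: Let_def)
  next
    case False
    have "tens_cons (Quiv C S) Y d ds \<cdot>\<^bsub>Quiv C S\<^esub>
      (Id (Quiv C S) (ObjF Y d) \<otimes>\<^bsub>Quiv C S\<^esub> insert_zeros (Quiv C S) Y ds) \<cdot>\<^bsub>Quiv C S\<^esub>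
      inv_arr (Quiv C S) (tens_cons (Quiv C S) Y d ?es) \<in> hom (Quiv C S) (T (d # ?es)) (T (d # ds))"
      by (rule quiv_comp_hom[OF quiv_comp_hom[OF quiv_inv_hom[OF tens_cons_iso tens_cons_hom]
            qtens_hom[OF S quiv_id_hom[OF Y_obj] Cons]] tens_cons_hom])
    then show ?thesis using False by (simp add: Let_def)
  qed
qed

lemma active_map_hom:
  "set hs \<subseteq> Arr Delta_f \<Longrightarrow>
   active_map (Quiv C S) Y hs \<in> hom (Quiv C S) (T (map (Cod Delta_f) hs)) (T (map (Dom Delta_f) hs))"
proof (induction hs)
  case Nil
  then show ?case using quiv_id_hom[OF quiv_unit_obj] by simp
next
  case (Cons h hs)
  then show ?case using Y_arr[of h] qtens_hom[OF S Y_arr[of h] Cons.IH] by simp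
qed

end

context enriching_category
begin

text \<open>Such families correspond to templicial morphisms from \<open>F_tilde C K\<close> to \<open>(Y, S)\<close>, see
  \<open>templicial_hom_iff\<close> below.\<close>

definition is_family :: "'s set \<Rightarrow> ('s, 'o, 'm) quiv_colax \<Rightarrow> 'k sset \<Rightarrow> ('k \<Rightarrow> 's) \<Rightarrow> (nat \<Rightarrow> 'k \<Rightarrow> 'm) \<Rightarrow> bool" where
  "is_family S Y K f e \<longleftrightarrow>
     (\<forall>v \<in> simp K 0. f v \<in> S) \<and>
     (\<forall>n. \<forall>x \<in> simp K n. e n x \<in> hom C I (ObjF Y n (f (src K n x), f (tgt K n x)))) \<and>
     (\<forall>h \<in> Arr Delta_f. \<forall>x \<in> simp K (Cod Delta h).
        ArrF Y h (f (src K (Cod Delta h) x), f (tgt K (Cod Delta h) x)) \<cdot> e (Cod Delta h) x =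
        e (Dom Delta h) (act K h x)) \<and>
     (\<forall>v \<in> simp K 0. counit Y (f v, f v) \<cdot> e 0 v = Id C I) \<and>
     (\<forall>k l. \<forall>x \<in> simp K (k + l).
        comult Y k l (f (src K (k + l) x), f (tgt K (k + l) x)) \<cdot> e (k + l) x =
        qprod S (ObjF Y k) (ObjF Y l) (f (src K (k + l) x)) (f (tgt K (k + l) x)) (f (act K (seg 0 k (k + l)) x))
          (e k (front_face K k l x)) (e l (back_face K k l x)))"

end

locale element_family = colax_quiver C S Y + simplicial_set K
  for C :: "('o, 'm, 'z) symcat_scheme" (structure) and S :: "'s set" and Y and K :: "'k sset" +
  fixes f :: "'k \<Rightarrow> 's" and e :: "nat \<Rightarrow> 'k \<Rightarrow> 'm"
  assumes family: "is_family S Y K f e"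
begin

lemma f_in: "v \<in> simp K 0 \<Longrightarrow> f v \<in> S"
  and e_hom: "x \<in> simp K n \<Longrightarrow> e n x \<in> hom C I (ObjF Y n (f (src K n x), f (tgt K n x)))"
  and e_act: "h \<in> Arr Delta_f \<Longrightarrow> x \<in> simp K (Cod Delta h) \<Longrightarrow>
    ArrF Y h (f (src K (Cod Delta h) x), f (tgt K (Cod Delta h) x)) \<cdot> e (Cod Delta h) x = e (Dom Delta h) (act K h x)"
  and e_counit: "v \<in> simp K 0 \<Longrightarrow> counit Y (f v, f v) \<cdot> e 0 v = Id C I"
  and e_comult: "x \<in> simp K (k + l) \<Longrightarrow>
    comult Y k l (f (src K (k + l) x), f (tgt K (k + l) x)) \<cdot> e (k + l) x =
        qprod S (ObjF Y k) (ObjF Y l) (f (src K (k + l) x)) (f (tgt K (k + l) x)) (f (act K (seg 0 k (k + l)) x))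
          (e k (front_face K k l x)) (e l (back_face K k l x))"
  using family unfolding is_family_def by blast+

lemma fs: "x \<in> simp K n \<Longrightarrow> f (src K n x) \<in> S" and ft: "x \<in> simp K n \<Longrightarrow> f (tgt K n x) \<in> S"
  by (auto intro: f_in src_in tgt_in)

text \<open>The product of the elements along a chain, bracketed to the right like
  \<open>tens\<close>. The end point \<open>b\<close> is an argument because every partial product
  lies in a component with second index \<open>f b\<close>; the empty product is the identity of I,
  read in a diagonal component of the unit quiver.\<close>

fun el :: "'k \<Rightarrow> nat list \<Rightarrow> 'k list \<Rightarrow> 'm" where
  "el b (d # ds) (x # xs) = (if ds = [] then e d x else
     qprod S (ObjF Y d) (T ds) (f (src K d x)) (f b) (f (tgt K d x)) (e d x) (el b ds xs))"
| "el b _ _ = Id C I"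

lemma el_hom: "chain K ds xs a b \<Longrightarrow> el b ds xs \<in> hom C I (T ds (f a, f b))"
proof (induction ds arbitrary: xs a)
  case Nil
  then show ?case using id_hom[OF unit_obj] by (auto simp: chain_Nil f_in)
next
  case (Cons d ds)
  obtain y ys where xs: "xs = y # ys" and y: "y \<in> simp K d" "src K d y = a" and ys: "chain K ds ys (tgt K d y) b"
    using Cons.prems by (auto simp: chain_Cons)
  have b: "f b \<in> S" using chain_ends[OF ys] f_in by blast
  show ?case
  proof (cases "ds = []")
    case True
    then show ?thesis using e_hom[OF y(1)] y ys by (simp add: xs chain_Nil)
  next
    case False
    then show ?thesis
      using qprod_hom[OF S Y_obj T_obj fs[OF y(1)] b ft[OF y(1)] e_hom[OF y(1)] Cons.IH[OF ys]] y by (simp add: xs)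
  qed
qed

text \<open>Treats the two forms of \<open>tens_cons\<close> together: at a last bead the right
  unitor removes a trailing identity of I, otherwise nothing happens. The later inductions are
  thereby spared this distinction.\<close>

lemma tens_cons_el:
  assumes y: "y \<in> simp K d" and ys: "chain K ds ys (tgt K d y) b"
  shows "tens_cons (Quiv C S) Y d ds (f (src K d y), f b) \<cdot>
    qprod S (ObjF Y d) (T ds) (f (src K d y)) (f b) (f (tgt K d y)) (e d y) (el b ds ys) = el b (d # ds) (y # ys)"
proof (cases "ds = []")
  case True
  then have "b = tgt K d y" "ys = []" using ys by (auto simp: chain_Nil)
  then show ?thesis using qrunit_qprod[OF S Y_obj fs[OF y] ft[OF y] e_hom[OF y]] True by (simp add: tens_cons_def)
next
  case False
  have b: "f b \<in> S" using chain_ends[OF ys] f_in by blast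
  show ?thesis
    using quiv_id_app'[OF quiv_tens_obj[OF S Y_obj T_obj] fs[OF y] b
        qprod_hom[OF S Y_obj T_obj fs[OF y] b ft[OF y] e_hom[OF y] el_hom[OF ys]]] False
    by (simp add: tens_cons_def)
qed

lemma inv_tens_cons_el:
  assumes y: "y \<in> simp K d" and ys: "chain K ds ys (tgt K d y) b"
  shows "inv_arr (Quiv C S) (tens_cons (Quiv C S) Y d ds) (f (src K d y), f b) \<cdot> el b (d # ds) (y # ys) =
    qprod S (ObjF Y d) (T ds) (f (src K d y)) (f b) (f (tgt K d y)) (e d y) (el b ds ys)"
proof -
  have b: "f b \<in> S" using chain_ends[OF ys] f_in by blast
  show ?thesis
    by (rule quiv_inv_app[OF tens_cons_iso tens_cons_hom fs[OF y] b
          qprod_hom[OF S Y_obj T_obj fs[OF y] b ft[OF y] e_hom[OF y] el_hom[OF ys]] tens_cons_el[OF y ys]])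
qed

lemma id_e: "y \<in> simp K d \<Longrightarrow> Id (Quiv C S) (ObjF Y d) (f (src K d y), f (tgt K d y)) \<cdot> e d y = e d y"
  by (rule quiv_id_app'[OF Y_obj fs ft e_hom])

lemma id_el: "chain K ds ys a b \<Longrightarrow> Id (Quiv C S) (T ds) (f a, f b) \<cdot> el b ds ys = el b ds ys"
  using chain_ends f_in by (blast intro: quiv_id_app'[OF T_obj] el_hom)

text \<open>On a pure tensor the four factors in the definition of \<open>tens_append\<close>
  successively detach the first entry, reassociate, append to the tail by the induction hypothesis,
  and reattach the entry.\<close>

lemma tens_append_el:
  assumes "chain K ds xs a c" "chain K es ys c b"
  shows "tens_append (Quiv C S) Y ds es (f a, f b) \<cdot> qprod S (T ds) (T es) (f a) (f b) (f c) (el c ds xs) (el b es ys) =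
    el b (ds @ es) (xs @ ys)"
  using assms(1)
proof (induction ds arbitrary: xs a)
  case Nil
  then have a: "a = c" "xs = []" by (auto simp: chain_Nil)
  have "f c \<in> S" "f b \<in> S" using chain_ends[OF assms(2)] f_in by auto
  then show ?case using qlunit_qprod[OF S T_obj _ _ el_hom[OF assms(2)]] a by simp
next
  case (Cons d ds)
  obtain y zs where xs: "xs = y # zs" and y: "y \<in> simp K d" "src K d y = a" and zs: "chain K ds zs (tgt K d y) c"
    using Cons.prems by (auto simp: chain_Cons)
  have S': "f a \<in> S" "f b \<in> S" "f c \<in> S" "f (tgt K d y) \<in> S"
    using chain_ends[OF assms(2)] ft[OF y(1)] fs[OF y(1)] y(2) f_in by auto
  note ey = e_hom[OF y(1), unfolded y(2)] and ezs = el_hom[OF zs] and eys = el_hom[OF assms(2)]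
    and exs = el_hom[OF Cons.prems]
  note zsys = chain_append[OF zs assms(2)]
  note m1 = qtens_hom[OF S quiv_inv_hom[OF tens_cons_iso tens_cons_hom] quiv_id_hom[OF T_obj], of d ds es]
    and m2 = qassoc_hom[OF S Y_obj T_obj T_obj, of d ds es]
    and m3 = qtens_hom[OF S quiv_id_hom[OF Y_obj] tens_append_hom, of d ds es]
    and m4 = tens_cons_hom[of d "ds @ es"]
  note q1 = qprod_hom[OF S T_obj T_obj S'(1,2,3) exs eys]
  note [simp del] = el.simps tens.simps
  have 1: "inv_arr (Quiv C S) (tens_cons (Quiv C S) Y d ds) (f a, f c) \<cdot> el c (d # ds) xs =
      qprod S (ObjF Y d) (T ds) (f a) (f c) (f (tgt K d y)) (e d y) (el c ds zs)"
    using inv_tens_cons_el[OF y(1) zs] y(2) xs by simp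
  show ?case
    unfolding tens_append.simps
    apply (subst quiv_comp_app'[OF m4 quiv_comp_hom[OF quiv_comp_hom[OF m1 m2] m3] S'(1,2) q1])
    apply (subst quiv_comp_app'[OF m3 quiv_comp_hom[OF m1 m2] S'(1,2) q1])
    apply (subst quiv_comp_app'[OF m2 m1 S'(1,2) q1])
    apply (subst qtens_qprod[OF S quiv_inv_hom[OF tens_cons_iso tens_cons_hom] quiv_id_hom[OF T_obj] S'(1,2,3) exs eys])
    apply (subst 1, subst id_el[OF assms(2)])
    apply (subst qassoc_qprod[OF S Y_obj T_obj T_obj S' ey ezs eys])
    apply (subst qtens_qprod[OF S quiv_id_hom[OF Y_obj] tens_append_hom S'(1,2,4) ey qprod_hom[OF S T_obj T_obj S'(4,2,3) ezs eys]])
    apply (subst id_e[OF y(1), unfolded y(2)])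
    apply (subst Cons.IH[OF zs])
    using tens_cons_el[OF y(1) zsys] y(2) xs by simp
qed

text \<open>\<open>e_comult\<close> splits off the front face of the length of the first bead, and
  the back face is again a simplex, to which the induction hypothesis applies.\<close>

lemma mu_el:
  "x \<in> simp K (sum_list ds) \<Longrightarrow>
   mu (Quiv C S) Y ds (f (src K (sum_list ds) x), f (tgt K (sum_list ds) x)) \<cdot> e (sum_list ds) x =
   el (tgt K (sum_list ds) x) ds (split_simplex K ds x)"
proof (induction ds arbitrary: x)
  case Nil
  then show ?case using e_counit by (simp add: src_vertex tgt_vertex)
next
  case (Cons d ds)
  let ?n = "sum_list ds"
  have x: "x \<in> simp K (d + ?n)" using Cons.prems by simp
  show ?case
  proof (cases "ds = []")
    case True
    then show ?thesis using x id_e[of x d] by (simp add: front_zero)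
  next
    case False
    note sS = fs[OF x] and tS = ft[OF x]
    have mS: "f (act K (seg 0 d (d + ?n)) x) \<in> S"
      using ft[OF front_in[OF x]] by (simp add: tgt_front[OF x])
    note ef = e_hom[OF front_in[OF x], unfolded src_front[OF x] tgt_front[OF x]]
      and eb = e_hom[OF back_in[OF x], unfolded src_back[OF x] tgt_back[OF x]]
    have "((Id (Quiv C S) (ObjF Y d) \<otimes>\<^bsub>Quiv C S\<^esub> mu (Quiv C S) Y ds) \<cdot>\<^bsub>Quiv C S\<^esub> comult Y d ?n)
        (f (src K (d + ?n) x), f (tgt K (d + ?n) x)) \<cdot> e (d + ?n) x =
      qprod S (ObjF Y d) (T ds) (f (src K (d + ?n) x)) (f (tgt K (d + ?n) x)) (f (act K (seg 0 d (d + ?n)) x))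
        (e d (front_face K d ?n x)) (el (tgt K (d + ?n) x) ds (split_simplex K ds (back_face K d ?n x)))"
      apply (subst quiv_comp_app'[OF qtens_hom[OF S quiv_id_hom[OF Y_obj] mu_hom] Y_comult sS tS e_hom[OF x]])
      apply (subst e_comult[OF x])
      apply (subst qtens_qprod[OF S quiv_id_hom[OF Y_obj] mu_hom sS tS mS ef eb])
      using id_e[OF front_in[OF x], unfolded src_front[OF x] tgt_front[OF x]]
        Cons.IH[OF back_in[OF x], unfolded src_back[OF x] tgt_back[OF x]] by simp
    then show ?thesis using False by (simp add: src_front[OF x] tgt_front[OF x])
  qed
qed

lemma inert_map_el:
  "chain K (map sum_list dss) xs a b \<Longrightarrow>
   inert_map (Quiv C S) Y dss (f a, f b) \<cdot> el b (map sum_list dss) xs = el b (concat dss) (split_chain K dss xs)"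
proof (induction dss arbitrary: xs a)
  case Nil
  then show ?case using id_el[of "[]" "[]" b b] by (auto simp: chain_Nil)
next
  case (Cons ds dss)
  let ?n = "sum_list ds" and ?es = "map sum_list dss"
  obtain y zs where xs: "xs = y # zs" and y: "y \<in> simp K ?n" "src K ?n y = a" and zs: "chain K ?es zs (tgt K ?n y) b"
    using Cons.prems by (auto simp: chain_Cons)
  have S': "f a \<in> S" "f b \<in> S" "f (tgt K ?n y) \<in> S"
    using chain_ends[OF zs] ft[OF y(1)] fs[OF y(1)] y(2) f_in by auto
  note ey = e_hom[OF y(1), unfolded y(2)] and ezs = el_hom[OF zs]
  have exs: "el b (?n # ?es) xs \<in> hom C I (T (?n # ?es) (f a, f b))" using el_hom[OF Cons.prems] by (simp del: tens.simps)
  note m1 = quiv_inv_hom[OF tens_cons_iso tens_cons_hom, of ?n ?es]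
    and m2 = qtens_hom[OF S mu_hom inert_map_hom, of ds dss]
    and m3 = tens_append_hom[of ds "concat dss"]
  note sp = chain_split_simplex[OF y(1), unfolded y(2)] and sc = chain_split_chain[OF zs]
  show ?case
    unfolding inert_map.simps list.map
    apply (subst quiv_comp_app'[OF m3 quiv_comp_hom[OF m1 m2] S'(1,2) exs])
    apply (subst quiv_comp_app'[OF m2 m1 S'(1,2) exs])
    unfolding xs
    apply (subst inv_tens_cons_el[OF y(1) zs, unfolded y(2)])
    apply (subst qtens_qprod[OF S mu_hom inert_map_hom S' ey ezs])
    apply (subst mu_el[OF y(1), unfolded y(2)])
    apply (subst Cons.IH[OF zs])
    apply (subst tens_append_el[OF sp sc])
    by simp
qed

lemma insert_zeros_el:
  "chain K (filter (\<lambda>d. d \<noteq> 0) ds) ys a b \<Longrightarrow>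
   insert_zeros (Quiv C S) Y ds (f a, f b) \<cdot> el b (filter (\<lambda>d. d \<noteq> 0) ds) ys = el b ds (insert_vertices K a ds ys)"
proof (induction ds arbitrary: ys a)
  case Nil
  then show ?case using id_el[of "[]" "[]" b b] by (auto simp: chain_Nil)
next
  case (Cons d ds)
  let ?es = "filter (\<lambda>d. d \<noteq> 0) ds"
  note m3 = tens_cons_hom[of d ds]
  show ?case
  proof (cases "d = 0")
    case True
    have c: "chain K ?es ys a b" using Cons.prems True by simp
    have a: "a \<in> simp K 0" and S': "f a \<in> S" "f b \<in> S" using chain_ends[OF c] f_in by auto
    note ea = e_hom[OF a, unfolded src_vertex[OF a] tgt_vertex[OF a]] and ec = el_hom[OF c]
    have one: "Id C I \<in> hom C I (quiv_unit C S (f a, f a))" using S' by (simp add: id_hom)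
    note m1 = quiv_inv_hom[OF qlunit_iso[OF S T_obj] qlunit_hom[OF S T_obj], of ?es]
      and m2 = qtens_hom[OF S quiv_inv_hom[OF Y_counit_iso Y_counit] insert_zeros_hom, of ds]
    have 1: "inv_arr (Quiv C S) (LUnit (Quiv C S) (T ?es)) (f a, f b) \<cdot> el b ?es ys =
      qprod S (quiv_unit C S) (T ?es) (f a) (f b) (f a) (Id C I) (el b ?es ys)"
      by (rule quiv_inv_app[OF qlunit_iso[OF S T_obj] qlunit_hom[OF S T_obj] S'
            qprod_hom[OF S quiv_unit_obj T_obj S' S'(1) one ec] qlunit_qprod[OF S T_obj S' ec]])
    \<comment> \<open>The counit sends \<open>e 0 a\<close> to the identity of I, so its inverse
      inserts exactly the element of the vertex \<open>a\<close>.\<close>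
    have 2: "inv_arr (Quiv C S) (counit Y) (f a, f a) \<cdot> Id C I = e 0 a"
      by (rule quiv_inv_app[OF Y_counit_iso Y_counit S'(1) S'(1) ea e_counit[OF a]])
    note ch = chain_insert_vertices[OF c]
    have "(tens_cons (Quiv C S) Y 0 ds \<cdot>\<^bsub>Quiv C S\<^esub>
      (inv_arr (Quiv C S) (counit Y) \<otimes>\<^bsub>Quiv C S\<^esub> insert_zeros (Quiv C S) Y ds) \<cdot>\<^bsub>Quiv C S\<^esub>
      inv_arr (Quiv C S) (LUnit (Quiv C S) (T ?es))) (f a, f b) \<cdot> el b ?es ys =
      tens_cons (Quiv C S) Y 0 ds (f a, f b) \<cdot>
        qprod S (ObjF Y 0) (T ds) (f a) (f b) (f a) (e 0 a) (el b ds (insert_vertices K a ds ys))"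
      apply (subst quiv_comp_app'[OF m3[unfolded True] quiv_comp_hom[OF m1 m2] S' ec])
      apply (subst quiv_comp_app'[OF m2 m1 S' ec])
      apply (subst 1)
      apply (subst qtens_qprod[OF S quiv_inv_hom[OF Y_counit_iso Y_counit] insert_zeros_hom S' S'(1) one ec])
      apply (subst 2)
      apply (subst Cons.IH[OF c])
      by (rule refl)
    also have "\<dots> = el b (0 # ds) (a # insert_vertices K a ds ys)"
      using tens_cons_el[OF a, of ds "insert_vertices K a ds ys" b] ch by (simp only: src_vertex[OF a] tgt_vertex[OF a])
    finally show ?thesis using True by (simp add: Let_def del: el.simps)
  next
    case False
    obtain y zs where xs: "ys = y # zs" and y: "y \<in> simp K d" "src K d y = a" and zs: "chain K ?es zs (tgt K d y) b"
      using Cons.prems False by (auto simp: chain_Cons)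
    have S': "f a \<in> S" "f b \<in> S" "f (tgt K d y) \<in> S"
      using chain_ends[OF zs] ft[OF y(1)] fs[OF y(1)] y(2) f_in by auto
    note ey = e_hom[OF y(1), unfolded y(2)] and ezs = el_hom[OF zs]
    have "chain K (d # ?es) (y # zs) a b" using y zs by simp
    note exs = el_hom[OF this]
    note m1 = quiv_inv_hom[OF tens_cons_iso tens_cons_hom, of d ?es]
      and m2 = qtens_hom[OF S quiv_id_hom[OF Y_obj] insert_zeros_hom, of d ds]
    note ch = chain_insert_vertices[OF zs]
    have "(tens_cons (Quiv C S) Y d ds \<cdot>\<^bsub>Quiv C S\<^esub>
      (Id (Quiv C S) (ObjF Y d) \<otimes>\<^bsub>Quiv C S\<^esub> insert_zeros (Quiv C S) Y ds) \<cdot>\<^bsub>Quiv C S\<^esub>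
      inv_arr (Quiv C S) (tens_cons (Quiv C S) Y d ?es)) (f a, f b) \<cdot> el b (d # ?es) (y # zs) =
      tens_cons (Quiv C S) Y d ds (f a, f b) \<cdot> qprod S (ObjF Y d) (T ds) (f a) (f b) (f (tgt K d y)) (e d y)
          (el b ds (insert_vertices K (tgt K d y) ds zs))"
      apply (subst quiv_comp_app'[OF m3 quiv_comp_hom[OF m1 m2] S'(1,2) exs])
      apply (subst quiv_comp_app'[OF m2 m1 S'(1,2) exs])
      apply (subst inv_tens_cons_el[OF y(1) zs, unfolded y(2)])
      apply (subst qtens_qprod[OF S quiv_id_hom[OF Y_obj] insert_zeros_hom S' ey ezs])
      apply (subst id_e[OF y(1), unfolded y(2)])
      apply (subst Cons.IH[OF zs])
      by (rule refl)
    also have "\<dots> = el b (d # ds) (y # insert_vertices K (tgt K d y) ds zs)"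
      using tens_cons_el[OF y(1) ch] by (simp only: y(2))
    finally show ?thesis using False by (simp add: Let_def xs del: el.simps)
  qed
qed

lemma active_map_el:
  "set hs \<subseteq> Arr Delta_f \<Longrightarrow> chain K (map (Cod Delta_f) hs) xs a b \<Longrightarrow>
   active_map (Quiv C S) Y hs (f a, f b) \<cdot> el b (map (Cod Delta_f) hs) xs = el b (map (Dom Delta_f) hs) (act_chain K hs xs)"
proof (induction hs arbitrary: xs a)
  case Nil
  then show ?case using id_el[of "[]" "[]" b b] by (auto simp: chain_Nil)
next
  case (Cons h hs)
  let ?n = "Cod Delta h"
  obtain y zs where xs: "xs = y # zs" and y: "y \<in> simp K ?n" "src K ?n y = a"
    and zs: "chain K (map (Cod Delta_f) hs) zs (tgt K ?n y) b"
    using Cons.prems by (auto simp: chain_Cons)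
  have h: "h \<in> Arr Delta_f" and hs: "set hs \<subseteq> Arr Delta_f" using Cons.prems by auto
  have S': "f a \<in> S" "f b \<in> S" "f (tgt K ?n y) \<in> S"
    using chain_ends[OF zs] ft[OF y(1)] fs[OF y(1)] y(2) f_in by auto
  show ?case
  proof (cases "hs = []")
    case True
    then show ?thesis using zs e_act[OF h y(1)] y(2) by (simp add: xs chain_Nil)
  next
    case False
    show ?thesis
      using False y(2) qtens_qprod[OF S Y_arr[OF h] active_map_hom[OF hs] S' e_hom[OF y(1), unfolded y(2)] el_hom[OF zs]]
        Cons.IH[OF hs zs] e_act[OF h y(1)]
      by (simp add: xs src_act[OF h y(1)] tgt_act[OF h y(1)])
  qed
qed

end

section \<open>Necklaces\<close>

definition diffs :: "nat list \<Rightarrow> nat list" where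
  "diffs ts = map (\<lambda>(s, t). t - s) (zip ts (tl ts))"

lemma diffs_simps [simp]: "diffs [] = []" "diffs [t] = []" "diffs (s # t # ts) = (t - s) # diffs (t # ts)"
  by (simp_all add: diffs_def)

lemma gaps_diffs: "gaps T = diffs (sorted_list_of_set T)"
  by (simp add: gaps_def steps_def diffs_def Let_def)

lemma diffs_append: "diffs (xs @ v # ys) = diffs (xs @ [v]) @ diffs (v # ys)"
proof (induction xs)
  case (Cons x xs)
  then show ?case by (cases xs) auto
qed simp

lemma sum_list_diffs: "sorted (t # ts) \<Longrightarrow> t + sum_list (diffs (t # ts)) = last (t # ts)"
  by (induction ts arbitrary: t) auto

lemma sorted_list_of_set_split:
  fixes A :: "nat set"
  assumes "finite A" "v \<in> A" "u \<le> v" "v \<le> w"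
  shows "sorted_list_of_set (A \<inter> {u..w}) =
    sorted_list_of_set (A \<inter> {u..<v}) @ v # sorted_list_of_set (A \<inter> {v<..w})"
proof (rule strict_sorted_equal)
  show "sorted_wrt (<) (sorted_list_of_set (A \<inter> {u..<v}) @ v # sorted_list_of_set (A \<inter> {v<..w}))"
    using assms by (auto simp: sorted_wrt_append)
  show "set (sorted_list_of_set (A \<inter> {u..w})) =
      set (sorted_list_of_set (A \<inter> {u..<v}) @ v # sorted_list_of_set (A \<inter> {v<..w}))"
    using assms by auto
qed simp

text \<open>The joint \<open>v\<close> ends the list of the left part and starts the list of the
  right part, so no gap is lost or counted twice.\<close>

lemma gaps_split:
  assumes "finite A" "v \<in> A" "u \<le> v" "v \<le> w"
  shows "gaps (A \<inter> {u..w}) = gaps (A \<inter> {u..v}) @ gaps (A \<inter> {v..w})"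
  using sorted_list_of_set_split[OF assms] sorted_list_of_set_split[OF assms(1-3) order_refl]
    sorted_list_of_set_split[OF assms(1,2) order_refl assms(4)]
  by (simp add: gaps_diffs diffs_append[of _ v "sorted_list_of_set (A \<inter> {v<..w})"])

lemma sum_list_gaps:
  assumes "finite A" "u \<in> A" "w \<in> A" "u \<le> w"
  shows "sum_list (gaps (A \<inter> {u..w})) = w - u"
proof -
  obtain ts where ts: "sorted_list_of_set (A \<inter> {u..w}) = u # ts"
    using sorted_list_of_set_split[OF assms(1,2) order_refl assms(4)] by simp
  have "last (u # ts) = w"
    using sorted_list_of_set_split[OF assms(1,3,4) order_refl] ts by (metis greaterThanAtMost_empty inf_bot_right last_snoc order_refl sorted_list_of_set_empty)
  moreover have "sorted (u # ts)" using sorted_sorted_list_of_set[of "A \<inter> {u..w}"] ts by simp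
  ultimately show ?thesis using sum_list_diffs[of u ts] ts by (simp add: gaps_diffs)
qed

lemma concat_gaps:
  assumes "finite A"
  shows "sorted_wrt (<) (u # us) \<Longrightarrow> set (u # us) \<subseteq> A \<Longrightarrow>
    concat (map (\<lambda>(u, v). gaps (A \<inter> {u..v})) (zip (u # us) us)) = gaps (A \<inter> {u..last (u # us)})"
proof (induction us arbitrary: u)
  case Nil
  then have "A \<inter> {u..u} = {u}" by auto
  then show ?case by (simp add: gaps_diffs)
next
  case (Cons v us)
  have "v \<le> last (v # us)" using Cons.prems by (cases us rule: rev_cases) auto
  then have "gaps (A \<inter> {u..last (v # us)}) = gaps (A \<inter> {u..v}) @ gaps (A \<inter> {v..last (v # us)})"
    using Cons.prems by (intro gaps_split[OF assms]) auto
  then show ?case using Cons.IH[of v] Cons.prems by simp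
qed

lemma set_zip_tl:
  "sorted_wrt (<) ts \<Longrightarrow> (s, t) \<in> set (zip ts (tl ts)) \<Longrightarrow> s \<in> set ts \<and> t \<in> set ts \<and> s < (t :: nat)"
  by (induction ts rule: induct_list012) auto

lemma steps_mem: "finite T \<Longrightarrow> (s, t) \<in> set (steps T) \<Longrightarrow> s \<in> T \<and> t \<in> T \<and> s < t"
  using set_zip_tl[of "sorted_list_of_set T" s t] by (simp add: steps_def Let_def)

lemma sorted_list_of_set_insert_min:
  assumes "finite B" "\<And>b. b \<in> B \<Longrightarrow> a < b"
  shows "sorted_list_of_set (insert a B) = a # sorted_list_of_set (B :: nat set)"
proof (rule strict_sorted_equal)
  show "sorted_wrt (<) (sorted_list_of_set (insert a B))" by (rule strict_sorted_list_of_set)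
  show "set (sorted_list_of_set (insert a B)) = set (a # sorted_list_of_set B)"
    using assms by (simp del: sorted_list_of_set_insert_remove)
qed (use assms in auto)

text \<open>Neighbouring joints with the same image merge and contribute a zero difference. These
  zeros are the places where \<open>insert_zeros\<close> has to supply a factor in degree 0.\<close>

lemma gaps_image:
  fixes f :: "nat \<Rightarrow> nat"
  shows "sorted_wrt (<) (t # ts) \<Longrightarrow> mono_on (set (t # ts)) f \<Longrightarrow>
   gaps (f ` set (t # ts)) = filter (\<lambda>d. d \<noteq> 0) (map (\<lambda>(s, t). f t - f s) (zip (t # ts) ts))"
proof (induction ts arbitrary: t)
  case Nil
  then show ?case by (simp add: gaps_diffs)
next
  case (Cons u us)
  let ?B = "f ` set (u # us)"
  have ge: "f u \<le> b" if "b \<in> ?B" for b using that Cons.prems by (auto simp: mono_on_def less_imp_le)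
  have tu: "f t \<le> f u" using Cons.prems by (auto simp: mono_on_def)
  have IH: "gaps ?B = filter (\<lambda>d. d \<noteq> 0) (map (\<lambda>(s, t). f t - f s) (zip (u # us) us))"
    using Cons.prems by (intro Cons.IH) (auto intro: mono_on_subset)
  show ?case
  proof (cases "f t = f u")
    case True
    then have "f ` set (t # u # us) = ?B" by auto
    then show ?thesis using IH True by simp
  next
    case False
    then have lt: "f t < f u" using tu by simp
    have 1: "sorted_list_of_set (f ` set (t # u # us)) = f t # sorted_list_of_set ?B"
      using sorted_list_of_set_insert_min[of ?B "f t"] ge lt by (simp add: less_le_trans)
    \<comment> \<open>Hence the first gap of the image is \<open>f u - f t\<close>, and the
      remaining ones are the gaps of \<open>?B\<close>.\<close>
    have "Min ?B = f u" using ge by (intro Min_eqI) auto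
    then obtain r where "sorted_list_of_set ?B = f u # r"
      using sorted_list_of_set_nonempty[of ?B] by auto
    then show ?thesis using 1 IH lt by (simp add: gaps_diffs)
  qed
qed

section \<open>Beads and gaps of a necklace map, and its action on chains\<close>

lemma Nec_arr:
  "((T, p), f, (U, q)) \<in> Arr Nec \<longleftrightarrow> {0, p} \<subseteq> T \<and> T \<subseteq> {..p} \<and> {0, q} \<subseteq> U \<and> U \<subseteq> {..q} \<and>
     (p, f, q) \<in> Arr Delta_f \<and> U \<subseteq> f ` T"
  by (simp add: Nec_def)

lemma Nec_simps [simp]:
  "Obj Nec = {(T, p). {0, p} \<subseteq> T \<and> T \<subseteq> {..p}}" "Dom Nec (t, f, u) = t" "Cod Nec (t, f, u) = u"
  by (simp_all add: Nec_def)

text \<open>The gaps of the necklaces \<open>T\<^sub>i\<close> of which the image \<open>f(T)\<close> is the wedge over the beads of \<open>U\<close>.\<close>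

definition bead_gaps :: "nat set \<Rightarrow> (nat \<Rightarrow> nat) \<Rightarrow> nat set \<Rightarrow> nat list list" where
  "bead_gaps T f U = map (\<lambda>(u, v). gaps (f ` T \<inter> {u..v})) (steps U)"

context
  fixes T p f U q
  assumes h: "((T, p), f, (U, q)) \<in> Arr Nec"
begin

lemma Nec_arrD:
  shows "finite T" "finite U" "0 \<in> T" "p \<in> T" "T \<subseteq> {..p}" "0 \<in> U" "q \<in> U" "U \<subseteq> {..q}" "U \<subseteq> f ` T"
    "f ` T \<subseteq> {..q}" "mono_on {..p} f" "(p, f, q) \<in> Arr Delta_f"
  using h by (auto simp: Nec_arr Delta_f_arr Delta_arr intro: finite_subset[OF _ finite_atMost])

lemma sum_bead_gaps: "map sum_list (bead_gaps T f U) = gaps U"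
proof -
  have "sum_list (gaps (f ` T \<inter> {u..v})) = v - u" if "(u, v) \<in> set (steps U)" for u v
    using steps_mem[OF Nec_arrD(2) that] Nec_arrD by (intro sum_list_gaps) auto
  then show ?thesis by (auto simp: bead_gaps_def gaps_def)
qed

text \<open>U lies in f(T) and contains both ends, so cutting f(T) at the points of U loses nothing.
  With \<open>sum_bead_gaps\<close>, \<open>beads_cod\<close> and \<open>beads_dom\<close> it makes
  the three factors of \<open>neck_map\<close> composable with the expected source and
  target.\<close>

lemma concat_bead_gaps: "concat (bead_gaps T f U) = gaps (f ` T)"
proof -
  have fin: "finite (f ` T)" using Nec_arrD(1) by simp
  have "U \<inter> {0..q} = U" using Nec_arrD(8) by auto
  then have 1: "sorted_list_of_set U = 0 # sorted_list_of_set (U \<inter> {0<..q})"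
    "sorted_list_of_set U = sorted_list_of_set (U \<inter> {0..<q}) @ [q]"
    using sorted_list_of_set_split[OF Nec_arrD(2,6) order_refl, of q]
      sorted_list_of_set_split[OF Nec_arrD(2,7), of 0 q] by auto
  define us where "us = sorted_list_of_set (U \<inter> {0<..q})"
  have us: "sorted_list_of_set U = 0 # us" using 1(1) by (simp only: us_def)
  have "last (sorted_list_of_set U) = q" by (subst 1(2)) simp
  then have last: "last (0 # us) = q" using us by simp
  have "set (0 # us) \<subseteq> f ` T" unfolding us[symmetric] using Nec_arrD(2,9) by simp
  moreover have "sorted_wrt (<) (0 # us)" unfolding us[symmetric] by (rule strict_sorted_list_of_set)
  ultimately have "concat (bead_gaps T f U) = gaps (f ` T \<inter> {0..q})"
    using concat_gaps[OF fin, of 0 us] us last by (simp add: bead_gaps_def steps_def Let_def)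
  moreover have "f ` T \<inter> {0..q} = f ` T" using Nec_arrD(10) by auto
  ultimately show ?thesis by simp
qed

lemma beads_arr: "set (beads T f) \<subseteq> Arr Delta_f"
proof -
  have "(t - s, \<lambda>i \<in> {..t - s}. f (s + i) - f s, f t - f s) \<in> Arr Delta_f" if "(s, t) \<in> set (steps T)" for s t
  proof -
    have st: "s < t" "t \<le> p" using steps_mem[OF Nec_arrD(1) that] Nec_arrD(5) by auto
    have "f i \<le> f j" if "i \<le> j" "j \<le> t" for i j
      using Nec_arrD(11) that st by (auto simp: mono_on_def)
    then show ?thesis using st by (auto simp: Delta_f_arr Delta_arr mono_on_def intro!: diff_le_mono)
  qed
  then show ?thesis by (auto simp: beads_def)
qed

lemma beads_dom: "map (Dom Delta_f) (beads T f) = gaps T"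
  by (auto simp: beads_def gaps_def)

lemma beads_cod: "filter (\<lambda>d. d \<noteq> 0) (map (Cod Delta_f) (beads T f)) = gaps (f ` T)"
proof -
  obtain t ts where ts: "sorted_list_of_set T = t # ts"
    using Nec_arrD(1,3) by (metis empty_iff sorted_list_of_set_eq_Nil_iff neq_Nil_conv)
  have set: "set (t # ts) = T" unfolding ts[symmetric] using Nec_arrD(1) by simp
  have "sorted_wrt (<) (t # ts)" unfolding ts[symmetric] by (rule strict_sorted_list_of_set)
  moreover have "mono_on (set (t # ts)) f" unfolding set using Nec_arrD(5,11) by (rule mono_on_subset[rotated])
  ultimately have "gaps (f ` T) = filter (\<lambda>d. d \<noteq> 0) (map (\<lambda>(s, t). f t - f s) (zip (t # ts) ts))"
    using gaps_image[of t ts f] unfolding set by blast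
  moreover have "map (Cod Delta_f) (beads T f) = map (\<lambda>(s, t). f t - f s) (zip (t # ts) ts)"
    by (auto simp: beads_def steps_def Let_def ts)
  ultimately show ?thesis by simp
qed

end

text \<open>The action of a necklace map on chains, read off from the three factors of
  \<open>neck_map\<close>.\<close>

definition neck_chain :: "'k sset \<Rightarrow> 'k \<Rightarrow> neck_arr \<Rightarrow> 'k list \<Rightarrow> 'k list" where
  "neck_chain K a = (\<lambda>((T, p), f, (U, q)) xs.
     act_chain K (beads T f) (insert_vertices K a (map (Cod Delta_f) (beads T f)) (split_chain K (bead_gaps T f U) xs)))"

lemma (in simplicial_set) chain_neck_chain:
  assumes h: "((T, p), f, (U, q)) \<in> Arr Nec" and xs: "chain K (gaps U) xs a b"
  shows "chain K (gaps T) (neck_chain K a ((T, p), f, (U, q)) xs) a b"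
proof -
  have "chain K (map sum_list (bead_gaps T f U)) xs a b" using xs sum_bead_gaps[OF h] by simp
  from chain_split_chain[OF this]
  have "chain K (filter (\<lambda>d. d \<noteq> 0) (map (Cod Delta_f) (beads T f))) (split_chain K (bead_gaps T f U) xs) a b"
    by (simp only: concat_bead_gaps[OF h] beads_cod[OF h])
  from chain_act_chain[OF beads_arr[OF h] chain_insert_vertices[OF this]]
  show ?thesis by (simp only: beads_dom[OF h] neck_chain_def prod.case)
qed

lemma (in colax_quiver) neck_map_hom:
  assumes h: "((N, p), f, (M, q)) \<in> Arr Nec"
  shows "neck_map (Quiv C S) Y ((N, p), f, (M, q)) \<in> hom (Quiv C S) (tens (Quiv C S) Y (gaps M)) (tens (Quiv C S) Y (gaps N))"
proof -
  note 1 = inert_map_hom[of "bead_gaps N f M", unfolded sum_bead_gaps[OF h] concat_bead_gaps[OF h]]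
    and 2 = insert_zeros_hom[of "map (Cod Delta_f) (beads N f)", unfolded beads_cod[OF h]]
    and 3 = active_map_hom[OF beads_arr[OF h], unfolded beads_dom[OF h]]
  show ?thesis
    using quiv_comp_hom[OF quiv_comp_hom[OF 1 2] 3] by (simp only: neck_map_def bead_gaps_def prod.case)
qed

text \<open>The resulting chain depends on \<open>K\<close> alone and not on \<open>Y\<close> or
  \<open>e\<close>. Read once for the free object and once for the target, the lemma therefore gives
  the naturality in \<open>neck_nat_trans\<close>.\<close>

lemma (in element_family) neck_map_el:
  assumes h: "((N, p), g, (M, q)) \<in> Arr Nec" and xs: "chain K (gaps M) xs a b"
  shows "neck_map (Quiv C S) Y ((N, p), g, (M, q)) (f a, f b) \<cdot> el b (gaps M) xs =
    el b (gaps N) (neck_chain K a ((N, p), g, (M, q)) xs)"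
proof -
  note 1 = inert_map_hom[of "bead_gaps N g M", unfolded sum_bead_gaps[OF h] concat_bead_gaps[OF h]]
    and 2 = insert_zeros_hom[of "map (Cod Delta_f) (beads N g)", unfolded beads_cod[OF h]]
    and 3 = active_map_hom[OF beads_arr[OF h], unfolded beads_dom[OF h]]
  have S': "f a \<in> S" "f b \<in> S" using chain_ends[OF xs] f_in by auto
  have c1: "chain K (map sum_list (bead_gaps N g M)) xs a b" using xs sum_bead_gaps[OF h] by simp
  from chain_split_chain[OF this]
  have c2: "chain K (filter (\<lambda>d. d \<noteq> 0) (map (Cod Delta_f) (beads N g))) (split_chain K (bead_gaps N g M) xs) a b"
    by (simp only: concat_bead_gaps[OF h] beads_cod[OF h])
  note c3 = chain_insert_vertices[OF c2]
  show ?thesis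
    unfolding neck_map_def neck_chain_def prod.case bead_gaps_def[symmetric]
    apply (subst quiv_comp_app'[OF 3 quiv_comp_hom[OF 1 2] S' el_hom[OF xs]])
    apply (subst quiv_comp_app'[OF 2 1 S' el_hom[OF xs]])
    apply (subst inert_map_el[OF c1, unfolded sum_bead_gaps[OF h] concat_bead_gaps[OF h]])
    apply (subst insert_zeros_el[OF c2, unfolded beads_cod[OF h]])
    apply (subst active_map_el[OF beads_arr[OF h] c3, unfolded beads_dom[OF h]])
    by (rule refl)
qed

section \<open>The free templicial object on a simplicial set\<close>

context enriching_category
begin

lemma
  assumes "has_coprods C A"
  shows free_obj_obj: "free_obj C A \<in> Obj C"
    and free_inj_hom: "x \<in> A \<Longrightarrow> free_inj C A x \<in> hom C I (free_obj C A)"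
  unfolding free_obj_def free_inj_def
  by (rule coprod_obj[OF assms]) (simp, rule coprod_inj_hom[OF assms, of "\<lambda>_. I"], simp_all)

lemma
  assumes "has_coprods C A" "Z \<in> Obj C" "\<And>x. x \<in> A \<Longrightarrow> g x \<in> hom C I Z"
  shows free_copair_hom: "free_copair C A Z g \<in> hom C (free_obj C A) Z"
    and free_copair_inj: "x \<in> A \<Longrightarrow> free_copair C A Z g \<cdot> free_inj C A x = g x"
  unfolding free_obj_def free_inj_def free_copair_def
  by (rule copair_hom[OF assms(1,2)], simp add: assms(3))
     (rule copair_inj[OF assms(1,2)], simp_all add: assms(3))

lemma jointly_epi_free:
  assumes "has_coprods C A"
  shows "jointly_epi C (free_obj C A) (free_inj C A ` A)"
proof -
  have "jointly_epi C (coprod C A (\<lambda>_. I)) {coprod_inj C A (\<lambda>_. I) i \<cdot> x |i x. i \<in> A \<and> x \<in> {Id C I}}"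
    by (rule jointly_epi_coprod[OF assms]) (auto intro: jointly_epi_id)
  moreover have "{coprod_inj C A (\<lambda>_. I) i \<cdot> x |i x. i \<in> A \<and> x \<in> {Id C I}} = free_inj C A ` A"
    using comp_id[OF free_inj_hom[OF assms]] by (force simp: free_inj_def)
  ultimately show ?thesis by (simp add: free_obj_def)
qed

lemma free_eqI:
  assumes "has_coprods C A" "u \<in> hom C (free_obj C A) Z" "v \<in> hom C (free_obj C A) Z"
    "\<And>x. x \<in> A \<Longrightarrow> u \<cdot> free_inj C A x = v \<cdot> free_inj C A x"
  shows "u = v"
  by (rule jointly_epiD[OF jointly_epi_free[OF assms(1)] assms(2,3)]) (use assms(4) in auto)

end

text \<open>Coproducts over sets of simplices serve for the free objects on
  \<open>simp_between\<close>, and for \<open>V\<close> in the tensor product of quivers; those over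
  sets of pairs of vertices serve for the fibres in \<open>push_obj\<close>.\<close>

locale free_object = enriching_category C + simplicial_set K
  for C :: "('o, 'm, 'z) symcat_scheme" (structure) and K :: "'k sset" +
  assumes simp_coprods: "A \<subseteq> simp K n \<Longrightarrow> has_coprods C A"
    and vertex_pair_coprods: "\<forall>B. B \<subseteq> simp K 0 \<times> simp K 0 \<longrightarrow> has_coprods C B"
begin

abbreviation V where "V \<equiv> simp K 0"
abbreviation F where "F \<equiv> fst (F_tilde C K)"
abbreviation between where "between n a b \<equiv> simp_between K n a b"

definition gen :: "nat \<Rightarrow> 'k \<Rightarrow> 'm" where
  "gen n x = free_inj C (between n (src K n x) (tgt K n x)) x"

lemma F_tilde_eq: "F_tilde C K = (F, V)"
  by (simp add: F_tilde_def)

lemma snd_F_tilde: "snd (F_tilde C K) = V"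
  by (simp add: F_tilde_def)

lemma V_coprods: "has_coprods C V"
  by (rule simp_coprods[of _ 0]) simp

lemma between_coprods: "has_coprods C (between n a b)"
  by (rule simp_coprods[of _ n]) (auto simp: simp_between_iff)

lemma F_obj: "ObjF F n = free_quiv C K n"
  by (simp add: F_tilde_def)

lemma free_quiv_app: "a \<in> V \<Longrightarrow> b \<in> V \<Longrightarrow> free_quiv C K n (a, b) = free_obj C (between n a b)"
  by (simp add: free_quiv_def)

lemma free_quiv_obj: "free_quiv C K n \<in> Obj (Quiv C V)"
  by (auto simp: free_quiv_def PiE_iff free_obj_obj between_coprods)

lemma free_quiv_ext [simp]: "free_quiv C K n \<in> extensional (V \<times> V)"
  by (auto simp: free_quiv_def)

lemma gen_hom: "x \<in> simp K n \<Longrightarrow> gen n x \<in> hom C I (free_quiv C K n (src K n x, tgt K n x))"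
  unfolding gen_def using free_inj_hom[OF between_coprods, of x n "src K n x" "tgt K n x"]
  by (simp add: free_quiv_app src_in tgt_in simp_between_iff)

lemma gen_between: "x \<in> between n a b \<Longrightarrow> gen n x = free_inj C (between n a b) x"
  by (simp add: gen_def simp_between_iff)

lemma between_vertex: "a \<in> V \<Longrightarrow> between 0 a b = (if a = b then {a} else {})"
  by (auto simp: simp_between_iff src_vertex tgt_vertex)

lemma act_between: "h \<in> Arr Delta_f \<Longrightarrow> x \<in> between (Cod Delta h) a b \<Longrightarrow> act K h x \<in> between (Dom Delta h) a b"
  by (simp add: simp_between_iff act_in Delta_f_arrD src_act tgt_act)

lemma F_arr_app:
  "a \<in> V \<Longrightarrow> b \<in> V \<Longrightarrow> ArrF F h (a, b) = free_map C (between (Cod Delta h) a b) (between (Dom Delta h) a b) (act K h)"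
  by (simp add: F_tilde_def)

lemma
  assumes h: "h \<in> Arr Delta_f" and ab: "a \<in> V" "b \<in> V"
  shows F_arr_hom: "ArrF F h (a, b) \<in> hom C (free_quiv C K (Cod Delta h) (a, b)) (free_quiv C K (Dom Delta h) (a, b))"
    and F_arr_gen: "x \<in> between (Cod Delta h) a b \<Longrightarrow> ArrF F h (a, b) \<cdot> gen (Cod Delta h) x = gen (Dom Delta h) (act K h x)"
proof -
  have g: "free_inj C (between (Dom Delta h) a b) (act K h x) \<in> hom C I (free_obj C (between (Dom Delta h) a b))"
    if "x \<in> between (Cod Delta h) a b" for x
    using free_inj_hom[OF between_coprods act_between[OF h that]] .
  note ob = free_obj_obj[OF between_coprods, of "Dom Delta h" a b]
  show "ArrF F h (a, b) \<in> hom C (free_quiv C K (Cod Delta h) (a, b)) (free_quiv C K (Dom Delta h) (a, b))"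
    using free_copair_hom[OF between_coprods ob g] ab by (simp add: F_arr_app free_quiv_app free_map_def)
  show "ArrF F h (a, b) \<cdot> gen (Cod Delta h) x = gen (Dom Delta h) (act K h x)" if x: "x \<in> between (Cod Delta h) a b"
    using free_copair_inj[OF between_coprods ob g x] x ab act_between[OF h x]
    by (simp add: F_arr_app free_map_def gen_between)
qed

lemma F_counit_app:
  "a \<in> V \<Longrightarrow> b \<in> V \<Longrightarrow> counit F (a, b) = free_copair C (between 0 a b) (quiv_unit C V (a, b)) (\<lambda>_. Id C I)"
  by (simp add: F_tilde_def)

lemma
  assumes ab: "a \<in> V" "b \<in> V"
  shows F_counit_hom: "counit F (a, b) \<in> hom C (free_quiv C K 0 (a, b)) (quiv_unit C V (a, b))"
    and F_counit_gen: "a = b \<Longrightarrow> counit F (a, b) \<cdot> gen 0 a = Id C I"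
proof -
  have g: "Id C I \<in> hom C I (quiv_unit C V (a, b))" if "x \<in> between 0 a b" for x
    using that ab by (auto simp: between_vertex hom_iff split: if_splits)
  have ob: "quiv_unit C V (a, b) \<in> Obj C" using quiv_objD[OF quiv_unit_obj ab] .
  show "counit F (a, b) \<in> hom C (free_quiv C K 0 (a, b)) (quiv_unit C V (a, b))"
    using free_copair_hom[OF between_coprods ob g] ab by (simp add: F_counit_app free_quiv_app)
  show "counit F (a, b) \<cdot> gen 0 a = Id C I" if "a = b"
  proof -
    have a: "a \<in> between 0 a b" using ab that by (simp add: between_vertex)
    show ?thesis using free_copair_inj[OF between_coprods ob g a] ab gen_between[OF a] by (simp add: F_counit_app)
  qed
qed

lemma F_comult_app:
  assumes "a \<in> V" "b \<in> V"
  shows "comult F k l (a, b) = free_copair C (between (k + l) a b) (quiv_tens C V (free_quiv C K k) (free_quiv C K l) (a, b))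
    (\<lambda>x. qprod V (free_quiv C K k) (free_quiv C K l) a b (act K (seg 0 k (k + l)) x)
       (free_inj C (between k a (act K (seg 0 k (k + l)) x)) (front_face K k l x))
       (free_inj C (between l (act K (seg 0 k (k + l)) x) b) (back_face K k l x)))"
  using assms by (simp add: F_tilde_def qprod_def etens_def front_face_def back_face_def Let_def)

lemma
  assumes ab: "a \<in> V" "b \<in> V"
  shows F_comult_hom: "comult F k l (a, b) \<in> hom C (free_quiv C K (k + l) (a, b)) (quiv_tens C V (free_quiv C K k) (free_quiv C K l) (a, b))"
    and F_comult_gen: "x \<in> between (k + l) a b \<Longrightarrow> comult F k l (a, b) \<cdot> gen (k + l) x =
      qprod V (free_quiv C K k) (free_quiv C K l) a b (act K (seg 0 k (k + l)) x) (gen k (front_face K k l x)) (gen l (back_face K k l x))"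
proof -
  let ?m = "\<lambda>x. act K (seg 0 k (k + l)) x"
  have fb: "front_face K k l x \<in> between k a (?m x)" "back_face K k l x \<in> between l (?m x) b" "?m x \<in> V"
    if "x \<in> between (k + l) a b" for x
  proof -
    have x: "x \<in> simp K (k + l)" using that by (simp add: simp_between_iff)
    show "front_face K k l x \<in> between k a (?m x)" "back_face K k l x \<in> between l (?m x) b" "?m x \<in> V"
      using that x front_in[OF x] back_in[OF x] src_front[OF x] src_back[OF x] tgt_front[OF x] tgt_back[OF x]
        src_in[OF back_in[OF x]]
      by (auto simp: simp_between_iff)
  qed
  have g: "qprod V (free_quiv C K k) (free_quiv C K l) a b (?m x)
       (free_inj C (between k a (?m x)) (front_face K k l x))
       (free_inj C (between l (?m x) b) (back_face K k l x))
       \<in> hom C I (quiv_tens C V (free_quiv C K k) (free_quiv C K l) (a, b))" if x: "x \<in> between (k + l) a b" for x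
    by (rule qprod_hom[OF V_coprods free_quiv_obj free_quiv_obj ab fb(3)[OF x]])
       (use fb[OF x] ab in \<open>auto simp: free_quiv_app intro!: free_inj_hom[OF between_coprods]\<close>)
  note ob = quiv_objD[OF quiv_tens_obj[OF V_coprods free_quiv_obj free_quiv_obj] ab, of k l]
  show "comult F k l (a, b) \<in> hom C (free_quiv C K (k + l) (a, b)) (quiv_tens C V (free_quiv C K k) (free_quiv C K l) (a, b))"
    using free_copair_hom[OF between_coprods ob g] ab by (simp add: F_comult_app free_quiv_app)
  show "comult F k l (a, b) \<cdot> gen (k + l) x =
      qprod V (free_quiv C K k) (free_quiv C K l) a b (?m x) (gen k (front_face K k l x)) (gen l (back_face K k l x))"
    if x: "x \<in> between (k + l) a b"
    using free_copair_inj[OF between_coprods ob g x] x ab fb[OF x] by (simp add: F_comult_app gen_between)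
qed

text \<open>\<open>simp_between K 0 a b\<close> is a singleton for \<open>a = b\<close> and empty
  otherwise. On the diagonal the counit thus undoes the one generator, and off the diagonal it is an
  arrow between initial objects.\<close>

lemma F_counit_iso: "is_iso (Quiv C V) (counit F)"
proof -
  let ?g = "\<lambda>(a, b) \<in> V \<times> V. if a = b then gen 0 a else from_initial C (free_quiv C K 0 (a, b))"
  have \<phi>: "counit F \<in> hom (Quiv C V) (free_quiv C K 0) (quiv_unit C V)"
    by (rule quiv_homI) (auto simp: F_counit_hom, auto simp: quiv_unit_def F_tilde_def)
  have gh: "?g (a, b) \<in> hom C (quiv_unit C V (a, b)) (free_quiv C K 0 (a, b))" if ab: "a \<in> V" "b \<in> V" for a b
    using gen_hom[OF ab(1)] ab from_initial_hom[OF quiv_objD[OF free_quiv_obj ab]]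
    by (auto simp: quiv_unit_def src_vertex tgt_vertex)
  have g: "?g \<in> hom (Quiv C V) (quiv_unit C V) (free_quiv C K 0)"
    by (rule quiv_homI) (use gh in \<open>auto simp: quiv_unit_def\<close>)
  show ?thesis
  proof (rule quiv_is_isoI[OF \<phi> g])
    fix a b assume ab: "a \<in> V" "b \<in> V"
    note 1 = F_counit_hom[OF ab] and 2 = gh[OF ab]
    have c: "gen 0 x \<in> hom C I (free_quiv C K 0 (a, b))" "free_inj C (between 0 a b) x = gen 0 x" "x = a" "a = b"
      if "x \<in> between 0 a b" for x
      using that gen_hom[of x 0] gen_between[OF that] ab
      by (auto simp: between_vertex src_vertex tgt_vertex split: if_splits)
    show "?g (a, b) \<cdot> counit F (a, b) = Id C (free_quiv C K 0 (a, b))"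
    proof (rule free_eqI[OF between_coprods])
      show "?g (a, b) \<cdot> counit F (a, b) \<in> hom C (free_obj C (between 0 a b)) (free_quiv C K 0 (a, b))"
        "Id C (free_quiv C K 0 (a, b)) \<in> hom C (free_obj C (between 0 a b)) (free_quiv C K 0 (a, b))"
        using comp_hom[OF 1 2] id_hom[OF hom_obj(1)[OF 1]] ab by (simp_all add: free_quiv_app)
      fix x assume x: "x \<in> between 0 a b"
      show "(?g (a, b) \<cdot> counit F (a, b)) \<cdot> free_inj C (between 0 a b) x =
        Id C (free_quiv C K 0 (a, b)) \<cdot> free_inj C (between 0 a b) x"
        using comp_assoc[OF c(1)[OF x] 1 2] F_counit_gen[OF ab c(4)[OF x]] c[OF x] ab comp_id[OF c(1)[OF x]] id_comp[OF c(1)[OF x]]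
        by simp
    qed
    show "counit F (a, b) \<cdot> ?g (a, b) = Id C (quiv_unit C V (a, b))"
    proof (cases "a = b")
      case True
      then show ?thesis using F_counit_gen[OF ab] ab by simp
    next
      case False
      then show ?thesis
        using comp_hom[OF 2 1] id_hom[OF hom_obj(2)[OF 1]] ab by (intro initial_eqI) (auto simp: quiv_unit_def)
    qed
  qed
qed

text \<open>The generators are the tautological family of the free object in itself. The rules about
  \<open>el\<close> thereby compute its necklace maps on products of generators.\<close>

sublocale free: element_family C V F K "\<lambda>v. v" gen
proof
  show "has_coprods C V" by (rule V_coprods)
  show "ObjF F n \<in> Obj (Quiv C V)" for n using free_quiv_obj F_obj by simp
  show "ArrF F h \<in> hom (Quiv C V) (ObjF F (Cod Delta h)) (ObjF F (Dom Delta h))" if "h \<in> Arr Delta_f" for h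
    unfolding F_obj by (rule quiv_homI) (auto simp: F_arr_hom[OF that], simp add: F_tilde_def)
  show "comult F k l \<in> hom (Quiv C V) (ObjF F (k + l)) (quiv_tens C V (ObjF F k) (ObjF F l))" for k l
    unfolding F_obj by (rule quiv_homI) (auto simp: F_comult_hom, simp add: F_tilde_def)
  show "counit F \<in> hom (Quiv C V) (ObjF F 0) (quiv_unit C V)"
    unfolding F_obj by (rule quiv_homI) (auto simp: F_counit_hom, auto simp: quiv_unit_def F_tilde_def)
  show "is_iso (Quiv C V) (counit F)" by (rule F_counit_iso)
  show "is_family V F K (\<lambda>v. v) gen"
    unfolding is_family_def F_obj
    using gen_hom F_arr_gen F_counit_gen F_comult_gen src_in tgt_in by (auto simp: simp_between_iff)
qed

lemma jointly_epi_gen: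
  assumes ab: "a \<in> V" "b \<in> V"
  shows "jointly_epi C (free_quiv C K n (a, b)) (gen n ` between n a b)"
proof -
  have "gen n ` between n a b = free_inj C (between n a b) ` between n a b"
    by (rule image_cong) (auto simp: gen_between)
  then show ?thesis using jointly_epi_free[OF between_coprods, of n a b] ab by (simp add: free_quiv_app)
qed

text \<open>An iteration of \<open>jointly_epi_quiv_tens\<close>; one bead is a separate case
  because \<open>tens\<close> of a one-element list carries no unit factor.\<close>

lemma jointly_epi_el:
  assumes b: "b \<in> V"
  shows "a \<in> V \<Longrightarrow> jointly_epi C (tens (Quiv C V) F ds (a, b)) {free.el b ds xs |xs. chain K ds xs a b}"
proof (induction ds arbitrary: a)
  case Nil
  show ?case
  proof (cases "a = b")
    case True
    then have "{free.el b [] xs |xs. chain K [] xs a b} = {Id C I}" using Nil by (auto simp: chain_Nil)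
    then show ?thesis using True Nil jointly_epi_id by simp
  next
    case False
    \<comment> \<open>No chain exists here, but this component of the unit quiver is initial, so the
      empty family suffices.\<close>
    then show ?thesis using Nil b unfolding jointly_epi_def by (auto simp: quiv_unit_def intro: initial_eqI)
  qed
next
  case (Cons d ds)
  show ?case
  proof (cases "ds = []")
    case True
    have "chain K (d # ds) xs a b \<longleftrightarrow> (\<exists>x \<in> between d a b. xs = [x])" for xs
      unfolding True using tgt_in by (auto simp: chain_Cons chain_Nil simp_between_iff)
    then have "{free.el b (d # ds) xs |xs. chain K (d # ds) xs a b} = {free.el b (d # ds) xs |xs. \<exists>x\<in>between d a b. xs = [x]}"
      by (simp only:)
    also have "\<dots> = (\<lambda>x. free.el b (d # ds) [x]) ` between d a b" by (rule set_eqI) blast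
    finally have "{free.el b (d # ds) xs |xs. chain K (d # ds) xs a b} = gen d ` between d a b"
      by (simp add: True)
    then show ?thesis using jointly_epi_gen[OF Cons.prems b] True by (simp add: F_obj)
  next
    case False
    have "jointly_epi C (quiv_tens C V (free_quiv C K d) (tens (Quiv C V) F ds) (a, b))
      {qprod V (free_quiv C K d) (tens (Quiv C V) F ds) a b c x y |c x y.
        c \<in> V \<and> x \<in> gen d ` between d a c \<and> y \<in> {free.el b ds xs |xs. chain K ds xs c b}}"
    proof (rule jointly_epi_quiv_tens[OF V_coprods free_quiv_obj free.T_obj Cons.prems b])
      fix c assume c: "c \<in> V"
      show "gen d ` between d a c \<subseteq> hom C I (free_quiv C K d (a, c))"
        using gen_hom by (auto simp: simp_between_iff)
      show "{free.el b ds xs |xs. chain K ds xs c b} \<subseteq> hom C I (tens (Quiv C V) F ds (c, b))"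
        using free.el_hom by blast
    qed (use jointly_epi_gen Cons.prems b Cons.IH in auto)
    moreover have "{qprod V (free_quiv C K d) (tens (Quiv C V) F ds) a b c x y |c x y.
        c \<in> V \<and> x \<in> gen d ` between d a c \<and> y \<in> {free.el b ds xs |xs. chain K ds xs c b}} =
      {free.el b (d # ds) xs |xs. chain K (d # ds) xs a b}" (is "?L = ?R")
    proof
      show "?L \<subseteq> ?R"
      proof
        fix z assume "z \<in> ?L"
        then obtain c x xs where "c \<in> V" "x \<in> between d a c" "chain K ds xs c b"
          "z = qprod V (free_quiv C K d) (tens (Quiv C V) F ds) a b c (gen d x) (free.el b ds xs)" by blast
        then have "z = free.el b (d # ds) (x # xs) \<and> chain K (d # ds) (x # xs) a b"
          using False by (simp add: simp_between_iff F_obj)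
        then show "z \<in> ?R" by blast
      qed
      show "?R \<subseteq> ?L"
      proof
        fix z assume "z \<in> ?R"
        then obtain x xs where x: "x \<in> simp K d" "src K d x = a" "chain K ds xs (tgt K d x) b"
          "z = free.el b (d # ds) (x # xs)" by (auto simp: chain_Cons simp del: free.el.simps)
        then have "z = qprod V (free_quiv C K d) (tens (Quiv C V) F ds) a b (tgt K d x) (gen d x) (free.el b ds xs)"
          using False by (simp add: F_obj)
        moreover have "x \<in> between d a (tgt K d x)" "tgt K d x \<in> V" using x tgt_in by (auto simp: simp_between_iff)
        ultimately show "z \<in> ?L" using x(3) by blast
      qed
    qed
    ultimately show ?thesis using False by (simp add: F_obj)
  qed
qed

end

section \<open>Change of vertices\<close>

lemma pull_app [simp]: "a \<in> A \<Longrightarrow> b \<in> A \<Longrightarrow> pull A f Q (a, b) = Q (f a, f b)"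
  and pull_ext [simp]: "pull A f Q \<in> extensional (A \<times> A)"
  by (auto simp: pull_def)

lemma fibre_iff: "(a, b) \<in> fibre A f s t \<longleftrightarrow> a \<in> A \<and> b \<in> A \<and> f a = s \<and> f b = t"
  by (auto simp: fibre_def)

context enriching_category
begin

context
  fixes A :: "'a set" and S :: "'s set" and f :: "'a \<Rightarrow> 's"
  assumes fibre_coprods: "\<forall>B. B \<subseteq> A \<times> A \<longrightarrow> has_coprods C B"
    and f: "f \<in> A \<rightarrow> S"
begin

lemma vertex_in: "a \<in> A \<Longrightarrow> f a \<in> S"
  using f by blast

lemma fibre_coprods': "has_coprods C (fibre A f s t)"
  by (rule fibre_coprods[rule_format]) (auto simp: fibre_def)

lemma pull_obj: "R \<in> Obj (Quiv C S) \<Longrightarrow> pull A f R \<in> Obj (Quiv C A)"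
  using vertex_in by (auto simp: pull_def PiE_iff)

lemma pull_hom: "\<phi> \<in> hom (Quiv C S) Q R \<Longrightarrow> pull A f \<phi> \<in> hom (Quiv C A) (pull A f Q) (pull A f R)"
  using vertex_in by (intro quiv_homI) (auto intro: quiv_hom_app)

lemma push_obj_app: "s \<in> S \<Longrightarrow> t \<in> S \<Longrightarrow> push_obj C A S f Q (s, t) = coprod C (fibre A f s t) Q"
  by (simp add: push_obj_def)

lemma push_obj_ext [simp]: "push_obj C A S f Q \<in> extensional (S \<times> S)"
  by (auto simp: push_obj_def)

lemma fibre_obj: "Q \<in> Obj (Quiv C A) \<Longrightarrow> p \<in> fibre A f s t \<Longrightarrow> Q p \<in> Obj C"
  by (auto simp: fibre_def)

lemma push_obj_obj:
  assumes Q: "Q \<in> Obj (Quiv C A)"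
  shows "push_obj C A S f Q \<in> Obj (Quiv C S)"
proof -
  have "push_obj C A S f Q (s, t) \<in> Obj C" if "s \<in> S" "t \<in> S" for s t
    unfolding push_obj_app[OF that] by (rule coprod_obj[OF fibre_coprods']) (rule fibre_obj[OF Q])
  then show ?thesis by (auto simp: PiE_iff)
qed

lemma push_unit_app: "a \<in> A \<Longrightarrow> b \<in> A \<Longrightarrow> push_unit C A f Q (a, b) = coprod_inj C (fibre A f (f a) (f b)) Q (a, b)"
  by (simp add: push_unit_def)

lemma push_unit_app_hom:
  assumes "Q \<in> Obj (Quiv C A)" "a \<in> A" "b \<in> A"
  shows "push_unit C A f Q (a, b) \<in> hom C (Q (a, b)) (push_obj C A S f Q (f a, f b))"
  unfolding push_unit_app[OF assms(2,3)] push_obj_app[OF vertex_in[OF assms(2)] vertex_in[OF assms(3)]]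
  by (rule coprod_inj_hom[OF fibre_coprods']) (use assms in \<open>auto simp: fibre_iff intro: fibre_obj\<close>)

lemma push_unit_hom: "Q \<in> Obj (Quiv C A) \<Longrightarrow> push_unit C A f Q \<in> hom (Quiv C A) Q (pull A f (push_obj C A S f Q))"
  by (rule quiv_homI) (auto simp: push_unit_app_hom PiE_iff, auto simp: push_unit_def)

lemma
  assumes g: "g \<in> hom (Quiv C A) Q (pull A f R)" and R: "R \<in> Obj (Quiv C S)"
  shows push_transpose_hom: "push_transpose C A S f Q R g \<in> hom (Quiv C S) (push_obj C A S f Q) R"
    and push_transpose_unit: "a \<in> A \<Longrightarrow> b \<in> A \<Longrightarrow>
      push_transpose C A S f Q R g (f a, f b) \<cdot> push_unit C A f Q (a, b) = g (a, b)"
proof -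
  have 1: "g p \<in> hom C (Q p) (R (s, t))" if "p \<in> fibre A f s t" for p s t
    using that quiv_hom_app[OF g] by (auto simp: fibre_def)
  show "push_transpose C A S f Q R g \<in> hom (Quiv C S) (push_obj C A S f Q) R"
  proof (rule quiv_homI)
    fix s t assume st: "s \<in> S" "t \<in> S"
    show "push_transpose C A S f Q R g (s, t) \<in> hom C (push_obj C A S f Q (s, t)) (R (s, t))"
      using copair_hom[OF fibre_coprods' quiv_objD[OF R st] 1] st by (simp add: push_transpose_def push_obj_app)
  qed (use R in \<open>auto simp: push_transpose_def PiE_iff\<close>)
  show "push_transpose C A S f Q R g (f a, f b) \<cdot> push_unit C A f Q (a, b) = g (a, b)" if ab: "a \<in> A" "b \<in> A"
  proof -
    have "(a, b) \<in> fibre A f (f a) (f b)" using ab by (simp add: fibre_iff)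
    from copair_inj[OF fibre_coprods' quiv_objD[OF R vertex_in[OF ab(1)] vertex_in[OF ab(2)]] 1 this] show ?thesis
      using ab vertex_in by (simp add: push_transpose_def push_unit_app)
  qed
qed

text \<open>Each component of the pushforward is a coproduct over a fibre, with the components of
  \<open>push_unit\<close> as injections. Where the fibre is empty the component is initial and
  imposes no condition, so pairs in the image of \<open>f\<close> suffice.\<close>

lemma push_eqI:
  assumes Q: "Q \<in> Obj (Quiv C A)"
    and u: "u \<in> hom (Quiv C S) (push_obj C A S f Q) R" "v \<in> hom (Quiv C S) (push_obj C A S f Q) R"
    and eq: "\<And>a b. a \<in> A \<Longrightarrow> b \<in> A \<Longrightarrow> u (f a, f b) \<cdot> push_unit C A f Q (a, b) = v (f a, f b) \<cdot> push_unit C A f Q (a, b)"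
  shows "u = v"
proof (rule quiv_hom_eqI[OF u])
  fix s t assume st: "s \<in> S" "t \<in> S"
  show "u (s, t) = v (s, t)"
  proof (rule coprod_eqI[OF fibre_coprods'])
    show "Q p \<in> Obj C" if "p \<in> fibre A f s t" for p by (rule fibre_obj[OF Q that])
    show "u (s, t) \<in> hom C (coprod C (fibre A f s t) Q) (R (s, t))" "v (s, t) \<in> hom C (coprod C (fibre A f s t) Q) (R (s, t))"
      using quiv_hom_app[OF u(1) st] quiv_hom_app[OF u(2) st] st by (simp_all add: push_obj_app)
    fix p assume "p \<in> fibre A f s t"
    then obtain a b where "p = (a, b)" "a \<in> A" "b \<in> A" "s = f a" "t = f b" by (auto simp: fibre_def)
    then show "u (s, t) \<cdot> coprod_inj C (fibre A f s t) Q p = v (s, t) \<cdot> coprod_inj C (fibre A f s t) Q p"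
      using eq[of a b] by (simp add: push_unit_app)
  qed
qed

lemma
  assumes \<phi>: "\<phi> \<in> hom (Quiv C A) Q Q'"
  shows push_arr_hom: "ArrF (push C A S f) \<phi> \<in> hom (Quiv C S) (push_obj C A S f Q) (push_obj C A S f Q')"
    and push_arr_unit: "a \<in> A \<Longrightarrow> b \<in> A \<Longrightarrow>
      ArrF (push C A S f) \<phi> (f a, f b) \<cdot> push_unit C A f Q (a, b) = push_unit C A f Q' (a, b) \<cdot> \<phi> (a, b)"
proof -
  have 1: "ArrF (push C A S f) \<phi> = push_transpose C A S f Q (push_obj C A S f Q') (push_unit C A f Q' \<cdot>\<^bsub>Quiv C A\<^esub> \<phi>)"
    using quiv_dom_cod[OF \<phi>] by (simp add: push_def)
  note Q' = quiv_hom_obj(2)[OF \<phi>]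
  note 2 = quiv_comp_hom[OF \<phi> push_unit_hom[OF Q']]
  show "ArrF (push C A S f) \<phi> \<in> hom (Quiv C S) (push_obj C A S f Q) (push_obj C A S f Q')"
    unfolding 1 by (rule push_transpose_hom[OF 2 push_obj_obj[OF Q']])
  show "a \<in> A \<Longrightarrow> b \<in> A \<Longrightarrow>
      ArrF (push C A S f) \<phi> (f a, f b) \<cdot> push_unit C A f Q (a, b) = push_unit C A f Q' (a, b) \<cdot> \<phi> (a, b)"
    unfolding 1 using push_transpose_unit[OF 2 push_obj_obj[OF Q']] by simp
qed

lemma pull_one_hom: "pull_one C A S f \<in> hom (Quiv C A) (quiv_unit C A) (pull A f (quiv_unit C S))"
proof (rule quiv_homI)
  fix a b assume ab: "a \<in> A" "b \<in> A"
  show "pull_one C A S f (a, b) \<in> hom C (quiv_unit C A (a, b)) (pull A f (quiv_unit C S) (a, b))"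
    using ab vertex_in from_initial_hom[OF quiv_objD[OF quiv_unit_obj vertex_in[OF ab(1)] vertex_in[OF ab(2)]]]
    by (simp add: pull_one_def quiv_unit_def id_hom)
qed (auto simp: pull_one_def quiv_unit_def)

lemma
  shows push_counit_hom: "counit (push C A S f) \<in> hom (Quiv C S) (push_obj C A S f (quiv_unit C A)) (quiv_unit C S)"
    and push_counit_unit: "a \<in> A \<Longrightarrow> counit (push C A S f) (f a, f a) \<cdot> push_unit C A f (quiv_unit C A) (a, a) = Id C I"
  using push_transpose_hom[OF pull_one_hom quiv_unit_obj] push_transpose_unit[OF pull_one_hom quiv_unit_obj]
  by (simp_all add: push_def pull_one_def)

context
  assumes A: "has_coprods C A" and S: "has_coprods C S"
begin

lemma
  assumes Q: "Q \<in> Obj (Quiv C S)" and P: "P \<in> Obj (Quiv C S)"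
  shows pull_mult_hom: "pull_mult C A S f Q P \<in> hom (Quiv C A) (quiv_tens C A (pull A f Q) (pull A f P)) (pull A f (quiv_tens C S Q P))"
    and pull_mult_qprod: "a \<in> A \<Longrightarrow> b \<in> A \<Longrightarrow> c \<in> A \<Longrightarrow> x \<in> hom C I (Q (f a, f c)) \<Longrightarrow> y \<in> hom C I (P (f c, f b)) \<Longrightarrow>
      pull_mult C A S f Q P (a, b) \<cdot> qprod A (pull A f Q) (pull A f P) a b c x y = qprod S Q P (f a) (f b) (f c) x y"
proof -
  have 1: "quiv_inj C S Q P (f a) (f b) (f c) \<in> hom C (pull A f Q (a, c) \<odot> pull A f P (c, b)) (quiv_tens C S Q P (f a, f b))"
    if "a \<in> A" "b \<in> A" "c \<in> A" for a b c
    using quiv_inj_hom[OF S Q P vertex_in[OF that(1)] vertex_in[OF that(2)] vertex_in[OF that(3)]] that by simp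
  note ob = quiv_objD[OF quiv_tens_obj[OF S Q P] vertex_in vertex_in]
  have 2: "pull_mult C A S f Q P (a, b) \<in> hom C (quiv_tens C A (pull A f Q) (pull A f P) (a, b)) (quiv_tens C S Q P (f a, f b))"
    if ab: "a \<in> A" "b \<in> A" for a b
  proof -
    have "quiv_copair C A (pull A f Q) (pull A f P) a b (quiv_tens C S Q P (f a, f b)) (\<lambda>c. quiv_inj C S Q P (f a) (f b) (f c))
        \<in> hom C (quiv_tens C A (pull A f Q) (pull A f P) (a, b)) (quiv_tens C S Q P (f a, f b))"
      by (rule quiv_copair_hom[OF A ob[OF ab] ab]) (rule 1[OF ab])
    then show ?thesis using ab by (simp add: pull_mult_def)
  qed
  show "pull_mult C A S f Q P \<in> hom (Quiv C A) (quiv_tens C A (pull A f Q) (pull A f P)) (pull A f (quiv_tens C S Q P))"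
    by (rule quiv_homI) (auto simp: 2, auto simp: pull_mult_def)
  show "pull_mult C A S f Q P (a, b) \<cdot> qprod A (pull A f Q) (pull A f P) a b c x y = qprod S Q P (f a) (f b) (f c) x y"
    if ab: "a \<in> A" "b \<in> A" "c \<in> A" and x: "x \<in> hom C I (Q (f a, f c))" and y: "y \<in> hom C I (P (f c, f b))"
  proof -
    have xy: "x \<boxtimes> y \<in> hom C I (pull A f Q (a, c) \<odot> pull A f P (c, b))" using etens_hom[OF x y] ab by simp
    have "quiv_copair C A (pull A f Q) (pull A f P) a b (quiv_tens C S Q P (f a, f b)) (\<lambda>c. quiv_inj C S Q P (f a) (f b) (f c)) \<cdot>
        quiv_inj C A (pull A f Q) (pull A f P) a b c = quiv_inj C S Q P (f a) (f b) (f c)"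
      by (rule quiv_copair_inj[OF A ob[OF ab(1,2)] ab(1,2) _ ab(3)]) (rule 1[OF ab(1,2)])
    then show ?thesis
      unfolding qprod_def
      using comp_assoc[OF xy quiv_inj_hom[OF A pull_obj[OF Q] pull_obj[OF P] ab] 2[OF ab(1,2)]] ab
      by (simp add: pull_mult_def)
  qed
qed

text \<open>The mate is evaluated in two moves: the units of the adjunction act factor by factor,
  and \<open>pull_mult\<close> merely relabels the summand at \<open>c\<close> as the one at
  \<open>f c\<close>.\<close>

lemma
  assumes Q: "Q \<in> Obj (Quiv C A)" and P: "P \<in> Obj (Quiv C A)"
  shows push_comult_hom: "comult (push C A S f) Q P \<in>
      hom (Quiv C S) (push_obj C A S f (quiv_tens C A Q P)) (quiv_tens C S (push_obj C A S f Q) (push_obj C A S f P))"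
    and push_comult_qprod: "a \<in> A \<Longrightarrow> b \<in> A \<Longrightarrow> c \<in> A \<Longrightarrow> x \<in> hom C I (Q (a, c)) \<Longrightarrow> y \<in> hom C I (P (c, b)) \<Longrightarrow>
      comult (push C A S f) Q P (f a, f b) \<cdot> push_unit C A f (quiv_tens C A Q P) (a, b) \<cdot> qprod A Q P a b c x y =
      qprod S (push_obj C A S f Q) (push_obj C A S f P) (f a) (f b) (f c)
        (push_unit C A f Q (a, c) \<cdot> x) (push_unit C A f P (c, b) \<cdot> y)"
proof -
  let ?g = "pull_mult C A S f (push_obj C A S f Q) (push_obj C A S f P) \<cdot>\<^bsub>Quiv C A\<^esub>
    (push_unit C A f Q \<otimes>\<^bsub>Quiv C A\<^esub> push_unit C A f P)"
  note Q' = push_obj_obj[OF Q] and P' = push_obj_obj[OF P]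
  note 1 = qtens_hom[OF A push_unit_hom[OF Q] push_unit_hom[OF P]] and 2 = pull_mult_hom[OF Q' P']
  note 3 = quiv_comp_hom[OF 1 2] and 4 = quiv_tens_obj[OF S Q' P']
  show h: "comult (push C A S f) Q P \<in>
      hom (Quiv C S) (push_obj C A S f (quiv_tens C A Q P)) (quiv_tens C S (push_obj C A S f Q) (push_obj C A S f P))"
    using push_transpose_hom[OF 3 4] by (simp add: push_def)
  show "comult (push C A S f) Q P (f a, f b) \<cdot> push_unit C A f (quiv_tens C A Q P) (a, b) \<cdot> qprod A Q P a b c x y =
      qprod S (push_obj C A S f Q) (push_obj C A S f P) (f a) (f b) (f c)
        (push_unit C A f Q (a, c) \<cdot> x) (push_unit C A f P (c, b) \<cdot> y)"
    if ab: "a \<in> A" "b \<in> A" "c \<in> A" and x: "x \<in> hom C I (Q (a, c))" and y: "y \<in> hom C I (P (c, b))"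
  proof -
    note q = qprod_hom[OF A Q P ab x y]
    have "(comult (push C A S f) Q P (f a, f b) \<cdot> push_unit C A f (quiv_tens C A Q P) (a, b)) \<cdot> qprod A Q P a b c x y =
      ?g (a, b) \<cdot> qprod A Q P a b c x y"
      using push_transpose_unit[OF 3 4 ab(1,2)] by (simp add: push_def)
    also have "\<dots> = pull_mult C A S f (push_obj C A S f Q) (push_obj C A S f P) (a, b) \<cdot>
        qprod A (pull A f (push_obj C A S f Q)) (pull A f (push_obj C A S f P)) a b c (push_unit C A f Q (a, c) \<cdot> x) (push_unit C A f P (c, b) \<cdot> y)"
      by (simp only: quiv_comp_app'[OF 2 1 ab(1,2) q] qtens_qprod[OF A push_unit_hom[OF Q] push_unit_hom[OF P] ab x y])
    also have "\<dots> = qprod S (push_obj C A S f Q) (push_obj C A S f P) (f a) (f b) (f c)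
        (push_unit C A f Q (a, c) \<cdot> x) (push_unit C A f P (c, b) \<cdot> y)"
      by (rule pull_mult_qprod[OF Q' P' ab comp_hom[OF x push_unit_app_hom[OF Q ab(1,3)]] comp_hom[OF y push_unit_app_hom[OF P ab(3,2)]]])
    finally show ?thesis
      using comp_assoc[OF q push_unit_app_hom[OF quiv_tens_obj[OF A Q P] ab(1,2)] quiv_hom_app[OF h vertex_in[OF ab(1)] vertex_in[OF ab(2)]]]
      by simp
  qed
qed

end

end

end

section \<open>Templicial morphisms out of free templicial objects\<close>

lemma op_Delta_f_simps [simp]:
  "Obj (op_moncat Delta_f) = UNIV" "Arr (op_moncat Delta_f) = Arr Delta_f"
  "Dom (op_moncat Delta_f) = Cod Delta" "Cod (op_moncat Delta_f) = Dom Delta"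
  "TensO (op_moncat Delta_f) = (+)" "Unit (op_moncat Delta_f) = 0"
  by (simp_all add: op_moncat_def)

locale free_object_target = free_object C K + colax_quiver C S Y
  for C :: "('o, 'm, 'z) symcat_scheme" (structure) and K :: "'k sset" and S :: "'s set" and Y
begin

abbreviation pushF where "pushF f n \<equiv> push_obj C V S f (free_quiv C K n)"

text \<open>The generator at \<open>x\<close>, carried into the pushforward. By
  \<open>pushF_eqI\<close> these elements detect morphisms of quivers out of it.\<close>

definition pgen where
  "pgen f n x = push_unit C V f (free_quiv C K n) (src K n x, tgt K n x) \<cdot> gen n x"

text \<open>The value at \<open>x\<close> of the family of elements that corresponds to \<open>(\<alpha>, f)\<close>.\<close>

definition ev where
  "ev \<alpha> f n x = \<alpha> n (f (src K n x), f (tgt K n x)) \<cdot> pgen f n x"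

context
  fixes f :: "'k \<Rightarrow> 's"
  assumes f: "f \<in> V \<rightarrow> S"
begin

lemma target_vertex_in: "v \<in> V \<Longrightarrow> f v \<in> S"
  using f by blast

lemmas vp = vertex_pair_coprods f

lemma pgen_hom: "x \<in> simp K n \<Longrightarrow> pgen f n x \<in> hom C I (pushF f n (f (src K n x), f (tgt K n x)))"
  unfolding pgen_def by (rule comp_hom[OF gen_hom push_unit_app_hom[OF vp free_quiv_obj src_in tgt_in]])

lemma pushF_eqI:
  assumes u: "u \<in> hom (Quiv C S) (pushF f n) R" "v \<in> hom (Quiv C S) (pushF f n) R"
    and eq: "\<And>x. x \<in> simp K n \<Longrightarrow> u (f (src K n x), f (tgt K n x)) \<cdot> pgen f n x = v (f (src K n x), f (tgt K n x)) \<cdot> pgen f n x"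
  shows "u = v"
proof (rule push_eqI[OF vp free_quiv_obj u])
  fix a b assume ab: "a \<in> V" "b \<in> V"
  note p = push_unit_app_hom[OF vp free_quiv_obj ab, of n]
  note uh = quiv_hom_app[OF u(1) target_vertex_in[OF ab(1)] target_vertex_in[OF ab(2)]] quiv_hom_app[OF u(2) target_vertex_in[OF ab(1)] target_vertex_in[OF ab(2)]]
  show "u (f a, f b) \<cdot> push_unit C V f (free_quiv C K n) (a, b) = v (f a, f b) \<cdot> push_unit C V f (free_quiv C K n) (a, b)"
  proof (rule jointly_epiD[OF jointly_epi_gen[OF ab] comp_hom[OF p uh(1)] comp_hom[OF p uh(2)]])
    fix y assume "y \<in> gen n ` between n a b"
    then obtain x where x: "x \<in> simp K n" "src K n x = a" "tgt K n x = b" "y = gen n x" by (auto simp: simp_between_iff)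
    have y: "y \<in> hom C I (free_quiv C K n (a, b))" using gen_hom[OF x(1)] x by simp
    show "(u (f a, f b) \<cdot> push_unit C V f (free_quiv C K n) (a, b)) \<cdot> y = (v (f a, f b) \<cdot> push_unit C V f (free_quiv C K n) (a, b)) \<cdot> y"
      using eq[OF x(1)] comp_assoc[OF y p uh(1)] comp_assoc[OF y p uh(2)] x by (simp add: pgen_def)
  qed
qed

lemma push_arr_pgen:
  assumes \<phi>: "\<phi> \<in> hom (Quiv C V) (free_quiv C K n) Q" and x: "x \<in> simp K n"
  shows "ArrF (push C V S f) \<phi> (f (src K n x), f (tgt K n x)) \<cdot> pgen f n x =
    push_unit C V f Q (src K n x, tgt K n x) \<cdot> \<phi> (src K n x, tgt K n x) \<cdot> gen n x"
proof -
  note st = src_in[OF x] tgt_in[OF x]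
  show ?thesis
    unfolding pgen_def
    using comp_assoc[OF gen_hom[OF x] push_unit_app_hom[OF vp free_quiv_obj st]
        quiv_hom_app[OF push_arr_hom[OF vp \<phi>] target_vertex_in[OF st(1)] target_vertex_in[OF st(2)]]]
      comp_assoc[OF gen_hom[OF x] quiv_hom_app[OF \<phi> st] push_unit_app_hom[OF vp quiv_hom_obj(2)[OF \<phi>] st]]
      push_arr_unit[OF vp \<phi> st]
    by simp
qed

context
  fixes \<alpha> assumes \<alpha>: "\<And>n. \<alpha> n \<in> hom (Quiv C S) (pushF f n) (ObjF Y n)"
begin

lemma ev_hom: "x \<in> simp K n \<Longrightarrow> ev \<alpha> f n x \<in> hom C I (ObjF Y n (f (src K n x), f (tgt K n x)))"
  unfolding ev_def by (rule comp_hom[OF pgen_hom quiv_hom_app[OF \<alpha> target_vertex_in[OF src_in] target_vertex_in[OF tgt_in]]])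

text \<open>Both sides are morphisms out of the pushforward of a free quiver, hence determined by
  their values on \<open>pgen\<close>, and there the arrow of the free object moves \<open>x\<close>
  to \<open>act K h x\<close>. \<open>counit_iff\<close> and \<open>comult_iff\<close> follow the
  same pattern.\<close>

lemma nat_iff:
  assumes h: "h \<in> Arr Delta_f"
  shows "\<alpha> (Dom Delta h) \<cdot>\<^bsub>Quiv C S\<^esub> ArrF (push C V S f) (ArrF F h) = ArrF Y h \<cdot>\<^bsub>Quiv C S\<^esub> \<alpha> (Cod Delta h) \<longleftrightarrow>
    (\<forall>x \<in> simp K (Cod Delta h). ArrF Y h (f (src K (Cod Delta h) x), f (tgt K (Cod Delta h) x)) \<cdot> ev \<alpha> f (Cod Delta h) x =
        ev \<alpha> f (Dom Delta h) (act K h x))" (is "?L = ?R \<longleftrightarrow> _")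
proof -
  let ?m = "Dom Delta h" and ?n = "Cod Delta h"
  note Fh = free.Y_arr[OF h, unfolded F_obj] and Yh = Y_arr[OF h]
  note pFh = push_arr_hom[OF vp Fh]
  have L: "?L (f (src K ?n x), f (tgt K ?n x)) \<cdot> pgen f ?n x = ev \<alpha> f ?m (act K h x)" if x: "x \<in> simp K ?n" for x
  proof -
    note st = target_vertex_in[OF src_in[OF x]] target_vertex_in[OF tgt_in[OF x]]
    show ?thesis
      using quiv_comp_app'[OF \<alpha> pFh st pgen_hom[OF x]] push_arr_pgen[OF Fh x] free.e_act[OF h x] src_act[OF h x] tgt_act[OF h x]
      by (simp add: ev_def pgen_def)
  qed
  have R: "?R (f (src K ?n x), f (tgt K ?n x)) \<cdot> pgen f ?n x =
      ArrF Y h (f (src K ?n x), f (tgt K ?n x)) \<cdot> ev \<alpha> f ?n x" if x: "x \<in> simp K ?n" for x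
    unfolding ev_def by (rule quiv_comp_app'[OF Yh \<alpha> target_vertex_in[OF src_in[OF x]] target_vertex_in[OF tgt_in[OF x]] pgen_hom[OF x]])
  show ?thesis
  proof
    assume "?L = ?R"
    then show "\<forall>x \<in> simp K ?n. ArrF Y h (f (src K ?n x), f (tgt K ?n x)) \<cdot> ev \<alpha> f ?n x = ev \<alpha> f ?m (act K h x)"
      using L R by metis
  next
    assume *: "\<forall>x \<in> simp K ?n. ArrF Y h (f (src K ?n x), f (tgt K ?n x)) \<cdot> ev \<alpha> f ?n x = ev \<alpha> f ?m (act K h x)"
    show "?L = ?R"
      by (rule pushF_eqI[OF quiv_comp_hom[OF pFh \<alpha>] quiv_comp_hom[OF \<alpha> Yh]]) (metis L R *)
  qed
qed

lemma counit_iff: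
  "counit Y \<cdot>\<^bsub>Quiv C S\<^esub> \<alpha> 0 = counit (push C V S f) \<cdot>\<^bsub>Quiv C S\<^esub> ArrF (push C V S f) (counit F) \<longleftrightarrow>
    (\<forall>v \<in> V. counit Y (f v, f v) \<cdot> ev \<alpha> f 0 v = Id C I)" (is "?L = ?R \<longleftrightarrow> _")
proof -
  note Fc = free.Y_counit[unfolded F_obj]
  note pFc = push_arr_hom[OF vp Fc] and pc = push_counit_hom[OF vp]
  have vv: "f (src K 0 v) = f v" "f (tgt K 0 v) = f v" if "v \<in> V" for v using that by (simp_all add: src_vertex tgt_vertex)
  have L: "?L (f (src K 0 v), f (tgt K 0 v)) \<cdot> pgen f 0 v = counit Y (f v, f v) \<cdot> ev \<alpha> f 0 v" if v: "v \<in> V" for v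
    unfolding ev_def using quiv_comp_app'[OF Y_counit \<alpha> target_vertex_in[OF src_in[OF v]] target_vertex_in[OF tgt_in[OF v]] pgen_hom[OF v]] vv[OF v] by simp
  have R: "?R (f (src K 0 v), f (tgt K 0 v)) \<cdot> pgen f 0 v = Id C I" if v: "v \<in> V" for v
  proof -
    have "counit F (v, v) \<cdot> gen 0 v = Id C I" using free.e_counit[OF v] .
    moreover have "push_unit C V f (quiv_unit C V) (v, v) \<in> hom C I (push_obj C V S f (quiv_unit C V) (f v, f v))"
      using push_unit_app_hom[OF vp quiv_unit_obj v v] v by simp
    ultimately show ?thesis
      using quiv_comp_app'[OF pc pFc target_vertex_in[OF src_in[OF v]] target_vertex_in[OF tgt_in[OF v]] pgen_hom[OF v]] push_arr_pgen[OF Fc v]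
        push_counit_unit[OF vp v] comp_id v
      by (simp add: src_vertex tgt_vertex)
  qed
  show ?thesis
  proof
    assume "?L = ?R"
    then show "\<forall>v \<in> V. counit Y (f v, f v) \<cdot> ev \<alpha> f 0 v = Id C I" using L R by metis
  next
    assume *: "\<forall>v \<in> V. counit Y (f v, f v) \<cdot> ev \<alpha> f 0 v = Id C I"
    show "?L = ?R"
      by (rule pushF_eqI[OF quiv_comp_hom[OF \<alpha> Y_counit] quiv_comp_hom[OF pFc pc]]) (metis L R *)
  qed
qed

lemma comult_iff:
  "comult Y k l \<cdot>\<^bsub>Quiv C S\<^esub> \<alpha> (k + l) = (\<alpha> k \<otimes>\<^bsub>Quiv C S\<^esub> \<alpha> l) \<cdot>\<^bsub>Quiv C S\<^esub>
      comult (push C V S f) (ObjF F k) (ObjF F l) \<cdot>\<^bsub>Quiv C S\<^esub> ArrF (push C V S f) (comult F k l) \<longleftrightarrow>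
    (\<forall>x \<in> simp K (k + l). comult Y k l (f (src K (k + l) x), f (tgt K (k + l) x)) \<cdot> ev \<alpha> f (k + l) x =
        qprod S (ObjF Y k) (ObjF Y l) (f (src K (k + l) x)) (f (tgt K (k + l) x)) (f (act K (seg 0 k (k + l)) x))
          (ev \<alpha> f k (front_face K k l x)) (ev \<alpha> f l (back_face K k l x)))" (is "?L = ?R \<longleftrightarrow> (\<forall>x \<in> _. ?P x = ?Q x)")
proof -
  let ?n = "k + l"
  note Fc = free.Y_comult[of k l, unfolded F_obj]
  note pFc = push_arr_hom[OF vp Fc] and pc = push_comult_hom[OF vp V_coprods S free_quiv_obj free_quiv_obj, of k l]
  note aa = qtens_hom[OF S \<alpha> \<alpha>, of k l]
  have L: "?L (f (src K ?n x), f (tgt K ?n x)) \<cdot> pgen f ?n x = ?P x" if x: "x \<in> simp K ?n" for x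
    unfolding ev_def by (rule quiv_comp_app'[OF Y_comult \<alpha> target_vertex_in[OF src_in[OF x]] target_vertex_in[OF tgt_in[OF x]] pgen_hom[OF x]])
  have R: "?R (f (src K ?n x), f (tgt K ?n x)) \<cdot> pgen f ?n x = ?Q x" if x: "x \<in> simp K ?n" for x
  proof -
    let ?s = "src K ?n x" and ?t = "tgt K ?n x" and ?m = "act K (seg 0 k ?n) x"
    note V' = src_in[OF x] tgt_in[OF x]
    have m: "?m \<in> V" using tgt_in[OF front_in[OF x]] by (simp add: tgt_front[OF x])
    note S' = target_vertex_in[OF V'(1)] target_vertex_in[OF V'(2)] target_vertex_in[OF m]
    note gf = gen_hom[OF front_in[OF x], unfolded src_front[OF x] tgt_front[OF x]]
      and gb = gen_hom[OF back_in[OF x], unfolded src_back[OF x] tgt_back[OF x]]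
      and pf = pgen_hom[OF front_in[OF x], unfolded src_front[OF x] tgt_front[OF x]]
      and pb = pgen_hom[OF back_in[OF x], unfolded src_back[OF x] tgt_back[OF x]]
    have "?R (f ?s, f ?t) \<cdot> pgen f ?n x = (\<alpha> k \<otimes>\<^bsub>Quiv C S\<^esub> \<alpha> l) (f ?s, f ?t) \<cdot>
        comult (push C V S f) (free_quiv C K k) (free_quiv C K l) (f ?s, f ?t) \<cdot>
        push_unit C V f (quiv_tens C V (free_quiv C K k) (free_quiv C K l)) (?s, ?t) \<cdot>
        qprod V (free_quiv C K k) (free_quiv C K l) ?s ?t ?m (gen k (front_face K k l x)) (gen l (back_face K k l x))"
      using quiv_comp_app'[OF aa quiv_comp_hom[OF pFc pc] S'(1,2) pgen_hom[OF x]] quiv_comp_app'[OF pc pFc S'(1,2) pgen_hom[OF x]]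
        push_arr_pgen[OF Fc x] free.e_comult[OF x]
      by (simp add: F_obj)
    also have "\<dots> = (\<alpha> k \<otimes>\<^bsub>Quiv C S\<^esub> \<alpha> l) (f ?s, f ?t) \<cdot> qprod S (pushF f k) (pushF f l) (f ?s) (f ?t) (f ?m)
        (pgen f k (front_face K k l x)) (pgen f l (back_face K k l x))"
      using push_comult_qprod[OF vp V_coprods S free_quiv_obj free_quiv_obj V' m gf gb]
      by (simp add: pgen_def src_front[OF x] tgt_front[OF x] src_back[OF x] tgt_back[OF x])
    also have "\<dots> = ?Q x"
      using qtens_qprod[OF S \<alpha> \<alpha> S' pf pb]
      by (simp add: ev_def src_front[OF x] tgt_front[OF x] src_back[OF x] tgt_back[OF x])
    finally show ?thesis .
  qed
  have R_hom: "?R \<in> hom (Quiv C S) (pushF f ?n) (quiv_tens C S (ObjF Y k) (ObjF Y l))"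
    using quiv_comp_hom[OF quiv_comp_hom[OF pFc pc] aa] by (simp only: F_obj)
  show ?thesis
  proof
    assume "?L = ?R"
    then show "\<forall>x \<in> simp K ?n. ?P x = ?Q x" using L R by metis
  next
    assume *: "\<forall>x \<in> simp K ?n. ?P x = ?Q x"
    show "?L = ?R"
      by (rule pushF_eqI[OF quiv_comp_hom[OF \<alpha> Y_comult] R_hom]) (metis L R *)
  qed
qed

lemma monoidal_nat_trans_iff:
  "is_monoidal_nat_trans (op_moncat Delta_f) (Quiv C S) (colax_comp (Quiv C S) (push C V S f) F) Y \<alpha> \<longleftrightarrow>
   is_family S Y K f (ev \<alpha> f)"
proof -
  have "ObjF (push C V S f) (ObjF F n) = pushF f n" for n by (simp add: push_def F_obj)
  then show ?thesis
    unfolding is_monoidal_nat_trans_def is_nat_trans_def is_family_def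
    using \<alpha> target_vertex_in ev_hom by (simp add: colax_comp_def nat_iff counit_iff comult_iff)
qed

end

text \<open>The two universal properties in turn: copairing the elements gives morphisms out of the
  free quivers, and transposing these gives morphisms out of the pushforwards.\<close>

lemma family_morphism_ex:
  assumes e: "is_family S Y K f e"
  shows "\<exists>\<alpha>. (\<forall>n. \<alpha> n \<in> hom (Quiv C S) (pushF f n) (ObjF Y n)) \<and> (\<forall>n. \<forall>x \<in> simp K n. ev \<alpha> f n x = e n x)"
proof (intro exI conjI allI ballI)
  interpret E: element_family C S Y K f e by unfold_locales (rule e)
  define g where "g n = (\<lambda>(a, b) \<in> V \<times> V. free_copair C (between n a b) (ObjF Y n (f a, f b)) (e n))" for n
  have eh: "e n x \<in> hom C I (ObjF Y n (f a, f b))" if "x \<in> between n a b" for n a b x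
    using that E.e_hom by (auto simp: simp_between_iff)
  have Yob: "ObjF Y n (f a, f b) \<in> Obj C" if "a \<in> V" "b \<in> V" for n a b
    using quiv_objD[OF Y_obj target_vertex_in[OF that(1)] target_vertex_in[OF that(2)]] .
  have g: "g n \<in> hom (Quiv C V) (free_quiv C K n) (pull V f (ObjF Y n))" for n
  proof (rule quiv_homI)
    fix a b assume ab: "a \<in> V" "b \<in> V"
    show "g n (a, b) \<in> hom C (free_quiv C K n (a, b)) (pull V f (ObjF Y n) (a, b))"
      using free_copair_hom[OF between_coprods Yob[OF ab] eh] ab by (simp add: g_def free_quiv_app)
  qed (auto simp: g_def)
  fix n
  let ?\<alpha> = "\<lambda>n. push_transpose C V S f (free_quiv C K n) (ObjF Y n) (g n)"
  show h: "?\<alpha> n \<in> hom (Quiv C S) (pushF f n) (ObjF Y n)" by (rule push_transpose_hom[OF vp g Y_obj])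
  fix x assume x: "x \<in> simp K n"
  note V' = src_in[OF x] tgt_in[OF x]
  have x': "x \<in> between n (src K n x) (tgt K n x)" using x by (simp add: simp_between_iff)
  have "ev ?\<alpha> f n x = g n (src K n x, tgt K n x) \<cdot> gen n x"
    using comp_assoc[OF gen_hom[OF x] push_unit_app_hom[OF vp free_quiv_obj V'] quiv_hom_app[OF h target_vertex_in[OF V'(1)] target_vertex_in[OF V'(2)]]]
      push_transpose_unit[OF vp g Y_obj V']
    by (simp add: ev_def pgen_def)
  then show "ev ?\<alpha> f n x = e n x"
    using free_copair_inj[OF between_coprods Yob[OF V'] eh x'] V' by (simp add: g_def gen_between[OF x'])
qed

end

text \<open>\<open>monoidal_nat_trans_iff\<close> presupposes the types of the
  \<open>\<alpha> n\<close>; they are recovered from \<open>is_nat_trans\<close>, which makes the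
  equivalence unconditional.\<close>

lemma templicial_hom_iff:
  "(\<alpha>, f) \<in> templicial_hom C (F_tilde C K) (Y, S) \<longleftrightarrow> f \<in> V \<rightarrow>\<^sub>E S \<and>
    (\<forall>n. \<alpha> n \<in> hom (Quiv C S) (pushF f n) (ObjF Y n)) \<and> is_family S Y K f (ev \<alpha> f)"
proof -
  have 1: "(\<alpha>, f) \<in> templicial_hom C (F_tilde C K) (Y, S) \<longleftrightarrow> f \<in> V \<rightarrow>\<^sub>E S \<and>
    is_monoidal_nat_trans (op_moncat Delta_f) (Quiv C S) (colax_comp (Quiv C S) (push C V S f) F) Y \<alpha>"
    by (subst F_tilde_eq) (simp add: templicial_hom_def)
  have 2: "\<forall>n. \<alpha> n \<in> hom (Quiv C S) (pushF f n) (ObjF Y n)"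
    if "is_monoidal_nat_trans (op_moncat Delta_f) (Quiv C S) (colax_comp (Quiv C S) (push C V S f) F) Y \<alpha>"
    using that by (simp add: is_monoidal_nat_trans_def is_nat_trans_def colax_comp_def push_def F_obj)
  have 3: "is_monoidal_nat_trans (op_moncat Delta_f) (Quiv C S) (colax_comp (Quiv C S) (push C V S f) F) Y \<alpha> \<longleftrightarrow>
      is_family S Y K f (ev \<alpha> f)"
    if "f \<in> V \<rightarrow>\<^sub>E S" "\<forall>n. \<alpha> n \<in> hom (Quiv C S) (pushF f n) (ObjF Y n)"
    by (rule monoidal_nat_trans_iff) (use that in auto)
  show ?thesis unfolding 1 using 2 3 by metis
qed

lemma templicial_hom_ex:
  assumes f: "f \<in> V \<rightarrow>\<^sub>E S" and e: "is_family S Y K f e"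
  shows "\<exists>\<alpha>. (\<alpha>, f) \<in> templicial_hom C (F_tilde C K) (Y, S) \<and> (\<forall>n. \<forall>x \<in> simp K n. ev \<alpha> f n x = e n x)"
proof -
  have f': "f \<in> V \<rightarrow> S" using f by auto
  obtain \<alpha> where \<alpha>: "\<And>n. \<alpha> n \<in> hom (Quiv C S) (pushF f n) (ObjF Y n)" and ev: "\<And>n x. x \<in> simp K n \<Longrightarrow> ev \<alpha> f n x = e n x"
    using family_morphism_ex[OF f' e] by blast
  have "is_family S Y K f (ev \<alpha> f)"
    using e unfolding is_family_def by (simp add: ev act_in Delta_f_arrD front_in back_in)
  then have "(\<alpha>, f) \<in> templicial_hom C (F_tilde C K) (Y, S)" using \<alpha> f by (simp add: templicial_hom_iff)
  then show ?thesis using ev by blast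
qed

lemma templicial_hom_eqI:
  assumes h: "(\<alpha>, f) \<in> templicial_hom C (F_tilde C K) (Y, S)" "(\<alpha>', f') \<in> templicial_hom C (F_tilde C K) (Y, S)"
    and v: "\<And>v. v \<in> V \<Longrightarrow> f v = f' v" and x: "\<And>n x. x \<in> simp K n \<Longrightarrow> ev \<alpha> f n x = ev \<alpha>' f' n x"
  shows "(\<alpha>, f) = (\<alpha>', f')"
proof -
  have f: "f \<in> V \<rightarrow>\<^sub>E S" "f' \<in> V \<rightarrow>\<^sub>E S" using h by (auto simp: templicial_hom_iff)
  have ff: "f = f'" by (rule PiE_ext[OF f v])
  have "\<alpha> n = \<alpha>' n" for n
    by (rule pushF_eqI[of f "\<alpha> n" n "ObjF Y n" "\<alpha>' n"]) (use h f ff x in \<open>auto simp: templicial_hom_iff ev_def\<close>)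
  then show ?thesis using ff by auto
qed

text \<open>Type and value are proved in one induction, because the value at \<open>d # ds\<close>
  is computed with the type at \<open>ds\<close>.\<close>

lemma tens_map_el:
  assumes f: "f \<in> V \<rightarrow> S" and \<alpha>: "\<And>n. \<alpha> n \<in> hom (Quiv C S) (pushF f n) (ObjF Y n)"
    and e: "is_family S Y K f e" and ev: "\<And>n x. x \<in> simp K n \<Longrightarrow> ev \<alpha> f n x = e n x"
  shows "tens_map C (F_tilde C K) (Y, S) (\<alpha>, f) ds \<in> hom (Quiv C V) (tens (Quiv C V) F ds) (pull V f (tens (Quiv C S) Y ds)) \<and>
    (\<forall>a b xs. chain K ds xs a b \<longrightarrow> tens_map C (F_tilde C K) (Y, S) (\<alpha>, f) ds (a, b) \<cdot> free.el b ds xs =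
      element_family.el C S Y K f e b ds xs)"
proof -
  interpret E: element_family C S Y K f e by unfold_locales (rule e)
  note vp' = vertex_pair_coprods f
  let ?a = "\<lambda>d. pull V f (\<alpha> d) \<cdot>\<^bsub>Quiv C V\<^esub> push_unit C V f (free_quiv C K d)"
  have pa: "pull V f (\<alpha> d) \<in> hom (Quiv C V) (pull V f (pushF f d)) (pull V f (ObjF Y d))" for d
    by (rule pull_hom[OF vp' \<alpha>])
  have a: "?a d \<in> hom (Quiv C V) (free_quiv C K d) (pull V f (ObjF Y d))" for d
    by (rule quiv_comp_hom[OF push_unit_hom[OF vp' free_quiv_obj] pa])
  have ae: "?a d (src K d x, tgt K d x) \<cdot> gen d x = e d x" if x: "x \<in> simp K d" for d x
    using quiv_comp_app'[OF pa push_unit_hom[OF vp' free_quiv_obj] src_in[OF x] tgt_in[OF x] gen_hom[OF x]]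
      ev[OF x] src_in[OF x] tgt_in[OF x]
    by (simp add: ev_def pgen_def)
  \<comment> \<open>The equations of \<open>tens_map\<close> match on explicit pairs; folding
    restores \<open>F_tilde C K\<close>.\<close>
  note tens_map_Nil = tens_map.simps(1)[of C F V Y S \<alpha> f, folded F_tilde_eq]
    and tens_map_Cons = tens_map.simps(2)[of C F V Y S \<alpha> f, folded F_tilde_eq]
  show ?thesis
  proof (induction ds)
    case Nil
    have "pull_one C V S f (b, b) \<cdot> Id C I = Id C I" if "b \<in> V" for b
      using that by (simp add: pull_one_def)
    then show ?case using pull_one_hom[OF vp'] by (auto simp: tens_map_Nil chain_Nil)
  next
    case (Cons d ds)
    show ?case
    proof (cases "ds = []")
      case True
      then show ?thesis using a[of d] ae[of _ d] by (auto simp: tens_map_Cons F_obj chain_Cons chain_Nil Let_def)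
    next
      case False
      let ?t = "tens_map C (F_tilde C K) (Y, S) (\<alpha>, f) ds"
      have eq: "tens_map C (F_tilde C K) (Y, S) (\<alpha>, f) (d # ds) =
        pull_mult C V S f (ObjF Y d) (T ds) \<cdot>\<^bsub>Quiv C V\<^esub> (?a d \<otimes>\<^bsub>Quiv C V\<^esub> ?t)"
        using False by (simp add: tens_map_Cons F_obj Let_def)
      have t: "?t \<in> hom (Quiv C V) (tens (Quiv C V) F ds) (pull V f (T ds))" using Cons by blast
      note at = qtens_hom[OF V_coprods a t, of d] and pm = pull_mult_hom[OF vp' V_coprods S Y_obj T_obj, of d ds]
      have el: "tens_map C (F_tilde C K) (Y, S) (\<alpha>, f) (d # ds) (a, b) \<cdot> free.el b (d # ds) xs = E.el b (d # ds) xs"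
        if "chain K (d # ds) xs a b" for a b xs
      proof -
        obtain y ys where xs: "xs = y # ys" and y: "y \<in> simp K d" "src K d y = a" and ys: "chain K ds ys (tgt K d y) b"
          using \<open>chain K (d # ds) xs a b\<close> by (auto simp: chain_Cons)
        have V': "a \<in> V" "b \<in> V" "tgt K d y \<in> V" using y src_in[OF y(1)] tgt_in[OF y(1)] chain_ends[OF ys] by auto
        note g = gen_hom[OF y(1), unfolded y(2)] and l = free.el_hom[OF ys] and ey = E.e_hom[OF y(1), unfolded y(2)] and eys = E.el_hom[OF ys]
        have ty: "?t (tgt K d y, b) \<cdot> free.el b ds ys = E.el b ds ys" using Cons ys by blast
        have "tens_map C (F_tilde C K) (Y, S) (\<alpha>, f) (d # ds) (a, b) \<cdot> free.el b (d # ds) xs =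
          pull_mult C V S f (ObjF Y d) (T ds) (a, b) \<cdot> qprod V (pull V f (ObjF Y d)) (pull V f (T ds)) a b (tgt K d y) (e d y) (E.el b ds ys)"
          unfolding eq using False y
            quiv_comp_app'[OF pm at V'(1,2) qprod_hom[OF V_coprods free_quiv_obj free.T_obj V' g l]]
            qtens_qprod[OF V_coprods a t V' g l] ae[OF y(1)] ty
          by (simp add: xs F_obj del: Quiv_comp_app)
        also have "\<dots> = E.el b (d # ds) xs"
          using pull_mult_qprod[OF vp' V_coprods S Y_obj T_obj V' ey eys] False y by (simp add: xs)
        finally show ?thesis .
      qed
      have "tens_map C (F_tilde C K) (Y, S) (\<alpha>, f) (d # ds) \<in>
          hom (Quiv C V) (tens (Quiv C V) F (d # ds)) (pull V f (T (d # ds)))"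
        unfolding eq using quiv_comp_hom[OF at pm] False by (simp add: F_obj)
      then show ?thesis using el by blast
    qed
  qed
qed

end

section \<open>Functoriality of families along maps of simplicial sets\<close>

locale free_object_map = free_object C K + L: free_object C L
  for C :: "('o, 'm, 'z) symcat_scheme" (structure) and K :: "'k sset" and L :: "'l sset" +
  fixes \<phi> :: "nat \<Rightarrow> 'k \<Rightarrow> 'l"
  assumes sset_map: "is_sset_map K L \<phi>"
begin

abbreviation r where "r \<equiv> restrict (\<phi> 0) V"

lemma \<phi>_in: "x \<in> simp K n \<Longrightarrow> \<phi> n x \<in> simp L n"
  using sset_map by (simp add: is_sset_map_def)

lemma \<phi>_act: "h \<in> Arr Delta \<Longrightarrow> x \<in> simp K (Cod Delta h) \<Longrightarrow> \<phi> (Dom Delta h) (act K h x) = act L h (\<phi> (Cod Delta h) x)"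
  using sset_map by (simp add: is_sset_map_def)

lemma \<phi>_src: "x \<in> simp K n \<Longrightarrow> \<phi> 0 (src K n x) = src L n (\<phi> n x)"
  and \<phi>_tgt: "x \<in> simp K n \<Longrightarrow> \<phi> 0 (tgt K n x) = tgt L n (\<phi> n x)"
  and \<phi>_front: "x \<in> simp K (k + l) \<Longrightarrow> \<phi> k (front_face K k l x) = front_face L k l (\<phi> (k + l) x)"
  and \<phi>_back: "x \<in> simp K (k + l) \<Longrightarrow> \<phi> l (back_face K k l x) = back_face L k l (\<phi> (k + l) x)"
  and \<phi>_mid: "x \<in> simp K (k + l) \<Longrightarrow> \<phi> 0 (act K (seg 0 k (k + l)) x) = act L (seg 0 k (k + l)) (\<phi> (k + l) x)"
  using \<phi>_act[of "seg 0 0 n" x] \<phi>_act[of "seg 0 n n" x] \<phi>_act[of "seg k 0 (k + l)" x] \<phi>_act[of "seg l k (k + l)" x]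
    \<phi>_act[of "seg 0 k (k + l)" x]
  by (simp_all add: src_def tgt_def front_face_def back_face_def)

lemma r_in: "v \<in> V \<Longrightarrow> r v \<in> L.V"
  by (simp add: \<phi>_in)

lemma r_Pi: "r \<in> V \<rightarrow> L.V"
  by (rule Pi_I) (rule r_in)

lemma r_src: "x \<in> simp K n \<Longrightarrow> r (src K n x) = src L n (\<phi> n x)"
  and r_tgt: "x \<in> simp K n \<Longrightarrow> r (tgt K n x) = tgt L n (\<phi> n x)"
  by (simp_all add: src_in tgt_in \<phi>_src \<phi>_tgt)

definition \<rho> where "\<rho> n = fst (F_tilde_map C K L \<phi>) n"

lemma F_tilde_map_eq: "F_tilde_map C K L \<phi> = (\<rho>, r)"
  unfolding \<rho>_def by (simp add: F_tilde_map_def Let_def)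

sublocale KL: free_object_target C K L.V L.F
  by unfold_locales

lemma
  shows \<rho>_hom: "\<rho> n \<in> hom (Quiv C L.V) (push_obj C V L.V r (free_quiv C K n)) (free_quiv C L n)"
    and \<rho>_gen: "x \<in> simp K n \<Longrightarrow> \<rho> n (r (src K n x), r (tgt K n x)) \<cdot>
      push_unit C V r (free_quiv C K n) (src K n x, tgt K n x) \<cdot> gen n x = L.gen n (\<phi> n x)"
proof -
  let ?g = "\<lambda>(a, b) \<in> V \<times> V. free_map C (between n a b) (simp_between L n (r a) (r b)) (\<phi> n)"
  note vp' = vertex_pair_coprods r_Pi
  have \<rho>: "\<rho> n = push_transpose C V L.V r (free_quiv C K n) (free_quiv C L n) ?g"
    by (simp add: \<rho>_def F_tilde_map_def Let_def)
  have b: "\<phi> n x \<in> simp_between L n (r a) (r b)" if "x \<in> between n a b" for x a b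
    using that r_src[of x n] r_tgt[of x n] by (auto simp: simp_between_iff \<phi>_in)
  have i: "free_inj C (simp_between L n (r a) (r b)) (\<phi> n x) \<in> hom C I (free_obj C (simp_between L n (r a) (r b)))"
    if "x \<in> between n a b" for x a b
    by (rule free_inj_hom[OF L.between_coprods b[OF that]])
  have g: "?g \<in> hom (Quiv C V) (free_quiv C K n) (pull V r (free_quiv C L n))"
  proof (rule quiv_homI)
    fix a b assume ab: "a \<in> V" "b \<in> V"
    show "?g (a, b) \<in> hom C (free_quiv C K n (a, b)) (pull V r (free_quiv C L n) (a, b))"
    proof -
      have "free_map C (between n a b) (simp_between L n (r a) (r b)) (\<phi> n) \<in>
          hom C (free_obj C (between n a b)) (free_obj C (simp_between L n (r a) (r b)))"
        unfolding free_map_def by (rule free_copair_hom[OF between_coprods free_obj_obj[OF L.between_coprods]]) (rule i)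
      then show ?thesis
        using ab L.free_quiv_app[OF r_in[OF ab(1)] r_in[OF ab(2)]] by (simp add: free_quiv_app)
    qed
  qed auto
  show h: "\<rho> n \<in> hom (Quiv C L.V) (push_obj C V L.V r (free_quiv C K n)) (free_quiv C L n)"
    unfolding \<rho> by (rule push_transpose_hom[OF vp' g L.free_quiv_obj])
  show "\<rho> n (r (src K n x), r (tgt K n x)) \<cdot> push_unit C V r (free_quiv C K n) (src K n x, tgt K n x) \<cdot> gen n x = L.gen n (\<phi> n x)"
    if x: "x \<in> simp K n"
  proof -
    note V' = src_in[OF x] tgt_in[OF x]
    have x': "x \<in> between n (src K n x) (tgt K n x)" using x by (simp add: simp_between_iff)
    have "\<rho> n (r (src K n x), r (tgt K n x)) \<cdot> push_unit C V r (free_quiv C K n) (src K n x, tgt K n x) \<cdot> gen n x =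
      ?g (src K n x, tgt K n x) \<cdot> gen n x"
      using comp_assoc[OF gen_hom[OF x] push_unit_app_hom[OF vp' free_quiv_obj V'] quiv_hom_app[OF h r_in[OF V'(1)] r_in[OF V'(2)]]]
        push_transpose_unit[OF vp' g L.free_quiv_obj V']
      unfolding \<rho> by simp
    also have "\<dots> = free_copair C (between n (src K n x) (tgt K n x)) (free_obj C (simp_between L n (r (src K n x)) (r (tgt K n x))))
        (\<lambda>x'. free_inj C (simp_between L n (r (src K n x)) (r (tgt K n x))) (\<phi> n x')) \<cdot> free_inj C (between n (src K n x) (tgt K n x)) x"
      using V' by (simp add: free_map_def gen_between[OF x'])
    also have "\<dots> = free_inj C (simp_between L n (r (src K n x)) (r (tgt K n x))) (\<phi> n x)"
      by (rule free_copair_inj[OF between_coprods free_obj_obj[OF L.between_coprods] _ x']) (rule i)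
    also have "\<dots> = L.gen n (\<phi> n x)" by (rule sym[OF L.gen_between[OF b[OF x']]])
    finally show ?thesis .
  qed
qed

lemma ev_\<rho>: "x \<in> simp K n \<Longrightarrow> KL.ev \<rho> r n x = L.gen n (\<phi> n x)"
  unfolding KL.ev_def KL.pgen_def by (rule \<rho>_gen)

text \<open>Source, target, faces and degeneracies commute with \<open>\<phi>\<close>, so each
  condition at \<open>x\<close> is the same condition at \<open>\<phi> n x\<close>.\<close>

lemma is_family_pullback:
  assumes e: "is_family S Y L g e"
    and f: "\<And>v. v \<in> V \<Longrightarrow> f v = g (\<phi> 0 v)" and e': "\<And>n x. x \<in> simp K n \<Longrightarrow> e' n x = e n (\<phi> n x)"
  shows "is_family S Y K f e'"
  unfolding is_family_def
proof (intro conjI allI ballI)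
  show "f v \<in> S" if "v \<in> V" for v using e f[OF that] \<phi>_in[OF that] by (simp add: is_family_def)
  have fs: "f (src K n x) = g (src L n (\<phi> n x))" and ft: "f (tgt K n x) = g (tgt L n (\<phi> n x))" if "x \<in> simp K n" for n x
    using f[OF src_in[OF that]] f[OF tgt_in[OF that]] by (simp_all add: \<phi>_src[OF that] \<phi>_tgt[OF that])
  show "e' n x \<in> hom C I (ObjF Y n (f (src K n x), f (tgt K n x)))" if "x \<in> simp K n" for n x
    using e \<phi>_in[OF that] unfolding e'[OF that] fs[OF that] ft[OF that] by (simp add: is_family_def)
  show "counit Y (f v, f v) \<cdot> e' 0 v = Id C I" if "v \<in> V" for v
    using e \<phi>_in[OF that] f[OF that] by (simp add: is_family_def e'[OF that])
  show "ArrF Y h (f (src K (Cod Delta h) x), f (tgt K (Cod Delta h) x)) \<cdot> e' (Cod Delta h) x = e' (Dom Delta h) (act K h x)"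
    if h: "h \<in> Arr Delta_f" and x: "x \<in> simp K (Cod Delta h)" for h x
    using e \<phi>_in[OF x] h unfolding e'[OF x] e'[OF act_in[OF Delta_f_arrD[OF h] x]] fs[OF x] ft[OF x]
    by (simp add: is_family_def \<phi>_act[OF Delta_f_arrD[OF h] x])
  show "comult Y k l (f (src K (k + l) x), f (tgt K (k + l) x)) \<cdot> e' (k + l) x =
        qprod S (ObjF Y k) (ObjF Y l) (f (src K (k + l) x)) (f (tgt K (k + l) x)) (f (act K (seg 0 k (k + l)) x))
          (e' k (front_face K k l x)) (e' l (back_face K k l x))" if x: "x \<in> simp K (k + l)" for k l x
  proof -
    have m: "f (act K (seg 0 k (k + l)) x) = g (act L (seg 0 k (k + l)) (\<phi> (k + l) x))"
      using f[OF tgt_in[OF front_in[OF x]]] by (simp add: tgt_front[OF x] \<phi>_mid[OF x])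
    show ?thesis
      using e \<phi>_in[OF x] unfolding e'[OF x] e'[OF front_in[OF x]] e'[OF back_in[OF x]] fs[OF x] ft[OF x] m \<phi>_front[OF x] \<phi>_back[OF x]
      by (simp add: is_family_def)
  qed
qed

text \<open>On families, composing with \<open>F_tilde_map\<close> is reindexing along
  \<open>\<phi>\<close>. The simplicial structure of \<open>U_tilde\<close> rests on this: its
  identities become identities between simplices.\<close>

lemma templicial_comp_hom:
  fixes S :: "'s set"
  assumes Y: "colax_quiver C S Y" and \<beta>: "(\<beta>, g) \<in> templicial_hom C (F_tilde C L) (Y, S)"
    and comp: "templicial_comp C (F_tilde C K) L.V S (F_tilde_map C K L \<phi>) (\<beta>, g) = (\<gamma>, f)"
  shows "(\<gamma>, f) \<in> templicial_hom C (F_tilde C K) (Y, S)"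
    and "v \<in> V \<Longrightarrow> f v = g (\<phi> 0 v)"
    and "x \<in> simp K n \<Longrightarrow> free_object_target.ev C K \<gamma> f n x = free_object_target.ev C L \<beta> g n (\<phi> n x)"
proof -
  interpret Y: colax_quiver C S Y by (rule Y)
  interpret KY: free_object_target C K S Y by unfold_locales
  interpret LY: free_object_target C L S Y by unfold_locales
  have g: "g \<in> L.V \<rightarrow>\<^sub>E S" and \<beta>h: "\<And>n. \<beta> n \<in> hom (Quiv C S) (LY.pushF g n) (ObjF Y n)" and fam: "is_family S Y L g (LY.ev \<beta> g)"
    using \<beta> by (auto simp: LY.templicial_hom_iff)
  have gS: "g \<in> L.V \<rightarrow> S" and g': "\<And>v. v \<in> L.V \<Longrightarrow> g v \<in> S" using g by auto
  have f_eq: "f = compose V g r"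
    and \<gamma>_eq: "\<gamma> n = \<beta> n \<cdot>\<^bsub>Quiv C S\<^esub> ArrF (push C L.V S g) (\<rho> n) \<cdot>\<^bsub>Quiv C S\<^esub> push_push C V L.V S r g (free_quiv C K n)" for n
    using comp by (auto simp: templicial_comp_def case_prod_beta F_tilde_map_eq F_obj snd_F_tilde)
  have f_app: "f v = g (r v)" if "v \<in> V" for v using that by (simp add: f_eq compose_def)
  have f': "f v \<in> S" if "v \<in> V" for v using f_app[OF that] g'[OF r_in[OF that]] by simp
  then have fS: "f \<in> V \<rightarrow> S" by (rule Pi_I)
  note vpr = vertex_pair_coprods r_Pi and vpf = vertex_pair_coprods fS and vpg = L.vertex_pair_coprods gS
  let ?P = "\<lambda>n. push_obj C V L.V r (free_quiv C K n)"
  have P: "?P n \<in> Obj (Quiv C L.V)" for n by (rule push_obj_obj[OF vpr free_quiv_obj])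
  have pP: "push_obj C L.V S g (?P n) \<in> Obj (Quiv C S)" for n by (rule push_obj_obj[OF vpg P])
  let ?h = "\<lambda>n. pull V r (push_unit C L.V g (?P n)) \<cdot>\<^bsub>Quiv C V\<^esub> push_unit C V r (free_quiv C K n)"
  have hr: "pull V r (push_unit C L.V g (?P n)) \<in> hom (Quiv C V) (pull V r (?P n)) (pull V r (pull L.V g (push_obj C L.V S g (?P n))))" for n
    by (rule pull_hom[OF vpr push_unit_hom[OF vpg P]])
  \<comment> \<open>\<open>pull\<close> yields extensional functions, so pulling back in two steps
    equals pulling back along the composite on the nose.\<close>
  have "pull V r (pull L.V g (push_obj C L.V S g (?P n))) = pull V f (push_obj C L.V S g (?P n))" for n
    by (rule extensionalityI[of _ "V \<times> V"]) (use r_in f_app in \<open>auto simp del: restrict_apply restrict_apply'\<close>)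
  note hr' = hr[unfolded this]
  have h: "?h n \<in> hom (Quiv C V) (free_quiv C K n) (pull V f (push_obj C L.V S g (?P n)))" for n
    by (rule quiv_comp_hom[OF push_unit_hom[OF vpr free_quiv_obj] hr'])
  have pp_eq: "push_push C V L.V S r g (free_quiv C K n) = push_transpose C V S f (free_quiv C K n) (push_obj C L.V S g (?P n)) (?h n)" for n
    by (simp add: push_push_def f_eq)
  have pp: "push_push C V L.V S r g (free_quiv C K n) \<in> hom (Quiv C S) (KY.pushF f n) (push_obj C L.V S g (?P n))" for n
    unfolding pp_eq by (rule push_transpose_hom[OF vpf h pP])
  have p\<rho>: "ArrF (push C L.V S g) (\<rho> n) \<in> hom (Quiv C S) (push_obj C L.V S g (?P n)) (LY.pushF g n)" for n
    by (rule push_arr_hom[OF vpg \<rho>_hom])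
  have \<gamma>h: "\<gamma> n \<in> hom (Quiv C S) (KY.pushF f n) (ObjF Y n)" for n
    unfolding \<gamma>_eq by (rule quiv_comp_hom[OF quiv_comp_hom[OF pp p\<rho>] \<beta>h])
  show fv: "f v = g (\<phi> 0 v)" if "v \<in> V" for v using f_app[OF that] that by simp
  show ev: "KY.ev \<gamma> f n x = LY.ev \<beta> g n (\<phi> n x)" if x: "x \<in> simp K n" for n x
  proof -
    let ?s = "src K n x" and ?t = "tgt K n x"
    note V' = src_in[OF x] tgt_in[OF x] and x' = \<phi>_in[OF x]
    note rV = r_in[OF V'(1)] r_in[OF V'(2)]
    have fs: "f ?s = g (r ?s)" "f ?t = g (r ?t)" using f_app V' by auto
    note S' = f'[OF V'(1)] f'[OF V'(2)]
    note u = push_unit_app_hom[OF vpr free_quiv_obj V', of n]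
      and ug = push_unit_app_hom[OF vpg P rV, of n] and ul = push_unit_app_hom[OF vpg L.free_quiv_obj rV, of n]
    have ugen: "push_unit C V r (free_quiv C K n) (?s, ?t) \<cdot> gen n x \<in> hom C I (?P n (r ?s, r ?t))"
      by (rule comp_hom[OF gen_hom[OF x] u])
    have \<rho>a: "\<rho> n (r ?s, r ?t) \<in> hom C (?P n (r ?s, r ?t)) (free_quiv C L n (r ?s, r ?t))"
      by (rule quiv_hom_app[OF \<rho>_hom rV])
    have p\<rho>a: "ArrF (push C L.V S g) (\<rho> n) (g (r ?s), g (r ?t)) \<in> hom C (push_obj C L.V S g (?P n) (g (r ?s), g (r ?t))) (LY.pushF g n (g (r ?s), g (r ?t)))"
      using quiv_hom_app[OF p\<rho> S'] by (simp add: fs del: restrict_apply)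
    have "push_push C V L.V S r g (free_quiv C K n) (f ?s, f ?t) \<cdot> KY.pgen f n x =
      (push_push C V L.V S r g (free_quiv C K n) (f ?s, f ?t) \<cdot> push_unit C V f (free_quiv C K n) (?s, ?t)) \<cdot> gen n x"
      unfolding KY.pgen_def
      using comp_assoc[OF gen_hom[OF x] push_unit_app_hom[OF vpf free_quiv_obj V'] quiv_hom_app[OF pp S']] by simp
    also have "\<dots> = ?h n (?s, ?t) \<cdot> gen n x"
      unfolding pp_eq by (simp only: push_transpose_unit[OF vpf h pP V'])
    also have "\<dots> = push_unit C L.V g (?P n) (r ?s, r ?t) \<cdot> push_unit C V r (free_quiv C K n) (?s, ?t) \<cdot> gen n x"
      using quiv_comp_app'[OF hr' push_unit_hom[OF vpr free_quiv_obj] V' gen_hom[OF x]] V'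
      by (simp del: Quiv_comp_app restrict_apply)
    finally have 1: "push_push C V L.V S r g (free_quiv C K n) (f ?s, f ?t) \<cdot> KY.pgen f n x =
      push_unit C L.V g (?P n) (r ?s, r ?t) \<cdot> push_unit C V r (free_quiv C K n) (?s, ?t) \<cdot> gen n x" .
    have "KY.ev \<gamma> f n x = \<beta> n (f ?s, f ?t) \<cdot> ArrF (push C L.V S g) (\<rho> n) (f ?s, f ?t) \<cdot>
        push_push C V L.V S r g (free_quiv C K n) (f ?s, f ?t) \<cdot> KY.pgen f n x"
      unfolding KY.ev_def \<gamma>_eq
      using quiv_comp_app'[OF \<beta>h quiv_comp_hom[OF pp p\<rho>] S' KY.pgen_hom[OF fS x]] quiv_comp_app'[OF p\<rho> pp S' KY.pgen_hom[OF fS x]]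
      by simp
    also have "\<dots> = \<beta> n (f ?s, f ?t) \<cdot> (ArrF (push C L.V S g) (\<rho> n) (g (r ?s), g (r ?t)) \<cdot> push_unit C L.V g (?P n) (r ?s, r ?t)) \<cdot>
        push_unit C V r (free_quiv C K n) (?s, ?t) \<cdot> gen n x"
      unfolding 1 comp_assoc[OF ugen ug p\<rho>a] by (simp only: fs)
    \<comment> \<open>Naturality of the unit for \<open>g\<close> moves \<open>\<rho> n\<close> next
      to the generator at \<open>x\<close>, which \<open>\<rho>_gen\<close> then sends to the
      generator at its image.\<close>
    also have "\<dots> = \<beta> n (f ?s, f ?t) \<cdot> push_unit C L.V g (free_quiv C L n) (r ?s, r ?t) \<cdot> L.gen n (\<phi> n x)"
      unfolding push_arr_unit[OF vpg \<rho>_hom rV] using comp_assoc[OF ugen \<rho>a ul] \<rho>_gen[OF x] by simp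
    also have "\<dots> = LY.ev \<beta> g n (\<phi> n x)"
      unfolding LY.ev_def LY.pgen_def fs r_src[OF x] r_tgt[OF x] by (rule refl)
    finally show ?thesis .
  qed
  have "is_family S Y K f (KY.ev \<gamma> f)" by (rule is_family_pullback[OF fam fv ev])
  moreover have "f \<in> V \<rightarrow>\<^sub>E S" using f' by (auto simp: f_eq compose_def)
  ultimately show "(\<gamma>, f) \<in> templicial_hom C (F_tilde C K) (Y, S)" using \<gamma>h by (simp add: KY.templicial_hom_iff)
qed

end

section \<open>Unit coherence for quivers\<close>

text \<open>The mirror image of \<open>lunit_tens\<close>: after tensoring with I on the right, the
  pentagon for a, b, I, I applies, with the triangle used both for b and for
  \<open>a \<odot> b\<close>.\<close>

lemma (in monoidal_category) runit_tens:
  assumes a: "a \<in> Obj C" and b: "b \<in> Obj C"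
  shows "(Id C a \<otimes> RUnit C b) \<cdot> Assoc C a b I = RUnit C (a \<odot> b)"
proof (rule tens_unit_faithful)
  let ?\<alpha> = "Assoc C a b I"
  have "?\<alpha> \<cdot> (((Id C a \<otimes> RUnit C b) \<cdot> ?\<alpha>) \<otimes> Id C I) = (?\<alpha> \<cdot> ((Id C a \<otimes> RUnit C b) \<otimes> Id C I)) \<cdot> (?\<alpha> \<otimes> Id C I)"
    using a b by simp
  also have "\<dots> = (Id C a \<otimes> (RUnit C b \<otimes> Id C I)) \<cdot> Assoc C a (b \<odot> I) I \<cdot> (?\<alpha> \<otimes> Id C I)"
    using a b assoc_nat'[of "Id C a" "RUnit C b" "Id C I"] by simp
  also have "\<dots> = (Id C a \<otimes> (Id C b \<otimes> LUnit C I)) \<cdot> (Id C a \<otimes> Assoc C b I I) \<cdot> Assoc C a (b \<odot> I) I \<cdot> (?\<alpha> \<otimes> Id C I)"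
    using a b triangle[of b I] by simp
  also have "\<dots> = ((Id C a \<otimes> (Id C b \<otimes> LUnit C I)) \<cdot> Assoc C a b (I \<odot> I)) \<cdot> Assoc C (a \<odot> b) I I"
    using a b by (subst pentagon) auto
  also have "\<dots> = (?\<alpha> \<cdot> (Id C (a \<odot> b) \<otimes> LUnit C I)) \<cdot> Assoc C (a \<odot> b) I I"
    using a b assoc_nat'[of "Id C a" "Id C b" "LUnit C I", symmetric] by (simp del: assoc)
  also have "\<dots> = ?\<alpha> \<cdot> (RUnit C (a \<odot> b) \<otimes> Id C I)"
    using a b triangle[of "a \<odot> b" I] by simp
  finally show "((Id C a \<otimes> RUnit C b) \<cdot> ?\<alpha>) \<otimes> Id C I = RUnit C (a \<odot> b) \<otimes> Id C I"
    using a b by (rule_tac iso_mono[of ?\<alpha>]) auto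
qed (use a b in auto)

context enriching_category
begin

context
  fixes S :: "'s set" and Q P :: "'s \<times> 's \<Rightarrow> 'o"
  assumes S: "has_coprods C S" and Q: "Q \<in> Obj (Quiv C S)" and P: "P \<in> Obj (Quiv C S)"
begin

text \<open>The components of \<open>Q\<close> and \<open>P\<close> are arbitrary objects, which
  elements need not detect. The identity is therefore reduced summand by summand to
  \<open>runit_tens\<close>: \<open>qrunit_eqI\<close> leaves the unit summand at \<open>b\<close>,
  and the injections of the other factor are cancelled by closedness.\<close>

lemma qrunit_tens:
  "(Id (Quiv C S) Q \<otimes>\<^bsub>Quiv C S\<^esub> RUnit (Quiv C S) P) \<cdot>\<^bsub>Quiv C S\<^esub> Assoc (Quiv C S) Q P (quiv_unit C S) =
   RUnit (Quiv C S) (quiv_tens C S Q P)" (is "?l \<cdot>\<^bsub>_\<^esub> ?A = ?r")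
proof -
  let ?U = "quiv_unit C S"
  note U = quiv_unit_obj[of S] and QP = quiv_tens_obj[OF S Q P]
  note l = qtens_hom[OF S quiv_id_hom[OF Q] qrunit_hom[OF S P]] and A = qassoc_hom[OF S Q P U] and r = qrunit_hom[OF S QP]
  show ?thesis
  proof (rule quiv_hom_eqI[OF quiv_comp_hom[OF A l] r])
    fix a b assume ab: "a \<in> S" "b \<in> S"
    note la = quiv_hom_app[OF l ab] and Aa = quiv_hom_app[OF A ab] and ra = quiv_hom_app[OF r ab]
    note i = quiv_inj_hom[OF S QP U ab ab(2)]
    note lA = comp_hom[OF Aa la]
    have "?l (a, b) \<cdot> ?A (a, b) = ?r (a, b)"
    proof (rule qrunit_eqI[OF S QP ab lA ra])
      show "(?l (a, b) \<cdot> ?A (a, b)) \<cdot> quiv_inj C S (quiv_tens C S Q P) ?U a b b =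
        ?r (a, b) \<cdot> quiv_inj C S (quiv_tens C S Q P) ?U a b b"
      proof (rule tens_left_cancel[OF quiv_objD[OF QP ab] quiv_objD[OF U ab(2) ab(2)] _ _ comp_hom[OF i lA] comp_hom[OF i ra],
            where A = S and x = "\<lambda>d. quiv_inj C S Q P a b d"])
        show "quiv_inj C S Q P a b d \<in> hom C (Q (a, d) \<odot> P (d, b)) (quiv_tens C S Q P (a, b))" if "d \<in> S" for d
          by (rule quiv_inj_hom[OF S Q P ab that])
        show "k = k'" if "k \<in> hom C (quiv_tens C S Q P (a, b)) z" "k' \<in> hom C (quiv_tens C S Q P (a, b)) z"
          "\<And>d. d \<in> S \<Longrightarrow> k \<cdot> quiv_inj C S Q P a b d = k' \<cdot> quiv_inj C S Q P a b d" for k k' z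
          by (rule quiv_tens_eqI[OF S Q P ab that])
        fix d assume d: "d \<in> S"
        let ?i = "quiv_inj C S (quiv_tens C S Q P) ?U a b b" and ?j = "quiv_inj C S Q P a b d \<otimes> Id C (?U (b, b))"
          and ?k = "quiv_inj C S Q (quiv_tens C S P ?U) a b d" and ?m = "Id C (Q (a, d)) \<otimes> quiv_inj C S P ?U d b b"
          and ?\<alpha> = "Assoc C (Q (a, d)) (P (d, b)) (?U (b, b))"
        note ob = quiv_objD[OF Q ab(1) d] quiv_objD[OF P d ab(2)] quiv_objD[OF U ab(2) ab(2)]
        note j0 = quiv_inj_hom[OF S Q P ab d]
        note j = tens_hom[OF j0 id_hom[OF ob(3)]]
        note k = quiv_inj_hom[OF S Q quiv_tens_obj[OF S P U] ab d]
          and m = tens_hom[OF id_hom[OF ob(1)] quiv_inj_hom[OF S P U d ab(2) ab(2)]] and \<alpha> = assoc_hom[OF ob]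
        note pr = qrunit_app_hom[OF S P d ab(2)]
        have "((?l (a, b) \<cdot> ?A (a, b)) \<cdot> ?i) \<cdot> ?j = ?l (a, b) \<cdot> (?A (a, b) \<cdot> ?i \<cdot> ?j)"
          by (simp only: comp_assoc[OF i Aa la] comp_assoc[OF j comp_hom[OF i Aa] la] comp_assoc[OF j i Aa])
        also have "\<dots> = ?l (a, b) \<cdot> ?k \<cdot> ?m \<cdot> ?\<alpha>"
          by (simp only: qassoc_inj[OF S Q P U ab ab(2) d])
        also have "\<dots> = (?l (a, b) \<cdot> ?k) \<cdot> ?m \<cdot> ?\<alpha>"
          by (rule sym[OF comp_assoc[OF comp_hom[OF \<alpha> m] k la]])
        also have "\<dots> = (quiv_inj C S Q P a b d \<cdot> (Id C (Q (a, d)) \<otimes> RUnit (Quiv C S) P (d, b))) \<cdot> ?m \<cdot> ?\<alpha>"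
          using qtens_inj[OF S quiv_id_hom[OF Q] qrunit_hom[OF S P] ab d] ab d by simp
        also have "\<dots> = quiv_inj C S Q P a b d \<cdot> (Id C (Q (a, d)) \<otimes> (RUnit (Quiv C S) P (d, b) \<cdot> quiv_inj C S P ?U d b b)) \<cdot> ?\<alpha>"
          using j0 ob pr m \<alpha> quiv_inj_hom[OF S P U d ab(2) ab(2)] by (simp add: hom_iff)
        also have "\<dots> = quiv_inj C S Q P a b d \<cdot> RUnit C (Q (a, d) \<odot> P (d, b))"
          unfolding qrunit_inj[OF S P d ab(2)] quiv_unit_app[OF ab(2)] runit_tens[OF ob(1,2)] by (rule refl)
        also have "\<dots> = RUnit C (quiv_tens C S Q P (a, b)) \<cdot> ?j"
          using runit_nat[OF j0] ab by simp
        also have "\<dots> = (?r (a, b) \<cdot> ?i) \<cdot> ?j"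
          by (simp only: qrunit_inj[OF S QP ab])
        finally show "((?l (a, b) \<cdot> ?A (a, b)) \<cdot> ?i) \<cdot> ?j = (?r (a, b) \<cdot> ?i) \<cdot> ?j" .
      qed
    qed
    then show "(?l \<cdot>\<^bsub>Quiv C S\<^esub> ?A) (a, b) = ?r (a, b)" using ab by simp
  qed
qed

end

lemma qtriangle_unit:
  assumes S: "has_coprods C S" and Q: "Q \<in> Obj (Quiv C S)"
  shows
  "(Id (Quiv C S) Q \<otimes>\<^bsub>Quiv C S\<^esub> LUnit (Quiv C S) (quiv_unit C S)) \<cdot>\<^bsub>Quiv C S\<^esub> Assoc (Quiv C S) Q (quiv_unit C S) (quiv_unit C S) =
   RUnit (Quiv C S) Q \<otimes>\<^bsub>Quiv C S\<^esub> Id (Quiv C S) (quiv_unit C S)" (is "?l \<cdot>\<^bsub>_\<^esub> ?A = ?r")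
proof -
  let ?U = "quiv_unit C S"
  note U = quiv_unit_obj[of S] and QU = quiv_tens_obj[OF S Q quiv_unit_obj]
  note l = qtens_hom[OF S quiv_id_hom[OF Q] qlunit_hom[OF S U]] and A = qassoc_hom[OF S Q U U]
    and r = qtens_hom[OF S qrunit_hom[OF S Q] quiv_id_hom[OF U]]
  show ?thesis
  proof (rule quiv_hom_eqI[OF quiv_comp_hom[OF A l] r])
    fix a b assume ab: "a \<in> S" "b \<in> S"
    note la = quiv_hom_app[OF l ab] and Aa = quiv_hom_app[OF A ab] and ra = quiv_hom_app[OF r ab]
    note i = quiv_inj_hom[OF S QU U ab ab(2)]
    note lA = comp_hom[OF Aa la]
    have "?l (a, b) \<cdot> ?A (a, b) = ?r (a, b)"
    proof (rule qrunit_eqI[OF S QU ab lA ra])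
      show "(?l (a, b) \<cdot> ?A (a, b)) \<cdot> quiv_inj C S (quiv_tens C S Q ?U) ?U a b b =
        ?r (a, b) \<cdot> quiv_inj C S (quiv_tens C S Q ?U) ?U a b b"
      \<comment> \<open>By \<open>qrunit_eqI\<close> the single injection at \<open>b\<close> is
        already jointly epimorphic on this tensor product, whence the one-element index set.\<close>
      proof (rule tens_left_cancel[OF quiv_objD[OF QU ab] quiv_objD[OF U ab(2) ab(2)] _ _ comp_hom[OF i lA] comp_hom[OF i ra],
            where A = "{b}" and x = "\<lambda>d. quiv_inj C S Q ?U a b d" and d = "\<lambda>d. Q (a, d) \<odot> ?U (d, b)"])
        show "quiv_inj C S Q ?U a b d \<in> hom C (Q (a, d) \<odot> ?U (d, b)) (quiv_tens C S Q ?U (a, b))" if "d \<in> {b}" for d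
          by (rule quiv_inj_hom[OF S Q U ab]) (use that ab in simp)
        show "k = k'" if "k \<in> hom C (quiv_tens C S Q ?U (a, b)) z" "k' \<in> hom C (quiv_tens C S Q ?U (a, b)) z"
          "\<And>d. d \<in> {b} \<Longrightarrow> k \<cdot> quiv_inj C S Q ?U a b d = k' \<cdot> quiv_inj C S Q ?U a b d" for k k' z
          by (rule qrunit_eqI[OF S Q ab that(1,2)]) (use that(3) in simp)
        fix d assume "d \<in> {b}"
        then have d: "d = b" by simp
        let ?i = "quiv_inj C S (quiv_tens C S Q ?U) ?U a b b" and ?j = "quiv_inj C S Q ?U a b b \<otimes> Id C (?U (b, b))"
          and ?k = "quiv_inj C S Q (quiv_tens C S ?U ?U) a b b" and ?m = "Id C (Q (a, b)) \<otimes> quiv_inj C S ?U ?U b b b"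
          and ?\<alpha> = "Assoc C (Q (a, b)) (?U (b, b)) (?U (b, b))"
        note ob = quiv_objD[OF Q ab] quiv_objD[OF U ab(2) ab(2)]
        note j0 = quiv_inj_hom[OF S Q U ab ab(2)]
        note j = tens_hom[OF j0 id_hom[OF ob(2)]]
        note k = quiv_inj_hom[OF S Q quiv_tens_obj[OF S U U] ab ab(2)]
          and m = tens_hom[OF id_hom[OF ob(1)] quiv_inj_hom[OF S U U ab(2) ab(2) ab(2)]] and \<alpha> = assoc_hom[OF ob(1,2,2)]
        note pl = qlunit_app_hom[OF S U ab(2) ab(2)] and pr = qrunit_app_hom[OF S Q ab]
        have "((?l (a, b) \<cdot> ?A (a, b)) \<cdot> ?i) \<cdot> ?j = ?l (a, b) \<cdot> (?A (a, b) \<cdot> ?i \<cdot> ?j)"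
          by (simp only: comp_assoc[OF i Aa la] comp_assoc[OF j comp_hom[OF i Aa] la] comp_assoc[OF j i Aa])
        also have "\<dots> = ?l (a, b) \<cdot> ?k \<cdot> ?m \<cdot> ?\<alpha>"
          by (simp only: qassoc_inj[OF S Q U U ab ab(2) ab(2)])
        also have "\<dots> = (?l (a, b) \<cdot> ?k) \<cdot> ?m \<cdot> ?\<alpha>"
          by (rule sym[OF comp_assoc[OF comp_hom[OF \<alpha> m] k la]])
        also have "\<dots> = (quiv_inj C S Q ?U a b b \<cdot> (Id C (Q (a, b)) \<otimes> LUnit (Quiv C S) ?U (b, b))) \<cdot> ?m \<cdot> ?\<alpha>"
          using qtens_inj[OF S quiv_id_hom[OF Q] qlunit_hom[OF S U] ab ab(2)] ab by simp
        also have "\<dots> = quiv_inj C S Q ?U a b b \<cdot> (Id C (Q (a, b)) \<otimes> (LUnit (Quiv C S) ?U (b, b) \<cdot> quiv_inj C S ?U ?U b b b)) \<cdot> ?\<alpha>"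
          using j0 ob pl m \<alpha> quiv_inj_hom[OF S U U ab(2) ab(2) ab(2)] by (simp add: hom_iff)
        also have "\<dots> = quiv_inj C S Q ?U a b b \<cdot> (RUnit C (Q (a, b)) \<otimes> Id C I)"
          unfolding qlunit_inj[OF S U ab(2) ab(2)] quiv_unit_app[OF ab(2)] triangle[OF ob(1) unit_obj] by (rule refl)
        also have "\<dots> = quiv_inj C S Q ?U a b b \<cdot> ((RUnit (Quiv C S) Q (a, b) \<cdot> quiv_inj C S Q ?U a b b) \<otimes> Id C (?U (b, b)))"
          unfolding qrunit_inj[OF S Q ab] quiv_unit_app[OF ab(2)] by (rule refl)
        also have "\<dots> = (quiv_inj C S Q ?U a b b \<cdot> (RUnit (Quiv C S) Q (a, b) \<otimes> Id C (?U (b, b)))) \<cdot> ?j"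
          using j0 ob pr by (simp add: hom_iff)
        also have "\<dots> = (?r (a, b) \<cdot> ?i) \<cdot> ?j"
          using qtens_inj[OF S qrunit_hom[OF S Q] quiv_id_hom[OF U] ab ab(2)] ab by simp
        finally show "((?l (a, b) \<cdot> ?A (a, b)) \<cdot> ?i) \<cdot> (quiv_inj C S Q ?U a b d \<otimes> Id C (?U (b, b))) =
            (?r (a, b) \<cdot> ?i) \<cdot> (quiv_inj C S Q ?U a b d \<otimes> Id C (?U (b, b)))" unfolding d .
      qed
    qed
    then show "(?l \<cdot>\<^bsub>Quiv C S\<^esub> ?A) (a, b) = ?r (a, b)" using ab by simp
  qed
qed

end

context colax_quiver
begin

interpretation D: category "Quiv C S" by (rule category_Quiv)

text \<open>An inert map into a one-bead necklace ends by appending the empty list, and this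
  identity removes that step. For a single factor \<open>tens_cons\<close> is itself a right unitor
  and \<open>qtriangle_unit\<close> is used; for longer lists it is
  \<open>qrunit_tens\<close>.\<close>

lemma tens_append_Nil: "ds \<noteq> [] \<Longrightarrow> tens_append (Quiv C S) Y ds [] = RUnit (Quiv C S) (T ds)"
proof (induction ds)
  case (Cons d ds)
  let ?U = "quiv_unit C S"
  note U = quiv_unit_obj[of S]
  show ?case
  proof (cases "ds = []")
    case True
    let ?R = "RUnit (Quiv C S) (ObjF Y d)" and ?A = "Assoc (Quiv C S) (ObjF Y d) ?U ?U"
      and ?l = "Id (Quiv C S) (ObjF Y d) \<otimes>\<^bsub>Quiv C S\<^esub> LUnit (Quiv C S) ?U"
      and ?i = "inv_arr (Quiv C S) (RUnit (Quiv C S) (ObjF Y d)) \<otimes>\<^bsub>Quiv C S\<^esub> Id (Quiv C S) ?U"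
    note R = qrunit_hom[OF S Y_obj, of d] and Ri = qrunit_iso[OF S Y_obj, of d]
    note Rin = quiv_inv_hom[OF Ri R]
    note l = qtens_hom[OF S quiv_id_hom[OF Y_obj] qlunit_hom[OF S U], of d]
      and A = qassoc_hom[OF S Y_obj U U, of d] and i = qtens_hom[OF S Rin quiv_id_hom[OF U]]
    have "?l \<cdot>\<^bsub>Quiv C S\<^esub> ?A \<cdot>\<^bsub>Quiv C S\<^esub> ?i = (RUnit (Quiv C S) (ObjF Y d) \<otimes>\<^bsub>Quiv C S\<^esub> Id (Quiv C S) ?U) \<cdot>\<^bsub>Quiv C S\<^esub> ?i"
      using D.comp_assoc[OF i A l] qtriangle_unit[OF S Y_obj, of d] by simp
    also have "\<dots> = (RUnit (Quiv C S) (ObjF Y d) \<cdot>\<^bsub>Quiv C S\<^esub> inv_arr (Quiv C S) (RUnit (Quiv C S) (ObjF Y d))) \<otimes>\<^bsub>Quiv C S\<^esub>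
        (Id (Quiv C S) ?U \<cdot>\<^bsub>Quiv C S\<^esub> Id (Quiv C S) ?U)"
      by (rule qtens_comp[OF S Rin R quiv_id_hom[OF U] quiv_id_hom[OF U]])
    also have "\<dots> = Id (Quiv C S) (ObjF Y d) \<otimes>\<^bsub>Quiv C S\<^esub> Id (Quiv C S) ?U"
      using D.inverse_arrows_inv[OF Ri] R D.id_comp[OF quiv_id_hom[OF U]] by (simp only: inverse_arrows_def hom_iff)
    also have "\<dots> = Id (Quiv C S) (quiv_tens C S (ObjF Y d) ?U)"
      by (rule qtens_id[OF S Y_obj U])
    finally show ?thesis using True D.comp_id[OF R] by (simp add: tens_cons_def)
  next
    case False
    let ?Q = "quiv_tens C S (ObjF Y d) (T ds)"
    note Q = quiv_tens_obj[OF S Y_obj T_obj, of d ds]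
    have inv: "inv_arr (Quiv C S) (Id (Quiv C S) ?Q) = Id (Quiv C S) ?Q" by (rule D.inv_id[OF Q])
    have "(Id (Quiv C S) (ObjF Y d) \<otimes>\<^bsub>Quiv C S\<^esub> RUnit (Quiv C S) (T ds)) \<cdot>\<^bsub>Quiv C S\<^esub> Assoc (Quiv C S) (ObjF Y d) (T ds) ?U \<cdot>\<^bsub>Quiv C S\<^esub>
        Id (Quiv C S) (quiv_tens C S ?Q ?U) = RUnit (Quiv C S) ?Q"
      unfolding D.comp_id[OF qassoc_hom[OF S Y_obj T_obj U]] by (rule qrunit_tens[OF S Y_obj T_obj])
    then show ?thesis
      using False Cons inv qtens_id[OF S Q U] D.id_comp[OF qrunit_hom[OF S Q]] by (simp add: tens_cons_def)
  qed
qed simp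

text \<open>The elements assigned to the simplices outside the horn are not yet known to form a family.
  Hence some necklace maps have to be computed at arbitrary elements.\<close>

lemma inert_map_single:
  assumes ds: "ds \<noteq> []" and ab: "a \<in> S" "b \<in> S" and z: "z \<in> hom C I (ObjF Y (sum_list ds) (a, b))"
  shows "inert_map (Quiv C S) Y [ds] (a, b) \<cdot> z = mu (Quiv C S) Y ds (a, b) \<cdot> z"
proof -
  let ?n = "sum_list ds" and ?U = "quiv_unit C S"
  note U = quiv_unit_obj[of S]
  have one: "Id C I \<in> hom C I (?U (b, b))" using ab by (simp add: id_hom)
  note R = qrunit_hom[OF S Y_obj, of ?n]
  note m1 = quiv_inv_hom[OF qrunit_iso[OF S Y_obj] R] and m2 = qtens_hom[OF S mu_hom quiv_id_hom[OF U], of ds]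
    and m3 = qrunit_hom[OF S T_obj, of ds]
  have 1: "inv_arr (Quiv C S) (RUnit (Quiv C S) (ObjF Y ?n)) (a, b) \<cdot> z = qprod S (ObjF Y ?n) ?U a b b z (Id C I)"
    by (rule quiv_inv_app[OF qrunit_iso[OF S Y_obj] R ab qprod_hom[OF S Y_obj U ab ab(2) z one] qrunit_qprod[OF S Y_obj ab z]])
  have "inert_map (Quiv C S) Y [ds] = RUnit (Quiv C S) (T ds) \<cdot>\<^bsub>Quiv C S\<^esub>
      (mu (Quiv C S) Y ds \<otimes>\<^bsub>Quiv C S\<^esub> Id (Quiv C S) ?U) \<cdot>\<^bsub>Quiv C S\<^esub> inv_arr (Quiv C S) (RUnit (Quiv C S) (ObjF Y ?n))"
    using tens_append_Nil[OF ds] by (simp add: tens_cons_def)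
  moreover have "Id (Quiv C S) ?U (b, b) \<cdot> Id C I = Id C I" by (rule quiv_id_app'[OF U ab(2) ab(2) one])
  ultimately show ?thesis
    using quiv_comp_app'[OF m3 quiv_comp_hom[OF m1 m2] ab z] quiv_comp_app'[OF m2 m1 ab z]
      qtens_qprod[OF S mu_hom quiv_id_hom[OF U] ab ab(2) z one]
      qrunit_qprod[OF S T_obj ab comp_hom[OF z quiv_hom_app[OF mu_hom ab]]] 1
    by (simp del: Quiv_comp_app Quiv_id_app)
qed

lemma insert_zeros_id: "0 \<notin> set ds \<Longrightarrow> insert_zeros (Quiv C S) Y ds = Id (Quiv C S) (T ds)"
proof (induction ds)
  case (Cons d ds)
  have f: "filter (\<lambda>d. d \<noteq> 0) ds = ds" using Cons.prems by (intro filter_True) (metis list.set_intros(2))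
  note t = tens_cons_hom[of d ds]
  note ti = quiv_inv_hom[OF tens_cons_iso t]
  have d: "d \<noteq> 0" and IH: "insert_zeros (Quiv C S) Y ds = Id (Quiv C S) (T ds)" using Cons by auto
  have "insert_zeros (Quiv C S) Y (d # ds) = tens_cons (Quiv C S) Y d ds \<cdot>\<^bsub>Quiv C S\<^esub>
    (Id (Quiv C S) (ObjF Y d) \<otimes>\<^bsub>Quiv C S\<^esub> Id (Quiv C S) (T ds)) \<cdot>\<^bsub>Quiv C S\<^esub> inv_arr (Quiv C S) (tens_cons (Quiv C S) Y d ds)"
    unfolding insert_zeros.simps Let_def f IH using d by (simp only: if_False)
  also have "\<dots> = Id (Quiv C S) (T (d # ds))"
    unfolding qtens_id[OF S Y_obj T_obj] D.id_comp[OF ti]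
    using D.inverse_arrows_inv[OF tens_cons_iso, of d ds] t by (simp only: inverse_arrows_def hom_iff)
  finally show ?case .
qed simp

lemma inv_counit_hom: "b \<in> S \<Longrightarrow> inv_arr (Quiv C S) (counit Y) (b, b) \<in> hom C I (ObjF Y 0 (b, b))"
  using quiv_hom_app[OF quiv_inv_hom[OF Y_counit_iso Y_counit], of b b] by simp

abbreviation (input) \<epsilon>' where "\<epsilon>' c \<equiv> inv_arr (Quiv C S) (counit Y) (c, c)"

context
  fixes a b assumes ab: "a \<in> S" "b \<in> S"
begin

lemma insert_zeros_left:
  assumes d: "d \<noteq> 0" and z: "z \<in> hom C I (ObjF Y d (a, b))"
  shows "insert_zeros (Quiv C S) Y [0, d] (a, b) \<cdot> z = qprod S (ObjF Y 0) (ObjF Y d) a b a (\<epsilon>' a) z"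
proof -
  let ?U = "quiv_unit C S"
  note U = quiv_unit_obj[of S]
  have one: "Id C I \<in> hom C I (?U (a, a))" using ab by (simp add: id_hom)
  note L = qlunit_hom[OF S Y_obj, of d] and Y0 = quiv_inv_hom[OF Y_counit_iso Y_counit]
  note m1 = quiv_inv_hom[OF qlunit_iso[OF S Y_obj] L] and m2 = qtens_hom[OF S Y0 quiv_id_hom[OF Y_obj], of d]
  have 1: "inv_arr (Quiv C S) (LUnit (Quiv C S) (ObjF Y d)) (a, b) \<cdot> z = qprod S ?U (ObjF Y d) a b a (Id C I) z"
    by (rule quiv_inv_app[OF qlunit_iso[OF S Y_obj] L ab qprod_hom[OF S U Y_obj ab ab(1) one z] qlunit_qprod[OF S Y_obj ab z]])
  have "insert_zeros (Quiv C S) Y [0, d] = Id (Quiv C S) (quiv_tens C S (ObjF Y 0) (ObjF Y d)) \<cdot>\<^bsub>Quiv C S\<^esub>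
     (inv_arr (Quiv C S) (counit Y) \<otimes>\<^bsub>Quiv C S\<^esub> Id (Quiv C S) (ObjF Y d)) \<cdot>\<^bsub>Quiv C S\<^esub> inv_arr (Quiv C S) (LUnit (Quiv C S) (ObjF Y d))"
    using d insert_zeros_id[of "[d]"] by (simp add: tens_cons_def Let_def)
  also have "\<dots> = (inv_arr (Quiv C S) (counit Y) \<otimes>\<^bsub>Quiv C S\<^esub> Id (Quiv C S) (ObjF Y d)) \<cdot>\<^bsub>Quiv C S\<^esub> inv_arr (Quiv C S) (LUnit (Quiv C S) (ObjF Y d))"
    by (rule D.id_comp[OF quiv_comp_hom[OF m1 m2]])
  finally show ?thesis
    using quiv_comp_app'[OF m2 m1 ab z] qtens_qprod[OF S Y0 quiv_id_hom[OF Y_obj] ab ab(1) one z] 1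
      quiv_id_app'[OF Y_obj ab z] comp_id[OF inv_counit_hom[OF ab(1)]]
    by (simp del: Quiv_comp_app Quiv_id_app)
qed

text \<open>The zero stands at the end, where \<open>insert_zeros\<close> has to build the list
  \<open>[0]\<close> out of the unit quiver; \<open>z0b\<close> evaluates that inner step.\<close>

lemma insert_zeros_right:
  assumes d: "d \<noteq> 0" and z: "z \<in> hom C I (ObjF Y d (a, b))"
  shows "insert_zeros (Quiv C S) Y [d, 0] (a, b) \<cdot> z = qprod S (ObjF Y d) (ObjF Y 0) a b b z (\<epsilon>' b)"
proof -
  let ?U = "quiv_unit C S"
  note U = quiv_unit_obj[of S]
  have one: "Id C I \<in> hom C I (?U (b, b))" using ab by (simp add: id_hom)
  have z0: "insert_zeros (Quiv C S) Y [0] \<in> hom (Quiv C S) ?U (ObjF Y 0)" using insert_zeros_hom[of "[0]"] by simp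
  have z0b: "insert_zeros (Quiv C S) Y [0] (b, b) \<cdot> Id C I = \<epsilon>' b"
  proof -
    note L = qlunit_hom[OF S U] and Y0 = quiv_inv_hom[OF Y_counit_iso Y_counit]
    note m1 = quiv_inv_hom[OF qlunit_iso[OF S U] L] and m2 = qtens_hom[OF S Y0 quiv_id_hom[OF U]]
      and m3 = qrunit_hom[OF S Y_obj, of 0]
    have 1: "inv_arr (Quiv C S) (LUnit (Quiv C S) ?U) (b, b) \<cdot> Id C I = qprod S ?U ?U b b b (Id C I) (Id C I)"
      by (rule quiv_inv_app[OF qlunit_iso[OF S U] L ab(2) ab(2) qprod_hom[OF S U U ab(2) ab(2) ab(2) one one]
            qlunit_qprod[OF S U ab(2) ab(2) one]])
    have "insert_zeros (Quiv C S) Y [0] = RUnit (Quiv C S) (ObjF Y 0) \<cdot>\<^bsub>Quiv C S\<^esub>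
     (inv_arr (Quiv C S) (counit Y) \<otimes>\<^bsub>Quiv C S\<^esub> Id (Quiv C S) ?U) \<cdot>\<^bsub>Quiv C S\<^esub> inv_arr (Quiv C S) (LUnit (Quiv C S) ?U)"
      by (simp add: tens_cons_def Let_def)
    then show ?thesis
      using quiv_comp_app'[OF m3 quiv_comp_hom[OF m1 m2] ab(2) ab(2) one] quiv_comp_app'[OF m2 m1 ab(2) ab(2) one]
        qtens_qprod[OF S Y0 quiv_id_hom[OF U] ab(2) ab(2) ab(2) one one] 1 quiv_id_app'[OF U ab(2) ab(2) one]
        comp_id[OF inv_counit_hom[OF ab(2)]] qrunit_qprod[OF S Y_obj ab(2) ab(2) inv_counit_hom[OF ab(2)]]
      by (simp del: Quiv_comp_app Quiv_id_app)
  qed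
  note R = qrunit_hom[OF S Y_obj, of d]
  note m1 = quiv_inv_hom[OF qrunit_iso[OF S Y_obj] R] and m2 = qtens_hom[OF S quiv_id_hom[OF Y_obj] z0, of d]
  have 1: "inv_arr (Quiv C S) (RUnit (Quiv C S) (ObjF Y d)) (a, b) \<cdot> z = qprod S (ObjF Y d) ?U a b b z (Id C I)"
    by (rule quiv_inv_app[OF qrunit_iso[OF S Y_obj] R ab qprod_hom[OF S Y_obj U ab ab(2) z one] qrunit_qprod[OF S Y_obj ab z]])
  have "insert_zeros (Quiv C S) Y [d, 0] = Id (Quiv C S) (quiv_tens C S (ObjF Y d) (ObjF Y 0)) \<cdot>\<^bsub>Quiv C S\<^esub>
     (Id (Quiv C S) (ObjF Y d) \<otimes>\<^bsub>Quiv C S\<^esub> insert_zeros (Quiv C S) Y [0]) \<cdot>\<^bsub>Quiv C S\<^esub> inv_arr (Quiv C S) (RUnit (Quiv C S) (ObjF Y d))"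
    using d by (simp add: tens_cons_def Let_def)
  also have "\<dots> = (Id (Quiv C S) (ObjF Y d) \<otimes>\<^bsub>Quiv C S\<^esub> insert_zeros (Quiv C S) Y [0]) \<cdot>\<^bsub>Quiv C S\<^esub> inv_arr (Quiv C S) (RUnit (Quiv C S) (ObjF Y d))"
    by (rule D.id_comp[OF quiv_comp_hom[OF m1 m2]])
  finally show ?thesis
    using quiv_comp_app'[OF m2 m1 ab z] qtens_qprod[OF S quiv_id_hom[OF Y_obj] z0 ab ab(2) z one] 1
      quiv_id_app'[OF Y_obj ab z] z0b
    by (simp del: Quiv_comp_app Quiv_id_app)
qed

end

end

section \<open>Templicial objects on special necklace maps\<close>

text \<open>The unitors of \<open>op_moncat Delta_f\<close> are defined as inverses of identities;
  recognising them as identities takes the category axioms.\<close>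

lemma category_Delta_f: "category Delta_f"
proof
  fix f g :: delta and a b c assume fg: "f \<in> hom Delta_f a b" "g \<in> hom Delta_f b c"
  have "g \<cdot>\<^bsub>Delta\<^esub> f \<in> Arr Delta" using fg by (simp add: hom_iff Delta_f_arrD)
  then show "g \<cdot>\<^bsub>Delta_f\<^esub> f \<in> hom Delta_f a c" using fg by (cases f, cases g) (auto simp: hom_iff Delta_f_arr compose_def)
next
  fix f g h :: delta and a b c d assume "f \<in> hom Delta_f a b" "g \<in> hom Delta_f b c" "h \<in> hom Delta_f c d"
  then show "(h \<cdot>\<^bsub>Delta_f\<^esub> g) \<cdot>\<^bsub>Delta_f\<^esub> f = h \<cdot>\<^bsub>Delta_f\<^esub> g \<cdot>\<^bsub>Delta_f\<^esub> f"
    by (simp add: hom_iff Delta_f_arrD)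
next
  fix a show "Id Delta_f a \<in> hom Delta_f a a" using Delta.arr_id[of a] by (auto simp: hom_iff Delta_f_arr)
next
  fix f :: delta and a b assume f: "f \<in> hom Delta_f a b"
  show "f \<cdot>\<^bsub>Delta_f\<^esub> Id Delta_f a = f" "Id Delta_f b \<cdot>\<^bsub>Delta_f\<^esub> f = f"
    using f Delta.comp_id_right[of f a] Delta.comp_id_left[of f b] by (simp_all only: hom_iff Delta_f_arrD Delta_f_simps)
qed simp_all

lemma op_Delta_f_units:
  "LUnit (op_moncat Delta_f) n = Id Delta n" "RUnit (op_moncat Delta_f) n = Id Delta n" "Id (op_moncat Delta_f) = Id Delta"
  using category.inv_id[OF category_Delta_f, of n] by (simp_all add: op_moncat_def del: Delta_simps)

locale templicial_object = enriching_category C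
  for C :: "('o, 'm, 'z) symcat_scheme" (structure) +
  fixes S :: "'s set" and X :: "('s, 'o, 'm) quiv_colax"
  assumes coprods: "has_coprods C S" and templicial: "templicial C (X, S)"
begin

lemma colax: "is_colax_monoidal (op_moncat Delta_f) (Quiv C S) X" and counit_iso: "is_iso (Quiv C S) (counit X)"
  using templicial by (auto simp: templicial_def)

sublocale colax_quiver C S X
proof
  show "ObjF X n \<in> Obj (Quiv C S)" for n
    using colax unfolding is_colax_monoidal_def is_functor_def op_Delta_f_simps by blast
  show "h \<in> Arr Delta_f \<Longrightarrow> ArrF X h \<in> hom (Quiv C S) (ObjF X (Cod Delta h)) (ObjF X (Dom Delta h))" for h
    using colax unfolding is_colax_monoidal_def is_functor_def op_Delta_f_simps by blast
  show "comult X k l \<in> hom (Quiv C S) (ObjF X (k + l)) (quiv_tens C S (ObjF X k) (ObjF X l))" for k l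
    using colax unfolding is_colax_monoidal_def op_Delta_f_simps Quiv_simps by blast
  show "counit X \<in> hom (Quiv C S) (ObjF X 0) (quiv_unit C S)"
    using colax unfolding is_colax_monoidal_def op_Delta_f_simps Quiv_simps by blast
qed (rule coprods, rule counit_iso)

lemma X_id: "ArrF X (Id Delta n) = Id (Quiv C S) (ObjF X n)"
  using colax unfolding is_colax_monoidal_def is_functor_def op_Delta_f_simps op_Delta_f_units by blast

lemma counit_left: "LUnit (Quiv C S) (ObjF X n) \<cdot>\<^bsub>Quiv C S\<^esub> (counit X \<otimes>\<^bsub>Quiv C S\<^esub> Id (Quiv C S) (ObjF X n)) \<cdot>\<^bsub>Quiv C S\<^esub> comult X 0 n =
    Id (Quiv C S) (ObjF X n)"
  and counit_right: "RUnit (Quiv C S) (ObjF X n) \<cdot>\<^bsub>Quiv C S\<^esub> (Id (Quiv C S) (ObjF X n) \<otimes>\<^bsub>Quiv C S\<^esub> counit X) \<cdot>\<^bsub>Quiv C S\<^esub> comult X n 0 =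
    Id (Quiv C S) (ObjF X n)"
  using colax[unfolded is_colax_monoidal_def, THEN conjunct2, THEN conjunct2, THEN conjunct2, THEN conjunct2, THEN conjunct2,
      unfolded op_Delta_f_simps op_Delta_f_units Quiv_simps X_id]
  by simp_all

interpretation D: category "Quiv C S" by (rule category_Quiv)


lemma quiv_inv_comp: "\<phi> \<in> hom (Quiv C S) Q P \<Longrightarrow> is_iso (Quiv C S) \<phi> \<Longrightarrow> inv_arr (Quiv C S) \<phi> \<cdot>\<^bsub>Quiv C S\<^esub> \<phi> = Id (Quiv C S) Q"
  using D.inverse_arrows_inv[of \<phi>] by (simp only: inverse_arrows_def hom_iff)

text \<open>The counit law forces the value: followed by the counit on the first factor and the left
  unitor, both invertible there, \<open>comult X 0 n\<close> is the identity. Hence it is the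
  inverse of these, which is then evaluated at \<open>z\<close>.\<close>

lemma comult_zero_left:
  assumes ab: "a \<in> S" "b \<in> S" and z: "z \<in> hom C I (ObjF X n (a, b))"
  shows "comult X 0 n (a, b) \<cdot> z = qprod S (ObjF X 0) (ObjF X n) a b a (\<epsilon>' a) z"
proof -
  let ?L = "LUnit (Quiv C S) (ObjF X n)" and ?U = "counit X \<otimes>\<^bsub>Quiv C S\<^esub> Id (Quiv C S) (ObjF X n)"
    and ?V = "inv_arr (Quiv C S) (counit X) \<otimes>\<^bsub>Quiv C S\<^esub> Id (Quiv C S) (ObjF X n)"
  note L = qlunit_hom[OF S Y_obj, of n] and Li = qlunit_iso[OF S Y_obj, of n]
  note I' = quiv_id_hom[OF Y_obj, of n] and E' = quiv_inv_hom[OF Y_counit_iso Y_counit]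
  note U = qtens_hom[OF S Y_counit I'] and V = qtens_hom[OF S E' I']
  note c = Y_comult[of 0 n, simplified]
  have one: "Id C I \<in> hom C I (quiv_unit C S (a, a))" using ab by (simp add: id_hom)
  have VU: "?V \<cdot>\<^bsub>Quiv C S\<^esub> ?U = Id (Quiv C S) (quiv_tens C S (ObjF X 0) (ObjF X n))"
    unfolding qtens_comp[OF S Y_counit E' I' I'] D.id_comp[OF I'] quiv_inv_comp[OF Y_counit Y_counit_iso]
    by (rule qtens_id[OF S Y_obj Y_obj])
  have "comult X 0 n = ?V \<cdot>\<^bsub>Quiv C S\<^esub> ?U \<cdot>\<^bsub>Quiv C S\<^esub> comult X 0 n"
    using D.comp_assoc[OF c U V] VU D.id_comp[OF c] by simp
  also have "?U \<cdot>\<^bsub>Quiv C S\<^esub> comult X 0 n = inv_arr (Quiv C S) ?L \<cdot>\<^bsub>Quiv C S\<^esub> ?L \<cdot>\<^bsub>Quiv C S\<^esub> ?U \<cdot>\<^bsub>Quiv C S\<^esub> comult X 0 n"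
    using D.comp_assoc[OF quiv_comp_hom[OF c U] L quiv_inv_hom[OF Li L]] quiv_inv_comp[OF L Li] D.id_comp[OF quiv_comp_hom[OF c U]] by simp
  also have "\<dots> = inv_arr (Quiv C S) ?L" unfolding counit_left by (rule D.comp_id[OF quiv_inv_hom[OF Li L]])
  finally have eq: "comult X 0 n = ?V \<cdot>\<^bsub>Quiv C S\<^esub> inv_arr (Quiv C S) ?L" .
  have 1: "inv_arr (Quiv C S) ?L (a, b) \<cdot> z = qprod S (quiv_unit C S) (ObjF X n) a b a (Id C I) z"
    by (rule quiv_inv_app[OF Li L ab qprod_hom[OF S quiv_unit_obj Y_obj ab ab(1) one z] qlunit_qprod[OF S Y_obj ab z]])
  show ?thesis
    unfolding eq quiv_comp_app'[OF V quiv_inv_hom[OF Li L] ab z] 1 qtens_qprod[OF S E' I' ab ab(1) one z]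
      quiv_id_app'[OF Y_obj ab z] comp_id[OF inv_counit_hom[OF ab(1)]]
    by (rule refl)
qed

lemma comult_zero_right:
  assumes ab: "a \<in> S" "b \<in> S" and z: "z \<in> hom C I (ObjF X n (a, b))"
  shows "comult X n 0 (a, b) \<cdot> z = qprod S (ObjF X n) (ObjF X 0) a b b z (\<epsilon>' b)"
proof -
  let ?L = "RUnit (Quiv C S) (ObjF X n)" and ?U = "Id (Quiv C S) (ObjF X n) \<otimes>\<^bsub>Quiv C S\<^esub> counit X"
    and ?V = "Id (Quiv C S) (ObjF X n) \<otimes>\<^bsub>Quiv C S\<^esub> inv_arr (Quiv C S) (counit X)"
  note L = qrunit_hom[OF S Y_obj, of n] and Li = qrunit_iso[OF S Y_obj, of n]
  note I' = quiv_id_hom[OF Y_obj, of n] and E' = quiv_inv_hom[OF Y_counit_iso Y_counit]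
  note U = qtens_hom[OF S I' Y_counit] and V = qtens_hom[OF S I' E']
  note c = Y_comult[of n 0, simplified]
  have one: "Id C I \<in> hom C I (quiv_unit C S (b, b))" using ab by (simp add: id_hom)
  have VU: "?V \<cdot>\<^bsub>Quiv C S\<^esub> ?U = Id (Quiv C S) (quiv_tens C S (ObjF X n) (ObjF X 0))"
    unfolding qtens_comp[OF S I' I' Y_counit E'] D.id_comp[OF I'] quiv_inv_comp[OF Y_counit Y_counit_iso]
    by (rule qtens_id[OF S Y_obj Y_obj])
  have "comult X n 0 = ?V \<cdot>\<^bsub>Quiv C S\<^esub> ?U \<cdot>\<^bsub>Quiv C S\<^esub> comult X n 0"
    using D.comp_assoc[OF c U V] VU D.id_comp[OF c] by simp
  also have "?U \<cdot>\<^bsub>Quiv C S\<^esub> comult X n 0 = inv_arr (Quiv C S) ?L \<cdot>\<^bsub>Quiv C S\<^esub> ?L \<cdot>\<^bsub>Quiv C S\<^esub> ?U \<cdot>\<^bsub>Quiv C S\<^esub> comult X n 0"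
    using D.comp_assoc[OF quiv_comp_hom[OF c U] L quiv_inv_hom[OF Li L]] quiv_inv_comp[OF L Li] D.id_comp[OF quiv_comp_hom[OF c U]] by simp
  also have "\<dots> = inv_arr (Quiv C S) ?L" unfolding counit_right by (rule D.comp_id[OF quiv_inv_hom[OF Li L]])
  finally have eq: "comult X n 0 = ?V \<cdot>\<^bsub>Quiv C S\<^esub> inv_arr (Quiv C S) ?L" .
  have 1: "inv_arr (Quiv C S) ?L (a, b) \<cdot> z = qprod S (ObjF X n) (quiv_unit C S) a b b z (Id C I)"
    by (rule quiv_inv_app[OF Li L ab qprod_hom[OF S Y_obj quiv_unit_obj ab ab(2) z one] qrunit_qprod[OF S Y_obj ab z]])
  show ?thesis
    unfolding eq quiv_comp_app'[OF V quiv_inv_hom[OF Li L] ab z] 1 qtens_qprod[OF S I' E' ab ab(2) z one]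
      quiv_id_app'[OF Y_obj ab z] comp_id[OF inv_counit_hom[OF ab(2)]]
    by (rule refl)
qed

end

section \<open>Necklaces with one or two beads\<close>

definition collapse :: "nat \<Rightarrow> delta" where
  "collapse k = (k, \<lambda>i \<in> {..k}. 0, 0)"

lemma collapse_arr: "collapse k \<in> Arr Delta_f"
  by (simp add: collapse_def Delta_f_arr Delta_arr mono_on_def)

lemma collapse_simps [simp]: "Dom Delta (collapse k) = k" "Cod Delta (collapse k) = 0"
  by (simp_all add: collapse_def)

text \<open>In dimension 0 this necklace has no bead, its list of gaps being empty; hence the
  positivity conditions below.\<close>

definition bead :: "nat \<Rightarrow> neck" where "bead m = ({0, m}, m)"
definition beads2 :: "nat \<Rightarrow> nat \<Rightarrow> neck" where "beads2 k l = ({0, k, k + l}, k + l)"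

definition bead_arr :: "delta \<Rightarrow> neck_arr" where
  "bead_arr h = (bead (Dom Delta h), dfun h, bead (Cod Delta h))"
text \<open>This map is inert and induces the comultiplication. In contrast,
  \<open>drop_right\<close> and \<open>drop_left\<close> are active: they send one of the two beads
  to a joint and so induce the insertion of a degenerate vertex.\<close>

definition cut_arr :: "nat \<Rightarrow> nat \<Rightarrow> neck_arr" where
  "cut_arr k l = (beads2 k l, \<lambda>i \<in> {..k + l}. i, bead (k + l))"
definition drop_right :: "nat \<Rightarrow> nat \<Rightarrow> neck_arr" where
  "drop_right k l = (beads2 k l, \<lambda>i \<in> {..k + l}. min i k, bead k)"
definition drop_left :: "nat \<Rightarrow> nat \<Rightarrow> neck_arr" where
  "drop_left k l = (beads2 k l, \<lambda>i \<in> {..k + l}. i - k, bead l)"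

lemma sorted_list_bead: "0 < m \<Longrightarrow> sorted_list_of_set {0, m} = [0, m :: nat]"
  and sorted_list_beads2: "0 < k \<Longrightarrow> 0 < l \<Longrightarrow> sorted_list_of_set {0, k, k + l} = [0, k, k + l :: nat]"
  by simp_all

lemma steps_bead: "0 < m \<Longrightarrow> steps {0, m} = [(0, m)]"
  and steps_beads2: "0 < k \<Longrightarrow> 0 < l \<Longrightarrow> steps {0, k, k + l} = [(0, k), (k, k + l)]"
  unfolding steps_def Let_def by (simp_all only: sorted_list_bead sorted_list_beads2) simp_all

lemma gaps_bead: "0 < m \<Longrightarrow> gaps {0, m} = [m]"
  and gaps_beads2: "0 < k \<Longrightarrow> 0 < l \<Longrightarrow> gaps {0, k, k + l} = [k, l]"
  unfolding gaps_def by (simp_all only: steps_bead steps_beads2) simp_all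

context
  fixes h :: delta
  assumes h: "h \<in> Arr Delta_f" and pos: "0 < Dom Delta h" "0 < Cod Delta h"
begin

lemma bead_arr_Nec: "bead_arr h \<in> Arr Nec"
  using h by (cases h) (auto simp: bead_arr_def bead_def Nec_arr Delta_f_arr)

lemma bead_arr_beads: "beads {0, Dom Delta h} (dfun h) = [h]"
proof -
  obtain m f n where hh: "h = (m, f, n)" by (cases h)
  have "(\<lambda>i \<in> {..m}. f i) = f" using h by (auto simp: hh Delta_f_arr Delta_arr intro: PiE_restrict)
  then show ?thesis using h pos by (simp add: hh beads_def steps_bead Delta_f_arr)
qed

lemma bead_arr_bead_gaps: "bead_gaps {0, Dom Delta h} (dfun h) {0, Cod Delta h} = [[Cod Delta h]]"
proof -
  have "dfun h ` {0, Dom Delta h} \<inter> {0..Cod Delta h} = {0, Cod Delta h}" using h by (cases h) (auto simp: Delta_f_arr)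
  then show ?thesis using pos by (simp add: bead_gaps_def steps_bead gaps_bead)
qed

end

context
  fixes k l :: nat
  assumes pos: "0 < k" "0 < l"
begin

lemma cut_arr_Nec: "cut_arr k l \<in> Arr Nec"
  by (auto simp: cut_arr_def bead_def beads2_def Nec_arr Delta_f_arr Delta_arr mono_on_def)

lemma drop_right_Nec: "drop_right k l \<in> Arr Nec"
  by (auto simp: drop_right_def bead_def beads2_def Nec_arr Delta_f_arr Delta_arr mono_on_def)

lemma drop_left_Nec: "drop_left k l \<in> Arr Nec"
  by (auto simp: drop_left_def bead_def beads2_def Nec_arr Delta_f_arr Delta_arr mono_on_def)

lemma cut_arr_beads: "beads {0, k, k + l} (\<lambda>i \<in> {..k + l}. i) = [Id Delta k, Id Delta l]"
  using pos by (auto simp: beads_def steps_beads2 fun_eq_iff)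

lemma drop_right_beads: "beads {0, k, k + l} (\<lambda>i \<in> {..k + l}. min i k) = [Id Delta k, collapse l]"
  using pos by (auto simp: beads_def steps_beads2 fun_eq_iff collapse_def)

lemma drop_left_beads: "beads {0, k, k + l} (\<lambda>i \<in> {..k + l}. i - k) = [collapse k, Id Delta l]"
  using pos by (auto simp: beads_def steps_beads2 fun_eq_iff collapse_def)

lemma cut_arr_bead_gaps: "bead_gaps {0, k, k + l} (\<lambda>i \<in> {..k + l}. i) {0, k + l} = [[k, l]]"
proof -
  have "(\<lambda>i \<in> {..k + l}. i) ` {0, k, k + l} \<inter> {0..k + l} = {0, k, k + l}" by auto
  then show ?thesis using pos gaps_beads2[OF pos] steps_bead[of "k + l"] by (simp add: bead_gaps_def)
qed

lemma drop_right_bead_gaps: "bead_gaps {0, k, k + l} (\<lambda>i \<in> {..k + l}. min i k) {0, k} = [[k]]"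
proof -
  have "(\<lambda>i \<in> {..k + l}. min i k) ` {0, k, k + l} \<inter> {0..k} = {0, k}" by auto
  then show ?thesis using pos by (simp add: bead_gaps_def steps_bead gaps_bead)
qed

lemma drop_left_bead_gaps: "bead_gaps {0, k, k + l} (\<lambda>i \<in> {..k + l}. i - k) {0, l} = [[l]]"
proof -
  have "(\<lambda>i \<in> {..k + l}. i - k) ` {0, k, k + l} \<inter> {0..l} = {0, l}" by auto
  then show ?thesis using pos by (simp add: bead_gaps_def steps_bead gaps_bead)
qed

end

lemma Delta_f_id: "Id Delta k \<in> Arr Delta_f"
  using category.id_hom[OF category_Delta_f, of k] by (simp add: hom_iff del: Delta_simps)

context simplicial_set
begin

lemma neck_chain_bead_arr:
  assumes "h \<in> Arr Delta_f" "0 < Dom Delta h" "0 < Cod Delta h" "x \<in> simp K (Cod Delta h)"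
  shows "neck_chain K a (bead_arr h) [x] = [act K h x]"
  using bead_arr_beads[OF assms(1-3)] bead_arr_bead_gaps[OF assms(1-3)] assms
  by (simp add: neck_chain_def bead_arr_def bead_def front_zero)

lemma neck_chain_cut_arr:
  assumes "0 < k" "0 < l" "x \<in> simp K (k + l)"
  shows "neck_chain K a (cut_arr k l) [x] = [front_face K k l x, back_face K k l x]"
  using assms act_id[OF front_in[OF assms(3)]] act_id[OF back_in[OF assms(3)]]
  by (simp add: neck_chain_def cut_arr_def bead_def beads2_def cut_arr_beads cut_arr_bead_gaps front_zero back_in)

lemma neck_chain_drop_right:
  assumes "0 < k" "0 < l" "x \<in> simp K k"
  shows "neck_chain K a (drop_right k l) [x] = [x, act K (collapse l) (tgt K k x)]"
  using assms act_id[OF assms(3)]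
  by (simp add: neck_chain_def drop_right_def bead_def beads2_def drop_right_beads drop_right_bead_gaps front_zero)

lemma neck_chain_drop_left:
  assumes "0 < k" "0 < l" "x \<in> simp K l"
  shows "neck_chain K a (drop_left k l) [x] = [act K (collapse k) a, x]"
  using assms act_id[OF assms(3)]
  by (simp add: neck_chain_def drop_left_def bead_def beads2_def drop_left_beads drop_left_bead_gaps front_zero)

end

lemma (in colax_quiver) neck_map_app:
  assumes h: "((N, p), g, (M, q)) \<in> Arr Nec" and ab: "a \<in> S" "b \<in> S" and z: "z \<in> hom C I (T (gaps M) (a, b))"
  shows "neck_map (Quiv C S) Y ((N, p), g, (M, q)) (a, b) \<cdot> z = active_map (Quiv C S) Y (beads N g) (a, b) \<cdot>
    insert_zeros (Quiv C S) Y (map (Cod Delta_f) (beads N g)) (a, b) \<cdot> inert_map (Quiv C S) Y (bead_gaps N g M) (a, b) \<cdot> z"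
proof -
  note 1 = inert_map_hom[of "bead_gaps N g M", unfolded sum_bead_gaps[OF h] concat_bead_gaps[OF h]]
    and 2 = insert_zeros_hom[of "map (Cod Delta_f) (beads N g)", unfolded beads_cod[OF h]]
    and 3 = active_map_hom[OF beads_arr[OF h], unfolded beads_dom[OF h]]
  show ?thesis
    unfolding neck_map_def prod.case bead_gaps_def[symmetric]
    by (simp only: quiv_comp_app'[OF 3 quiv_comp_hom[OF 1 2] ab z] quiv_comp_app'[OF 2 1 ab z])
qed

context templicial_object
begin

interpretation D: category "Quiv C S" by (rule category_Quiv)

context
  fixes a b assumes ab: "a \<in> S" "b \<in> S"
begin

lemma inert_map_one:
  assumes z: "z \<in> hom C I (ObjF X m (a, b))"
  shows "inert_map (Quiv C S) X [[m]] (a, b) \<cdot> z = z"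
  using inert_map_single[of "[m]" a b z] ab z quiv_id_app'[OF Y_obj ab z] by (simp del: inert_map.simps Quiv_id_app)

lemma neck_map_bead_arr:
  assumes h: "h \<in> Arr Delta_f" "0 < Dom Delta h" "0 < Cod Delta h" and z: "z \<in> hom C I (ObjF X (Cod Delta h) (a, b))"
  shows "neck_map (Quiv C S) X (bead_arr h) (a, b) \<cdot> z = ArrF X h (a, b) \<cdot> z"
proof -
  have z': "z \<in> hom C I (T (gaps {0, Cod Delta h}) (a, b))" using z h(3) by (simp add: gaps_bead)
  have i: "insert_zeros (Quiv C S) X [Cod Delta h] (a, b) \<cdot> z = z"
    using insert_zeros_id[of "[Cod Delta h]"] h(3) quiv_id_app'[OF Y_obj ab z] by (simp del: insert_zeros.simps Quiv_id_app)
  show ?thesis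
    using neck_map_app[OF bead_arr_Nec[OF h, unfolded bead_arr_def bead_def] ab z']
      bead_arr_beads[OF h] bead_arr_bead_gaps[OF h] inert_map_one[OF z] i
    by (simp add: bead_arr_def bead_def del: inert_map.simps insert_zeros.simps)
qed

lemma neck_map_cut_arr:
  assumes kl: "0 < k" "0 < l" and z: "z \<in> hom C I (ObjF X (k + l) (a, b))"
  shows "neck_map (Quiv C S) X (cut_arr k l) (a, b) \<cdot> z = comult X k l (a, b) \<cdot> z"
proof -
  have z': "z \<in> hom C I (T (gaps {0, k + l}) (a, b))" using z gaps_bead[of "k + l"] kl by simp
  have "mu (Quiv C S) X [k, l] = comult X k l"
    using qtens_id[OF S Y_obj Y_obj, of k l] D.id_comp[OF Y_comult, of k l] by simp
  then have 1: "inert_map (Quiv C S) X [[k, l]] (a, b) \<cdot> z = comult X k l (a, b) \<cdot> z"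
    using inert_map_single[of "[k, l]" a b z] ab z by (simp del: inert_map.simps mu.simps)
  have T: "T [k, l] = quiv_tens C S (ObjF X k) (ObjF X l)" by simp
  have 2: "insert_zeros (Quiv C S) X [k, l] = Id (Quiv C S) (T [k, l])"
    by (rule insert_zeros_id) (use kl in simp)
  have 3: "active_map (Quiv C S) X [Id Delta k, Id Delta l] = Id (Quiv C S) (T [k, l])"
    using qtens_id[OF S Y_obj Y_obj, of k l] by (simp add: X_id del: Delta_simps)
  note cz = comp_hom[OF z quiv_hom_app[OF Y_comult ab]]
  have id: "Id (Quiv C S) (T [k, l]) (a, b) \<cdot> comult X k l (a, b) \<cdot> z = comult X k l (a, b) \<cdot> z"
    by (rule quiv_id_app'[OF T_obj ab cz[folded T]])
  have cod: "map (Cod Delta_f) [Id Delta k, Id Delta l] = [k, l]" by simp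
  show ?thesis
    using neck_map_app[OF cut_arr_Nec[OF kl, unfolded cut_arr_def bead_def beads2_def] ab z']
    unfolding cut_arr_def bead_def beads2_def cut_arr_beads[OF kl] cut_arr_bead_gaps[OF kl] cod 1 2 3 id .
qed

lemma neck_map_drop_right:
  assumes kl: "0 < k" "0 < l" and z: "z \<in> hom C I (ObjF X k (a, b))"
  shows "neck_map (Quiv C S) X (drop_right k l) (a, b) \<cdot> z =
    qprod S (ObjF X k) (ObjF X l) a b b z (ArrF X (collapse l) (b, b) \<cdot> inv_arr (Quiv C S) (counit X) (b, b))"
proof -
  have z': "z \<in> hom C I (T (gaps {0, k}) (a, b))" using z kl by (simp add: gaps_bead)
  have cod: "map (Cod Delta_f) [Id Delta k, collapse l] = [k, 0]" by simp
  note Xi = Y_arr[OF Delta_f_id, of k] and Xc = Y_arr[OF collapse_arr, of l]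
  have idz: "ArrF X (Id Delta k) (a, b) \<cdot> z = z" unfolding X_id by (rule quiv_id_app'[OF Y_obj ab z])
  have e: "inv_arr (Quiv C S) (counit X) (b, b) \<in> hom C I (ObjF X (Cod Delta (collapse l)) (b, b))"
    using inv_counit_hom[OF ab(2)] by simp
  have zi: "z \<in> hom C I (ObjF X (Cod Delta (Id Delta k)) (a, b))" using z by simp
  have act: "active_map (Quiv C S) X [Id Delta k, collapse l] = ArrF X (Id Delta k) \<otimes>\<^bsub>Quiv C S\<^esub> ArrF X (collapse l)"
    by (simp del: Delta_simps)
  show ?thesis
    using neck_map_app[OF drop_right_Nec[OF kl, unfolded drop_right_def bead_def beads2_def] ab z']
      insert_zeros_right[OF ab _ z] kl qtens_qprod[OF S Xi Xc ab ab(2) zi e]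
    unfolding drop_right_def bead_def beads2_def drop_right_beads[OF kl] drop_right_bead_gaps[OF kl] cod inert_map_one[OF z] act
    by (simp add: idz del: Delta_simps(4) insert_zeros.simps)
qed

lemma neck_map_drop_left:
  assumes kl: "0 < k" "0 < l" and z: "z \<in> hom C I (ObjF X l (a, b))"
  shows "neck_map (Quiv C S) X (drop_left k l) (a, b) \<cdot> z =
    qprod S (ObjF X k) (ObjF X l) a b a (ArrF X (collapse k) (a, a) \<cdot> inv_arr (Quiv C S) (counit X) (a, a)) z"
proof -
  have z': "z \<in> hom C I (T (gaps {0, l}) (a, b))" using z kl by (simp add: gaps_bead)
  have cod: "map (Cod Delta_f) [collapse k, Id Delta l] = [0, l]" by simp
  note Xi = Y_arr[OF Delta_f_id, of l] and Xc = Y_arr[OF collapse_arr, of k]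
  have idz: "ArrF X (Id Delta l) (a, b) \<cdot> z = z" unfolding X_id by (rule quiv_id_app'[OF Y_obj ab z])
  have e: "inv_arr (Quiv C S) (counit X) (a, a) \<in> hom C I (ObjF X (Cod Delta (collapse k)) (a, a))"
    using inv_counit_hom[OF ab(1)] by simp
  have zi: "z \<in> hom C I (ObjF X (Cod Delta (Id Delta l)) (a, b))" using z by simp
  have act: "active_map (Quiv C S) X [collapse k, Id Delta l] = ArrF X (collapse k) \<otimes>\<^bsub>Quiv C S\<^esub> ArrF X (Id Delta l)"
    by (simp del: Delta_simps)
  show ?thesis
    using neck_map_app[OF drop_left_Nec[OF kl, unfolded drop_left_def bead_def beads2_def] ab z']
      insert_zeros_left[OF ab _ z] kl qtens_qprod[OF S Xc Xi ab ab(1) e zi]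
    unfolding drop_left_def bead_def beads2_def drop_left_beads[OF kl] drop_left_bead_gaps[OF kl] cod inert_map_one[OF z] act
    by (simp add: idz del: Delta_simps(4) insert_zeros.simps)
qed

end

end

section \<open>Simplices and horns\<close>

lemma std_simplex_simps [simp]:
  "simp (std_simplex n) m = hom Delta m n" "act (std_simplex n) h x = x \<cdot>\<^bsub>Delta\<^esub> h"
  by (simp_all add: std_simplex_def)

lemma horn_act [simp]: "act (horn n j) h x = x \<cdot>\<^bsub>Delta\<^esub> h"
  by (simp add: horn_def)

lemma horn_iff: "x \<in> simp (horn n j) m \<longleftrightarrow> x \<in> hom Delta m n \<and> \<not> {..n} - {j} \<subseteq> dfun x ` {..m}"
  by (simp add: horn_def)

lemma horn_faces [simp]:
  "src (horn n j) = src (std_simplex n)" "tgt (horn n j) = tgt (std_simplex n)"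
  "front_face (horn n j) = front_face (std_simplex n)" "back_face (horn n j) = back_face (std_simplex n)"
  by (simp_all add: fun_eq_iff src_def tgt_def front_face_def back_face_def)

lemma simplicial_set_std_simplex: "simplicial_set (std_simplex n)"
proof
  show "is_sset (std_simplex n)"
    unfolding is_sset_def by (auto simp: hom_iff simp del: Delta_simps)
qed

lemma simplicial_set_horn: "simplicial_set (horn n j)"
proof
  have im: "dfun (x \<cdot>\<^bsub>Delta\<^esub> h) ` {..Dom Delta h} \<subseteq> dfun x ` {..Cod Delta h}" if "h \<in> Arr Delta" for x h
    using that by (cases x, cases h) (auto simp: Delta_arr compose_def)
  have "x \<cdot>\<^bsub>Delta\<^esub> h \<in> simp (horn n j) (Dom Delta h)" if "h \<in> Arr Delta" "x \<in> simp (horn n j) (Cod Delta h)" for x h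
  proof -
    have "h \<in> hom Delta (Dom Delta h) (Cod Delta h)" "x \<in> hom Delta (Cod Delta h) n"
      and "\<not> {..n} - {j} \<subseteq> dfun x ` {..Cod Delta h}"
      using that by (auto simp: hom_iff horn_iff)
    then show ?thesis
      using im[OF that(1), of x] Delta.comp_hom[of h _ _ x] unfolding horn_iff by blast
  qed
  then show "is_sset (horn n j)"
    unfolding is_sset_def by (auto simp: horn_iff hom_iff simp del: Delta_simps)
qed

lemma finite_hom_Delta: "finite (hom Delta m n)"
proof (rule finite_subset)
  show "hom Delta m n \<subseteq> {m} \<times> ({..m} \<rightarrow>\<^sub>E {..n}) \<times> {n}" by (auto simp: hom_iff Delta_arr)
  show "finite ({m} \<times> ({..m} \<rightarrow>\<^sub>E {..n}) \<times> {n})" by (intro finite_cartesian_product finite_PiE) auto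
qed

text \<open>A monotone map with equal end values is constant. This identifies the companion of a
  face outside the horn as a degenerate vertex.\<close>

lemma constant_simplex:
  assumes x: "x \<in> simp (std_simplex n) k" and v: "src (std_simplex n) k x = v" "tgt (std_simplex n) k x = v"
  shows "act (std_simplex n) (collapse k) v = x"
proof -
  obtain f where xx: "x = (k, f, n)" and f: "f \<in> {..k} \<rightarrow>\<^sub>E {..n}" "mono_on {..k} f"
    using x by (cases x) (auto simp: hom_iff Delta_arr)
  have "dfun (src (std_simplex n) k x) 0 = f 0" "dfun (tgt (std_simplex n) k x) 0 = f k"
    by (simp_all add: xx src_def tgt_def seg_def compose_def)
  then have "f 0 = f k" using v by simp
  then have const: "f i = f 0" if "i \<le> k" for i
    using f(2) that mono_onD[OF f(2), of 0 i] mono_onD[OF f(2), of i k] by fastforce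
  have "(\<lambda>i \<in> {..k}. f 0) = f"
  proof
    fix i show "(\<lambda>i \<in> {..k}. f 0) i = f i" using const[of i] f(1) by (cases "i \<le> k") (auto simp: PiE_iff extensional_def)
  qed
  then show ?thesis unfolding v(1)[symmetric] by (simp add: xx src_def seg_def compose_def collapse_def cong: restrict_cong)
qed

context
  fixes n j :: nat
  assumes j: "0 < j" "j < n"
begin

text \<open>Both 0 and n differ from the inner index \<open>j\<close>, and a single vertex misses
  one of them.\<close>

lemma horn_vertices: "simp (horn n j) 0 = simp (std_simplex n) 0"
proof -
  have "\<not> {..n} - {j} \<subseteq> {v}" for v using j by (auto simp: subset_iff)
  then show ?thesis by (auto simp: horn_def)
qed

text \<open>The image contains every vertex except possibly \<open>j\<close>, hence 0 and n. This
  places all simplices outside the horn over the pair of vertices for which the lifting property is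
  formulated.\<close>

lemma not_in_horn:
  assumes x: "x \<in> simp (std_simplex n) m" "x \<notin> simp (horn n j) m"
  shows "src (std_simplex n) m x = seg 0 0 n" "tgt (std_simplex n) m x = seg 0 n n" "0 < m"
proof -
  obtain f where xx: "x = (m, f, n)" and f: "f \<in> {..m} \<rightarrow>\<^sub>E {..n}" "mono_on {..m} f"
    using x(1) by (cases x) (auto simp: hom_iff Delta_arr)
  have im: "{..n} - {j} \<subseteq> f ` {..m}" using x by (simp add: horn_iff xx)
  have "0 \<in> f ` {..m}" by (rule subsetD[OF im]) (use j in simp)
  then obtain i where "i \<le> m" "f i = 0" by auto
  then have f0: "f 0 = 0" using mono_onD[OF f(2), of 0 i] by simp
  have "n \<in> f ` {..m}" by (rule subsetD[OF im]) (use j in simp)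
  then obtain i where "i \<le> m" "f i = n" by auto
  moreover have "f m \<le> n" using f(1) by auto
  ultimately have fm: "f m = n" using mono_onD[OF f(2), of i m] by simp
  show "src (std_simplex n) m x = seg 0 0 n" "tgt (std_simplex n) m x = seg 0 n n"
    using f0 fm by (auto simp: xx src_def tgt_def seg_def compose_def fun_eq_iff)
  show "0 < m" using f0 fm j by (cases m) auto
qed

end

section \<open>Extending families from horns to simplices\<close>

lemma op_Nec_simps [simp]:
  "Obj (op_cat Nec) = Obj Nec" "Arr (op_cat Nec) = Arr Nec" "Dom (op_cat Nec) = Cod Nec" "Cod (op_cat Nec) = Dom Nec"
  by (simp_all add: op_cat_def)

lemma neck_functor_simps:
  "ObjF (neck_functor C (X, S) a b) t = tens (Quiv C S) X (gaps (fst t)) (a, b)"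
  "ArrF (neck_functor C (X, S) a b) h = neck_map (Quiv C S) X h (a, b)"
  by (simp_all add: neck_functor_def neck_obj_def case_prod_beta)

lemma (in free_object) neck_functor_free:
  "ObjF (neck_functor C (F_tilde C K) a b) t = tens (Quiv C V) F (gaps (fst t)) (a, b)"
  "ArrF (neck_functor C (F_tilde C K) a b) h = neck_map (Quiv C V) F h (a, b)"
  by (simp_all add: neck_functor_def neck_obj_def case_prod_beta snd_F_tilde)

lemma (in free_object_target) neck_nat_trans:
  assumes f: "f \<in> V \<rightarrow> S" and \<alpha>: "\<And>n. \<alpha> n \<in> hom (Quiv C S) (pushF f n) (ObjF Y n)"
    and e: "is_family S Y K f e" and ev: "\<And>n x. x \<in> simp K n \<Longrightarrow> ev \<alpha> f n x = e n x"
    and ab: "a \<in> V" "b \<in> V"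
  shows "is_nat_trans (op_cat Nec) C (neck_functor C (F_tilde C K) a b) (neck_functor C (Y, S) (f a) (f b))
    (\<lambda>t. tens_map C (F_tilde C K) (Y, S) (\<alpha>, f) (gaps (fst t)) (a, b))"
proof -
  interpret E: element_family C S Y K f e by unfold_locales (rule e)
  let ?t = "\<lambda>ds. tens_map C (F_tilde C K) (Y, S) (\<alpha>, f) ds (a, b)"
  have S': "f a \<in> S" "f b \<in> S" using f ab by auto
  have t: "?t ds \<in> hom C (tens (Quiv C V) F ds (a, b)) (T ds (f a, f b))" for ds
    using quiv_hom_app[OF conjunct1[OF tens_map_el[OF f \<alpha> e ev]] ab] ab by simp
  have tel: "?t ds \<cdot> free.el b ds xs = E.el b ds xs" if "chain K ds xs a b" for ds xs
    using conjunct2[OF tens_map_el[OF f \<alpha> e ev]] that by blast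
  have nat: "?t (gaps N) \<cdot> neck_map (Quiv C V) F ((N, p), g, (M, q)) (a, b) =
      neck_map (Quiv C S) Y ((N, p), g, (M, q)) (f a, f b) \<cdot> ?t (gaps M)"
    if h: "((N, p), g, (M, q)) \<in> Arr Nec" for N p g M q
  proof (rule jointly_epiD[OF jointly_epi_el[OF ab(2,1)]])
    note nF = quiv_hom_app[OF free.neck_map_hom[OF h] ab] and nY = quiv_hom_app[OF neck_map_hom[OF h] S']
    show "?t (gaps N) \<cdot> neck_map (Quiv C V) F ((N, p), g, (M, q)) (a, b) \<in> hom C (tens (Quiv C V) F (gaps M) (a, b)) (T (gaps N) (f a, f b))"
      by (rule comp_hom[OF nF t])
    show "neck_map (Quiv C S) Y ((N, p), g, (M, q)) (f a, f b) \<cdot> ?t (gaps M) \<in> hom C (tens (Quiv C V) F (gaps M) (a, b)) (T (gaps N) (f a, f b))"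
      by (rule comp_hom[OF t nY])
    fix z assume "z \<in> {free.el b (gaps M) xs |xs. chain K (gaps M) xs a b}"
    then obtain xs where z: "z = free.el b (gaps M) xs" and xs: "chain K (gaps M) xs a b" by blast
    note zh = free.el_hom[OF xs]
    have "(?t (gaps N) \<cdot> neck_map (Quiv C V) F ((N, p), g, (M, q)) (a, b)) \<cdot> z =
        ?t (gaps N) \<cdot> free.el b (gaps N) (neck_chain K a ((N, p), g, (M, q)) xs)"
      unfolding z comp_assoc[OF zh nF t] free.neck_map_el[OF h xs] by (rule refl)
    also have "\<dots> = E.el b (gaps N) (neck_chain K a ((N, p), g, (M, q)) xs)"
      by (rule tel[OF chain_neck_chain[OF h xs]])
    also have "\<dots> = (neck_map (Quiv C S) Y ((N, p), g, (M, q)) (f a, f b) \<cdot> ?t (gaps M)) \<cdot> z"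
      unfolding z comp_assoc[OF zh t nY] tel[OF xs] E.neck_map_el[OF h xs] by (rule refl)
    finally show "(?t (gaps N) \<cdot> neck_map (Quiv C V) F ((N, p), g, (M, q)) (a, b)) \<cdot> z =
      (neck_map (Quiv C S) Y ((N, p), g, (M, q)) (f a, f b) \<cdot> ?t (gaps M)) \<cdot> z" .
  qed
  show ?thesis
    unfolding is_nat_trans_def op_Nec_simps neck_functor_simps neck_functor_free
  proof (intro conjI ballI)
    fix h assume h: "h \<in> Arr Nec"
    obtain N p g M q where hh: "h = ((N, p), g, (M, q))" by (metis prod.exhaust)
    show "?t (gaps (fst (Dom Nec h))) \<cdot> neck_map (Quiv C V) F h (a, b) = neck_map (Quiv C S) Y h (f a, f b) \<cdot> ?t (gaps (fst (Cod Nec h)))"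
      using nat h by (simp add: hh)
  qed (rule t)
qed

context free_object_map
begin

lemma family_of_map: "is_family L.V L.F K r (\<lambda>n x. L.gen n (\<phi> n x))"
  by (rule is_family_pullback[OF L.free.family]) auto

text \<open>For the inclusion of a horn, this computes \<open>horn_incl\<close> on products of
  generators.\<close>

lemma tens_map_free:
  assumes xs: "chain K ds xs a b"
  shows "tens_map C (F_tilde C K) (F_tilde C L) (F_tilde_map C K L \<phi>) ds (a, b) \<in>
      hom C (tens (Quiv C V) F ds (a, b)) (tens (Quiv C L.V) L.F ds (\<phi> 0 a, \<phi> 0 b))"
    and "tens_map C (F_tilde C K) (F_tilde C L) (F_tilde_map C K L \<phi>) ds (a, b) \<cdot> free.el b ds xs =
      L.free.el (\<phi> 0 b) ds (map (\<lambda>(d, x). \<phi> d x) (zip ds xs))"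
proof -
  interpret E: element_family C L.V L.F K r "\<lambda>n x. L.gen n (\<phi> n x)" by unfold_locales (rule family_of_map)
  have ab: "a \<in> V" "b \<in> V" using chain_ends[OF xs] by auto
  note 1 = KL.tens_map_el[OF r_Pi \<rho>_hom[folded L.F_obj] family_of_map ev_\<rho>, of ds, folded L.F_tilde_eq, folded F_tilde_map_eq]
  show "tens_map C (F_tilde C K) (F_tilde C L) (F_tilde_map C K L \<phi>) ds (a, b) \<in>
      hom C (tens (Quiv C V) F ds (a, b)) (tens (Quiv C L.V) L.F ds (\<phi> 0 a, \<phi> 0 b))"
    using quiv_hom_app[OF conjunct1[OF 1] ab] ab by simp
  have "E.el b ds xs = L.free.el (\<phi> 0 b) ds (map (\<lambda>(d, x). \<phi> d x) (zip ds xs))"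
    using xs
  proof (induction ds arbitrary: xs a)
    case (Cons d ds)
    then obtain y ys where "xs = y # ys" "y \<in> simp K d" "chain K ds ys (tgt K d y) b" by (auto simp: chain_Cons)
    then show ?case using Cons.IH ab(2) r_src[of y d] r_tgt[of y d] by (simp del: restrict_apply) simp
  qed (simp add: chain_Nil)
  then show "tens_map C (F_tilde C K) (F_tilde C L) (F_tilde_map C K L \<phi>) ds (a, b) \<cdot> free.el b ds xs =
      L.free.el (\<phi> 0 b) ds (map (\<lambda>(d, x). \<phi> d x) (zip ds xs))"
    using conjunct2[OF 1] xs by simp
qed

end

text \<open>Finite index sets suffice over \<open>delta\<close>, since \<open>hom Delta m n\<close>
  is finite; the possibly infinite vertex set \<open>S\<close> has its coproducts from
  \<open>templicial_object\<close>.\<close>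

locale finitary_templicial_object = templicial_object C S X
  for C :: "('o, 'm, 'z) symcat_scheme" (structure) and S :: "'s set" and X +
  assumes simplex_coprods: "finite (A :: delta set) \<Longrightarrow> has_coprods C A"
    and simplex_pair_coprods: "finite (B :: (delta \<times> delta) set) \<Longrightarrow> has_coprods C B"
begin

lemma free_object_finite:
  fixes K :: "delta sset"
  assumes "simplicial_set K" "\<And>n. finite (simp K n)"
  shows "free_object C K"
  by (intro free_object.intro free_object_axioms.intro enriching_category_axioms assms)
     (auto intro!: simplex_coprods simplex_pair_coprods intro: finite_subset[OF _ assms(2)] finite_subset[OF _ finite_cartesian_product[OF assms(2) assms(2)]])

lemma free_object_std_simplex: "free_object C (std_simplex n)"
  by (rule free_object_finite[OF simplicial_set_std_simplex]) (simp add: finite_hom_Delta)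

lemma free_object_horn: "free_object C (horn n j)"
  by (rule free_object_finite[OF simplicial_set_horn]) (auto simp: horn_def finite_hom_Delta)

lemma free_object_target_std_simplex: "free_object_target C (std_simplex n) S X"
  by (intro free_object_target.intro free_object_std_simplex colax_quiver_axioms)

lemma free_object_target_horn: "free_object_target C (horn n j) S X"
  by (intro free_object_target.intro free_object_horn colax_quiver_axioms)

lemma extend_family:
  assumes qcat: "quasi_category_in C (X, S)" and j: "0 < j" "j < n"
    and f: "f \<in> simp (horn n j) 0 \<rightarrow>\<^sub>E S" and e: "is_family S X (horn n j) f e"
  shows "\<exists>e'. is_family S X (std_simplex n) f e' \<and> (\<forall>m. \<forall>x \<in> simp (horn n j) m. e' m x = e m x)"
proof -
  let ?H = "horn n j" and ?D = "std_simplex n" and ?p = "seg 0 0 n" and ?q = "seg 0 n n"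
  interpret H: free_object C ?H by (rule free_object_horn)
  interpret D: free_object C ?D by (rule free_object_std_simplex)
  interpret HX: free_object_target C ?H S X by (rule free_object_target_horn)
  interpret HD: free_object_map C ?H ?D "\<lambda>_ x. x"
    by unfold_locales (auto simp: is_sset_map_def horn_iff)
  interpret E: element_family C S X ?H f e by unfold_locales (rule e)
  let ?a = "f ?p" and ?b = "f ?q"
  have VV: "simp ?H 0 = simp ?D 0" by (rule horn_vertices[OF j])
  have ends: "?p \<in> simp ?H 0" "?q \<in> simp ?H 0" unfolding VV by (auto simp: hom_iff)
  have ab: "?a \<in> S" "?b \<in> S" using ends E.f_in by auto
  obtain \<alpha> where \<alpha>: "(\<alpha>, f) \<in> templicial_hom C (F_tilde C ?H) (X, S)" and ev: "\<And>n x. x \<in> simp ?H n \<Longrightarrow> HX.ev \<alpha> f n x = e n x"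
    using HX.templicial_hom_ex[OF f e] by blast
  have f': "f \<in> simp ?H 0 \<rightarrow> S" and \<alpha>h: "\<And>n. \<alpha> n \<in> hom (Quiv C S) (HX.pushF f n) (ObjF X n)"
    using f \<alpha> by (auto simp: HX.templicial_hom_iff)
  let ?\<phi> = "\<lambda>t. tens_map C (F_tilde C ?H) (X, S) (\<alpha>, f) (gaps (fst t)) (?p, ?q)"
  have nat: "is_nat_trans (op_cat Nec) C (neck_functor C (F_tilde C ?H) ?p ?q) (neck_functor C (X, S) ?a ?b) ?\<phi>"
    by (rule HX.neck_nat_trans[OF f' \<alpha>h e ev ends])
  have "\<exists>\<psi>. is_nat_trans (op_cat Nec) C (neck_functor C (F_tilde C ?D) ?p ?q) (neck_functor C (X, S) ?a ?b) \<psi> \<and>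
      (\<forall>t \<in> Obj Nec. \<psi> t \<cdot> horn_incl C n j t = ?\<phi> t)"
    by (rule qcat[unfolded quasi_category_in_def snd_conv, THEN conjunct2, rule_format, OF ab conjI[OF j(1) conjI[OF j(2) nat]]])
  then obtain \<psi> where \<psi>: "is_nat_trans (op_cat Nec) C (neck_functor C (F_tilde C ?D) ?p ?q) (neck_functor C (X, S) ?a ?b) \<psi>"
    and \<psi>\<phi>: "\<And>t. t \<in> Obj Nec \<Longrightarrow> \<psi> t \<cdot> horn_incl C n j t = ?\<phi> t"
    by (elim exE conjE) (metis (no_types, lifting))
  have \<psi>_hom: "\<psi> t \<in> hom C (tens (Quiv C D.V) D.F (gaps (fst t)) (?p, ?q)) (T (gaps (fst t)) (?a, ?b))" if "t \<in> Obj Nec" for t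
    using \<psi> that unfolding is_nat_trans_def op_Nec_simps neck_functor_simps D.neck_functor_free by blast
  have aD: "?p \<in> D.V" "?q \<in> D.V" using ends VV by auto
  \<comment> \<open>Naturality evaluated at a chain: on the free side the necklace map acts on the
    chain alone.\<close>
  have \<psi>_nat: "neck_map (Quiv C S) X h (?a, ?b) \<cdot> \<psi> (Cod Nec h) \<cdot> D.free.el ?q (gaps (fst (Cod Nec h))) xs =
      \<psi> (Dom Nec h) \<cdot> D.free.el ?q (gaps (fst (Dom Nec h))) (neck_chain ?D ?p h xs)"
    if h: "h \<in> Arr Nec" and xs: "chain ?D (gaps (fst (Cod Nec h))) xs ?p ?q" for h xs
  proof -
    obtain N p g M q where hh: "h = ((N, p), g, (M, q))" by (metis prod.exhaust)
    note h' = h[unfolded hh] and xs' = xs[unfolded hh Nec_simps fst_conv]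
    have ob: "(N, p) \<in> Obj Nec" "(M, q) \<in> Obj Nec" using h' by (auto simp: Nec_arr)
    note nX = quiv_hom_app[OF neck_map_hom[OF h'] ab] and nF = quiv_hom_app[OF D.free.neck_map_hom[OF h'] aD]
    note \<psi>N = \<psi>_hom[OF ob(1), unfolded fst_conv] and \<psi>M = \<psi>_hom[OF ob(2), unfolded fst_conv] and el = D.free.el_hom[OF xs']
    have "\<psi> (N, p) \<cdot> neck_map (Quiv C D.V) D.F h (?p, ?q) = neck_map (Quiv C S) X h (?a, ?b) \<cdot> \<psi> (M, q)"
      using \<psi> h unfolding is_nat_trans_def op_Nec_simps neck_functor_simps D.neck_functor_free by (auto simp: hh)
    then have "(neck_map (Quiv C S) X h (?a, ?b) \<cdot> \<psi> (M, q)) \<cdot> D.free.el ?q (gaps M) xs =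
      (\<psi> (N, p) \<cdot> neck_map (Quiv C D.V) D.F h (?p, ?q)) \<cdot> D.free.el ?q (gaps M) xs" by simp
    then show ?thesis
      unfolding hh comp_assoc[OF el \<psi>M nX] comp_assoc[OF el nF \<psi>N] D.free.neck_map_el[OF h' xs'] by simp
  qed
  \<comment> \<open>A chain all of whose entries lie in the horn comes from the free object on the
    horn, where the extension is prescribed.\<close>
  have \<psi>_horn: "\<psi> t \<cdot> D.free.el ?q (gaps (fst t)) xs = E.el ?q (gaps (fst t)) xs"
    if t: "t \<in> Obj Nec" and xs: "chain ?H (gaps (fst t)) xs ?p ?q" for t xs
  proof -
    have "map (\<lambda>(d, x). x) (zip (gaps (fst t)) xs) = xs"
      using chain_length[OF xs] by (metis (no_types, lifting) case_prod_unfold map_eq_conv map_snd_zip)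
    note incl = HD.tens_map_free[OF xs, unfolded this]
    have hi: "horn_incl C n j t = tens_map C (F_tilde C ?H) (F_tilde C ?D) (F_tilde_map C ?H ?D (\<lambda>_ x. x)) (gaps (fst t)) (?p, ?q)"
      by (simp add: horn_incl_def case_prod_beta)
    have "\<psi> t \<cdot> D.free.el ?q (gaps (fst t)) xs = (\<psi> t \<cdot> horn_incl C n j t) \<cdot> H.free.el ?q (gaps (fst t)) xs"
      unfolding hi comp_assoc[OF H.free.el_hom[OF xs] incl(1) \<psi>_hom[OF t]] incl(2) by (rule refl)
    also have "\<dots> = E.el ?q (gaps (fst t)) xs"
      unfolding \<psi>\<phi>[OF t] using conjunct2[OF HX.tens_map_el[OF f' \<alpha>h e ev]] xs by blast
    finally show ?thesis .
  qed
  define e' where "e' m x = (if x \<in> simp ?H m then e m x else \<psi> (bead m) \<cdot> D.gen m x)" for m x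
  \<comment> \<open>Membership in \<open>?D\<close> stays folded so that the lemmas about simplicial
    sets match.\<close>
  note [simp del] = std_simplex_simps(1)
  have bead_Obj: "bead m \<in> Obj Nec" for m by (simp add: bead_def)
  have beads2_Obj: "beads2 k l \<in> Obj Nec" for k l by (auto simp: beads2_def)
  have fst_bead: "gaps (fst (bead m)) = [m]" if "0 < m" for m using that by (simp add: bead_def gaps_bead)
  have fst_beads2: "gaps (fst (beads2 k l)) = [k, l]" if "0 < k" "0 < l" for k l using that by (simp add: beads2_def gaps_beads2)
  \<comment> \<open>Simplices of the horn that run from 0 to n are included, by
    \<open>\<psi>_horn\<close>. This allows passing to a face without asking whether it lies in the
    horn.\<close>
  have e'_bead: "e' m x = \<psi> (bead m) \<cdot> D.gen m x"
    if x: "x \<in> simp ?D m" "src ?D m x = ?p" "tgt ?D m x = ?q" and m: "0 < m" for m x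
  proof (cases "x \<in> simp ?H m")
    case True
    then have "chain ?H (gaps (fst (bead m))) [x] ?p ?q" using x ends m by (simp add: fst_bead)
    from \<psi>_horn[OF bead_Obj this] show ?thesis using True m by (simp add: e'_def fst_bead)
  qed (simp add: e'_def)
  have not_H: "src ?D m x = ?p" "tgt ?D m x = ?q" "0 < m" if "x \<in> simp ?D m" "x \<notin> simp ?H m" for m x
    using not_in_horn[OF j that] by auto
  have e'_hom: "e' m x \<in> hom C I (ObjF X m (f (src ?D m x), f (tgt ?D m x)))" if x: "x \<in> simp ?D m" for m x
  proof (cases "x \<in> simp ?H m")
    case True
    then show ?thesis using E.e_hom[OF True] by (simp add: e'_def)
  next
    case False
    note nH = not_H[OF x False]
    have "\<psi> (bead m) \<in> hom C (free_quiv C ?D m (?p, ?q)) (ObjF X m (?a, ?b))"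
      using \<psi>_hom[OF bead_Obj, of m] nH(3) by (simp add: fst_bead D.F_obj)
    from comp_hom[OF D.gen_hom[OF x, unfolded nH(1,2)] this] show ?thesis using False nH by (simp add: e'_def)
  qed
  \<comment> \<open>In degree 0 the counit condition leaves no choice.\<close>
  have e0: "e 0 v = inv_arr (Quiv C S) (counit X) (f v, f v)" if v: "v \<in> simp ?H 0" for v
  proof -
    have fv: "f v \<in> S" by (rule E.f_in[OF v])
    have "e 0 v \<in> hom C I (ObjF X 0 (f v, f v))"
      using E.e_hom[OF v] H.src_vertex[OF v] H.tgt_vertex[OF v] by simp
    from quiv_inv_app[OF Y_counit_iso Y_counit fv fv this E.e_counit[OF v]] show ?thesis
      using comp_id[OF inv_counit_hom[OF fv]] by simp
  qed
  have e_collapse: "ArrF X (collapse k) (f v, f v) \<cdot> inv_arr (Quiv C S) (counit X) (f v, f v) = e' k (act ?D (collapse k) v)"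
    if v: "v \<in> simp ?H 0" for k v
  proof -
    have "act ?H (collapse k) v \<in> simp ?H k" using H.act_in[OF Delta_f_arrD[OF collapse_arr], of v k] v by simp
    then show ?thesis
      using E.e_act[OF collapse_arr, of v k] v e0[OF v] H.src_vertex[OF v] H.tgt_vertex[OF v] by (simp add: e'_def)
  qed
  have fam: "is_family S X ?D f e'"
    unfolding is_family_def
  proof (intro conjI ballI allI)
    show "f v \<in> S" if "v \<in> simp ?D 0" for v using E.f_in[of v] that VV by simp
    show "e' m x \<in> hom C I (ObjF X m (f (src ?D m x), f (tgt ?D m x)))" if "x \<in> simp ?D m" for m x by (rule e'_hom[OF that])
    show "counit X (f v, f v) \<cdot> e' 0 v = Id C I" if "v \<in> simp ?D 0" for v
      using E.e_counit[of v] that VV by (simp add: e'_def)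
  next
    fix h x assume h: "h \<in> Arr Delta_f" and x: "x \<in> simp ?D (Cod Delta h)"
    let ?m = "Dom Delta h" and ?n = "Cod Delta h"
    show "ArrF X h (f (src ?D ?n x), f (tgt ?D ?n x)) \<cdot> e' ?n x = e' ?m (act ?D h x)"
    proof (cases "x \<in> simp ?H ?n")
      case True
      then show ?thesis using E.e_act[OF h True] H.act_in[OF Delta_f_arrD[OF h] True] by (simp add: e'_def)
    next
      case False
      note nH = not_H[OF x False]
      note hx = D.act_in[OF Delta_f_arrD[OF h] x] and ends' = D.src_act[OF h x] D.tgt_act[OF h x]
      \<comment> \<open>A map of \<open>Delta_f\<close> out of [0] has codomain [0], as its value at
        0 is both first and last.\<close>
      have m: "0 < ?m"
      proof (rule ccontr)
        assume "\<not> 0 < ?m"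
        then show False using h nH(3) by (cases h) (simp add: Delta_f_arr)
      qed
      note ex = e'_hom[OF x, unfolded nH(1,2)] and ebx = e'_bead[OF x nH]
      have c: "chain ?D (gaps (fst (Cod Nec (bead_arr h)))) [x] ?p ?q"
        using x nH aD by (simp add: bead_arr_def fst_bead)
      \<comment> \<open>\<open>act ?D h x\<close> may well lie in the horn, but it still runs from 0
        to n in positive dimension, so \<open>e'_bead\<close> covers it.\<close>
      have "neck_map (Quiv C S) X (bead_arr h) (?a, ?b) \<cdot> e' ?n x = e' ?m (act ?D h x)"
        using \<psi>_nat[OF bead_arr_Nec[OF h m nH(3)] c] D.neck_chain_bead_arr[OF h m nH(3) x, of ?p]
          e'_bead[OF hx] ends' nH m ebx
        by (simp add: bead_arr_def fst_bead)
      then show ?thesis using neck_map_bead_arr[OF ab h m nH(3) ex] nH by simp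
    qed
  next
    fix k l x assume x: "x \<in> simp ?D (k + l)"
    let ?y = "front_face ?D k l x" and ?w = "back_face ?D k l x" and ?c = "act ?D (seg 0 k (k + l)) x"
    show "comult X k l (f (src ?D (k + l) x), f (tgt ?D (k + l) x)) \<cdot> e' (k + l) x =
      qprod S (ObjF X k) (ObjF X l) (f (src ?D (k + l) x)) (f (tgt ?D (k + l) x)) (f ?c) (e' k ?y) (e' l ?w)"
    proof (cases "x \<in> simp ?H (k + l)")
      case True
      then show ?thesis
        using E.e_comult[OF True] H.front_in[OF True] H.back_in[OF True] by (simp add: e'_def)
    next
      case False
      note nH = not_H[OF x False]
      note ex = e'_hom[OF x, unfolded nH(1,2)] and ebx = e'_bead[OF x nH]
      note y = D.front_in[OF x] and w = D.back_in[OF x]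
      have sy: "src ?D k ?y = ?p" and ty: "tgt ?D k ?y = ?c" and sw: "src ?D l ?w = ?c" and tw: "tgt ?D l ?w = ?q"
        using D.src_front[OF x] D.tgt_front[OF x] D.src_back[OF x] D.tgt_back[OF x] nH by auto
      \<comment> \<open>A two-bead necklace requires both lengths to be positive; the other two
        cases follow from \<open>comult_zero_left\<close> and
        \<open>comult_zero_right\<close>.\<close>
      consider "k = 0" | "l = 0" | "0 < k" "0 < l" by blast
      then show ?thesis
      proof cases
        case 1
        have x': "x \<in> simp ?D l" using x 1 by simp
        have y0: "?y = ?p" "?c = ?p" using 1 nH(1) by (simp_all add: front_face_def src_def)
        have w0: "?w = x" using 1 D.act_id[OF x'] by (simp add: back_face_def seg_id)
        have "e' 0 ?p = inv_arr (Quiv C S) (counit X) (?a, ?a)" using e0[OF ends(1)] ends by (simp add: e'_def)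
        then show ?thesis using comult_zero_left[OF ab, of "e' l x" l] ex nH 1 y0 w0 by simp
      next
        case 2
        have x': "x \<in> simp ?D k" using x 2 by simp
        have w0: "?w = ?q" "?c = ?q" using 2 nH(2) by (simp_all add: back_face_def tgt_def)
        have y0: "?y = x" using 2 D.front_zero[OF x'] by simp
        have "e' 0 ?q = inv_arr (Quiv C S) (counit X) (?b, ?b)" using e0[OF ends(2)] ends by (simp add: e'_def)
        then show ?thesis using comult_zero_right[OF ab, of "e' k x" k] ex nH 2 y0 w0 by simp
      next
        case 3
        have c: "chain ?D (gaps (fst (Cod Nec (cut_arr k l)))) [x] ?p ?q"
          using x nH aD 3 by (simp add: cut_arr_def fst_bead)
        have "comult X k l (?a, ?b) \<cdot> e' (k + l) x = neck_map (Quiv C S) X (cut_arr k l) (?a, ?b) \<cdot> e' (k + l) x"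
          by (rule sym[OF neck_map_cut_arr[OF ab 3 ex]])
        also have "\<dots> = \<psi> (beads2 k l) \<cdot> D.free.el ?q [k, l] [?y, ?w]"
          using \<psi>_nat[OF cut_arr_Nec[OF 3] c] D.neck_chain_cut_arr[OF 3 x, of ?p] ebx 3
          by (simp add: cut_arr_def fst_bead fst_beads2 del: D.free.el.simps(1)) (simp add: fst_bead)
        also have "\<dots> = qprod S (ObjF X k) (ObjF X l) ?a ?b (f ?c) (e' k ?y) (e' l ?w)"
        proof (cases "?y \<in> simp ?H k")
          case yH: True
          show ?thesis
          proof (cases "?w \<in> simp ?H l")
            case wH: True
            have "chain ?H (gaps (fst (beads2 k l))) [?y, ?w] ?p ?q"
              using yH wH sy ty sw tw ends 3 by (simp add: fst_beads2)
            from \<psi>_horn[OF beads2_Obj this] show ?thesis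
              using 3 yH wH sy ty by (simp add: fst_beads2 e'_def)
          next
            case False
            note nw = not_H[OF w False]
            \<comment> \<open>The back face is outside the horn, so it starts at 0; the front face
              then runs from 0 to 0 and is constant.\<close>
            have ca: "?c = ?p" using nw(1) sw by simp
            have yc: "act ?D (collapse k) ?p = ?y" by (rule constant_simplex[OF y sy]) (simp only: ty ca)
            have c': "chain ?D (gaps (fst (Cod Nec (drop_left k l)))) [?w] ?p ?q"
              using w nw aD 3 by (simp add: drop_left_def fst_bead)
            have ew: "e' l ?w = \<psi> (bead l) \<cdot> D.gen l ?w" by (rule e'_bead[OF w nw])
            have "\<psi> (beads2 k l) \<cdot> D.free.el ?q [k, l] [?y, ?w] = neck_map (Quiv C S) X (drop_left k l) (?a, ?b) \<cdot> e' l ?w"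
              using \<psi>_nat[OF drop_left_Nec[OF 3] c'] D.neck_chain_drop_left[OF 3 w, of ?p] ew 3 yc
              by (simp add: drop_left_def fst_bead fst_beads2 del: D.free.el.simps(1) std_simplex_simps) (simp add: fst_bead)
            then show ?thesis
              using neck_map_drop_left[OF ab 3 e'_hom[OF w, unfolded nw(1,2)]] e_collapse[OF ends(1), of k] yc ca by simp
          qed
        next
          case False
          note ny = not_H[OF y False]
          \<comment> \<open>Dually, the front face already ends at n, which makes the back face
            constant.\<close>
          have ca: "?c = ?q" using ny(2) ty by simp
          have wc: "act ?D (collapse l) ?q = ?w" by (rule constant_simplex[OF w _ tw]) (simp only: sw ca)
          have c': "chain ?D (gaps (fst (Cod Nec (drop_right k l)))) [?y] ?p ?q"
            using y ny aD 3 by (simp add: drop_right_def fst_bead)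
          have ey: "e' k ?y = \<psi> (bead k) \<cdot> D.gen k ?y" by (rule e'_bead[OF y ny])
          have "\<psi> (beads2 k l) \<cdot> D.free.el ?q [k, l] [?y, ?w] = neck_map (Quiv C S) X (drop_right k l) (?a, ?b) \<cdot> e' k ?y"
            using \<psi>_nat[OF drop_right_Nec[OF 3] c'] D.neck_chain_drop_right[OF 3 y, of ?p] ey 3 wc ny(2)
            by (simp add: drop_right_def fst_bead fst_beads2 del: D.free.el.simps(1) std_simplex_simps) (simp add: fst_bead)
          then show ?thesis
            using neck_map_drop_right[OF ab 3 e'_hom[OF y, unfolded ny(1,2)]] e_collapse[OF ends(2), of l] wc ca by simp
        qed
        finally show ?thesis using nH by simp
      qed
    qed
  qed
  show ?thesis using fam by (intro exI[of _ e']) (simp add: e'_def)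
qed

section \<open>The simplicial set of a templicial object\<close>

abbreviation U where "U \<equiv> U_tilde C (X, S)"

definition elem where
  "elem m \<theta> k x = free_object_target.ev C (std_simplex m) (fst \<theta>) (snd \<theta>) k x"

lemma U_simp: "simp U m = templicial_hom C (F_tilde C (std_simplex m)) (X, S)"
  by (simp add: U_tilde_def)

lemma U_eqI:
  assumes "\<theta> \<in> simp U m" "\<theta>' \<in> simp U m" "\<And>v. v \<in> hom Delta 0 m \<Longrightarrow> snd \<theta> v = snd \<theta>' v"
    "\<And>k x. x \<in> hom Delta k m \<Longrightarrow> elem m \<theta> k x = elem m \<theta>' k x"
  shows "\<theta> = \<theta>'"
proof -
  interpret free_object_target C "std_simplex m" S X by (rule free_object_target_std_simplex)
  show ?thesis
    using templicial_hom_eqI[of "fst \<theta>" "snd \<theta>" "fst \<theta>'" "snd \<theta>'"] assms by (simp add: U_simp elem_def)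
qed

lemma U_family:
  assumes "\<theta> \<in> simp U m"
  shows "is_family S X (std_simplex m) (snd \<theta>) (elem m \<theta>)"
proof -
  interpret free_object_target C "std_simplex m" S X by (rule free_object_target_std_simplex)
  show ?thesis using assms templicial_hom_iff[of "fst \<theta>" "snd \<theta>"] by (simp add: U_simp elem_def[abs_def])
qed

lemma
  assumes h: "h \<in> Arr Delta" and \<theta>: "\<theta> \<in> simp U (Cod Delta h)"
  shows U_act_in: "act U h \<theta> \<in> simp U (Dom Delta h)"
    and U_act_vertex: "v \<in> hom Delta 0 (Dom Delta h) \<Longrightarrow> snd (act U h \<theta>) v = snd \<theta> (h \<cdot>\<^bsub>Delta\<^esub> v)"
    and U_act_elem: "x \<in> hom Delta k (Dom Delta h) \<Longrightarrow> elem (Dom Delta h) (act U h \<theta>) k x = elem (Cod Delta h) \<theta> k (h \<cdot>\<^bsub>Delta\<^esub> x)"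
proof -
  let ?m = "Dom Delta h" and ?n = "Cod Delta h"
  have "is_sset_map (std_simplex ?m) (std_simplex ?n) (\<lambda>_ x. h \<cdot>\<^bsub>Delta\<^esub> x)"
    using h unfolding is_sset_map_def by (auto simp: hom_iff simp del: Delta_simps)
  then interpret free_object_map C "std_simplex ?m" "std_simplex ?n" "\<lambda>_ x. h \<cdot>\<^bsub>Delta\<^esub> x"
    by (intro free_object_map.intro free_object_std_simplex free_object_map_axioms.intro)
  obtain \<beta> g where \<beta>: "\<theta> = (\<beta>, g)" by (cases \<theta>)
  obtain \<gamma> f where \<gamma>: "act U h \<theta> = (\<gamma>, f)" by (cases "act U h \<theta>")
  have comp: "templicial_comp C (F_tilde C (std_simplex ?m)) L.V S
      (F_tilde_map C (std_simplex ?m) (std_simplex ?n) (\<lambda>_ x. h \<cdot>\<^bsub>Delta\<^esub> x)) (\<beta>, g) = (\<gamma>, f)"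
    using \<gamma> by (simp add: U_tilde_def \<beta> Let_def)
  note hom = \<theta>[unfolded U_simp \<beta>]
  show "act U h \<theta> \<in> simp U (Dom Delta h)"
    unfolding \<gamma> U_simp by (rule templicial_comp_hom(1)[OF colax_quiver_axioms hom comp])
  show "snd (act U h \<theta>) v = snd \<theta> (h \<cdot>\<^bsub>Delta\<^esub> v)" if "v \<in> hom Delta 0 (Dom Delta h)"
    using templicial_comp_hom(2)[OF colax_quiver_axioms hom comp, of v] that unfolding \<gamma> by (simp add: \<beta>)
  show "elem (Dom Delta h) (act U h \<theta>) k x = elem (Cod Delta h) \<theta> k (h \<cdot>\<^bsub>Delta\<^esub> x)" if "x \<in> hom Delta k (Dom Delta h)"
    using templicial_comp_hom(3)[OF colax_quiver_axioms hom comp, of x k] that unfolding \<gamma> by (simp add: \<beta> elem_def)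
qed

text \<open>By \<open>U_eqI\<close> a simplex of U is known from its vertices and its elements. On
  these, \<open>act U h\<close> is reindexing along postcomposition with \<open>h\<close>, so
  functoriality comes down to associativity in \<open>Delta\<close>.\<close>

lemma U_sset: "is_sset U"
  unfolding is_sset_def
proof (intro conjI ballI allI impI)
  fix n \<theta> assume \<theta>: "\<theta> \<in> simp U n"
  have id: "Id Delta n \<in> Arr Delta" "Dom Delta (Id Delta n) = n" "Cod Delta (Id Delta n) = n" using Delta.arr_id[of n] by simp_all
  show "act U (Id Delta n) \<theta> = \<theta>"
    using U_act_in[OF id(1), of \<theta>] U_act_vertex[OF id(1), of \<theta>] U_act_elem[OF id(1), of \<theta>] \<theta> Delta.id_comp
    unfolding id by (intro U_eqI) auto
next
  fix g h \<theta> assume g: "g \<in> Arr Delta" and h: "h \<in> Arr Delta" and gh: "Dom Delta g = Cod Delta h" and \<theta>: "\<theta> \<in> simp U (Cod Delta g)"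
  note ag = U_act_in[OF g \<theta>, unfolded gh]
  have c: "g \<cdot>\<^bsub>Delta\<^esub> h \<in> Arr Delta" "Dom Delta (g \<cdot>\<^bsub>Delta\<^esub> h) = Dom Delta h" "Cod Delta (g \<cdot>\<^bsub>Delta\<^esub> h) = Cod Delta g"
    using g h gh by (simp_all del: Delta_simps)
  have \<theta>': "\<theta> \<in> simp U (Cod Delta (g \<cdot>\<^bsub>Delta\<^esub> h))" using \<theta> by (simp only: c)
  have gh_hom: "h \<in> hom Delta (Dom Delta h) (Dom Delta g)" using h gh by (simp add: hom_iff)
  have hx: "h \<cdot>\<^bsub>Delta\<^esub> x \<in> hom Delta k (Dom Delta g)" "(g \<cdot>\<^bsub>Delta\<^esub> h) \<cdot>\<^bsub>Delta\<^esub> x = g \<cdot>\<^bsub>Delta\<^esub> h \<cdot>\<^bsub>Delta\<^esub> x"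
    if "x \<in> hom Delta k (Dom Delta h)" for x k
    using that g h gh by (auto simp: hom_iff simp del: Delta_simps)
  show "act U (g \<cdot>\<^bsub>Delta\<^esub> h) \<theta> = act U h (act U g \<theta>)"
  proof (rule U_eqI[OF U_act_in[OF c(1) \<theta>', unfolded c(2)] U_act_in[OF h ag]])
    fix v assume v: "v \<in> hom Delta 0 (Dom Delta h)"
    show "snd (act U (g \<cdot>\<^bsub>Delta\<^esub> h) \<theta>) v = snd (act U h (act U g \<theta>)) v"
      using U_act_vertex[OF c(1) \<theta>', unfolded c(2), OF v] U_act_vertex[OF h ag v] U_act_vertex[OF g \<theta> hx(1)[OF v]] hx(2)[OF v] by simp
  next
    fix k x assume x: "x \<in> hom Delta k (Dom Delta h)"
    show "elem (Dom Delta h) (act U (g \<cdot>\<^bsub>Delta\<^esub> h) \<theta>) k x = elem (Dom Delta h) (act U h (act U g \<theta>)) k x"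
      using U_act_elem[OF c(1) \<theta>', unfolded c(2,3), OF x] U_act_elem[OF h ag x] U_act_elem[OF g \<theta> hx(1)[OF x]] hx(2)[OF x] gh
      by simp
  qed
qed (rule U_act_in)

text \<open>Evaluating at the identity of \<open>[m]\<close> turns a map \<open>\<phi>\<close> into \<open>U\<close> into a family of elements.\<close>

lemma
  fixes K :: "'k sset" and \<phi>
  assumes K: "simplicial_set K" and \<phi>: "is_sset_map K U \<phi>" and x: "x \<in> simp K m"
  shows U_map_vertex: "v \<in> hom Delta 0 m \<Longrightarrow> snd (\<phi> m x) v = snd (\<phi> 0 (act K v x)) (Id Delta 0)"
    and U_map_elem: "h \<in> hom Delta k m \<Longrightarrow> elem m (\<phi> m x) k h = elem k (\<phi> k (act K h x)) k (Id Delta k)"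
proof -
  have \<phi>x: "\<phi> m x \<in> simp U m" using \<phi> x by (simp add: is_sset_map_def)
  have act: "\<phi> k (act K h x) = act U h (\<phi> m x)" if "h \<in> hom Delta k m" for h k
    using \<phi> x that unfolding is_sset_map_def hom_iff by auto
  show "snd (\<phi> m x) v = snd (\<phi> 0 (act K v x)) (Id Delta 0)" if v: "v \<in> hom Delta 0 m"
    using U_act_vertex[of v "\<phi> m x" "Id Delta 0"] v \<phi>x act[OF v] Delta.id_hom[of 0] Delta.comp_id[OF v]
    by (simp add: hom_iff del: Delta_simps(4,5))
  show "elem m (\<phi> m x) k h = elem k (\<phi> k (act K h x)) k (Id Delta k)" if h: "h \<in> hom Delta k m"
    using U_act_elem[of h "\<phi> m x" "Id Delta k" k] h \<phi>x act[OF h] Delta.id_hom[of k] Delta.comp_id[OF h]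
    by (simp add: hom_iff del: Delta_simps(4,5))
qed

text \<open>By \<open>U_map_vertex\<close> and \<open>U_map_elem\<close>, the data of
  \<open>\<phi> m x\<close> at any simplex of [m] are values of \<open>f\<close> and
  \<open>e\<close> at the corresponding simplex of \<open>K\<close>. Each condition on
  \<open>e\<close> at \<open>x\<close> is thus the condition on \<open>\<phi> m x\<close> at the
  identity simplex.\<close>

lemma family_of_U_map:
  fixes K :: "'k sset" and \<phi>
  assumes K: "simplicial_set K" and \<phi>: "is_sset_map K U \<phi>"
    and f: "\<And>v. v \<in> simp K 0 \<Longrightarrow> f v = snd (\<phi> 0 v) (Id Delta 0)"
    and e: "\<And>m x. x \<in> simp K m \<Longrightarrow> e m x = elem m (\<phi> m x) m (Id Delta m)"
  shows "is_family S X K f e"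
proof -
  interpret K: simplicial_set K by (rule K)
  have fam: "is_family S X (std_simplex m) (snd (\<phi> m x)) (elem m (\<phi> m x))" if "x \<in> simp K m" for m x
    using \<phi> that by (intro U_family) (simp add: is_sset_map_def)
  have idm: "Id Delta m \<in> simp (std_simplex m) m" for m using Delta.id_hom[of m] by simp
  have el: "elem m (\<phi> m x) k h = e k (act K h x)" if x: "x \<in> simp K m" and h: "h \<in> hom Delta k m" for m x k h
    using U_map_elem[OF K \<phi> x h] e[of "act K h x" k] K.act_in[of h x] h x by (auto simp: hom_iff)
  have vx: "snd (\<phi> m x) v = f (act K v x)" if x: "x \<in> simp K m" and v: "v \<in> hom Delta 0 m" for m x v
    using U_map_vertex[OF K \<phi> x v] f[of "act K v x"] K.act_in[of v x] v x by (auto simp: hom_iff)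
  have faces: "src (std_simplex m) m (Id Delta m) = seg 0 0 m" "tgt (std_simplex m) m (Id Delta m) = seg 0 m m" for m
    by (simp_all add: src_def tgt_def del: Delta_simps(4,5))
  have ends: "snd (\<phi> m x) (seg 0 0 m) = f (src K m x)" "snd (\<phi> m x) (seg 0 m m) = f (tgt K m x)" if "x \<in> simp K m" for m x
    using vx[OF that] by (simp_all add: src_def tgt_def hom_iff)
  have e_id: "elem m (\<phi> m x) m (Id Delta m) = e m x" if "x \<in> simp K m" for m x using e[OF that] by simp
  show ?thesis
    unfolding is_family_def
  proof (intro conjI ballI allI)
    show "f v \<in> S" if v: "v \<in> simp K 0" for v
      using fam[OF v] idm[of 0] f[OF v] unfolding is_family_def by auto
    show "e m x \<in> hom C I (ObjF X m (f (src K m x), f (tgt K m x)))" if x: "x \<in> simp K m" for m x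
    proof -
      have "elem m (\<phi> m x) m (Id Delta m) \<in> hom C I (ObjF X m (snd (\<phi> m x) (src (std_simplex m) m (Id Delta m)), snd (\<phi> m x) (tgt (std_simplex m) m (Id Delta m))))"
        using fam[OF x] idm[of m] unfolding is_family_def by blast
      then show ?thesis by (simp only: faces ends[OF x] e_id[OF x])
    qed
    show "counit X (f v, f v) \<cdot> e 0 v = Id C I" if v: "v \<in> simp K 0" for v
    proof -
      have "counit X (snd (\<phi> 0 v) (Id Delta 0), snd (\<phi> 0 v) (Id Delta 0)) \<cdot> elem 0 (\<phi> 0 v) 0 (Id Delta 0) = Id C I"
        using fam[OF v] idm[of 0] unfolding is_family_def by blast
      then show ?thesis by (simp only: e_id[OF v] f[OF v])
    qed
    show "ArrF X h (f (src K (Cod Delta h) x), f (tgt K (Cod Delta h) x)) \<cdot> e (Cod Delta h) x = e (Dom Delta h) (act K h x)"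
      if h: "h \<in> Arr Delta_f" and x: "x \<in> simp K (Cod Delta h)" for h x
    proof -
      let ?n = "Cod Delta h"
      have hh: "h \<in> hom Delta (Dom Delta h) ?n" using Delta_f_arrD[OF h] by (simp add: hom_iff)
      have "ArrF X h (snd (\<phi> ?n x) (src (std_simplex ?n) ?n (Id Delta ?n)), snd (\<phi> ?n x) (tgt (std_simplex ?n) ?n (Id Delta ?n))) \<cdot>
          elem ?n (\<phi> ?n x) ?n (Id Delta ?n) = elem ?n (\<phi> ?n x) (Dom Delta h) (act (std_simplex ?n) h (Id Delta ?n))"
        using fam[OF x] idm[of ?n] h unfolding is_family_def by blast
      then show ?thesis by (simp only: faces ends[OF x] e_id[OF x] std_simplex_simps Delta.id_comp[OF hh] el[OF x hh])
    qed
    show "comult X k l (f (src K (k + l) x), f (tgt K (k + l) x)) \<cdot> e (k + l) x =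
      qprod S (ObjF X k) (ObjF X l) (f (src K (k + l) x)) (f (tgt K (k + l) x)) (f (act K (seg 0 k (k + l)) x))
        (e k (front_face K k l x)) (e l (back_face K k l x))" if x: "x \<in> simp K (k + l)" for k l x
    proof -
      let ?n = "k + l" and ?i = "Id Delta (k + l)"
      have sh: "seg 0 k ?n \<in> hom Delta 0 ?n" "seg k 0 ?n \<in> hom Delta k ?n" "seg l k ?n \<in> hom Delta l ?n"
        by (simp_all add: hom_iff)
      have "comult X k l (snd (\<phi> ?n x) (src (std_simplex ?n) ?n ?i), snd (\<phi> ?n x) (tgt (std_simplex ?n) ?n ?i)) \<cdot> elem ?n (\<phi> ?n x) ?n ?i =
        qprod S (ObjF X k) (ObjF X l) (snd (\<phi> ?n x) (src (std_simplex ?n) ?n ?i)) (snd (\<phi> ?n x) (tgt (std_simplex ?n) ?n ?i))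
          (snd (\<phi> ?n x) (act (std_simplex ?n) (seg 0 k ?n) ?i))
          (elem ?n (\<phi> ?n x) k (front_face (std_simplex ?n) k l ?i)) (elem ?n (\<phi> ?n x) l (back_face (std_simplex ?n) k l ?i))"
        using fam[OF x] idm[of ?n] unfolding is_family_def by blast
      then show ?thesis
        by (simp only: faces ends[OF x] e_id[OF x] front_face_def back_face_def std_simplex_simps
            Delta.id_comp[OF sh(1)] Delta.id_comp[OF sh(2)] Delta.id_comp[OF sh(3)] vx[OF x sh(1)] el[OF x sh(2)] el[OF x sh(3)])
    qed
  qed
qed

lemma quasi_category_U:
  assumes qcat: "quasi_category_in C (X, S)"
  shows "quasi_category U"
  unfolding quasi_category_def
proof (intro conjI allI impI, rule U_sset, elim conjE)
  fix n j \<phi> assume j: "0 < j" "j < n" and \<phi>: "is_sset_map (horn n j) U \<phi>"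
  let ?H = "horn n j" and ?D = "std_simplex n"
  note H = simplicial_set_horn[of n j]
  \<comment> \<open>Restricted because vertex maps of templicial morphisms are extensional.\<close>
  define f where "f = restrict (\<lambda>v. snd (\<phi> 0 v) (Id Delta 0)) (simp ?H 0)"
  define e where "e m x = elem m (\<phi> m x) m (Id Delta m)" for m x
  have fam: "is_family S X ?H f e" by (rule family_of_U_map[OF H \<phi>]) (simp_all add: f_def e_def)
  then have f: "f \<in> simp ?H 0 \<rightarrow>\<^sub>E S" unfolding is_family_def by (auto simp: f_def)
  obtain e' where e': "is_family S X ?D f e'" "\<And>m x. x \<in> simp ?H m \<Longrightarrow> e' m x = e m x"
    using extend_family[OF qcat j f fam] by blast
  interpret free_object_target C ?D S X by (rule free_object_target_std_simplex)
  obtain \<alpha> where \<alpha>: "(\<alpha>, f) \<in> templicial_hom C (F_tilde C ?D) (X, S)" and ev: "\<And>m x. x \<in> simp ?D m \<Longrightarrow> ev \<alpha> f m x = e' m x"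
    using templicial_hom_ex[OF f[unfolded horn_vertices[OF j]] e'(1)] by blast
  have \<Theta>: "(\<alpha>, f) \<in> simp U n" using \<alpha> by (simp add: U_simp)
  \<comment> \<open>The Yoneda lemma: a map out of the standard simplex is given by acting on a
    single n-simplex.\<close>
  let ?\<psi> = "\<lambda>m x. act U x (\<alpha>, f)"
  have \<psi>_in: "?\<psi> m x \<in> simp U m" if "x \<in> hom Delta m n" for m x
    using U_act_in[of x "(\<alpha>, f)"] that \<Theta> by (simp add: hom_iff)
  have \<psi>: "is_sset_map ?D U ?\<psi>"
    unfolding is_sset_map_def
  proof (intro conjI allI ballI)
    show "?\<psi> m x \<in> simp U m" if "x \<in> simp ?D m" for m x using \<psi>_in that by simp
    show "?\<psi> (Dom Delta h) (act ?D h x) = act U h (?\<psi> (Cod Delta h) x)"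
      if "h \<in> Arr Delta" "x \<in> simp ?D (Cod Delta h)" for h x
      using U_sset that \<Theta> unfolding is_sset_def by (auto simp: hom_iff)
  qed
  have "?\<psi> m x = \<phi> m x" if x: "x \<in> simp ?H m" for m x
  proof -
    have xn: "x \<in> hom Delta m n" using x by (simp add: horn_iff)
    then have xa: "x \<in> Arr Delta" "Dom Delta x = m" "Cod Delta x = n" by (auto simp: hom_iff)
    have in_H: "act ?H h x \<in> simp ?H k" if "h \<in> hom Delta k m" for h k
      using simplicial_set.act_in[OF H, of h x] x that by (simp add: hom_iff)
    show ?thesis
    proof (rule U_eqI)
      show "?\<psi> m x \<in> simp U m" by (rule \<psi>_in[OF xn])
      show "\<phi> m x \<in> simp U m" using \<phi> x by (simp add: is_sset_map_def)
      show "snd (?\<psi> m x) v = snd (\<phi> m x) v" if v: "v \<in> hom Delta 0 m" for v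
        using U_act_vertex[OF xa(1), of "(\<alpha>, f)" v] \<Theta> v U_map_vertex[OF H \<phi> x v] in_H[OF v] xa by (simp add: f_def)
      show "elem m (?\<psi> m x) k h = elem m (\<phi> m x) k h" if h: "h \<in> hom Delta k m" for k h
      proof -
        have "x \<cdot>\<^bsub>Delta\<^esub> h \<in> simp ?D k" using Delta.comp_hom[OF h xn] by simp
        then show ?thesis
          using U_act_elem[OF xa(1), of "(\<alpha>, f)" h k] \<Theta> h U_map_elem[OF H \<phi> x h] in_H[OF h] xa ev e'(2)[OF in_H[OF h]]
          by (simp add: elem_def[of n] e_def)
      qed
    qed
  qed
  with \<psi> show "\<exists>\<psi>. is_sset_map ?D U \<psi> \<and> (\<forall>m. \<forall>x\<in>simp ?H m. \<psi> m x = \<phi> m x)" by blast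
qed

end

lemma finite_inj_on_infinite:
  assumes "infinite (UNIV :: 'u set)" "finite A"
  shows "\<exists>g :: 'a \<Rightarrow> 'u. inj_on g A"
proof -
  obtain B :: "'u set" where "finite B" "card B = card A"
    using infinite_arbitrarily_large[OF assms(1), of "card A"] by blast
  then show ?thesis using finite_same_card_bij[OF assms(2)] by (metis bij_betw_def)
qed

theorem corollary5p13:
  fixes V :: "('o, 'm) symcat"
    and X :: "('u, 'o, 'm) quiv_colax"
    and S :: "'u set"
  assumes "infinite (UNIV :: 'u set)"
    and "symmetric_monoidal_closed_category V"
    and "small_complete TYPE('u) V"
    and "small_cocomplete TYPE('u) V"
    and "quasi_category_in V (X, S)"
  shows "quasi_category (U_tilde V (X, S))"
proof -
  interpret symmetric_monoidal_closed_category V by (rule assms(2))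
  \<comment> \<open>Polymorphic in the index type: it is applied to \<open>unit\<close>, to
    \<open>delta\<close> and to pairs of elements of \<open>delta\<close>.\<close>
  have fin: "has_coprods V A" if "finite A" for A :: "'i set"
    using finite_inj_on_infinite[OF assms(1) that] has_coprods_small[OF assms(4)] by blast
  have S: "has_coprods V S" by (rule has_coprods_small[OF assms(4), of "\<lambda>x. x"]) simp
  interpret finitary_templicial_object V S X
    by unfold_locales (use assms(5) fin S in \<open>auto simp: quasi_category_in_def\<close>)
  show ?thesis by (rule quasi_category_U[OF assms(5)])
qed

end
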